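(* Let $X,Y$ be quantum vertex transitive graphs such that $\mathrm{Qut}(X[Y])\neq\mathrm{Qut}(Y)\wr_*\mathrm{Qut}(X)$. Assume that $\overline{Y}$ is connected. Then there exist (1) connected, pairwise quantum isomorphic, quantum vertex transitive graphs $\{Y_i\}_{i\in[\beta]}$, for some $\beta>1$, such that $Y=\bigsqcup_{i=1}^\beta Y_i$ (disjoint union), and (2) a quantum vertex transitive graph $X'$ with no twins and an integer $\alpha>1$ such that $X=X'[\overline{K_\alpha}]$, and $\mathrm{Qut}(X[Y])=\mathrm{Qut}\big(\bigsqcup_{i=1}^{\beta}\overline{K_\alpha}[Y_i]\big)\wr_*\mathrm{Qut}(X')$.
   Context: All graphs are finite and simple, with nonempty vertex set, not necessarily connected. $\overline{X}$ is the complement of $X$; $\overline{K_\alpha}$ is the edgeless graph on $\alpha$ vertices. Two distinct vertices $x,y$ of $X$ are twins if they have the same set of neighbours. Equalities between graphs are up to isomorphism, and equalities of quantum permutation groups are understood after the corresponding identification of vertex sets. Lexicographic product: $X[Y]$ has vertex set $V(X)\times V(Y)$ and edge set $\{(x,y)(x',y') : xx'\in E(X)\}\cup\{(x,y)(x,y') : yy'\in E(Y)\}$. A magic unitary is a matrix $u=[u_{ij}]$ (rows and columns possibly indexed by different finite sets) with entries in a unital $C^*$-algebra such that $u_{ij}^2=u_{ij}^*=u_{ij}$ for all $i,j$ and every row and every column sums to $1$. A quantum permutation group acting on a finite set $I$ is a pair $\mathbb{G}=(C(\mathbb{G}),u)$, where $C(\mathbb{G})$ is a unital $C^*$-algebra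 generated by the entries of a magic unitary $u=[u_{ij}]_{i,j\in I}$ (the fundamental representation), such that $\Delta(u_{ij})=\sum_k u_{ik}\otimes u_{kj}$ defines a unital $*$-homomorphism making $(C(\mathbb{G}),\Delta)$ a compact quantum group. Two quantum permutation groups $(C(\mathbb{G}),u)$ and $(C(\mathbb{H}),v)$ acting on the same set are equal if $u_{ij}\mapsto v_{ij}$ defines a $*$-isomorphism $C(\mathbb{G})\to C(\mathbb{H})$. $\mathrm{Qut}(X)=(C(\mathrm{Qut}(X)),u)$, where $C(\mathrm{Qut}(X))$ is the universal unital $C^*$-algebra generated by $[u_{ij}]_{i,j\in V(X)}$ subject to: $u$ is a magic unitary and $A_Xu=uA_X$ ($A_X$ the adjacency matrix). $X$ is quantum vertex transitive if $u_{xx'}\neq0$ for all $x,x'\in V(X)$. Graphs $X$ and $Y$ are quantum isomorphic if there are a nonzero unital $C^*$-algebra $\mathcal{A}$ and a magic unitary $u=[u_{xy}]_{x\in V(X),y\in V(Y)}$ with entries in $\mathcal{A}$ such that $A_Xu=uA_Y$. Free wreath product: for quantum permutation groups $\mathbb{G}=(C(\mathbb{G}),[u_{ij}]_{i,j\in[m]})$ and $\mathbb{H}=(C(\mathbb{H}),[v_{ab}]_{a,b\in[n]})$, let $C(\mathbb{G}^{*n})$ be the free product, amalgamated over $\mathbb{C}$ (coproduct of unital $C^*$-algebras), of $n$ copies of $C(\mathbb{G})$, and let $u^{(a)}$ be the fundamental representation of the $a$-th copy. Then $\mathbb{G}\wr_*\mathbb{H}$ is the quantum permutation group acting on $[n]\times[m]$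 with $C(\mathbb{G}\wr_*\mathbb{H})=(C(\mathbb{G}^{*n})*_{\mathbb{C}}C(\mathbb{H}))/\langle u^{(a)}_{ij}v_{ab}=v_{ab}u^{(a)}_{ij} \mid i,j\in[m],\ a,b\in[n]\rangle$ and fundamental representation $w_{(a,i)(b,j)}=u^{(a)}_{ij}v_{ab}$. *)

theory Defs
  imports
    Complex_Main
    "Graph_Theory.Graph_Theory"
    "HOL-Library.Poly_Mapping"
    "HOL-Algebra.QuotRing"
begin

section \<open>Unital C*-algebras\<close>

record 'a star_alg = "'a ring" +
  scale :: "complex \<Rightarrow> 'a \<Rightarrow> 'a"
  star :: "'a \<Rightarrow> 'a"

record 'a cstar_alg = "'a star_alg" +
  cnorm :: "'a \<Rightarrow> real"

locale star_algebra = ring A for A :: "('a, 'm) star_alg_scheme" (structure) +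
  assumes scale_closed: "x \<in> carrier A \<Longrightarrow> scale A c x \<in> carrier A"
    and scale_add_right: "\<lbrakk>x \<in> carrier A; y \<in> carrier A\<rbrakk> \<Longrightarrow>
      scale A c (x \<oplus> y) = scale A c x \<oplus> scale A c y"
    and scale_add_left: "x \<in> carrier A \<Longrightarrow> scale A (c + d) x = scale A c x \<oplus> scale A d x"
    and scale_scale: "x \<in> carrier A \<Longrightarrow> scale A c (scale A d x) = scale A (c * d) x"
    and scale_one: "x \<in> carrier A \<Longrightarrow> scale A 1 x = x"
    and scale_mult_left: "\<lbrakk>x \<in> carrier A; y \<in> carrier A\<rbrakk> \<Longrightarrow>
      scale A c x \<otimes> y = scale A c (x \<otimes> y)"
    and scale_mult_right: "\<lbrakk>x \<in> carrier A; y \<in> carrier A\<rbrakk> \<Longrightarrow>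
      x \<otimes> scale A c y = scale A c (x \<otimes> y)"
    and star_closed: "x \<in> carrier A \<Longrightarrow> star A x \<in> carrier A"
    and star_star: "x \<in> carrier A \<Longrightarrow> star A (star A x) = x"
    and star_add: "\<lbrakk>x \<in> carrier A; y \<in> carrier A\<rbrakk> \<Longrightarrow> star A (x \<oplus> y) = star A x \<oplus> star A y"
    and star_scale: "x \<in> carrier A \<Longrightarrow> star A (scale A c x) = scale A (cnj c) (star A x)"
    and star_mult: "\<lbrakk>x \<in> carrier A; y \<in> carrier A\<rbrakk> \<Longrightarrow> star A (x \<otimes> y) = star A y \<otimes> star A x"

definition cstar_seminorm :: "('a, 'm) star_alg_scheme \<Rightarrow> ('a \<Rightarrow> real) \<Rightarrow> bool" where
  "cstar_seminorm A p \<longleftrightarrow>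
     (\<forall>x\<in>carrier A. 0 \<le> p x) \<and>
     (\<forall>x\<in>carrier A. \<forall>y\<in>carrier A. p (x \<oplus>\<^bsub>A\<^esub> y) \<le> p x + p y) \<and>
     (\<forall>c. \<forall>x\<in>carrier A. p (scale A c x) = cmod c * p x) \<and>
     (\<forall>x\<in>carrier A. \<forall>y\<in>carrier A. p (x \<otimes>\<^bsub>A\<^esub> y) \<le> p x * p y) \<and>
     (\<forall>x\<in>carrier A. p (star A x \<otimes>\<^bsub>A\<^esub> x) = (p x)\<^sup>2)"

definition cauchy_seqs :: "('a, 'm) star_alg_scheme \<Rightarrow> ('a \<Rightarrow> real) \<Rightarrow> (nat \<Rightarrow> 'a) set" where
  "cauchy_seqs A p = {s. (\<forall>n. s n \<in> carrier A) \<and>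
     (\<forall>e>0. \<exists>N. \<forall>m\<ge>N. \<forall>n\<ge>N. p (s m \<ominus>\<^bsub>A\<^esub> s n) < e)}"

text \<open>The zero algebra is admitted: the norm of the unit may be 0.\<close>

locale unital_cstar_algebra = star_algebra A for A :: "('a, 'm) cstar_alg_scheme" (structure) +
  assumes seminorm: "cstar_seminorm A (cnorm A)"
    and definite: "\<lbrakk>x \<in> carrier A; cnorm A x = 0\<rbrakk> \<Longrightarrow> x = \<zero>"
    and complete: "s \<in> cauchy_seqs A (cnorm A) \<Longrightarrow>
      \<exists>x\<in>carrier A. (\<lambda>n. cnorm A (s n \<ominus> x)) \<longlonglongrightarrow> 0"

definition star_iso ::
  "('a, 'm) star_alg_scheme \<Rightarrow> ('b, 'n) star_alg_scheme \<Rightarrow> ('a \<Rightarrow> 'b) set" where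
  "star_iso A B = {\<phi> \<in> ring_hom A B. bij_betw \<phi> (carrier A) (carrier B) \<and>
     (\<forall>c. \<forall>x\<in>carrier A. \<phi> (scale A c x) = scale B c (\<phi> x)) \<and>
     (\<forall>x\<in>carrier A. \<phi> (star A x) = star B (\<phi> x))}"


section \<open>Completion with respect to a C*-seminorm\<close>

text \<open>The separated completion: Cauchy sequences modulo null sequences.\<close>

definition seq_class :: "('a, 'm) star_alg_scheme \<Rightarrow> ('a \<Rightarrow> real) \<Rightarrow> (nat \<Rightarrow> 'a) \<Rightarrow> (nat \<Rightarrow> 'a) set" where
  "seq_class A p s = {t \<in> cauchy_seqs A p. (\<lambda>n. p (t n \<ominus>\<^bsub>A\<^esub> s n)) \<longlonglongrightarrow> 0}"

definition completion ::
  "('a, 'm) star_alg_scheme \<Rightarrow> ('a \<Rightarrow> real) \<Rightarrow> (nat \<Rightarrow> 'a) set cstar_alg" where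
  "completion A p =
    \<lparr>carrier = seq_class A p ` cauchy_seqs A p,
     mult = (\<lambda>C D. \<Union>s\<in>C. \<Union>t\<in>D. seq_class A p (\<lambda>n. s n \<otimes>\<^bsub>A\<^esub> t n)),
     one = seq_class A p (\<lambda>_. \<one>\<^bsub>A\<^esub>),
     zero = seq_class A p (\<lambda>_. \<zero>\<^bsub>A\<^esub>),
     add = (\<lambda>C D. \<Union>s\<in>C. \<Union>t\<in>D. seq_class A p (\<lambda>n. s n \<oplus>\<^bsub>A\<^esub> t n)),
     scale = (\<lambda>c C. \<Union>s\<in>C. seq_class A p (\<lambda>n. scale A c (s n))),
     star = (\<lambda>C. \<Union>s\<in>C. seq_class A p (\<lambda>n. star A (s n))),
     cnorm = (\<lambda>C. lim (\<lambda>n. p ((SOME s. s \<in> C) n)))\<rparr>"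


section \<open>Free *-algebras\<close>

text \<open>A letter \<open>(g, False)\<close> stands for the generator \<open>g\<close>, and \<open>(g, True)\<close> for its adjoint.
  Words form a (noncommutative) monoid under concatenation, written additively so that the
  convolution product of finitely supported functions is that of the monoid algebra.\<close>

datatype 'g word = Word (letters: "('g \<times> bool) list")

instantiation word :: (type) monoid_add
begin

definition zero_word_def: "0 = Word []"

definition plus_word_def: "v + w = Word (letters v @ letters w)"

instance
  by standard (simp_all add: zero_word_def plus_word_def)

end

type_synonym 'g free_poly = "'g word \<Rightarrow>\<^sub>0 complex"

definition gen :: "'g \<Rightarrow> 'g free_poly" where
  "gen g = Poly_Mapping.single (Word [(g, False)]) 1"

definition free_scale :: "complex \<Rightarrow> 'g free_poly \<Rightarrow> 'g free_poly" where
  "free_scale c = Poly_Mapping.map ((*) c)"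

definition word_star :: "'g word \<Rightarrow> 'g word" where
  "word_star w = Word (rev (map (apsnd Not) (letters w)))"

definition free_star :: "'g free_poly \<Rightarrow> 'g free_poly" where
  "free_star f = Poly_Mapping.map cnj (Poly_Mapping.map_key word_star f)"

definition free_star_alg :: "'g set \<Rightarrow> 'g free_poly star_alg" where
  "free_star_alg G =
    \<lparr>carrier = {f. \<forall>w\<in>Poly_Mapping.keys f. fst ` set (letters w) \<subseteq> G},
     mult = (*), one = 1, zero = 0, add = (+), scale = free_scale, star = free_star\<rparr>"


section \<open>Universal C*-algebras, free products and quotients\<close>

text \<open>The universal unital C*-algebra generated by \<open>G\<close> subject to the relations \<open>r = 0\<close> for
  \<open>r \<in> R\<close>: the completion of the free unital *-algebra on \<open>G\<close> in the largest C*-seminorm that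
  vanishes on \<open>R\<close>.  Such seminorms are exactly the pullbacks of norms along unital
  *-homomorphisms into unital C*-algebras satisfying the relations, so this has the universal
  property with respect to C*-algebras over every HOL type.  For the presentations used below the
  seminorms are bounded pointwise (generators are projections, or are dominated by the norm of the
  given algebras), so the supremum is a genuine one.\<close>

definition universal_seminorm ::
  "('a, 'm) star_alg_scheme \<Rightarrow> 'a set \<Rightarrow> 'a \<Rightarrow> real" where
  "universal_seminorm A R x = (SUP p \<in> {p. cstar_seminorm A p \<and> (\<forall>r\<in>R. p r = 0)}. p x)"

type_synonym 'g universal = "(nat \<Rightarrow> 'g free_poly) set"

definition universal_cstar :: "'g set \<Rightarrow> 'g free_poly set \<Rightarrow> 'g universal cstar_alg" where
  "universal_cstar G R =
     completion (free_star_alg G) (universal_seminorm (free_star_alg G) R)"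

definition universal_gen :: "'g set \<Rightarrow> 'g free_poly set \<Rightarrow> 'g \<Rightarrow> 'g universal" where
  "universal_gen G R g =
     seq_class (free_star_alg G) (universal_seminorm (free_star_alg G) R) (\<lambda>_. gen g)"

text \<open>The relations that make \<open>\<iota>\<close> a unital *-homomorphism on \<open>A\<close>.\<close>

definition hom_relations ::
  "('a, 'm) star_alg_scheme \<Rightarrow> ('a \<Rightarrow> 'g free_poly) \<Rightarrow> 'g free_poly set" where
  "hom_relations A \<iota> =
     {\<iota> (x \<oplus>\<^bsub>A\<^esub> y) - (\<iota> x + \<iota> y) | x y. x \<in> carrier A \<and> y \<in> carrier A} \<union>
     {\<iota> (x \<otimes>\<^bsub>A\<^esub> y) - \<iota> x * \<iota> y | x y. x \<in> carrier A \<and> y \<in> carrier A} \<union>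
     {\<iota> (scale A c x) - free_scale c (\<iota> x) | c x. x \<in> carrier A} \<union>
     {\<iota> (star A x) - free_star (\<iota> x) | x. x \<in> carrier A} \<union>
     {\<iota> \<one>\<^bsub>A\<^esub> - 1}"

text \<open>Coproducts of unital C*-algebras (free products amalgamated over the scalars), of a family
  and of two algebras, together with the canonical maps.\<close>

definition family_gens :: "'i set \<Rightarrow> ('i \<Rightarrow> 'a cstar_alg) \<Rightarrow> ('i \<times> 'a) set" where
  "family_gens I A = (SIGMA i:I. carrier (A i))"

definition family_relations :: "'i set \<Rightarrow> ('i \<Rightarrow> 'a cstar_alg) \<Rightarrow> ('i \<times> 'a) free_poly set" where
  "family_relations I A = (\<Union>i\<in>I. hom_relations (A i) (\<lambda>x. gen (i, x)))"

definition family_coproduct ::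
  "'i set \<Rightarrow> ('i \<Rightarrow> 'a cstar_alg) \<Rightarrow> ('i \<times> 'a) universal cstar_alg" where
  "family_coproduct I A = universal_cstar (family_gens I A) (family_relations I A)"

definition family_in ::
  "'i set \<Rightarrow> ('i \<Rightarrow> 'a cstar_alg) \<Rightarrow> 'i \<Rightarrow> 'a \<Rightarrow> ('i \<times> 'a) universal" where
  "family_in I A i x = universal_gen (family_gens I A) (family_relations I A) (i, x)"

definition sum_gens :: "'a cstar_alg \<Rightarrow> 'b cstar_alg \<Rightarrow> ('a + 'b) set" where
  "sum_gens A B = Inl ` carrier A \<union> Inr ` carrier B"

definition sum_relations :: "'a cstar_alg \<Rightarrow> 'b cstar_alg \<Rightarrow> ('a + 'b) free_poly set" where
  "sum_relations A B =
     hom_relations A (\<lambda>x. gen (Inl x)) \<union> hom_relations B (\<lambda>x. gen (Inr x))"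

definition sum_coproduct :: "'a cstar_alg \<Rightarrow> 'b cstar_alg \<Rightarrow> ('a + 'b) universal cstar_alg" where
  "sum_coproduct A B = universal_cstar (sum_gens A B) (sum_relations A B)"

definition sum_inl :: "'a cstar_alg \<Rightarrow> 'b cstar_alg \<Rightarrow> 'a \<Rightarrow> ('a + 'b) universal" where
  "sum_inl A B x = universal_gen (sum_gens A B) (sum_relations A B) (Inl x)"

definition sum_inr :: "'a cstar_alg \<Rightarrow> 'b cstar_alg \<Rightarrow> 'b \<Rightarrow> ('a + 'b) universal" where
  "sum_inr A B y = universal_gen (sum_gens A B) (sum_relations A B) (Inr y)"

definition closed_ideal :: "'a set \<Rightarrow> ('a, 'm) cstar_alg_scheme \<Rightarrow> bool" where
  "closed_ideal J A \<longleftrightarrow> ideal J A \<and>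
     (\<forall>s. \<forall>x\<in>carrier A. (\<forall>n. s n \<in> J) \<and> (\<lambda>n. cnorm A (s n \<ominus>\<^bsub>A\<^esub> x)) \<longlonglongrightarrow> 0 \<longrightarrow> x \<in> J)"

definition closed_ideal_generated :: "('a, 'm) cstar_alg_scheme \<Rightarrow> 'a set \<Rightarrow> 'a set" where
  "closed_ideal_generated A S = \<Inter>{J. closed_ideal J A \<and> S \<subseteq> J}"

definition quotient_cstar :: "('a, 'm) cstar_alg_scheme \<Rightarrow> 'a set \<Rightarrow> 'a set cstar_alg" where
  "quotient_cstar A J =
    \<lparr>carrier = carrier (A Quot J), mult = mult (A Quot J), one = one (A Quot J),
     zero = zero (A Quot J), add = add (A Quot J),
     scale = (\<lambda>c C. \<Union>x\<in>C. J +>\<^bsub>A\<^esub> scale A c x),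
     star = (\<lambda>C. \<Union>x\<in>C. J +>\<^bsub>A\<^esub> star A x),
     cnorm = (\<lambda>C. INF x\<in>C. cnorm A x)\<rparr>"


section \<open>Graphs\<close>

text \<open>A simple graph is a symmetric loop-free digraph; each edge gives two arcs.\<close>

definition simple_graph :: "'v pair_pre_digraph \<Rightarrow> bool" where
  "simple_graph X \<longleftrightarrow> pair_graph X \<and> pverts X \<noteq> {}"

definition graph_iso :: "('v \<Rightarrow> 'w) \<Rightarrow> 'v pair_pre_digraph \<Rightarrow> 'w pair_pre_digraph \<Rightarrow> bool" where
  "graph_iso f X Y \<longleftrightarrow> bij_betw f (pverts X) (pverts Y) \<and>
     (\<forall>x\<in>pverts X. \<forall>x'\<in>pverts X. (x, x') \<in> parcs X \<longleftrightarrow> (f x, f x') \<in> parcs Y)"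

definition complement :: "'v pair_pre_digraph \<Rightarrow> 'v pair_pre_digraph" where
  "complement X = \<lparr>pverts = pverts X,
     parcs = {(x, y). x \<in> pverts X \<and> y \<in> pverts X \<and> x \<noteq> y \<and> (x, y) \<notin> parcs X}\<rparr>"

definition edgeless :: "nat \<Rightarrow> nat pair_pre_digraph" where
  "edgeless n = \<lparr>pverts = {..<n}, parcs = {}\<rparr>"

definition twins :: "'v pair_pre_digraph \<Rightarrow> 'v \<Rightarrow> 'v \<Rightarrow> bool" where
  "twins X x y \<longleftrightarrow> x \<in> pverts X \<and> y \<in> pverts X \<and> x \<noteq> y \<and>
     {z. (x, z) \<in> parcs X} = {z. (y, z) \<in> parcs X}"

definition lex_product ::
  "'v pair_pre_digraph \<Rightarrow> 'w pair_pre_digraph \<Rightarrow> ('v \<times> 'w) pair_pre_digraph" where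
  "lex_product X Y = \<lparr>pverts = pverts X \<times> pverts Y,
     parcs = {((x, y), (x', y')) | x y x' y'.
                (x, x') \<in> parcs X \<and> y \<in> pverts Y \<and> y' \<in> pverts Y} \<union>
             {((x, y), (x, y')) | x y y'. x \<in> pverts X \<and> (y, y') \<in> parcs Y}\<rparr>"

definition disjoint_union ::
  "'i set \<Rightarrow> ('i \<Rightarrow> 'v pair_pre_digraph) \<Rightarrow> ('i \<times> 'v) pair_pre_digraph" where
  "disjoint_union I Y = \<lparr>pverts = (SIGMA i:I. pverts (Y i)),
     parcs = {((i, y), (i, y')) | i y y'. i \<in> I \<and> (y, y') \<in> parcs (Y i)}\<rparr>"

definition adjacency :: "'v pair_pre_digraph \<Rightarrow> 'v \<Rightarrow> 'v \<Rightarrow> complex" where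
  "adjacency X x y = of_bool ((x, y) \<in> parcs X)"


section \<open>Quantum permutation groups\<close>

text \<open>The comultiplication is determined by the fundamental representation and plays no role in
  equality, so it is not recorded.\<close>

record ('i, 'a) qpg =
  points :: "'i set"
  qalg :: "'a cstar_alg"
  fund :: "'i \<Rightarrow> 'i \<Rightarrow> 'a"

text \<open>Equality of quantum permutation groups after identifying the sets they act on along \<open>f\<close>.
  For \<open>f = id\<close> the two sets have to coincide.\<close>

definition qpg_equal_via :: "('i \<Rightarrow> 'j) \<Rightarrow> ('i, 'a) qpg \<Rightarrow> ('j, 'b) qpg \<Rightarrow> bool" where
  "qpg_equal_via f P Q \<longleftrightarrow> bij_betw f (points P) (points Q) \<and>
     (\<exists>\<phi>\<in>star_iso (qalg P) (qalg Q).
        \<forall>i\<in>points P. \<forall>j\<in>points P. \<phi> (fund P i j) = fund Q (f i) (f j))"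

definition qpg_equal :: "('i, 'a) qpg \<Rightarrow> ('i, 'b) qpg \<Rightarrow> bool" where
  "qpg_equal P Q \<longleftrightarrow> qpg_equal_via id P Q"

definition magic_unitary ::
  "('a, 'm) star_alg_scheme \<Rightarrow> 'i set \<Rightarrow> 'j set \<Rightarrow> ('i \<Rightarrow> 'j \<Rightarrow> 'a) \<Rightarrow> bool" where
  "magic_unitary A I J u \<longleftrightarrow>
     (\<forall>i\<in>I. \<forall>j\<in>J. u i j \<in> carrier A \<and> u i j \<otimes>\<^bsub>A\<^esub> u i j = u i j \<and> star A (u i j) = u i j) \<and>
     (\<forall>i\<in>I. (\<Oplus>\<^bsub>A\<^esub>j\<in>J. u i j) = \<one>\<^bsub>A\<^esub>) \<and>
     (\<forall>j\<in>J. (\<Oplus>\<^bsub>A\<^esub>i\<in>I. u i j) = \<one>\<^bsub>A\<^esub>)"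

text \<open>HOL cannot quantify over types, so the type of the C*-algebra is fixed.  This loses nothing:
  if some C*-algebra works, then so does the universal one with the same presentation, and that
  one lives in the chosen type.\<close>

definition quantum_isomorphic :: "'v pair_pre_digraph \<Rightarrow> 'w pair_pre_digraph \<Rightarrow> bool" where
  "quantum_isomorphic X Y \<longleftrightarrow>
     (\<exists>(A :: ('v \<times> 'w) universal cstar_alg) u.
        unital_cstar_algebra A \<and> \<one>\<^bsub>A\<^esub> \<noteq> \<zero>\<^bsub>A\<^esub> \<and>
        magic_unitary A (pverts X) (pverts Y) u \<and>
        (\<forall>x\<in>pverts X. \<forall>y\<in>pverts Y.
           (\<Oplus>\<^bsub>A\<^esub>z\<in>pverts X. scale A (adjacency X x z) (u z y)) =
           (\<Oplus>\<^bsub>A\<^esub>z\<in>pverts Y. scale A (adjacency Y z y) (u x z))))"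

definition Qut_relations :: "'v pair_pre_digraph \<Rightarrow> ('v \<times> 'v) free_poly set" where
  "Qut_relations X = (let V = pverts X; u = (\<lambda>x y. gen (x, y)) in
     {u x y * u x y - u x y | x y. x \<in> V \<and> y \<in> V} \<union>
     {free_star (u x y) - u x y | x y. x \<in> V \<and> y \<in> V} \<union>
     {(\<Sum>y\<in>V. u x y) - 1 | x. x \<in> V} \<union>
     {(\<Sum>x\<in>V. u x y) - 1 | y. y \<in> V} \<union>
     {(\<Sum>z\<in>V. free_scale (adjacency X x z) (u z y)) -
      (\<Sum>z\<in>V. free_scale (adjacency X z y) (u x z)) | x y. x \<in> V \<and> y \<in> V})"

definition Qut :: "'v pair_pre_digraph \<Rightarrow> ('v, ('v \<times> 'v) universal) qpg" where
  "Qut X =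
    \<lparr>points = pverts X,
     qalg = universal_cstar (pverts X \<times> pverts X) (Qut_relations X),
     fund = (\<lambda>x y. universal_gen (pverts X \<times> pverts X) (Qut_relations X) (x, y))\<rparr>"

definition quantum_vertex_transitive :: "'v pair_pre_digraph \<Rightarrow> bool" where
  "quantum_vertex_transitive X \<longleftrightarrow>
     (\<forall>x\<in>pverts X. \<forall>x'\<in>pverts X. fund (Qut X) x x' \<noteq> \<zero>\<^bsub>qalg (Qut X)\<^esub>)"


section \<open>Free wreath products\<close>

text \<open>With \<open>P\<close> acting on \<open>[m]\<close> and \<open>Q\<close> acting on \<open>[n]\<close>: the free product of \<open>n\<close> copies of the
  algebra of \<open>P\<close>, its free product with the algebra of \<open>Q\<close>, and the images \<open>u\<^sup>(\<^sup>a\<^sup>)\<^sub>i\<^sub>j\<close> and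
  \<open>v\<^sub>a\<^sub>b\<close> of the two fundamental representations in the latter.\<close>

definition wreath_copies :: "('i, 'a) qpg \<Rightarrow> ('k, 'b) qpg \<Rightarrow> ('k \<times> 'a) universal cstar_alg" where
  "wreath_copies P Q = family_coproduct (points Q) (\<lambda>_. qalg P)"

definition wreath_cover ::
  "('i, 'a) qpg \<Rightarrow> ('k, 'b) qpg \<Rightarrow> (('k \<times> 'a) universal + 'b) universal cstar_alg" where
  "wreath_cover P Q = sum_coproduct (wreath_copies P Q) (qalg Q)"

definition wreath_u :: "('i, 'a) qpg \<Rightarrow> ('k, 'b) qpg \<Rightarrow>
    'k \<Rightarrow> 'i \<Rightarrow> 'i \<Rightarrow> (('k \<times> 'a) universal + 'b) universal" where
  "wreath_u P Q a i j =
     sum_inl (wreath_copies P Q) (qalg Q) (family_in (points Q) (\<lambda>_. qalg P) a (fund P i j))"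

definition wreath_v :: "('i, 'a) qpg \<Rightarrow> ('k, 'b) qpg \<Rightarrow>
    'k \<Rightarrow> 'k \<Rightarrow> (('k \<times> 'a) universal + 'b) universal" where
  "wreath_v P Q a b = sum_inr (wreath_copies P Q) (qalg Q) (fund Q a b)"

definition wreath_ideal ::
  "('i, 'a) qpg \<Rightarrow> ('k, 'b) qpg \<Rightarrow> (('k \<times> 'a) universal + 'b) universal set" where
  "wreath_ideal P Q = closed_ideal_generated (wreath_cover P Q)
     {wreath_u P Q a i j \<otimes>\<^bsub>wreath_cover P Q\<^esub> wreath_v P Q a b \<ominus>\<^bsub>wreath_cover P Q\<^esub>
      wreath_v P Q a b \<otimes>\<^bsub>wreath_cover P Q\<^esub> wreath_u P Q a i j | i j a b.
      i \<in> points P \<and> j \<in> points P \<and> a \<in> points Q \<and> b \<in> points Q}"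

definition free_wreath :: "('i, 'a) qpg \<Rightarrow> ('k, 'b) qpg \<Rightarrow>
    ('k \<times> 'i, (('k \<times> 'a) universal + 'b) universal set) qpg" where
  "free_wreath P Q =
    \<lparr>points = points Q \<times> points P,
     qalg = quotient_cstar (wreath_cover P Q) (wreath_ideal P Q),
     fund = (\<lambda>(a, i) (b, j). wreath_ideal P Q +>\<^bsub>wreath_cover P Q\<^esub>
       (wreath_u P Q a i j \<otimes>\<^bsub>wreath_cover P Q\<^esub> wreath_v P Q a b))\<rparr>"

end

theory Submission
  imports Defs
begin

text \<open>Write \<open>u\<close> for the fundamental representation of \<open>Qut(X[Y])\<close>, and call a binary relation on
  vertices preserved if \<open>u\<^sub>p\<^sub>q u\<^sub>r\<^sub>s = 0\<close> whenever it distinguishes \<open>(p, r)\<close> from \<open>(q, s)\<close>.  Preserved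
  relations are closed under Boolean operations, counting of two-step paths and transitive closure.
  If the fibre relation of \<open>X[Y]\<close> is preserved, then summing \<open>u\<close> over fibres, or across them, splits
  it as in the free wreath product, and universal properties give \<open>Qut(X[Y]) = Qut(Y) \<wr>\<^sub>* Qut(X)\<close>.

  A quantum vertex transitive \<open>Y\<close> is regular, and for regular \<open>Y\<close> with connected complement the sizes
  of symmetric differences of neighbourhoods show that the fibre relation is preserved as soon as
  \<open>Y\<close> is connected or \<open>X\<close> has no twins.  So under the hypotheses \<open>X\<close> has twins and \<open>Y\<close> is
  disconnected.  The twin and the component relations are preserved as well: twin classes
  give \<open>X = X'[\<alpha>K\<^sub>1]\<close>, and the compressions of \<open>u\<close> to the corners cut out by its block sums make the
  components of \<open>Y\<close> quantum isomorphic and quantum vertex transitive.  The criterion applies again to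
  \<open>X'\<close> without twins and the disconnected \<open>\<alpha>Y\<close>.

  On the analytic side everything rests on the square root of \<open>1 - x\<close> for a self-adjoint
  contraction \<open>x\<close>: it shows that C*-seminorms on C*-algebras are dominated by the norm (so that the
  suprema defining the universal algebras are finite), that projections with sum 1 are orthogonal,
  and that quotients by closed ideals are C*-algebras.\<close>

section \<open>C*-seminorms\<close>

text \<open>What breaks the fibres of X[Y] is visible classically: if x, x' are twins of X and Y is
  disconnected, a single component of Y may be exchanged between the fibres over x and x'. Over the
  twin quotient X' a fibre consists of \<alpha> disjoint copies of Y, such exchanges stay inside it,
  and \<beta> > 1 makes its complement connected. Nonvanishing of a product of two entries of u
  replaces an orbit of pairs. Counting still works: sums equal to 1 inserted between the factors
  turn the number of intermediate vertices into a scalar multiple of the product, and different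
  multiples of a nonzero element are different. A universal algebra is the completion in a supremum
  of C*-seminorms, which means nothing unless they are bounded on generators. For \<open>Qut\<close>
  the generators are projections modulo the relations. For coproducts they are all elements of the
  given algebras, and the bound is the domination of C*-seminorms by a complete C*-norm. The
  analysis works with squares and with the norm of 1 - a in place of spectra: self-adjoint x and s
  that commute with x^2 + s^2 = 1 give u = x + is with star u times u equal to 1, so x has seminorm
  at most 1 in every C*-seminorm.\<close>

no_notation vwalk_join (infixr "\<oplus>" 65)

section \<open>Arithmetic in star algebras\<close>

context star_algebra
begin

lemma diff_eq_zero_iff [simp]:
  assumes "x \<in> carrier A" "y \<in> carrier A"
  shows "x \<ominus> y = \<zero> \<longleftrightarrow> x = y"
proof
  assume "x \<ominus> y = \<zero>"
  then have "\<ominus> y = \<ominus> x" using assms by (intro minus_equality[symmetric]) (auto simp: minus_eq a_comm)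
  then show "x = y" using assms by (metis minus_minus)
qed (use assms in \<open>simp add: minus_eq r_neg\<close>)

lemma diff_self [simp]: "x \<in> carrier A \<Longrightarrow> x \<ominus> x = \<zero>"
  by simp

lemma scale_zero_left [simp]: "x \<in> carrier A \<Longrightarrow> scale A 0 x = \<zero>"
  using scale_add_left[of x 0 0] scale_closed[of x 0] by (simp add: add.l_cancel_one')

lemma scale_zero_right [simp]: "scale A c \<zero> = \<zero>"
  using scale_add_right[of \<zero> \<zero> c] scale_closed[of \<zero> c] by (simp add: add.l_cancel_one')

lemma scale_minus_one: "x \<in> carrier A \<Longrightarrow> scale A (-1) x = \<ominus> x"
  using scale_add_left[of x "-1" 1] scale_one[of x] scale_closed[of x "-1"]
  by (simp add: minus_equality)

lemma scale_minus_right: "x \<in> carrier A \<Longrightarrow> scale A c (\<ominus> x) = \<ominus> scale A c x"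
  by (metis scale_closed scale_minus_one scale_scale mult.commute)

lemma scale_diff_right:
  "\<lbrakk>x \<in> carrier A; y \<in> carrier A\<rbrakk> \<Longrightarrow> scale A c (x \<ominus> y) = scale A c x \<ominus> scale A c y"
  by (simp add: minus_eq scale_add_right scale_minus_right)

lemma star_zero [simp]: "star A \<zero> = \<zero>"
  using star_add[of \<zero> \<zero>] star_closed[of \<zero>] by (simp add: add.l_cancel_one')

lemma star_one [simp]: "star A \<one> = \<one>"
  by (metis one_closed r_one l_one star_closed star_mult star_star)

lemma star_minus: "x \<in> carrier A \<Longrightarrow> star A (\<ominus> x) = \<ominus> star A x"
  by (metis (no_types, lifting) scale_minus_one star_scale star_closed complex_cnj_minus complex_cnj_one)

lemma star_diff: "\<lbrakk>x \<in> carrier A; y \<in> carrier A\<rbrakk> \<Longrightarrow> star A (x \<ominus> y) = star A x \<ominus> star A y"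
  by (simp add: minus_eq star_add star_minus star_closed)

lemma star_finsum:
  "finite I \<Longrightarrow> f \<in> I \<rightarrow> carrier A \<Longrightarrow> star A (\<Oplus>i\<in>I. f i) = (\<Oplus>i\<in>I. star A (f i))"
  by (induction I rule: finite_induct) (auto simp: star_add star_closed Pi_def finsum_closed)

lemma diff_diff_swap:
  "\<lbrakk>a \<in> carrier A; b \<in> carrier A; c \<in> carrier A; d \<in> carrier A\<rbrakk> \<Longrightarrow>
    (a \<oplus> b) \<ominus> (c \<oplus> d) = (a \<ominus> c) \<oplus> (b \<ominus> d)"
  by (simp add: minus_eq minus_add a_ac)

text \<open>The telescoping identity behind all estimates for products: joint continuity, products
  of Cauchy sequences, and the step bound of the square root iteration.\<close>

lemma diff_mult_split:
  "\<lbrakk>a \<in> carrier A; b \<in> carrier A; c \<in> carrier A; d \<in> carrier A\<rbrakk> \<Longrightarrow>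
    (a \<otimes> b) \<ominus> (c \<otimes> d) = (a \<ominus> c) \<otimes> b \<oplus> c \<otimes> (b \<ominus> d)"
  by (simp add: minus_eq l_distr r_distr l_minus r_minus a_assoc)
     (metis (no_types, lifting) a_closed a_inv_closed add.inv_closed m_closed r_neg1)

lemma diff_triangle:
  "\<lbrakk>a \<in> carrier A; b \<in> carrier A; c \<in> carrier A\<rbrakk> \<Longrightarrow> a \<ominus> c = (a \<ominus> b) \<oplus> (b \<ominus> c)"
  by (simp add: minus_eq a_assoc r_neg1)

end

section \<open>C*-seminorms and convergence with respect to them\<close>

locale seminormed_star_algebra = star_algebra A for A :: "('a, 'm) star_alg_scheme" (structure) +
  fixes p :: "'a \<Rightarrow> real"
  assumes semi: "cstar_seminorm A p"
begin

lemma p_nonneg [simp]: "x \<in> carrier A \<Longrightarrow> 0 \<le> p x"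
  and p_add: "\<lbrakk>x \<in> carrier A; y \<in> carrier A\<rbrakk> \<Longrightarrow> p (x \<oplus> y) \<le> p x + p y"
  and p_scale: "x \<in> carrier A \<Longrightarrow> p (scale A c x) = cmod c * p x"
  and p_mult: "\<lbrakk>x \<in> carrier A; y \<in> carrier A\<rbrakk> \<Longrightarrow> p (x \<otimes> y) \<le> p x * p y"
  and p_cstar: "x \<in> carrier A \<Longrightarrow> p (star A x \<otimes> x) = (p x)\<^sup>2"
  using semi unfolding cstar_seminorm_def by auto

lemma p_zero [simp]: "p \<zero> = 0"
  using p_scale[of \<zero> 0] by simp

lemma p_minus: "x \<in> carrier A \<Longrightarrow> p (\<ominus> x) = p x"
  using p_scale[of x "-1"] by (simp add: scale_minus_one)

lemma p_diff: "\<lbrakk>x \<in> carrier A; y \<in> carrier A\<rbrakk> \<Longrightarrow> p (x \<ominus> y) \<le> p x + p y"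
  using p_add[of x "\<ominus> y"] by (simp add: minus_eq p_minus)

lemma p_diff_commute: "\<lbrakk>x \<in> carrier A; y \<in> carrier A\<rbrakk> \<Longrightarrow> p (x \<ominus> y) = p (y \<ominus> x)"
  using p_minus[of "x \<ominus> y"] by (simp add: minus_eq minus_add a_comm)

lemma p_diff_triangle:
  "\<lbrakk>x \<in> carrier A; y \<in> carrier A; z \<in> carrier A\<rbrakk> \<Longrightarrow> p (x \<ominus> z) \<le> p (x \<ominus> y) + p (y \<ominus> z)"
  using diff_triangle[of x y z] p_add[of "x \<ominus> y" "y \<ominus> z"] by simp

lemma p_le_diff: "\<lbrakk>x \<in> carrier A; y \<in> carrier A\<rbrakk> \<Longrightarrow> p x \<le> p (x \<ominus> y) + p y"
  using p_diff_triangle[of x y \<zero>] by (simp add: minus_eq)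

lemma p_abs_diff: "\<lbrakk>x \<in> carrier A; y \<in> carrier A\<rbrakk> \<Longrightarrow> \<bar>p x - p y\<bar> \<le> p (x \<ominus> y)"
  using p_le_diff[of x y] p_le_diff[of y x] p_diff_commute[of x y] by simp

text \<open>\<open>cstar_seminorm\<close> does not ask the adjoint to be isometric. The C*-identity
  and submultiplicativity bound the square of p at y by the product of the values at y and at its
  adjoint; cancelling one factor, once for x and once for the adjoint of x, gives both
  inequalities.\<close>

lemma p_star: assumes "x \<in> carrier A" shows "p (star A x) = p x"
proof -
  have *: "p y \<le> p (star A y)" if y: "y \<in> carrier A" for y
  proof (cases "p y = 0")
    case False
    have "p y * p y \<le> p (star A y) * p y"
      using p_cstar[OF y] p_mult[of "star A y" y] y by (simp add: star_closed power2_eq_square)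
    then show ?thesis using False p_nonneg[OF y] by simp
  qed (use y in \<open>simp add: star_closed\<close>)
  show ?thesis using *[of x] *[of "star A x"] assms by (simp add: star_closed star_star)
qed

text \<open>The value 0 does occur: the zero seminorm is one of those over which a universal
  seminorm is formed.\<close>

lemma p_one_cases: "p \<one> = 0 \<or> p \<one> = 1"
proof -
  have "p \<one> = p \<one> * p \<one>" using p_cstar[of \<one>] by (simp add: power2_eq_square)
  then show ?thesis by (metis mult_cancel_left1)
qed

lemma p_one_le: "p \<one> \<le> 1"
  using p_one_cases by auto

text \<open>Membership in the carrier is part of convergence, so that the limit rules compose
  without side conditions. For a mere seminorm, limits are unique only up to seminorm 0
  (\<open>tends_diff_zero\<close>).\<close>

definition tends :: "(nat \<Rightarrow> 'a) \<Rightarrow> 'a \<Rightarrow> bool" where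
  "tends s x \<longleftrightarrow> (\<forall>n. s n \<in> carrier A) \<and> x \<in> carrier A \<and> (\<lambda>n. p (s n \<ominus> x)) \<longlonglongrightarrow> 0"

lemma tendsI:
  assumes "\<And>n. s n \<in> carrier A" "x \<in> carrier A" "\<And>n. p (s n \<ominus> x) \<le> e n" "e \<longlonglongrightarrow> 0"
  shows "tends s x"
  unfolding tends_def using assms
  by (auto intro!: tendsto_sandwich[of "\<lambda>_. 0" "\<lambda>n. p (s n \<ominus> x)" sequentially e 0])

lemma tends_const: "x \<in> carrier A \<Longrightarrow> tends (\<lambda>_. x) x"
  by (simp add: tends_def r_neg minus_eq)

lemma tends_Suc: "tends s x \<Longrightarrow> tends (\<lambda>n. s (Suc n)) x"
  unfolding tends_def using LIMSEQ_Suc by blast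

lemma tends_add: assumes "tends s x" "tends t y" shows "tends (\<lambda>n. s n \<oplus> t n) (x \<oplus> y)"
proof (rule tendsI[where e = "\<lambda>n. p (s n \<ominus> x) + p (t n \<ominus> y)"])
  show "(\<lambda>n. p (s n \<ominus> x) + p (t n \<ominus> y)) \<longlonglongrightarrow> 0"
    using assms tendsto_add_zero unfolding tends_def by blast
  show "p (s n \<oplus> t n \<ominus> (x \<oplus> y)) \<le> p (s n \<ominus> x) + p (t n \<ominus> y)" for n
    using assms unfolding tends_def by (simp add: diff_diff_swap p_add)
qed (use assms in \<open>auto simp: tends_def\<close>)

lemma tends_scale: assumes "tends s x" shows "tends (\<lambda>n. scale A c (s n)) (scale A c x)"
proof (rule tendsI[where e = "\<lambda>n. cmod c * p (s n \<ominus> x)"])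
  show "(\<lambda>n. cmod c * p (s n \<ominus> x)) \<longlonglongrightarrow> 0"
    using assms tendsto_mult_right_zero unfolding tends_def by blast
qed (use assms in \<open>auto simp: tends_def scale_closed p_scale simp flip: scale_diff_right\<close>)

lemma tends_minus: "tends s x \<Longrightarrow> tends (\<lambda>n. \<ominus> s n) (\<ominus> x)"
  using tends_scale[of s x "-1"] by (simp add: tends_def scale_minus_one)

lemma tends_diff: "tends s x \<Longrightarrow> tends t y \<Longrightarrow> tends (\<lambda>n. s n \<ominus> t n) (x \<ominus> y)"
  using tends_add[OF _ tends_minus] by (simp add: minus_eq)

lemma tends_star: assumes "tends s x" shows "tends (\<lambda>n. star A (s n)) (star A x)"
  using assms unfolding tends_def by (auto simp: star_closed p_star simp flip: star_diff)

lemma tends_norm: assumes "tends s x" shows "(\<lambda>n. p (s n)) \<longlonglongrightarrow> p x"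
proof -
  have "(\<lambda>n. p (s n) - p x) \<longlonglongrightarrow> 0"
    using assms unfolding tends_def
    by (intro tendsto_rabs_zero_cancel[of "\<lambda>n. p (s n) - p x"] 
        tendsto_sandwich[of "\<lambda>_. 0" "\<lambda>n. \<bar>p (s n) - p x\<bar>" sequentially "\<lambda>n. p (s n \<ominus> x)" 0])
       (auto simp: p_abs_diff)
  then show ?thesis by (simp add: LIM_zero_iff)
qed

lemma tends_mult: assumes "tends s x" "tends t y" shows "tends (\<lambda>n. s n \<otimes> t n) (x \<otimes> y)"
proof (rule tendsI[where e = "\<lambda>n. p (s n \<ominus> x) * p (t n) + p x * p (t n \<ominus> y)"])
  show "(\<lambda>n. p (s n \<ominus> x) * p (t n) + p x * p (t n \<ominus> y)) \<longlonglongrightarrow> 0"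
    using tendsto_add[OF tendsto_mult[of "\<lambda>n. p (s n \<ominus> x)" 0 _ "\<lambda>n. p (t n)" "p y"]
        tendsto_mult[of "\<lambda>n. p x" "p x" _ "\<lambda>n. p (t n \<ominus> y)" 0]] assms tends_norm[of t y]
    unfolding tends_def by simp
  show "p (s n \<otimes> t n \<ominus> x \<otimes> y) \<le> p (s n \<ominus> x) * p (t n) + p x * p (t n \<ominus> y)" for n
  proof -
    have c: "s n \<in> carrier A" "t n \<in> carrier A" "x \<in> carrier A" "y \<in> carrier A"
      using assms by (auto simp: tends_def)
    have "p (s n \<otimes> t n \<ominus> x \<otimes> y) \<le> p ((s n \<ominus> x) \<otimes> t n) + p (x \<otimes> (t n \<ominus> y))"
      using c by (simp add: diff_mult_split p_add)
    also have "\<dots> \<le> p (s n \<ominus> x) * p (t n) + p x * p (t n \<ominus> y)"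
      using c by (intro add_mono p_mult) auto
    finally show ?thesis .
  qed
qed (use assms in \<open>auto simp: tends_def\<close>)

lemma tends_norm_le: "tends s x \<Longrightarrow> (\<And>n. p (s n) \<le> c) \<Longrightarrow> p x \<le> c"
  using tends_norm LIMSEQ_le_const2 by blast

lemma tends_diff_zero: assumes "tends s x" "tends s y" shows "p (x \<ominus> y) = 0"
proof -
  have "tends (\<lambda>n. s n \<ominus> s n) (x \<ominus> y)" using tends_diff assms by blast
  then have "(\<lambda>n. p (s n \<ominus> s n)) \<longlonglongrightarrow> p (x \<ominus> y)" by (rule tends_norm)
  moreover have "p (s n \<ominus> s n) = 0" for n using assms by (simp add: tends_def minus_eq r_neg)
  ultimately show ?thesis by (simp add: LIMSEQ_const_iff)
qed

lemma tends_cauchy: assumes "tends s x" shows "s \<in> cauchy_seqs A p"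
  unfolding cauchy_seqs_def
proof (intro CollectI conjI allI impI)
  show "s n \<in> carrier A" for n using assms by (simp add: tends_def)
  fix e :: real assume "0 < e"
  then have "\<forall>\<^sub>F n in sequentially. p (s n \<ominus> x) < e / 2"
    using assms unfolding tends_def by (auto dest!: order_tendstoD(2)[of _ _ _ "e/2"])
  then obtain N where N: "\<And>n. n \<ge> N \<Longrightarrow> p (s n \<ominus> x) < e / 2"
    unfolding eventually_sequentially by blast
  have "p (s m \<ominus> s n) < e" if "m \<ge> N" "n \<ge> N" for m n
    using p_diff_triangle[of "s m" x "s n"] N[OF that(1)] N[OF that(2)] assms p_diff_commute[of x "s n"]
    by (simp add: tends_def)
  then show "\<exists>N. \<forall>m\<ge>N. \<forall>n\<ge>N. p (s m \<ominus> s n) < e" by blast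
qed

text \<open>Comparison with a numerical sequence: increments bounded by those of \<open>v\<close>
  telescope. It serves the square root iteration, the Neumann series and the lifting of sequences
  from a quotient.\<close>

lemma dominated_cauchy:
  assumes c: "\<And>n. s n \<in> carrier A" and step: "\<And>n. p (s (Suc n) \<ominus> s n) \<le> v (Suc n) - v n"
    and "Cauchy v"
  shows "s \<in> cauchy_seqs A p"
  unfolding cauchy_seqs_def
proof (intro CollectI conjI allI impI)
  have steps: "p (s (n + k) \<ominus> s n) \<le> v (n + k) - v n" for n k
  proof (induction k)
    case 0
    then show ?case using c[of n] by simp
  next
    case (Suc k)
    then show ?case
      using p_diff_triangle[of "s (Suc (n + k))" "s (n + k)" "s n"] c step[of "n + k"] by simp
  qed
  fix e :: real assume "0 < e"
  then obtain N where N: "\<And>m n. m \<ge> N \<Longrightarrow> n \<ge> N \<Longrightarrow> \<bar>v m - v n\<bar> < e"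
    using \<open>Cauchy v\<close> unfolding Cauchy_def dist_real_def by meson
  have "p (s m \<ominus> s n) < e" if "m \<ge> N" "n \<ge> N" for m n
  proof (cases "n \<le> m")
    case True
    then show ?thesis using steps[of n "m - n"] N[OF that] by simp
  next
    case False
    then show ?thesis using steps[of m "n - m"] N[OF that] p_diff_commute[OF c c, of m n] by simp
  qed
  then show "\<exists>N. \<forall>m\<ge>N. \<forall>n\<ge>N. p (s m \<ominus> s n) < e" by blast
qed (use c in simp)

text \<open>The power x^(2^n). Repeated squaring keeps elements self-adjoint, so that the
  C*-identity applies at every stage and gives the seminorm exactly.\<close>

primrec sq_pow :: "nat \<Rightarrow> 'a \<Rightarrow> 'a" where
  "sq_pow 0 x = x" | "sq_pow (Suc n) x = sq_pow n x \<otimes> sq_pow n x"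

lemma sq_pow_closed [simp]: "x \<in> carrier A \<Longrightarrow> sq_pow n x \<in> carrier A"
  by (induction n) auto

lemma sq_pow_star: "x \<in> carrier A \<Longrightarrow> star A x = x \<Longrightarrow> star A (sq_pow n x) = sq_pow n x"
  by (induction n) (auto simp: star_mult)

lemma p_square: "x \<in> carrier A \<Longrightarrow> star A x = x \<Longrightarrow> p (x \<otimes> x) = (p x)\<^sup>2"
  using p_cstar[of x] by simp

lemma p_sq_pow: "x \<in> carrier A \<Longrightarrow> star A x = x \<Longrightarrow> p (sq_pow n x) = p x ^ (2 ^ n)"
  by (induction n) (auto simp: p_square sq_pow_star power_mult[symmetric] mult.commute simp flip: power_mult)

text \<open>The spectral radius argument: for self-adjoint x the seminorm of x^(2^n) equals the
  2^n-th power of p(x), which is unbounded in n as soon as p(x) > 1.\<close>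

lemma p_le_one_of_bounded_powers:
  assumes "x \<in> carrier A" "star A x = x" "\<And>n. p (sq_pow n x) \<le> c"
  shows "p x \<le> 1"
proof (rule ccontr)
  assume "\<not> p x \<le> 1"
  then obtain k where k: "c < p x ^ k" using real_arch_pow by (metis not_le)
  have "p x ^ k \<le> p x ^ (2 ^ k)" using \<open>\<not> p x \<le> 1\<close> by (intro power_increasing) auto
  then show False using assms(3)[of k] k p_sq_pow[OF assms(1,2), of k] by simp
qed

end

lemma (in star_algebra) seminormed: "cstar_seminorm A p \<Longrightarrow> seminormed_star_algebra A p"
  by (simp add: seminormed_star_algebra_def star_algebra_axioms seminormed_star_algebra_axioms_def)

sublocale unital_cstar_algebra \<subseteq> seminormed_star_algebra A "cnorm A"
  by unfold_locales (rule seminorm)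

context unital_cstar_algebra
begin

lemma norm_diff_zero: "\<lbrakk>x \<in> carrier A; y \<in> carrier A; cnorm A (x \<ominus> y) = 0\<rbrakk> \<Longrightarrow> x = y"
  using definite[of "x \<ominus> y"] by (simp add: diff_eq_zero_iff)

lemma tends_unique: "tends s x \<Longrightarrow> tends s y \<Longrightarrow> x = y"
  using tends_diff_zero[of s x y] norm_diff_zero unfolding tends_def by blast

lemma cauchy_tends: "s \<in> cauchy_seqs A (cnorm A) \<Longrightarrow> \<exists>x. tends s x"
  using complete[of s] unfolding tends_def cauchy_seqs_def by blast

lemma tends_commute:
  assumes "tends s x" "y \<in> carrier A" "\<And>n. s n \<otimes> y = y \<otimes> s n"
  shows "x \<otimes> y = y \<otimes> x"
  using tends_unique[OF tends_mult[OF assms(1) tends_const[OF assms(2)]]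
      tends_mult[OF tends_const[OF assms(2)] assms(1), folded assms(3)]] .

end

section \<open>Square roots in unital C*-algebras\<close>

primrec visser :: "nat \<Rightarrow> real" where
  "visser 0 = 0" | "visser (Suc n) = (1 + (visser n)\<^sup>2) / 2"

lemma visser_bounds: "0 \<le> visser n \<and> visser n \<le> 1"
  by (induction n) (auto simp: power_le_one)

lemma visser_mono: "visser n \<le> visser (Suc n)"
  using zero_le_power2[of "visser n - 1"] by (simp add: power2_eq_square algebra_simps)

lemma visser_Cauchy: "Cauchy visser"
  using visser_mono visser_bounds
  by (intro convergent_Cauchy Bseq_mono_convergent BseqI'[of _ 1] incseq_SucI[THEN incseqD]) 
     (auto intro: incseq_SucI[THEN incseqD])

context unital_cstar_algebra
begin

primrec visser_seq :: "'a \<Rightarrow> nat \<Rightarrow> 'a" where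
  "visser_seq x 0 = \<zero>"
| "visser_seq x (Suc n) = scale A (1/2) (x \<oplus> visser_seq x n \<otimes> visser_seq x n)"

lemma visser_seq_closed [simp]: "x \<in> carrier A \<Longrightarrow> visser_seq x n \<in> carrier A"
  by (induction n) (auto simp: scale_closed)

text \<open>The iteration \<open>y \<mapsto> (x + y\<^sup>2)/2\<close> converges to \<open>1 - sqrt (1 - x)\<close>; it is dominated
  termwise by its scalar version at \<open>x = 1\<close>.\<close>

lemma sqrt_exists:
  assumes x: "x \<in> carrier A" and sa: "star A x = x" and le: "cnorm A x \<le> 1"
  obtains s where "s \<in> carrier A" "star A s = s" "s \<otimes> s = \<one> \<ominus> x"
    "\<And>y. y \<in> carrier A \<Longrightarrow> x \<otimes> y = y \<otimes> x \<Longrightarrow> s \<otimes> y = y \<otimes> s"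
proof -
  let ?y = "visser_seq x"
  have bound: "cnorm A (?y n) \<le> visser n" for n
  proof (induction n)
    case (Suc n)
    have "cnorm A (?y n \<otimes> ?y n) \<le> (visser n)\<^sup>2"
      using p_mult[of "?y n" "?y n"] mult_mono[OF Suc Suc] x visser_bounds[of n]
      by (simp add: power2_eq_square)
    then show ?case using p_add[of x "?y n \<otimes> ?y n"] le x by (simp add: p_scale)
  qed simp
  \<comment> \<open>The next increment is half of a^2 - b^2 = (a - b)a + b(a - b) for consecutive
    iterates a, b. Bounding the factors by the scalar iterates reproduces the scalar recursion,
    without any commutativity.\<close>
  have step: "cnorm A (?y (Suc n) \<ominus> ?y n) \<le> visser (Suc n) - visser n" for n
  proof (induction n)
    case 0
    then show ?case using x le by (simp add: p_scale minus_eq scale_closed)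
  next
    case (Suc n)
    let ?a = "?y (Suc n)" and ?b = "?y n"
    have c: "?a \<in> carrier A" "?b \<in> carrier A" using x visser_seq_closed by blast+
    have "?y (Suc (Suc n)) \<ominus> ?a = scale A (1/2) ((x \<oplus> ?a \<otimes> ?a) \<ominus> (x \<oplus> ?b \<otimes> ?b))"
      using x c by (subst scale_diff_right) auto
    also have "(x \<oplus> ?a \<otimes> ?a) \<ominus> (x \<oplus> ?b \<otimes> ?b) = (?a \<ominus> ?b) \<otimes> ?a \<oplus> ?b \<otimes> (?a \<ominus> ?b)"
      using x c diff_diff_swap[of x "?a \<otimes> ?a" x "?b \<otimes> ?b"] diff_mult_split[of ?a ?a ?b ?b] c
      by (metis (no_types, lifting) a_closed l_zero m_closed minus_closed diff_eq_zero_iff)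
    finally have "cnorm A (?y (Suc (Suc n)) \<ominus> ?a) = cnorm A ((?a \<ominus> ?b) \<otimes> ?a \<oplus> ?b \<otimes> (?a \<ominus> ?b)) / 2"
      using c p_scale[of "(?a \<ominus> ?b) \<otimes> ?a \<oplus> ?b \<otimes> (?a \<ominus> ?b)" "1/2"]
      by (metis (no_types, lifting) a_closed m_closed minus_closed norm_divide norm_one norm_numeral
          times_divide_eq_left mult_1)
    also have "\<dots> \<le> (cnorm A ((?a \<ominus> ?b) \<otimes> ?a) + cnorm A (?b \<otimes> (?a \<ominus> ?b))) / 2"
      using c p_add by (intro divide_right_mono) auto
    also have "\<dots> \<le> (cnorm A (?a \<ominus> ?b) * cnorm A ?a + cnorm A ?b * cnorm A (?a \<ominus> ?b)) / 2"
      using c p_mult by (intro divide_right_mono add_mono) auto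
    also have "\<dots> \<le> ((visser (Suc n) - visser n) * visser (Suc n) + visser n * (visser (Suc n) - visser n)) / 2"
      using c bound[of n] bound[of "Suc n"] Suc visser_bounds visser_mono[of n]
      by (intro divide_right_mono add_mono mult_mono) (auto simp del: visser.simps visser_seq.simps)
    also have "\<dots> = visser (Suc (Suc n)) - visser (Suc n)"
      unfolding visser.simps(2)[of "Suc n"]
      by (subst (5) visser.simps(2)) (simp add: power2_eq_square field_simps del: visser.simps)
    finally show ?case .
  qed
  have "?y \<in> cauchy_seqs A (cnorm A)"
    using x step by (intro dominated_cauchy[OF _ _ visser_Cauchy]) auto
  then obtain y where y: "tends ?y y" using cauchy_tends by blast
  have yc: "y \<in> carrier A" using y by (simp add: tends_def)
  have "tends (\<lambda>n. scale A (1/2) (x \<oplus> ?y n \<otimes> ?y n)) (scale A (1/2) (x \<oplus> y \<otimes> y))"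
    by (intro tends_scale tends_add tends_mult tends_const x y)
  then have "tends (\<lambda>n. ?y (Suc n)) (scale A (1/2) (x \<oplus> y \<otimes> y))"
    by simp
  then have fixpt: "y = scale A (1/2) (x \<oplus> y \<otimes> y)"
    by (rule tends_unique[OF tends_Suc[OF y]])
  have "y \<oplus> y = scale A (1/2) (x \<oplus> y \<otimes> y) \<oplus> scale A (1/2) (x \<oplus> y \<otimes> y)"
    by (rule arg_cong2[OF fixpt fixpt])
  also have "\<dots> = x \<oplus> y \<otimes> y"
    using x yc scale_add_left[of "x \<oplus> y \<otimes> y" "1/2" "1/2"] scale_one[of "x \<oplus> y \<otimes> y"] by simp
  finally have 2: "y \<oplus> y = x \<oplus> y \<otimes> y" .
  have "(\<one> \<ominus> y) \<otimes> (\<one> \<ominus> y) = \<one> \<ominus> (y \<oplus> y) \<oplus> y \<otimes> y"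
    using yc by (simp add: minus_eq l_distr r_distr l_minus r_minus minus_add a_assoc)
  also have "\<dots> = \<one> \<ominus> x"
    using yc x unfolding 2 by (simp add: minus_eq minus_add a_assoc l_neg)
  finally have sq: "(\<one> \<ominus> y) \<otimes> (\<one> \<ominus> y) = \<one> \<ominus> x" .
  have "star A (?y n) = ?y n" for n
    using x sa by (induction n) (auto simp: star_scale star_add star_mult scale_closed)
  then have ys: "star A y = y" using tends_unique[OF tends_star[OF y]] y by simp
  \<comment> \<open>The iterates are polynomials in x, so whatever commutes with x commutes with
    each of them and with their limit.\<close>
  have comm: "y \<otimes> z = z \<otimes> y" if z: "z \<in> carrier A" "x \<otimes> z = z \<otimes> x" for z
  proof (rule tends_commute[OF y z(1)])
    show "?y n \<otimes> z = z \<otimes> ?y n" for n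
    proof (induction n)
      case (Suc n)
      have "?y n \<otimes> ?y n \<otimes> z = z \<otimes> (?y n \<otimes> ?y n)"
        using x z Suc by (metis m_assoc visser_seq_closed)
      then show ?case using x z by (simp add: scale_mult_left scale_mult_right l_distr r_distr)
    qed (use z in simp)
  qed
  show ?thesis
  proof (rule that[OF _ _ sq])
    show "(\<one> \<ominus> y) \<otimes> z = z \<otimes> (\<one> \<ominus> y)" if "z \<in> carrier A" "x \<otimes> z = z \<otimes> x" for z
      using comm[OF that] that yc by (simp add: minus_eq l_distr r_distr l_minus r_minus)
  qed (use yc ys in \<open>auto simp: star_diff\<close>)
qed

end

section \<open>Positivity\<close>

context star_algebra
begin

lemma add_diff_cancel:
  assumes "x \<in> carrier A" "y \<in> carrier A"
  shows "x \<oplus> (y \<ominus> x) = y" "(y \<ominus> x) \<oplus> x = y"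
proof -
  show "(y \<ominus> x) \<oplus> x = y" using assms by (simp add: minus_eq a_assoc l_neg)
  then show "x \<oplus> (y \<ominus> x) = y" using assms by (simp add: a_comm)
qed

lemma diff_diff_cancel:
  assumes "x \<in> carrier A" "y \<in> carrier A"
  shows "y \<ominus> (y \<ominus> x) = x"
  using assms by (simp add: minus_eq minus_add minus_minus r_neg2)

lemma diff_add_cancel_right:
  assumes "x \<in> carrier A" "y \<in> carrier A" "z \<in> carrier A"
  shows "(x \<ominus> (y \<oplus> z)) \<oplus> z = x \<ominus> y"
  using assms by (simp add: minus_eq minus_add a_assoc l_neg)

lemma one_diff_commute:
  assumes "x \<in> carrier A" "y \<in> carrier A" "x \<otimes> y = y \<otimes> x"
  shows "(\<one> \<ominus> x) \<otimes> y = y \<otimes> (\<one> \<ominus> x)"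
  using assms by (simp add: minus_eq l_distr r_distr l_minus r_minus)

end

context seminormed_star_algebra
begin

text \<open>The element u = x + is satisfies star u times u = x^2 + s^2 = 1, because x and s
  commute; hence p(u) is at most 1, and x is the mean of u and its adjoint. The hypotheses are
  purely algebraic, so the bound holds in every C*-seminorm at once.\<close>

lemma p_le_one_of_unitary_pair:
  assumes c: "x \<in> carrier A" "s \<in> carrier A" and sa: "star A x = x" "star A s = s"
    and comm: "x \<otimes> s = s \<otimes> x" and sum: "x \<otimes> x \<oplus> s \<otimes> s = \<one>"
  shows "p x \<le> 1"
proof -
  define u where "u = x \<oplus> scale A \<i> s"
  have uc: "u \<in> carrier A" using c by (simp add: u_def scale_closed)
  have us: "star A u = x \<oplus> scale A (-\<i>) s"
    using c sa by (simp add: u_def star_add star_scale scale_closed)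
  have m: "x \<otimes> s \<in> carrier A" using c by simp
  have cancel: "scale A \<i> y \<oplus> scale A (-\<i>) y = \<zero>" if "y \<in> carrier A" for y
    using that scale_add_left[of y \<i> "-\<i>"] by simp
  have "star A u \<otimes> u = (x \<otimes> x \<oplus> scale A \<i> (x \<otimes> s)) \<oplus> (scale A (-\<i>) (x \<otimes> s) \<oplus> s \<otimes> s)"
    using c comm unfolding us unfolding u_def
    by (simp add: l_distr r_distr scale_closed scale_mult_left scale_mult_right scale_scale scale_one
        scale_add_right a_ac)
  also have "\<dots> = x \<otimes> x \<oplus> ((scale A \<i> (x \<otimes> s) \<oplus> scale A (-\<i>) (x \<otimes> s)) \<oplus> s \<otimes> s)"
    using c by (simp add: a_assoc scale_closed)
  also have "\<dots> = \<one>" using c cancel[OF m] sum by simp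
  finally have "(p u)\<^sup>2 \<le> 1" using p_cstar[OF uc] p_one_le by simp
  then have u1: "p u \<le> 1" using p_nonneg[OF uc] by (simp add: power_le_one_iff abs_le_square_iff)
  have "u \<oplus> star A u = (x \<oplus> x) \<oplus> (scale A \<i> s \<oplus> scale A (-\<i>) s)"
    unfolding us unfolding u_def using c by (simp add: a_ac scale_closed)
  also have "\<dots> = scale A 2 x"
    using c cancel[of s] scale_add_left[of x 1 1] by (simp add: scale_one)
  finally have "2 * p x \<le> p u + p (star A u)"
    using p_add[OF uc star_closed[OF uc]] p_scale[of x 2] c by simp
  then show ?thesis using u1 p_star[OF uc] by simp
qed

lemma p_projection_le:
  assumes "x \<in> carrier A" "x \<otimes> x = x" "star A x = x" shows "p x \<le> 1"
proof -
  have "p x = p x * p x" using p_cstar[of x] assms by (simp add: power2_eq_square)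
  then have "p x = 0 \<or> p x = 1" by (metis mult_cancel_left1)
  then show ?thesis by auto
qed

end

context unital_cstar_algebra
begin

text \<open>No continuity of q is assumed. If y is self-adjoint with norm at most 1, completeness
  supplies s with s^2 = 1 - y^2, and y, s form a unitary pair, which bounds q(y) by 1. Scaling
  covers self-adjoint elements, and the C*-identities of q and of the norm cover the rest through
  the product of x with its adjoint.\<close>

lemma seminorm_le_norm:
  assumes "cstar_seminorm A q" and x: "x \<in> carrier A"
  shows "q x \<le> cnorm A x"
proof -
  interpret q: seminormed_star_algebra A q using assms(1) by (rule seminormed)
  have le1: "q y \<le> 1" if y: "y \<in> carrier A" "star A y = y" "cnorm A y \<le> 1" for y
  proof -
    have "cnorm A (y \<otimes> y) \<le> 1" using p_square[OF y(1,2)] y by (simp add: power_le_one)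
    then have sq: "star A (y \<otimes> y) = y \<otimes> y" "cnorm A (y \<otimes> y) \<le> 1" "y \<otimes> y \<in> carrier A"
      using y by (auto simp: star_mult)
    then obtain s where s: "s \<in> carrier A" "star A s = s" "s \<otimes> s = \<one> \<ominus> y \<otimes> y"
     "\<And>z. z \<in> carrier A \<Longrightarrow> (y \<otimes> y) \<otimes> z = z \<otimes> (y \<otimes> y) \<Longrightarrow> s \<otimes> z = z \<otimes> s"
      using sqrt_exists[of "y \<otimes> y"] y(1) sq by blast
    \<comment> \<open>Here the commutation clause of \<open>sqrt_exists\<close> is needed: y
      commutes with y^2, hence with the root of 1 - y^2.\<close>
    have "s \<otimes> y = y \<otimes> s" using s(4)[OF y(1)] y by (simp add: m_assoc)
    then show ?thesis
      using q.p_le_one_of_unitary_pair[of y s] s(1-3) y by (simp add: add_diff_cancel)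
  qed
  have le: "q y \<le> cnorm A y" if y: "y \<in> carrier A" "star A y = y" for y
  proof (cases "cnorm A y = 0")
    case True
    then show ?thesis using definite[OF y(1)] by simp
  next
    case False
    define c where "c = cnorm A y"
    have c: "0 < c" using False p_nonneg[OF y(1)] by (simp add: c_def)
    have "q (scale A (of_real (1 / c)) y) \<le> 1"
      using y c by (intro le1) (auto simp: scale_closed star_scale p_scale c_def[symmetric] norm_divide)
    then show ?thesis using y c by (simp add: q.p_scale norm_divide c_def field_simps)
  qed
  have "(q x)\<^sup>2 \<le> cnorm A (star A x \<otimes> x)"
    using le[of "star A x \<otimes> x"] x q.p_cstar[OF x] by (simp add: star_mult star_star star_closed)
  then have "(q x)\<^sup>2 \<le> (cnorm A x)\<^sup>2" using p_cstar[OF x] by simp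
  then show ?thesis using x by (meson p_nonneg power2_le_imp_le)
qed

text \<open>The root t of 1 - s^2 forms a unitary pair with s in which the roles are exchanged, so t
  is a contraction and so is its square.\<close>

lemma norm_one_minus_square:
  assumes s: "s \<in> carrier A" "star A s = s" and le: "cnorm A s \<le> 1"
  shows "cnorm A (\<one> \<ominus> s \<otimes> s) \<le> 1"
proof -
  have "cnorm A (s \<otimes> s) \<le> 1" using p_square[OF s] s le by (simp add: power_le_one)
  then have sq: "star A (s \<otimes> s) = s \<otimes> s" "cnorm A (s \<otimes> s) \<le> 1" "s \<otimes> s \<in> carrier A"
    using s by (auto simp: star_mult)
  then obtain t where t: "t \<in> carrier A" "star A t = t" "t \<otimes> t = \<one> \<ominus> s \<otimes> s"
   "\<And>z. z \<in> carrier A \<Longrightarrow> (s \<otimes> s) \<otimes> z = z \<otimes> (s \<otimes> s) \<Longrightarrow> t \<otimes> z = z \<otimes> t"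
    using sqrt_exists[of "s \<otimes> s"] s(1) sq by blast
  have "t \<otimes> s = s \<otimes> t" using t(4)[OF s(1)] s by (simp add: m_assoc)
  then have "cnorm A t \<le> 1"
    using p_le_one_of_unitary_pair[of t s] t(1-3) s by (simp add: add_diff_cancel)
  then show ?thesis using p_square[OF t(1,2)] t(1,3) by (simp add: power_le_one)
qed

text \<open>Positivity as being the square of a self-adjoint element. For contractions it amounts to
  self-adjointness and 1 - a having norm at most 1 (\<open>posI\<close>,
  \<open>pos_norm_one_minus\<close>), and it is this criterion that makes sums tractable.\<close>

definition pos :: "'a \<Rightarrow> bool" where
  "pos a \<longleftrightarrow> (\<exists>s\<in>carrier A. star A s = s \<and> a = s \<otimes> s)"

lemma posI:
  assumes a: "a \<in> carrier A" "star A a = a" and le: "cnorm A (\<one> \<ominus> a) \<le> 1"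
  shows "pos a"
proof -
  have "star A (\<one> \<ominus> a) = \<one> \<ominus> a" using a by (simp add: star_diff)
  then obtain s where "s \<in> carrier A" "star A s = s" "s \<otimes> s = \<one> \<ominus> (\<one> \<ominus> a)"
    using sqrt_exists[of "\<one> \<ominus> a"] a(1) le by blast
  moreover have "\<one> \<ominus> (\<one> \<ominus> a) = a"
    using a by (simp add: diff_diff_cancel)
  ultimately show ?thesis unfolding pos_def by auto
qed

lemma pos_closed: "pos a \<Longrightarrow> a \<in> carrier A"
  and pos_star: "pos a \<Longrightarrow> star A a = a"
  by (auto simp: pos_def star_mult)

lemma pos_norm_one_minus: "pos a \<Longrightarrow> cnorm A a \<le> 1 \<Longrightarrow> cnorm A (\<one> \<ominus> a) \<le> 1"
  using norm_one_minus_square p_square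
  by (auto simp: pos_def power_le_one_iff abs_square_le_1)

lemma pos_scale:
  assumes "pos a" "0 \<le> c" shows "pos (scale A (of_real c) a)"
proof -
  obtain s where s: "s \<in> carrier A" "star A s = s" "a = s \<otimes> s" using assms by (auto simp: pos_def)
  let ?t = "scale A (of_real (sqrt c)) s"
  have "?t \<otimes> ?t = scale A (of_real c) a"
    using s assms(2) by (simp add: scale_mult_left scale_mult_right scale_scale scale_closed
        flip: of_real_mult)
  moreover have "star A ?t = ?t" using s by (simp add: star_scale)
  ultimately show ?thesis unfolding pos_def using s by (metis scale_closed)
qed

text \<open>A sum of squares is not visibly a square, but the norm criterion is convex: after
  scaling a and b into the unit ball, 1 - (a + b)/2 is the mean of two contractions 1 - a and 1 -
  b.\<close>

lemma pos_add: assumes a: "pos a" and b: "pos b" shows "pos (a \<oplus> b)"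
proof -
  \<comment> \<open>The summand 1 keeps the denominator positive when both a and b vanish.\<close>
  define t where "t = 1 / (cnorm A a + cnorm A b + 1)"
  note c = pos_closed[OF a] pos_closed[OF b]
  have t: "0 < t" "t * cnorm A a \<le> 1" "t * cnorm A b \<le> 1"
    using p_nonneg[OF c(1)] p_nonneg[OF c(2)] by (auto simp: t_def field_simps)
  let ?a = "scale A (of_real t) a" and ?b = "scale A (of_real t) b"
  have n: "cnorm A (\<one> \<ominus> ?a) \<le> 1" "cnorm A (\<one> \<ominus> ?b) \<le> 1"
    using t c by (auto intro!: pos_norm_one_minus pos_scale a b simp: p_scale)
  have half: "scale A (1/2) y \<oplus> scale A (1/2) y = y" if "y \<in> carrier A" for y
    using that scale_add_left[of y "1/2" "1/2"] by (simp add: scale_one)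
  have "\<one> \<ominus> scale A (1/2) (?a \<oplus> ?b) =
      (scale A (1/2) \<one> \<oplus> scale A (1/2) \<one>) \<ominus> (scale A (1/2) ?a \<oplus> scale A (1/2) ?b)"
    using c by (simp add: half scale_add_right scale_closed)
  also have "\<dots> = scale A (1/2) (\<one> \<ominus> ?a) \<oplus> scale A (1/2) (\<one> \<ominus> ?b)"
    using c by (subst diff_diff_swap) (auto simp: scale_diff_right scale_closed)
  finally have "cnorm A (\<one> \<ominus> scale A (1/2) (?a \<oplus> ?b)) \<le> 1"
    using p_add[of "scale A (1/2) (\<one> \<ominus> ?a)" "scale A (1/2) (\<one> \<ominus> ?b)"] n c
    by (simp add: p_scale scale_closed)
  then have "pos (scale A (1/2) (?a \<oplus> ?b))"
    using c a b by (intro posI) (auto simp: scale_closed star_scale star_add pos_star)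
  then have "pos (scale A (of_real (2 / t)) (scale A (1/2) (?a \<oplus> ?b)))"
    using t by (intro pos_scale) auto
  then show ?thesis
    using c t by (simp add: scale_scale scale_closed scale_one flip: scale_add_right)
qed

lemma pos_zero: "pos \<zero>"
  unfolding pos_def by (intro bexI[of _ \<zero>]) auto

lemma pos_finsum: "finite I \<Longrightarrow> (\<And>i. i \<in> I \<Longrightarrow> pos (f i)) \<Longrightarrow> pos (\<Oplus>i\<in>I. f i)"
proof (induction I rule: finite_induct)
  case (insert i I)
  then have "f \<in> insert i I \<rightarrow> carrier A" using pos_closed by blast
  then show ?case using insert by (simp add: pos_add Pi_def)
qed (simp add: pos_zero)

text \<open>The element 1 - a is the sum of the positive elements 1 - (a + b) and b. Commuting roots
  s of a and r of 1 - a then satisfy s^2 + r^2 = 1, which makes s a contraction and with it a =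
  s^2.\<close>

lemma pos_mono_one:
  assumes a: "pos a" and b: "pos b" and le: "cnorm A (a \<oplus> b) \<le> 1"
  shows "cnorm A a \<le> 1"
proof -
  note c = pos_closed[OF a] pos_closed[OF b]
  have "\<one> \<ominus> (\<one> \<ominus> (a \<oplus> b)) = a \<oplus> b"
    using c by (simp add: diff_diff_cancel)
  then have "pos (\<one> \<ominus> (a \<oplus> b))"
    using c a b le by (intro posI) (auto simp: star_diff star_add pos_star)
  then have "pos ((\<one> \<ominus> (a \<oplus> b)) \<oplus> b)" using b by (rule pos_add)
  moreover have "(\<one> \<ominus> (a \<oplus> b)) \<oplus> b = \<one> \<ominus> a"
    using c by (simp add: diff_add_cancel_right)
  ultimately have d: "pos (\<one> \<ominus> a)" by simp
  \<comment> \<open>The root of 1 - a provided by its positivity need not commute with s. Therefore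
    l scales 1 - a into the unit ball, so that x = 1 - l(1 - a) is a contraction and
    \<open>sqrt_exists\<close> yields a root of 1 - x = l(1 - a) commuting with everything that
    commutes with x.\<close>
  define l where "l = 1 / (cnorm A (\<one> \<ominus> a) + 1)"
  have n0: "0 \<le> cnorm A (\<one> \<ominus> a)" using c by simp
  then have l: "0 < l" "l * cnorm A (\<one> \<ominus> a) \<le> 1"
    by (auto simp: l_def field_simps)
  define x where "x = \<one> \<ominus> scale A (of_real l) (\<one> \<ominus> a)"
  have xc: "x \<in> carrier A" using c by (simp add: x_def scale_closed)
  have "cnorm A x \<le> 1"
    unfolding x_def using l c by (intro pos_norm_one_minus pos_scale d) (auto simp: p_scale)
  moreover have "star A x = x"
    using c a by (simp add: x_def star_diff star_scale scale_closed pos_star)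
  ultimately obtain t where t: "t \<in> carrier A" "star A t = t" "t \<otimes> t = \<one> \<ominus> x"
    "\<And>y. y \<in> carrier A \<Longrightarrow> x \<otimes> y = y \<otimes> x \<Longrightarrow> t \<otimes> y = y \<otimes> t"
    using sqrt_exists[OF xc] by blast
  have "\<one> \<ominus> x = scale A (of_real l) (\<one> \<ominus> a)"
    using c by (simp add: x_def diff_diff_cancel scale_closed)
  then have tt: "t \<otimes> t = scale A (of_real l) (\<one> \<ominus> a)" using t by simp
  obtain s where s: "s \<in> carrier A" "star A s = s" "a = s \<otimes> s" using a by (auto simp: pos_def)
  have "(\<one> \<ominus> a) \<otimes> s = s \<otimes> (\<one> \<ominus> a)"
    using s by (intro one_diff_commute) (auto simp: m_assoc)
  then have "x \<otimes> s = s \<otimes> x"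
    unfolding x_def using s(1) c
    by (intro one_diff_commute) (auto simp: scale_closed scale_mult_left scale_mult_right)
  then have ts: "t \<otimes> s = s \<otimes> t" using t(4) s by blast
  define r where "r = scale A (of_real (1 / sqrt l)) t"
  have "r \<otimes> r = scale A (of_real (1 / sqrt l) * of_real (1 / sqrt l)) (t \<otimes> t)"
    using t(1) by (simp add: r_def scale_mult_left scale_mult_right scale_scale scale_closed
        del: of_real_divide)
  also have "of_real (1 / sqrt l) * of_real (1 / sqrt l) = complex_of_real (1 / l)"
    using l by (simp flip: of_real_mult)
  also have "scale A (of_real (1 / l)) (t \<otimes> t) = \<one> \<ominus> a"
    unfolding tt using l c by (simp add: scale_scale scale_one)
  finally have "s \<otimes> s \<oplus> r \<otimes> r = \<one>"
    using s c by (simp add: add_diff_cancel)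
  then have "cnorm A s \<le> 1"
    using s t ts by (intro p_le_one_of_unitary_pair[of s r])
      (auto simp: r_def scale_closed star_scale scale_mult_left scale_mult_right)
  then show ?thesis using p_square[OF s(1,2)] s by (simp add: power_le_one)
qed

text \<open>Scaling to \<open>pos_mono_one\<close>; the slack e keeps the divisor M positive even if
  a + b = 0.\<close>

lemma pos_mono:
  assumes a: "pos a" and b: "pos b"
  shows "cnorm A a \<le> cnorm A (a \<oplus> b)"
proof (rule field_le_epsilon)
  note c = pos_closed[OF a] pos_closed[OF b]
  fix e :: real assume "0 < e"
  define M where "M = cnorm A (a \<oplus> b) + e"
  have M: "0 < M" "cnorm A (a \<oplus> b) \<le> M" using \<open>0 < e\<close> c
    by (auto simp: M_def intro: add_nonneg_pos)
  have "cnorm A (scale A (of_real (1 / M)) a) \<le> 1"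
  proof (rule pos_mono_one)
    show "cnorm A (scale A (of_real (1 / M)) a \<oplus> scale A (of_real (1 / M)) b) \<le> 1"
      using c M by (simp add: p_scale norm_divide flip: scale_add_right)
  qed (use M in \<open>auto intro!: pos_scale a b simp del: of_real_divide\<close>)
  then show "cnorm A a \<le> cnorm A (a \<oplus> b) + e" using c M
    by (simp add: p_scale norm_divide flip: M_def)
qed

text \<open>Each summand is dominated in norm by the whole sum, the remaining terms being positive
  together.\<close>

lemma pos_finsum_zero:
  assumes "finite I" "\<And>i. i \<in> I \<Longrightarrow> pos (f i)" "(\<Oplus>i\<in>I. f i) = \<zero>" "k \<in> I"
  shows "f k = \<zero>"
proof -
  have f: "f \<in> I \<rightarrow> carrier A" using assms(2) pos_closed by blast
  have eq: "(\<Oplus>i\<in>I. f i) = f k \<oplus> (\<Oplus>i\<in>I - {k}. f i)"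
    using finsum_insert[of "I - {k}" k f] assms f by (auto simp: insert_absorb Pi_def)
  then have "cnorm A (f k) \<le> 0"
    using pos_mono[of "f k" "\<Oplus>i\<in>I - {k}. f i"] pos_finsum[of "I - {k}" f] assms(1,2,4)
      eq[unfolded assms(3), symmetric] by simp
  then show ?thesis using definite[of "f k"] p_nonneg[of "f k"] f assms(4) by fastforce
qed

section \<open>Projections and their compressions\<close>

definition projection :: "'a \<Rightarrow> bool" where
  "projection x \<longleftrightarrow> x \<in> carrier A \<and> x \<otimes> x = x \<and> star A x = x"

text \<open>Positivity of a general product of an element with its adjoint is a deeper fact; for
  projections the norm criterion is enough. With e = 1 - x one has 1 - xyx = e + x(1 - y)x, a sum of
  two self-adjoint contractions annihilating each other, and the spectral radius argument gives norm
  at most 1.\<close>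

lemma pos_compress:
  assumes "projection x" "projection y"
  shows "pos (x \<otimes> y \<otimes> x)"
proof (rule posI)
  have x: "x \<in> carrier A" "x \<otimes> x = x" "star A x = x" and y: "y \<in> carrier A" "y \<otimes> y = y" "star A y = y"
    using assms by (auto simp: projection_def)
  define b where "b = x \<otimes> (\<one> \<ominus> y) \<otimes> x"
  define e where "e = \<one> \<ominus> x"
  have ec: "e \<in> carrier A" and bc: "b \<in> carrier A" using x y by (auto simp: e_def b_def)
  have ee: "e \<otimes> e = e" and ex: "e \<otimes> x = \<zero>" and xe: "x \<otimes> e = \<zero>"
    using x by (auto simp: e_def minus_eq l_distr r_distr l_minus r_minus r_neg l_neg)
  have eb: "e \<otimes> b = \<zero>" and be: "b \<otimes> e = \<zero>"
  proof -
    have "e \<otimes> b = (e \<otimes> x) \<otimes> ((\<one> \<ominus> y) \<otimes> x)" unfolding b_def using ec x y by (simp add: m_assoc)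
    then show "e \<otimes> b = \<zero>" using ex x y by simp
    have "b \<otimes> e = (x \<otimes> (\<one> \<ominus> y)) \<otimes> (x \<otimes> e)" unfolding b_def using ec x y by (simp add: m_assoc)
    then show "b \<otimes> e = \<zero>" using xe x y by simp
  qed
  have "x \<otimes> (\<one> \<ominus> y) \<otimes> x = x \<ominus> x \<otimes> y \<otimes> x"
    using x y by (simp add: minus_eq l_distr r_distr l_minus r_minus)
  then have eq: "\<one> \<ominus> x \<otimes> y \<otimes> x = e \<oplus> b"
    using x y by (simp add: e_def b_def minus_eq a_assoc r_neg2 r_neg1)
  \<comment> \<open>The cross terms vanish at each squaring, so the dyadic powers stay sums of two
    contractions, bounded by 2.\<close>
  have pow: "sq_pow n (e \<oplus> b) = e \<oplus> sq_pow n b \<and> e \<otimes> sq_pow n b = \<zero> \<and> sq_pow n b \<otimes> e = \<zero>" for n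
  proof (induction n)
    case (Suc n)
    have "e \<otimes> (sq_pow n b \<otimes> sq_pow n b) = \<zero>" "(sq_pow n b \<otimes> sq_pow n b) \<otimes> e = \<zero>"
      using Suc ec bc by (simp_all flip: m_assoc) (simp add: m_assoc)
    then show ?case using Suc ec bc ee by (simp add: l_distr r_distr)
  qed (simp add: eb be)
  have nx: "cnorm A x \<le> 1" using p_projection_le x by blast
  have ny: "cnorm A (\<one> \<ominus> y) \<le> 1"
    using y by (intro p_projection_le) (auto simp: minus_eq l_distr r_distr l_minus r_minus star_add star_minus r_neg)
  have ne: "cnorm A e \<le> 1"
    using ec ee x by (intro p_projection_le) (auto simp: e_def star_diff)
  have "cnorm A b \<le> cnorm A x * cnorm A (\<one> \<ominus> y) * cnorm A x"
    unfolding b_def using x y p_mult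
    by (intro order_trans[OF p_mult] mult_right_mono) auto
  also have "\<dots> \<le> 1 * 1 * 1" using nx ny x y by (intro mult_mono) auto
  finally have nb: "cnorm A b \<le> 1" by simp
  have nbp: "cnorm A (sq_pow n b) \<le> 1" for n
  proof (induction n)
    case (Suc n)
    then show ?case
      using p_mult[of "sq_pow n b" "sq_pow n b"] mult_mono[OF Suc Suc] bc by simp
  qed (use nb in simp)
  show "cnorm A (\<one> \<ominus> x \<otimes> y \<otimes> x) \<le> 1"
    unfolding eq
  proof (rule p_le_one_of_bounded_powers[where c = 2])
    show "star A (e \<oplus> b) = e \<oplus> b"
      using x y by (simp flip: eq add: star_diff star_mult m_assoc)
    show "cnorm A (sq_pow n (e \<oplus> b)) \<le> 2" for n
      using p_add[of e "sq_pow n b"] ne nbp[of n] pow[of n] ec bc by simp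
  qed (use ec bc in simp)
qed (use assms in \<open>auto simp: projection_def star_mult m_assoc\<close>)

text \<open>The compression of the unit to \<open>f i\<close> is \<open>f i\<close> itself, so the other compressions,
  being positive, have to vanish.\<close>

lemma projections_orthogonal:
  assumes fin: "finite I" and pr: "\<And>i. i \<in> I \<Longrightarrow> projection (f i)"
    and sum: "(\<Oplus>i\<in>I. f i) = \<one>" and ik: "i \<in> I" "k \<in> I" "i \<noteq> k"
  shows "f i \<otimes> f k = \<zero>"
proof -
  have f: "f j \<in> carrier A" "f j \<otimes> f j = f j" "star A (f j) = f j" if "j \<in> I" for j
    using pr[OF that] by (auto simp: projection_def)
  then have fI: "f \<in> I \<rightarrow> carrier A" by auto
  let ?g = "\<lambda>j. f k \<otimes> f j \<otimes> f k"
  have g: "?g \<in> I \<rightarrow> carrier A" using f ik by auto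
  have "f k = f k \<otimes> (\<Oplus>j\<in>I. f j) \<otimes> f k" using sum f ik by simp
  also have "\<dots> = (\<Oplus>j\<in>I. ?g j)"
    using fin f fI ik by (simp add: finsum_rdistr finsum_ldistr Pi_def)
  also have "\<dots> = ?g k \<oplus> (\<Oplus>j\<in>I - {k}. ?g j)"
    using finsum_insert[of "I - {k}" k ?g] fin ik g f by (auto simp: insert_absorb Pi_def)
  finally have "f k \<oplus> (\<Oplus>j\<in>I - {k}. ?g j) = f k" using f ik by simp
  then have "(\<Oplus>j\<in>I - {k}. ?g j) = \<zero>"
    using f ik g by (metis (no_types, lifting) DiffD1 Pi_iff add.l_cancel_one' finsum_closed)
  then have "?g i = \<zero>"
    using fin ik pr by (intro pos_finsum_zero[of "I - {k}" ?g i]) (auto intro: pos_compress)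
  \<comment> \<open>The vanishing compression is the product of the adjoint of f i f k with f i f k,
    so the C*-identity makes f i f k itself vanish.\<close>
  moreover have "star A (f i \<otimes> f k) \<otimes> (f i \<otimes> f k) = f k \<otimes> (f i \<otimes> f i) \<otimes> f k"
    using f(1,3) ik by (simp add: star_mult m_assoc)
  ultimately have "star A (f i \<otimes> f k) \<otimes> (f i \<otimes> f k) = \<zero>" using f ik by simp
  then have "(cnorm A (f i \<otimes> f k))\<^sup>2 = 0" using p_cstar[of "f i \<otimes> f k"] f ik by simp
  then show ?thesis using definite f ik by simp
qed

end

section \<open>Star homomorphisms\<close>

text \<open>\<open>star_iso\<close> without bijectivity. No boundedness is required: between
  C*-algebras it is automatic (\<open>star_hom_norm_le\<close>).\<close>

definition star_hom ::
  "('a, 'm) star_alg_scheme \<Rightarrow> ('b, 'n) star_alg_scheme \<Rightarrow> ('a \<Rightarrow> 'b) set" where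
  "star_hom A B = {\<phi> \<in> ring_hom A B.
     (\<forall>c. \<forall>x\<in>carrier A. \<phi> (scale A c x) = scale B c (\<phi> x)) \<and>
     (\<forall>x\<in>carrier A. \<phi> (star A x) = star B (\<phi> x))}"

lemma star_homI:
  assumes "\<And>x. x \<in> carrier A \<Longrightarrow> \<phi> x \<in> carrier B"
    "\<And>x y. x \<in> carrier A \<Longrightarrow> y \<in> carrier A \<Longrightarrow> \<phi> (x \<otimes>\<^bsub>A\<^esub> y) = \<phi> x \<otimes>\<^bsub>B\<^esub> \<phi> y"
    "\<And>x y. x \<in> carrier A \<Longrightarrow> y \<in> carrier A \<Longrightarrow> \<phi> (x \<oplus>\<^bsub>A\<^esub> y) = \<phi> x \<oplus>\<^bsub>B\<^esub> \<phi> y"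
    "\<phi> \<one>\<^bsub>A\<^esub> = \<one>\<^bsub>B\<^esub>"
    "\<And>c x. x \<in> carrier A \<Longrightarrow> \<phi> (scale A c x) = scale B c (\<phi> x)"
    "\<And>x. x \<in> carrier A \<Longrightarrow> \<phi> (star A x) = star B (\<phi> x)"
  shows "\<phi> \<in> star_hom A B"
  using assms by (auto simp: star_hom_def intro!: ring_hom_memI)

lemma star_homD:
  assumes "\<phi> \<in> star_hom A B"
  shows star_hom_closed: "x \<in> carrier A \<Longrightarrow> \<phi> x \<in> carrier B"
    and star_hom_mult: "x \<in> carrier A \<Longrightarrow> y \<in> carrier A \<Longrightarrow> \<phi> (x \<otimes>\<^bsub>A\<^esub> y) = \<phi> x \<otimes>\<^bsub>B\<^esub> \<phi> y"
    and star_hom_add: "x \<in> carrier A \<Longrightarrow> y \<in> carrier A \<Longrightarrow> \<phi> (x \<oplus>\<^bsub>A\<^esub> y) = \<phi> x \<oplus>\<^bsub>B\<^esub> \<phi> y"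
    and star_hom_one: "\<phi> \<one>\<^bsub>A\<^esub> = \<one>\<^bsub>B\<^esub>"
    and star_hom_scale: "x \<in> carrier A \<Longrightarrow> \<phi> (scale A c x) = scale B c (\<phi> x)"
    and star_hom_star: "x \<in> carrier A \<Longrightarrow> \<phi> (star A x) = star B (\<phi> x)"
  using assms by (auto simp: star_hom_def ring_hom_closed ring_hom_mult ring_hom_add ring_hom_one)

lemma star_hom_zero:
  assumes "star_algebra A" "star_algebra B" "\<phi> \<in> star_hom A B"
  shows "\<phi> \<zero>\<^bsub>A\<^esub> = \<zero>\<^bsub>B\<^esub>"
proof -
  interpret A: star_algebra A by fact
  interpret B: star_algebra B by fact
  have "\<phi> (scale A 0 \<zero>\<^bsub>A\<^esub>) = scale B 0 (\<phi> \<zero>\<^bsub>A\<^esub>)" using assms(3) by (intro star_hom_scale) auto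
  then show ?thesis using star_hom_closed[OF assms(3)] by simp
qed

lemma star_hom_diff:
  assumes "star_algebra A" "star_algebra B" "\<phi> \<in> star_hom A B" "x \<in> carrier A" "y \<in> carrier A"
  shows "\<phi> (x \<ominus>\<^bsub>A\<^esub> y) = \<phi> x \<ominus>\<^bsub>B\<^esub> \<phi> y"
proof -
  interpret A: star_algebra A by fact
  interpret B: star_algebra B by fact
  have "\<phi> (x \<oplus>\<^bsub>A\<^esub> scale A (-1) y) = \<phi> x \<oplus>\<^bsub>B\<^esub> scale B (-1) (\<phi> y)"
    using assms by (simp add: star_hom_add star_hom_scale A.scale_closed)
  then show ?thesis
    using assms star_hom_closed[OF assms(3)] by (simp add: A.scale_minus_one B.scale_minus_one A.minus_eq B.minus_eq)
qed

lemma star_hom_finsum: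
  assumes "star_algebra A" "star_algebra B" "\<phi> \<in> star_hom A B" "finite I" "f \<in> I \<rightarrow> carrier A"
  shows "\<phi> (\<Oplus>\<^bsub>A\<^esub>i\<in>I. f i) = (\<Oplus>\<^bsub>B\<^esub>i\<in>I. \<phi> (f i))"
proof -
  interpret A: star_algebra A by fact
  interpret B: star_algebra B by fact
  note c = star_hom_closed[OF assms(3)]
  show ?thesis
    using assms(4,5)
  proof (induction I rule: finite_induct)
    case (insert i I)
    then have "f i \<in> carrier A" "f \<in> I \<rightarrow> carrier A" "(\<lambda>i. \<phi> (f i)) \<in> I \<rightarrow> carrier B" "\<phi> (f i) \<in> carrier B"
      using c by auto
    then show ?case using insert by (simp add: star_hom_add[OF assms(3)] A.finsum_closed)
  qed (simp add: star_hom_zero assms)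
qed

lemma star_hom_comp: "\<phi> \<in> star_hom A B \<Longrightarrow> \<psi> \<in> star_hom B C \<Longrightarrow> \<psi> \<circ> \<phi> \<in> star_hom A C"
  by (auto intro!: star_homI simp: star_homD)

lemma star_hom_id: "(\<lambda>x. x) \<in> star_hom A A"
  by (auto intro!: star_homI)

text \<open>All laws are carried along a surjection before B is known to be a ring; completions and
  quotients, whose operations are defined on classes, obtain their structure this way. Preservation
  of zero is a separate assumption because it cannot be derived at this stage.\<close>

lemma star_algebra_image:
  fixes A :: "('a, 'm) star_alg_scheme" and B :: "('b, 'n) star_alg_scheme"
  assumes "star_algebra A" and h: "\<phi> \<in> star_hom A B" and surj: "carrier B = \<phi> ` carrier A"
    and z: "\<phi> \<zero>\<^bsub>A\<^esub> = \<zero>\<^bsub>B\<^esub>"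
  shows "star_algebra B"
proof -
  interpret A: star_algebra A by fact
  note hs = star_hom_mult[OF h, symmetric] star_hom_add[OF h, symmetric] star_hom_one[OF h, symmetric]
    star_hom_scale[OF h, symmetric] star_hom_star[OF h, symmetric] z[symmetric]
  have neg: "\<exists>y\<in>carrier A. \<phi> (y \<oplus>\<^bsub>A\<^esub> x) = \<phi> \<zero>\<^bsub>A\<^esub>"
    "\<exists>y\<in>carrier A. \<phi> (x \<oplus>\<^bsub>A\<^esub> y) = \<phi> \<zero>\<^bsub>A\<^esub>" if "x \<in> carrier A" for x
    using that by (auto intro!: bexI[of _ "\<ominus>\<^bsub>A\<^esub> x"] simp: A.l_neg A.r_neg)
  have "ring B"
    by (intro ringI abelian_groupI Group.monoidI)
       (auto simp: surj hs A.a_assoc A.m_assoc A.l_distr A.r_distr neg A.a_ac)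
  then show ?thesis
    by (intro star_algebra.intro star_algebra_axioms.intro)
       (auto simp: surj hs A.scale_closed A.star_closed A.scale_add_right A.scale_add_left A.scale_scale
          A.scale_one A.scale_mult_left A.scale_mult_right A.star_star A.star_add A.star_scale A.star_mult)
qed

lemma cstar_seminorm_image:
  assumes "star_algebra A" and "cstar_seminorm A p" and h: "\<phi> \<in> star_hom A B"
    and surj: "carrier B = \<phi> ` carrier A" and q: "\<And>x. x \<in> carrier A \<Longrightarrow> q (\<phi> x) = p x"
  shows "cstar_seminorm B q"
proof -
  interpret A: seminormed_star_algebra A p by (rule star_algebra.seminormed) fact+
  show ?thesis
    unfolding cstar_seminorm_def surj
    by (auto simp: star_hom_mult[OF h, symmetric] star_hom_add[OF h, symmetric] star_hom_scale[OF h, symmetric]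
        star_hom_star[OF h, symmetric] q A.scale_closed A.star_closed A.p_add A.p_scale A.p_mult A.p_cstar)
qed

lemma cstar_seminorm_pullback:
  assumes "star_algebra A" "star_algebra B" "\<phi> \<in> star_hom A B" "cstar_seminorm B q"
  shows "cstar_seminorm A (\<lambda>x. q (\<phi> x))"
proof -
  interpret B: seminormed_star_algebra B q by (rule star_algebra.seminormed) fact+
  interpret A: star_algebra A by fact
  show ?thesis
    unfolding cstar_seminorm_def
    using star_homD[OF assms(3)]
    by (auto simp: B.p_add B.p_scale B.p_mult B.p_cstar A.star_closed)
qed

text \<open>Automatic contractivity: the norm of B pulled back along the homomorphism is a
  C*-seminorm on A, hence below the norm of A.\<close>

lemma star_hom_norm_le:
  assumes A: "unital_cstar_algebra A" and B: "unital_cstar_algebra B" and h: "\<phi> \<in> star_hom A B"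
    and x: "x \<in> carrier A"
  shows "cnorm B (\<phi> x) \<le> cnorm A x"
proof -
  interpret A: unital_cstar_algebra A by fact
  interpret B: unital_cstar_algebra B by fact
  show ?thesis
    using A.seminorm_le_norm[OF cstar_seminorm_pullback[OF A.star_algebra_axioms B.star_algebra_axioms h B.seminorm] x] .
qed

lemma star_hom_tends:
  assumes A: "unital_cstar_algebra A" and B: "unital_cstar_algebra B" and h: "\<phi> \<in> star_hom A B"
    and t: "seminormed_star_algebra.tends A (cnorm A) s x"
  shows "seminormed_star_algebra.tends B (cnorm B) (\<lambda>n. \<phi> (s n)) (\<phi> x)"
proof -
  interpret A: unital_cstar_algebra A by fact
  interpret B: unital_cstar_algebra B by fact
  have c: "s n \<in> carrier A" "x \<in> carrier A" for n using t by (auto simp: A.tends_def)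
  show ?thesis
  proof (rule B.tendsI)
    show "cnorm B (\<phi> (s n) \<ominus>\<^bsub>B\<^esub> \<phi> x) \<le> cnorm A (s n \<ominus>\<^bsub>A\<^esub> x)" for n
      using star_hom_norm_le[OF A B h, of "s n \<ominus>\<^bsub>A\<^esub> x"] c
        star_hom_diff[OF A.star_algebra_axioms B.star_algebra_axioms h, of "s n" x] by simp
    show "(\<lambda>n. cnorm A (s n \<ominus>\<^bsub>A\<^esub> x)) \<longlonglongrightarrow> 0" using t by (simp add: A.tends_def)
  qed (use c star_hom_closed[OF h] in auto)
qed

context seminormed_star_algebra
begin

text \<open>A Cauchy sequence converges as soon as a subsequence does, so completeness may be tested
  on sequences with geometrically small increments. Such sequences can be lifted term by term
  through a quotient map.\<close>

lemma complete_of_fast: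
  assumes fast: "\<And>s. (\<And>n. s n \<in> carrier A) \<Longrightarrow> (\<And>n. p (s (Suc n) \<ominus> s n) < (1/2) ^ n) \<Longrightarrow> \<exists>x. tends s x"
    and s: "s \<in> cauchy_seqs A p"
  shows "\<exists>x. tends s x"
proof -
  have c: "s n \<in> carrier A" for n using s by (simp add: cauchy_seqs_def)
  have "\<forall>k. \<exists>N. \<forall>m\<ge>N. \<forall>n\<ge>N. p (s m \<ominus> s n) < (1/2) ^ k"
    using s by (simp add: cauchy_seqs_def)
  then obtain N where N: "\<And>k m n. m \<ge> N k \<Longrightarrow> n \<ge> N k \<Longrightarrow> p (s m \<ominus> s n) < (1/2) ^ k"
    by metis
  \<comment> \<open>Partial sums make the chosen indices monotone while keeping each of them above
    \<open>N k\<close>.\<close>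
  define M where "M k = (\<Sum>i\<le>k. N i)" for k
  have M: "N k \<le> M k" "M k \<le> M (Suc k)" for k
    unfolding M_def by (auto intro: member_le_sum)
  have "\<exists>x. tends (\<lambda>k. s (M k)) x"
    using N[OF order_trans[OF M] M(1)] c by (intro fast) auto
  then obtain x where x: "tends (\<lambda>k. s (M k)) x" by blast
  have xc: "x \<in> carrier A" using x by (simp add: tends_def)
  have "(\<lambda>n. p (s n \<ominus> x)) \<longlonglongrightarrow> 0"
  proof (rule LIMSEQ_I)
    fix e :: real assume "0 < e"
    then obtain k where k: "(1/2) ^ k < e / 2" using real_arch_pow_inv[of "e/2" "1/2"] by auto
    have "\<forall>\<^sub>F j in sequentially. p (s (M j) \<ominus> x) < e / 2"
      using x \<open>0 < e\<close> unfolding tends_def by (auto dest!: order_tendstoD(2)[of _ _ _ "e/2"])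
    then obtain j0 where j0: "\<And>j. j \<ge> j0 \<Longrightarrow> p (s (M j) \<ominus> x) < e / 2"
      unfolding eventually_sequentially by blast
    define j where "j = max j0 k"
    have "mono M" using M(2) by (rule incseq_SucI[unfolded])
    then have "N k \<le> M j" using M(1)[of k] monoD[of M k j] by (simp add: j_def)
    have "norm (p (s n \<ominus> x) - 0) < e" if "n \<ge> N k" for n
      using p_diff_triangle[of "s n" "s (M j)" x] c xc N[OF that \<open>N k \<le> M j\<close>] j0[of j] k
      by (simp add: j_def)
    then show "\<exists>no. \<forall>n\<ge>no. norm (p (s n \<ominus> x) - 0) < e" by blast
  qed
  then show ?thesis using c xc by (auto simp: tends_def)
qed

end

section \<open>Quotients by closed ideals\<close>

lemma (in star_algebra) diff_add_cancel_left:
  "\<lbrakk>x \<in> carrier A; y \<in> carrier A; z \<in> carrier A\<rbrakk> \<Longrightarrow> (x \<oplus> y) \<ominus> (x \<oplus> z) = y \<ominus> z"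
  by (simp add: diff_diff_swap)

lemma (in star_algebra) add_diff_right:
  "\<lbrakk>x \<in> carrier A; y \<in> carrier A\<rbrakk> \<Longrightarrow> (x \<oplus> y) \<ominus> y = x"
  by (simp add: minus_eq a_assoc r_neg)

lemma (in star_algebra) neg_diff_add:
  assumes "x \<in> carrier A" "y \<in> carrier A" shows "\<ominus> (x \<ominus> y) \<oplus> x = y"
proof -
  have "\<ominus> (x \<ominus> y) = y \<ominus> x" using assms by (simp add: minus_eq minus_add a_comm)
  then show ?thesis using assms by (simp add: add_diff_cancel)
qed

lemma (in star_algebra) mult_diff_right:
  "\<lbrakk>x \<in> carrier A; y \<in> carrier A; z \<in> carrier A\<rbrakk> \<Longrightarrow> x \<otimes> (y \<ominus> z) = x \<otimes> y \<ominus> x \<otimes> z"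
  by (simp add: minus_eq r_distr r_minus)

lemma (in star_algebra) mult_diff_left:
  "\<lbrakk>x \<in> carrier A; y \<in> carrier A; z \<in> carrier A\<rbrakk> \<Longrightarrow> (x \<ominus> y) \<otimes> z = x \<otimes> z \<ominus> y \<otimes> z"
  by (simp add: minus_eq l_distr l_minus)

section \<open>Inverses by Neumann series\<close>

context unital_cstar_algebra
begin

primrec neumann_seq :: "'a \<Rightarrow> nat \<Rightarrow> 'a" where
  "neumann_seq z 0 = \<zero>" | "neumann_seq z (Suc n) = \<one> \<oplus> z \<otimes> neumann_seq z n"

lemma neumann_seq_closed [simp]: "z \<in> carrier A \<Longrightarrow> neumann_seq z n \<in> carrier A"
  by (induction n) auto

text \<open>The partial sums 1 + z + ... + z^(n-1) of the Neumann series are dominated by the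
  geometric sums v n = (1 - r^n)/(1 - r), which also bound the norm of the limit.\<close>

lemma one_minus_inverse:
  assumes z: "z \<in> carrier A" and r: "cnorm A z \<le> r" "r < 1"
  obtains y where "y \<in> carrier A" "y = \<one> \<oplus> z \<otimes> y" "cnorm A y \<le> 1 / (1 - r)"
proof -
  define v where "v n = (1 - r ^ n) / (1 - r)" for n
  have r0: "0 \<le> r" using r p_nonneg[OF z] by linarith
  have v: "v (Suc n) - v n = r ^ n" "v n \<le> 1 / (1 - r)" "v (Suc n) = 1 + r * v n" for n
    using r r0 by (auto simp: v_def divide_simps) (auto simp: algebra_simps)
  have "v \<longlonglongrightarrow> (1 - 0) / (1 - r)"
    unfolding v_def using r r0 by (intro tendsto_intros LIMSEQ_power_zero) auto
  then have "Cauchy v" using convergent_Cauchy convergentI by blast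
  have bound: "cnorm A (neumann_seq z n) \<le> v n" for n
  proof (induction n)
    case (Suc n)
    have "cnorm A (z \<otimes> neumann_seq z n) \<le> r * v n"
      using p_mult[of z "neumann_seq z n"] mult_mono[OF r(1) Suc] z r0 by simp
    then show ?case
      using p_add[of \<one> "z \<otimes> neumann_seq z n"] p_one_le z v(3)[of n] by simp
  qed (simp add: v_def)
  have step: "cnorm A (neumann_seq z (Suc n) \<ominus> neumann_seq z n) \<le> v (Suc n) - v n" for n
    unfolding v(1)
  proof (induction n)
    case (Suc n)
    have "neumann_seq z (Suc (Suc n)) \<ominus> neumann_seq z (Suc n) = z \<otimes> (neumann_seq z (Suc n) \<ominus> neumann_seq z n)"
      unfolding neumann_seq.simps(2)[of z "Suc n"]
      by (subst (2) neumann_seq.simps(2))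
        (use z neumann_seq_closed[OF z] in \<open>simp add: diff_add_cancel_left mult_diff_right
          del: neumann_seq.simps\<close>)
    moreover have "cnorm A (z \<otimes> (neumann_seq z (Suc n) \<ominus> neumann_seq z n)) \<le> r * r ^ n"
      using z neumann_seq_closed[OF z, of "Suc n"] Suc r r0
      by (intro order_trans[OF p_mult] mult_mono) (auto simp del: neumann_seq.simps)
    ultimately show ?case by simp
  qed (use z p_one_le in \<open>simp add: minus_eq\<close>)
  obtain y where y: "tends (neumann_seq z) y"
    using cauchy_tends dominated_cauchy[OF neumann_seq_closed[OF z] step \<open>Cauchy v\<close>] by blast
  have "tends (\<lambda>n. \<one> \<oplus> z \<otimes> neumann_seq z n) (\<one> \<oplus> z \<otimes> y)"
    using z by (intro tends_add tends_mult tends_const y) auto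
  then have "tends (\<lambda>n. neumann_seq z (Suc n)) (\<one> \<oplus> z \<otimes> y)" by simp
  then have "y = \<one> \<oplus> z \<otimes> y" by (rule tends_unique[OF tends_Suc[OF y]])
  moreover have "cnorm A y \<le> 1 / (1 - r)"
    using tends_norm_le[OF y] bound v(2) by (meson order_trans)
  ultimately show ?thesis using that y by (auto simp: tends_def)
qed

text \<open>The element b is the inverse of 1 + a. With l = ||a|| + 1, positivity makes d = 1 - a/l
  a contraction, and 1 + a = (l + 1)(1 - rd) for r = l/(l + 1) < 1. The Neumann series inverts 1 -
  rd with norm at most 1/(1 - r) = l + 1, so that b has norm at most 1.\<close>

lemma one_plus_pos_inverse:
  assumes a: "pos a"
  obtains b where "b \<in> carrier A" "star A b = b" "cnorm A b \<le> 1" "a \<otimes> b = \<one> \<ominus> b"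
proof -
  note c = pos_closed[OF a]
  define l where "l = cnorm A a + 1"
  have l: "1 \<le> l" "cnorm A a \<le> l" using c by (simp_all add: l_def)
  define d where "d = \<one> \<ominus> scale A (of_real (1/l)) a"
  define r where "r = l / (l + 1)"
  define z where "z = scale A (of_real r) d"
  have dc: "d \<in> carrier A" using c by (simp add: d_def scale_closed)
  have zc: "z \<in> carrier A" using dc by (simp add: z_def scale_closed)
  have "cnorm A d \<le> 1"
    unfolding d_def using l c by (intro pos_norm_one_minus pos_scale a) (auto simp: p_scale norm_divide)
  then have "r * cnorm A d \<le> r * 1" using l by (intro mult_left_mono) (auto simp: r_def)
  then have zn: "cnorm A z \<le> r" using l dc by (simp add: z_def p_scale r_def norm_divide)
  have r: "r < 1" "1 / (1 - r) = l + 1" using l by (auto simp: r_def field_simps)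
  obtain y where y: "y \<in> carrier A" "y = \<one> \<oplus> z \<otimes> y" "cnorm A y \<le> l + 1"
    using one_minus_inverse[OF zc zn r(1)] unfolding r(2) by blast
  have ds: "star A d = d" using c a by (simp add: d_def star_diff star_scale scale_closed pos_star)
  then have zs: "star A z = z" using dc by (simp add: z_def star_scale)
  have "(\<one> \<ominus> z) \<otimes> y = (\<one> \<oplus> z \<otimes> y) \<ominus> z \<otimes> y"
    using zc y(1) by (simp add: minus_eq l_distr l_minus flip: y(2))
  then have inv: "(\<one> \<ominus> z) \<otimes> y = \<one>" using zc y(1) by (simp add: minus_eq a_assoc r_neg)
  have "star A ((\<one> \<ominus> z) \<otimes> y) = star A y \<otimes> (\<one> \<ominus> z)"
    using zc y(1) zs by (simp add: star_mult star_diff)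
  then have inv': "star A y \<otimes> (\<one> \<ominus> z) = \<one>" using inv by simp
  have "star A y = star A y \<otimes> ((\<one> \<ominus> z) \<otimes> y)" using inv y(1) by (simp add: star_closed)
  also have "\<dots> = y" using inv' y(1) zc by (simp add: star_closed flip: m_assoc)
  finally have ys: "star A y = y" .
  define b where "b = scale A (of_real (1 / (l + 1))) y"
  have "z = scale A (of_real r) \<one> \<ominus> scale A (of_real (1 / (l + 1))) a"
  proof -
    have "r * (1 / l) = 1 / (l + 1)" using l by (simp add: r_def)
    then show ?thesis using c unfolding z_def d_def
      by (simp add: scale_diff_right scale_closed scale_scale del: of_real_divide flip: of_real_mult)
  qed
  then have "\<one> \<ominus> z \<oplus> scale A (of_real r) \<one> = \<one> \<oplus> scale A (of_real (1 / (l + 1))) a"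
    using c by (simp add: minus_eq minus_add minus_minus scale_closed a_ac r_neg1 r_neg2)
  moreover have "\<one> = scale A (of_real (1 / (l + 1))) \<one> \<oplus> scale A (of_real r) \<one>"
    using scale_add_left[of \<one> "of_real (1 / (l + 1))" "of_real r"] l scale_one[of \<one>]
    by (simp add: r_def field_simps flip: of_real_add of_real_divide)
  ultimately have "(\<one> \<ominus> z) \<oplus> scale A (of_real r) \<one> =
      (scale A (of_real (1 / (l + 1))) \<one> \<oplus> scale A (of_real (1 / (l + 1))) a) \<oplus> scale A (of_real r) \<one>"
    using c by (metis (no_types, lifting) a_assoc a_comm one_closed scale_closed)
  then have oz: "\<one> \<ominus> z = scale A (of_real (1 / (l + 1))) (\<one> \<oplus> a)"
    using c zc by (simp add: scale_closed scale_add_right del: of_real_divide)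
  have "(\<one> \<oplus> a) \<otimes> b = \<one>"
    using inv c y(1) unfolding oz b_def by (simp add: scale_mult_left scale_mult_right)
  moreover have bc: "b \<in> carrier A" using y(1) by (simp add: b_def scale_closed)
  ultimately have "b \<oplus> a \<otimes> b = \<one>" using c by (simp add: l_distr)
  then have "a \<otimes> b = \<one> \<ominus> b" using bc c by (metis add_diff_right a_comm m_closed)
  moreover have "star A b = b" using y(1) ys by (simp add: b_def star_scale)
  moreover have "cnorm A b \<le> 1" using y(1,3) l by (simp add: b_def p_scale field_simps del: of_real_divide)
  ultimately show ?thesis using that bc by blast
qed

end

text \<open>Submultiplicativity of a norm defined by infima that need not be attained is checked on
  strictly larger bounds.\<close>

lemma le_mult_of_greater:
  fixes u v w :: real
  assumes "\<And>a b. u < a \<Longrightarrow> v < b \<Longrightarrow> w \<le> a * b"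
  shows "w \<le> u * v"
proof (rule LIMSEQ_le_const)
  show "(\<lambda>n. (u + inverse (real (Suc n))) * (v + inverse (real (Suc n)))) \<longlonglongrightarrow> u * v"
    using tendsto_mult[OF tendsto_add[OF tendsto_const LIMSEQ_inverse_real_of_nat]
      tendsto_add[OF tendsto_const LIMSEQ_inverse_real_of_nat], of u v] by simp
  show "\<exists>N. \<forall>n\<ge>N. w \<le> (u + inverse (real (Suc n))) * (v + inverse (real (Suc n)))"
    using assms by (auto simp del: of_nat_Suc)
qed

section \<open>Approximate units and the quotient norm\<close>

locale closed_star_ideal = unital_cstar_algebra A for A :: "('a, 'm) cstar_alg_scheme" (structure) +
  fixes J
  assumes closed_ideal: "closed_ideal J A"
    and star_ideal: "x \<in> J \<Longrightarrow> star A x \<in> J"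
begin

sublocale J: ideal J A
  using closed_ideal by (simp add: closed_ideal_def)

lemma ideal_limit: "(\<And>n. s n \<in> J) \<Longrightarrow> tends s x \<Longrightarrow> x \<in> J"
  using closed_ideal unfolding closed_ideal_def tends_def by blast

lemma ideal_scale: assumes "x \<in> J" shows "scale A c x \<in> J"
proof -
  have "x \<in> carrier A" using assms J.a_Hcarr by blast
  then have "scale A c x = scale A c \<one> \<otimes> x" by (simp add: scale_mult_left)
  then show ?thesis using J.I_l_closed[OF assms scale_closed[OF one_closed]] by simp
qed

lemma coset_eq: "J +> x = (\<lambda>j. j \<oplus> x) ` J"
  by (auto simp: a_r_coset_def r_coset_def)

lemma coset_cong_iff:
  "x \<in> carrier A \<Longrightarrow> y \<in> carrier A \<Longrightarrow> J +> x = J +> y \<longleftrightarrow> x \<ominus> y \<in> J"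
  using J.a_rcos_module[of y x] J.a_repr_independence'[of x y] J.a_repr_independenceD[of x y] minus_eq
  by (metis ring_axioms J.a_rcos_self J.a_rcos_module_minus)

text \<open>For \<open>h = j\<^sup>* j\<close> the element \<open>(1 + n h\<^sup>2)\<^sup>-\<^sup>1\<close> serves as \<open>1 - e\<close> for a member \<open>e\<close> of an
  approximate unit of the ideal.\<close>

lemma approximate_unit:
  assumes j: "j \<in> J" and "0 < (e::real)"
  obtains b where "b \<in> carrier A" "star A b = b" "cnorm A b \<le> 1" "\<one> \<ominus> b \<in> J" "cnorm A (j \<otimes> b) \<le> e"
proof -
  have jc: "j \<in> carrier A" using j J.a_Hcarr by blast
  define h where "h = star A j \<otimes> j"
  have hJ: "h \<in> J" using j jc by (simp add: h_def J.I_l_closed star_closed)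
  have h: "h \<in> carrier A" "star A h = h" using jc by (auto simp: h_def star_closed star_mult star_star)
  \<comment> \<open>The fourth power comes from two uses of the C*-identity: the norm of n h^2 b = 1
    - b is at most 2, so h^2 b is bounded by e^4, then h b by e^2, and finally j b by e.\<close>
  obtain n :: nat where n: "2 / e ^ 4 < real n" using reals_Archimedean2 by blast
  have n0: "0 < real n" using n \<open>0 < e\<close> by (meson divide_pos_pos less_trans zero_less_numeral zero_less_power)
  define a where "a = scale A (of_real (real n)) (h \<otimes> h)"
  have "pos a" unfolding a_def by (intro pos_scale) (use h in \<open>auto simp: pos_def\<close>)
  then obtain b where b: "b \<in> carrier A" "star A b = b" "cnorm A b \<le> 1" "a \<otimes> b = \<one> \<ominus> b"
    using one_plus_pos_inverse by blast
  have "\<one> \<ominus> b \<in> J"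
    using b(1) hJ h unfolding b(4)[symmetric] a_def by (intro J.I_r_closed ideal_scale) auto
  moreover have "cnorm A (j \<otimes> b) \<le> e"
  proof -
    have sandwich: "cnorm A (b \<otimes> (y \<otimes> b)) \<le> cnorm A (y \<otimes> b)" if "y \<in> carrier A" for y
      using p_mult[of b "y \<otimes> b"] mult_right_mono[OF b(3) p_nonneg[of "y \<otimes> b"]] b(1) that by simp
    have "real n * cnorm A (h \<otimes> h \<otimes> b) = cnorm A (a \<otimes> b)"
      using h b(1) by (simp add: a_def scale_mult_left p_scale)
    also have "\<dots> \<le> 2" unfolding b(4) using p_diff[of \<one> b] p_one_le b by simp
    finally have "real n * cnorm A (h \<otimes> h \<otimes> b) \<le> 2" .
    also have "2 \<le> real n * e ^ 4" using n \<open>0 < e\<close> by (simp add: field_simps)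
    finally have 4: "cnorm A (h \<otimes> h \<otimes> b) \<le> e ^ 4" using n0 by simp
    have "star A (h \<otimes> b) \<otimes> (h \<otimes> b) = b \<otimes> ((h \<otimes> h) \<otimes> b)"
      using h b by (simp add: star_mult m_assoc)
    then have "(cnorm A (h \<otimes> b))\<^sup>2 \<le> e ^ 4"
      using p_cstar[of "h \<otimes> b"] sandwich[of "h \<otimes> h"] 4 h b by simp
    then have "(cnorm A (h \<otimes> b))\<^sup>2 \<le> (e\<^sup>2)\<^sup>2" by simp
    then have 2: "cnorm A (h \<otimes> b) \<le> e\<^sup>2" by (rule power2_le_imp_le) simp
    have "star A (j \<otimes> b) \<otimes> (j \<otimes> b) = b \<otimes> (h \<otimes> b)"
      using jc b by (simp add: h_def star_mult m_assoc star_closed)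
    then have "(cnorm A (j \<otimes> b))\<^sup>2 \<le> e\<^sup>2"
      using p_cstar[of "j \<otimes> b"] sandwich[of h] 2 h b jc by simp
    then show ?thesis by (rule power2_le_imp_le) (use \<open>0 < e\<close> in simp)
  qed
  ultimately show ?thesis using that b by blast
qed

text \<open>The quotient norm is first studied as a function on A. It is shown to be a C*-seminorm
  there and only then transported to the cosets.\<close>

definition quot_norm :: "'a \<Rightarrow> real" where
  "quot_norm x = (INF y\<in>J +> x. cnorm A y)"

lemma bdd_below_coset: "x \<in> carrier A \<Longrightarrow> bdd_below (cnorm A ` (J +> x))"
  by (rule bdd_belowI[of _ 0]) (auto simp: coset_eq)

lemma quot_norm_le: "x \<in> carrier A \<Longrightarrow> j \<in> J \<Longrightarrow> quot_norm x \<le> cnorm A (j \<oplus> x)"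
  unfolding quot_norm_def by (rule cINF_lower[OF bdd_below_coset]) (auto simp: coset_eq)

lemma quot_norm_le_norm: "x \<in> carrier A \<Longrightarrow> quot_norm x \<le> cnorm A x"
  using quot_norm_le[of x \<zero>] by simp

lemma quot_norm_less:
  assumes "x \<in> carrier A" "quot_norm x < c"
  obtains j where "j \<in> J" "cnorm A (j \<oplus> x) < c"
  using assms cINF_less_iff[OF _ bdd_below_coset[OF assms(1)], of c] J.a_rcos_self[OF assms(1)]
  by (auto simp: quot_norm_def coset_eq)

lemma quot_norm_nonneg: "x \<in> carrier A \<Longrightarrow> 0 \<le> quot_norm x"
  unfolding quot_norm_def coset_eq using empty_iff[of \<zero>] J.zero_closed
  by (intro cINF_greatest) (blast, auto)

lemma quot_norm_ideal: "x \<in> J \<Longrightarrow> quot_norm x = 0"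
  using quot_norm_le[of x "\<ominus> x"] quot_norm_nonneg[of x] by (simp add: l_neg)

lemma quot_norm_scale_le: assumes x: "x \<in> carrier A" shows "quot_norm (scale A c x) \<le> cmod c * quot_norm x"
proof (cases "c = 0")
  case False
  have "quot_norm (scale A c x) / cmod c \<le> quot_norm x"
  proof (rule dense_le, rule ccontr)
    fix w assume "w < quot_norm (scale A c x) / cmod c" "\<not> w \<le> quot_norm x"
    then obtain j where j: "j \<in> J" "cnorm A (j \<oplus> x) < w" using quot_norm_less[OF x, of w] by auto
    have "quot_norm (scale A c x) \<le> cnorm A (scale A c j \<oplus> scale A c x)"
      using x j by (intro quot_norm_le ideal_scale) (auto simp: scale_closed)
    also have "\<dots> = cmod c * cnorm A (j \<oplus> x)"
      using x j by (simp add: p_scale flip: scale_add_right)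
    also have "\<dots> \<le> cmod c * w" using j by (intro mult_left_mono) auto
    finally show False using \<open>w < _\<close> False by (simp add: field_simps)
  qed
  then show ?thesis using False by (simp add: field_simps)
qed (use x in \<open>simp add: quot_norm_ideal\<close>)

lemma quot_norm_add:
  assumes x: "x \<in> carrier A" "y \<in> carrier A" shows "quot_norm (x \<oplus> y) \<le> quot_norm x + quot_norm y"
proof (rule field_le_epsilon)
  fix e :: real assume "0 < e"
  obtain i where i: "i \<in> J" "cnorm A (i \<oplus> x) < quot_norm x + e / 2"
    using quot_norm_less[OF x(1), of "quot_norm x + e / 2"] \<open>0 < e\<close> by auto
  obtain j where j: "j \<in> J" "cnorm A (j \<oplus> y) < quot_norm y + e / 2"
    using quot_norm_less[OF x(2), of "quot_norm y + e / 2"] \<open>0 < e\<close> by auto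
  have "(i \<oplus> j) \<oplus> (x \<oplus> y) = (i \<oplus> x) \<oplus> (j \<oplus> y)" using x i j by (simp add: a_ac)
  then have "quot_norm (x \<oplus> y) \<le> cnorm A ((i \<oplus> x) \<oplus> (j \<oplus> y))"
    using quot_norm_le[of "x \<oplus> y" "i \<oplus> j"] x i j by simp
  also have "\<dots> \<le> cnorm A (i \<oplus> x) + cnorm A (j \<oplus> y)" using x i j by (intro p_add) auto
  finally show "quot_norm (x \<oplus> y) \<le> quot_norm x + quot_norm y + e" using i j by simp
qed

lemma quot_norm_mult:
  assumes x: "x \<in> carrier A" "y \<in> carrier A" shows "quot_norm (x \<otimes> y) \<le> quot_norm x * quot_norm y"
proof (rule le_mult_of_greater)
  fix a b assume "quot_norm x < a" "quot_norm y < b"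
  then obtain i j where ij: "i \<in> J" "cnorm A (i \<oplus> x) < a" "j \<in> J" "cnorm A (j \<oplus> y) < b"
    using quot_norm_less x by metis
  have "(i \<otimes> (j \<oplus> y) \<oplus> x \<otimes> j) \<oplus> x \<otimes> y = (i \<oplus> x) \<otimes> (j \<oplus> y)"
    using x ij by (simp add: l_distr r_distr a_ac)
  moreover have "i \<otimes> (j \<oplus> y) \<oplus> x \<otimes> j \<in> J"
    using x ij by (intro J.a_closed J.I_l_closed J.I_r_closed) auto
  ultimately have "quot_norm (x \<otimes> y) \<le> cnorm A ((i \<oplus> x) \<otimes> (j \<oplus> y))"
    using quot_norm_le[of "x \<otimes> y" "i \<otimes> (j \<oplus> y) \<oplus> x \<otimes> j"] x by simp
  also have "\<dots> \<le> cnorm A (i \<oplus> x) * cnorm A (j \<oplus> y)" using x ij by (intro p_mult) auto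
  also have "\<dots> \<le> a * b" proof -
    have "0 \<le> cnorm A (i \<oplus> x)" using ij(1) x by simp
    then have "0 \<le> a" using ij(2) by linarith
    then show ?thesis using x ij by (intro mult_mono) auto
  qed
  finally show "quot_norm (x \<otimes> y) \<le> a * b" .
qed

lemma quot_norm_star_le: assumes x: "x \<in> carrier A" shows "quot_norm (star A x) \<le> quot_norm x"
proof (rule field_le_epsilon)
  fix e :: real assume "0 < e"
  obtain i where i: "i \<in> J" "cnorm A (i \<oplus> x) < quot_norm x + e"
    using quot_norm_less[OF x, of "quot_norm x + e"] \<open>0 < e\<close> by auto
  have "quot_norm (star A x) \<le> cnorm A (star A i \<oplus> star A x)"
    using x i by (intro quot_norm_le star_ideal) (auto simp: star_closed)
  then show "quot_norm (star A x) \<le> quot_norm x + e"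
    using x i p_star[of "i \<oplus> x"] by (simp add: star_add)
qed

text \<open>For the nontrivial inequality a representative y = j + star x times x of nearly minimal
  norm is chosen, and b with 1 - b in the ideal and j b small. As x b represents the same coset as
  x, the square of the quotient norm of x is at most the norm of b (star x times x) b = b y b - b j
  b, whose second term is negligible and whose first is at most the norm of y.\<close>

lemma quot_norm_cstar: assumes x: "x \<in> carrier A" shows "quot_norm (star A x \<otimes> x) = (quot_norm x)\<^sup>2"
proof (rule antisym)
  have "quot_norm (star A x \<otimes> x) \<le> quot_norm (star A x) * quot_norm x"
    using x by (intro quot_norm_mult) (auto simp: star_closed)
  also have "\<dots> \<le> quot_norm x * quot_norm x"
    using x quot_norm_star_le by (intro mult_right_mono quot_norm_nonneg) auto
  finally show "quot_norm (star A x \<otimes> x) \<le> (quot_norm x)\<^sup>2" by (simp add: power2_eq_square)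
next
  have xx: "star A x \<otimes> x \<in> carrier A" using x by (simp add: star_closed)
  show "(quot_norm x)\<^sup>2 \<le> quot_norm (star A x \<otimes> x)"
  proof (rule field_le_epsilon)
    fix e :: real assume "0 < e"
    obtain j where j: "j \<in> J" "cnorm A (j \<oplus> star A x \<otimes> x) < quot_norm (star A x \<otimes> x) + e / 2"
      using quot_norm_less[OF xx, of "quot_norm (star A x \<otimes> x) + e / 2"] \<open>0 < e\<close> by auto
    define y where "y = j \<oplus> star A x \<otimes> x"
    have jc: "j \<in> carrier A" and yc: "y \<in> carrier A" using j xx by (auto simp: y_def)
    obtain b where b: "b \<in> carrier A" "star A b = b" "cnorm A b \<le> 1" "\<one> \<ominus> b \<in> J" "cnorm A (j \<otimes> b) \<le> e / 2"
      using approximate_unit[OF j(1), of "e / 2"] \<open>0 < e\<close> by auto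
    have "\<ominus> (x \<otimes> (\<one> \<ominus> b)) \<oplus> x = x \<otimes> b"
      using x b(1) by (simp add: mult_diff_right neg_diff_add)
    then have "quot_norm x \<le> cnorm A (x \<otimes> b)"
      using quot_norm_le[of x "\<ominus> (x \<otimes> (\<one> \<ominus> b))"] x b J.I_l_closed[OF b(4) x] by simp
    then have "(quot_norm x)\<^sup>2 \<le> (cnorm A (x \<otimes> b))\<^sup>2"
      using quot_norm_nonneg[OF x] by (intro power_mono) auto
    also have "\<dots> = cnorm A (b \<otimes> (star A x \<otimes> x) \<otimes> b)"
      using p_cstar[of "x \<otimes> b"] x b by (simp add: star_mult m_assoc star_closed)
    also have "star A x \<otimes> x = y \<ominus> j"
      using jc xx by (simp add: y_def minus_eq a_ac r_neg1 r_neg2)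
    also have "b \<otimes> (y \<ominus> j) \<otimes> b = b \<otimes> y \<otimes> b \<ominus> b \<otimes> (j \<otimes> b)"
      using b jc yc by (simp add: mult_diff_left mult_diff_right m_assoc)
    also have "cnorm A \<dots> \<le> cnorm A (b \<otimes> y \<otimes> b) + cnorm A (b \<otimes> (j \<otimes> b))"
      using b jc yc by (intro p_diff) auto
    also have "\<dots> \<le> cnorm A b * cnorm A y * cnorm A b + cnorm A b * cnorm A (j \<otimes> b)"
      using b jc yc by (intro add_mono p_mult order_trans[OF p_mult] mult_right_mono) auto
    also have "\<dots> \<le> 1 * cnorm A y * 1 + 1 * cnorm A (j \<otimes> b)"
      using b jc yc by (intro add_mono mult_mono) auto
    finally show "(quot_norm x)\<^sup>2 \<le> quot_norm (star A x \<otimes> x) + e" using j(2) b(5) by (simp add: y_def)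
  qed
qed

lemma quot_norm_scale: assumes x: "x \<in> carrier A" shows "quot_norm (scale A c x) = cmod c * quot_norm x"
proof (cases "c = 0")
  case False
  have "quot_norm x \<le> cmod (1 / c) * quot_norm (scale A c x)"
    using quot_norm_scale_le[of "scale A c x" "1 / c"] x False by (simp add: scale_closed scale_scale scale_one)
  then show ?thesis using quot_norm_scale_le[OF x, of c] False by (simp add: norm_divide field_simps)
qed (use x in \<open>simp add: quot_norm_ideal\<close>)

lemma quot_norm_seminorm: "cstar_seminorm A quot_norm"
  unfolding cstar_seminorm_def
  by (auto simp: quot_norm_nonneg quot_norm_add quot_norm_scale quot_norm_mult quot_norm_cstar)

abbreviation "AJ \<equiv> quotient_cstar A J"

lemma quotient_carrier: "carrier AJ = (\<lambda>x. J +> x) ` carrier A"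
  by (auto simp: quotient_cstar_def FactRing_simps)

text \<open>The operations of \<open>quotient_cstar\<close> are unions over representatives; if all
  representatives yield the same class, the union is that class.\<close>

lemma union_coset_cong:
  assumes "x \<in> carrier A" and "\<And>y. y \<in> J +> x \<Longrightarrow> f y = f x"
  shows "(\<Union>y\<in>J +> x. f y) = f x"
  using assms J.a_rcos_self by blast

lemma coset_star_hom: "(\<lambda>x. J +> x) \<in> star_hom A AJ"
proof (rule star_homI)
  have coset_elem: "y \<in> carrier A \<and> y \<ominus> x \<in> J" if "x \<in> carrier A" "y \<in> J +> x" for x y
    using that J.a_elemrcos_carrier J.a_rcos_module_minus[of x y] ring_axioms by blast
  fix x assume x: "x \<in> carrier A"
  have "(\<Union>y\<in>J +> x. J +> scale A c y) = J +> scale A c x" for c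
    using x coset_elem ideal_scale
    by (intro union_coset_cong) (simp_all add: coset_cong_iff scale_closed flip: scale_diff_right)
  then show "J +> scale A c x = scale AJ c (J +> x)" for c by (simp add: quotient_cstar_def)
  have "(\<Union>y\<in>J +> x. J +> star A y) = J +> star A x"
    using x coset_elem star_ideal
    by (intro union_coset_cong) (simp_all add: coset_cong_iff star_closed flip: star_diff)
  then show "J +> star A x = star AJ (J +> x)" by (simp add: quotient_cstar_def)
  fix y assume y: "y \<in> carrier A"
  show "J +> x \<otimes> y = (J +> x) \<otimes>\<^bsub>AJ\<^esub> (J +> y)"
    using x y J.rcoset_mult_add by (simp add: quotient_cstar_def FactRing_def)
  show "J +> x \<oplus> y = (J +> x) \<oplus>\<^bsub>AJ\<^esub> (J +> y)"
    using x y J.a_rcos_sum by (simp add: quotient_cstar_def FactRing_def)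
qed (auto simp: quotient_cstar_def FactRing_def intro: a_rcosetsI[OF J.a_subset])

lemma quotient_zero: "\<zero>\<^bsub>AJ\<^esub> = J"
  by (simp add: quotient_cstar_def FactRing_def)

lemma coset_zero: "J +> \<zero> = J"
  using J.a_subset by simp

lemma quotient_norm: "cnorm AJ (J +> x) = quot_norm x"
  by (simp add: quotient_cstar_def quot_norm_def)

text \<open>A coset of norm 0 contains elements j n + x tending to 0, so x is the limit of the ideal
  elements - j n and lies in the ideal, which is closed. Completeness follows by lifting fast
  sequences.\<close>

theorem quotient_unital_cstar_algebra: "unital_cstar_algebra AJ"
proof -
  have Q: "star_algebra AJ"
    using star_algebra_image[OF star_algebra_axioms coset_star_hom quotient_carrier]
    by (simp add: coset_zero quotient_zero)
  have sn: "cstar_seminorm AJ (cnorm AJ)"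
    by (rule cstar_seminorm_image[OF star_algebra_axioms quot_norm_seminorm coset_star_hom quotient_carrier])
       (rule quotient_norm)
  interpret Q: seminormed_star_algebra AJ "cnorm AJ"
    using Q sn by (rule star_algebra.seminormed)
  have hd: "(J +> x) \<ominus>\<^bsub>AJ\<^esub> (J +> y) = J +> (x \<ominus> y)" if "x \<in> carrier A" "y \<in> carrier A" for x y
    using star_hom_diff[OF star_algebra_axioms Q coset_star_hom that] by simp
  have definite': "C = \<zero>\<^bsub>AJ\<^esub>" if "C \<in> carrier AJ" "cnorm AJ C = 0" for C
  proof -
    obtain x where x: "x \<in> carrier A" "C = J +> x" using \<open>C \<in> _\<close> by (auto simp: quotient_carrier)
    have "quot_norm x < inverse (real (Suc n))" for n using that x by (simp add: quotient_norm)
    then have "\<forall>n. \<exists>j\<in>J. cnorm A (j \<oplus> x) < inverse (real (Suc n))"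
      using quot_norm_less[OF x(1)] by metis
    then obtain j where j: "\<And>n. j n \<in> J" "\<And>n. cnorm A (j n \<oplus> x) < inverse (real (Suc n))" by metis
    have "tends (\<lambda>n. \<ominus> j n) x"
    proof (rule tendsI)
      show "cnorm A (\<ominus> j n \<ominus> x) \<le> inverse (real (Suc n))" for n
        using p_minus[of "j n \<oplus> x"] j[of n] x(1) by (simp add: minus_eq minus_add)
      show "\<ominus> j n \<in> carrier A" for n using J.a_Hcarr[OF j(1)] by simp
    qed (rule x(1) LIMSEQ_inverse_real_of_nat)+
    then have "x \<in> J" by (rule ideal_limit[rotated]) (simp add: j(1))
    then have "J +> x = J +> \<zero>" using x(1) by (subst coset_cong_iff) (auto simp: minus_eq)
    then show ?thesis using x(2) by (simp add: coset_zero quotient_zero)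
  qed
  have fast: "\<exists>C. Q.tends S C"
    if S: "\<And>n. S n \<in> carrier AJ" and step: "\<And>n. cnorm AJ (S (Suc n) \<ominus>\<^bsub>AJ\<^esub> S n) < (1/2) ^ n" for S
  proof -
    \<comment> \<open>Each lift is chosen after its predecessor: an arbitrary representative of the
      next class is corrected by an ideal element until it is within (1/2)^n of the current
      one.\<close>
    have "\<exists>s. \<forall>n. (s n \<in> carrier A \<and> J +> s n = S n) \<and> cnorm A (s (Suc n) \<ominus> s n) < (1/2) ^ n"
    proof (rule dependent_nat_choice)
      show "\<exists>x. x \<in> carrier A \<and> J +> x = S 0" using S[of 0] by (auto simp: quotient_carrier)
      fix x n assume x: "x \<in> carrier A \<and> J +> x = S n"
      obtain y where y: "y \<in> carrier A" "J +> y = S (Suc n)" using S[of "Suc n"] by (auto simp: quotient_carrier)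
      have "quot_norm (y \<ominus> x) < (1/2) ^ n"
        using step[of n] x y hd[of y x] by (simp add: quotient_norm[symmetric])
      then obtain j where j: "j \<in> J" "cnorm A (j \<oplus> (y \<ominus> x)) < (1/2) ^ n"
        using quot_norm_less[of "y \<ominus> x"] x y by auto
      have "(j \<oplus> y) \<ominus> x = j \<oplus> (y \<ominus> x)" "(j \<oplus> y) \<ominus> y = j"
        using x y j by (auto simp: minus_eq a_assoc r_neg)
      then show "\<exists>z. (z \<in> carrier A \<and> J +> z = S (Suc n)) \<and> cnorm A (z \<ominus> x) < (1/2) ^ n"
        using j y by (intro exI[of _ "j \<oplus> y"]) (auto simp: coset_cong_iff simp flip: y(2))
    qed
    then obtain s where s: "\<And>n. s n \<in> carrier A" "\<And>n. J +> s n = S n"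
      "\<And>n. cnorm A (s (Suc n) \<ominus> s n) < (1/2) ^ n" by blast
    have "s \<in> cauchy_seqs A (cnorm A)"
    \<comment> \<open>The increments of 2 - 2(1/2)^n are exactly (1/2)^n.\<close>
    proof (rule dominated_cauchy[where v = "\<lambda>n. 2 - 2 * (1/2) ^ n"])
      show "cnorm A (s (Suc n) \<ominus> s n) \<le> 2 - 2 * (1/2) ^ Suc n - (2 - 2 * (1/2) ^ n)" for n
        using s(3)[of n] by simp
      have "(\<lambda>n. 2 - 2 * (1/2) ^ n :: real) \<longlonglongrightarrow> 2 - 2 * 0"
        by (intro tendsto_intros LIMSEQ_power_zero) simp
      then show "Cauchy (\<lambda>n. 2 - 2 * (1/2) ^ n :: real)" using convergent_Cauchy convergentI by blast
    qed (use s in auto)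
    then obtain x where x: "tends s x" using cauchy_tends by blast
    have xc: "x \<in> carrier A" using x by (simp add: tends_def)
    have "Q.tends S (J +> x)"
    proof (rule Q.tendsI)
      show "cnorm AJ (S n \<ominus>\<^bsub>AJ\<^esub> (J +> x)) \<le> cnorm A (s n \<ominus> x)" for n
        using hd[of "s n" x] s xc quot_norm_le_norm[of "s n \<ominus> x"] by (simp add: quotient_norm)
    qed (use x xc S in \<open>auto simp: tends_def quotient_carrier\<close>)
    then show ?thesis by blast
  qed
  show ?thesis
  proof (intro unital_cstar_algebra.intro unital_cstar_algebra_axioms.intro Q sn)
    show "\<exists>x\<in>carrier AJ. (\<lambda>n. cnorm AJ (s n \<ominus>\<^bsub>AJ\<^esub> x)) \<longlonglongrightarrow> 0"
      if "s \<in> cauchy_seqs AJ (cnorm AJ)" for s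
      using Q.complete_of_fast[OF fast that] by (auto simp: Q.tends_def)
  qed (use definite' in auto)
qed

end

section \<open>Completions\<close>

context seminormed_star_algebra
begin

text \<open>Cauchy sequences with pointwise operations. The completion is the image of this algebra
  under \<open>seq_class\<close>, so its laws and its norm are inherited through
  \<open>star_algebra_image\<close> and \<open>cstar_seminorm_image\<close>.\<close>

definition seq_alg :: "(nat \<Rightarrow> 'a) star_alg" where
  "seq_alg = \<lparr>carrier = cauchy_seqs A p, mult = (\<lambda>s t n. s n \<otimes> t n), one = (\<lambda>_. \<one>),
     zero = (\<lambda>_. \<zero>), add = (\<lambda>s t n. s n \<oplus> t n), scale = (\<lambda>c s n. scale A c (s n)),
     star = (\<lambda>s n. star A (s n))\<rparr>"

lemma seq_alg_simps [simp]:
  "carrier seq_alg = cauchy_seqs A p" "mult seq_alg s t = (\<lambda>n. s n \<otimes> t n)" "one seq_alg = (\<lambda>_. \<one>)"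
  "zero seq_alg = (\<lambda>_. \<zero>)" "add seq_alg s t = (\<lambda>n. s n \<oplus> t n)"
  "scale seq_alg c s = (\<lambda>n. scale A c (s n))" "star seq_alg s = (\<lambda>n. star A (s n))"
  by (simp_all add: seq_alg_def)

lemma cauchy_closed: "s \<in> cauchy_seqs A p \<Longrightarrow> s n \<in> carrier A"
  by (simp add: cauchy_seqs_def)

lemma cauchyD: "s \<in> cauchy_seqs A p \<Longrightarrow> 0 < e \<Longrightarrow> \<exists>N. \<forall>m\<ge>N. \<forall>n\<ge>N. p (s m \<ominus> s n) < e"
  by (simp add: cauchy_seqs_def)

lemma cauchyI:
  assumes "\<And>n. s n \<in> carrier A" "\<And>e. 0 < e \<Longrightarrow> \<exists>N. \<forall>m\<ge>N. \<forall>n\<ge>N. p (s m \<ominus> s n) \<le> e"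
  shows "s \<in> cauchy_seqs A p"
  unfolding cauchy_seqs_def
proof (intro CollectI conjI allI impI)
  fix e :: real assume "0 < e"
  then obtain N where "\<forall>m\<ge>N. \<forall>n\<ge>N. p (s m \<ominus> s n) \<le> e / 2" using assms(2)[of "e/2"] by auto
  then have "\<forall>m\<ge>N. \<forall>n\<ge>N. p (s m \<ominus> s n) < e" using \<open>0 < e\<close> by fastforce
  then show "\<exists>N. \<forall>m\<ge>N. \<forall>n\<ge>N. p (s m \<ominus> s n) < e" by blast
qed (rule assms(1))

lemma cauchy_norm_convergent: assumes s: "s \<in> cauchy_seqs A p" shows "convergent (\<lambda>n. p (s n))"
proof -
  have "Cauchy (\<lambda>n. p (s n))"
    unfolding Cauchy_def dist_real_def
    using cauchyD[OF s] p_abs_diff[OF cauchy_closed[OF s] cauchy_closed[OF s]] by (meson le_less_trans)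
  then show ?thesis by (simp add: Cauchy_convergent)
qed

definition lim_norm :: "(nat \<Rightarrow> 'a) \<Rightarrow> real" where
  "lim_norm s = lim (\<lambda>n. p (s n))"

lemma lim_norm: "s \<in> cauchy_seqs A p \<Longrightarrow> (\<lambda>n. p (s n)) \<longlonglongrightarrow> lim_norm s"
  unfolding lim_norm_def using cauchy_norm_convergent convergent_LIMSEQ_iff by blast

lemma lim_norm_eqI: "(\<lambda>n. p (s n)) \<longlonglongrightarrow> l \<Longrightarrow> lim_norm s = l"
  unfolding lim_norm_def by (rule limI)

lemma cauchy_bounded: assumes s: "s \<in> cauchy_seqs A p" shows "\<exists>B>0. \<forall>n. p (s n) \<le> B"
proof -
  have "Bseq (\<lambda>n. p (s n))" using cauchy_norm_convergent[OF s] by (rule convergent_imp_Bseq)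
  then obtain B where "0 < B" "\<And>n. norm (p (s n)) \<le> B" by (rule BseqE) blast
  then show ?thesis by (intro exI[of _ B]) (auto simp: abs_le_iff)
qed

lemma cauchy_const: "x \<in> carrier A \<Longrightarrow> (\<lambda>_. x) \<in> cauchy_seqs A p"
  by (rule tends_cauchy[OF tends_const])

lemma cauchy_add:
  assumes s: "s \<in> cauchy_seqs A p" and t: "t \<in> cauchy_seqs A p"
  shows "(\<lambda>n. s n \<oplus> t n) \<in> cauchy_seqs A p"
proof (rule cauchyI)
  note c = cauchy_closed[OF s] cauchy_closed[OF t]
  fix e :: real assume "0 < e"
  obtain M N where "\<forall>m\<ge>M. \<forall>n\<ge>M. p (s m \<ominus> s n) < e / 2" "\<forall>m\<ge>N. \<forall>n\<ge>N. p (t m \<ominus> t n) < e / 2"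
    using cauchyD[OF s, of "e/2"] cauchyD[OF t, of "e/2"] \<open>0 < e\<close> by auto
  moreover have "p (s m \<oplus> t m \<ominus> (s n \<oplus> t n)) \<le> p (s m \<ominus> s n) + p (t m \<ominus> t n)" for m n
    using c by (simp add: diff_diff_swap p_add)
  ultimately have "\<forall>m\<ge>max M N. \<forall>n\<ge>max M N. p (s m \<oplus> t m \<ominus> (s n \<oplus> t n)) \<le> e"
    by (smt (verit, best) field_sum_of_halves max.bounded_iff)
  then show "\<exists>N. \<forall>m\<ge>N. \<forall>n\<ge>N. p (s m \<oplus> t m \<ominus> (s n \<oplus> t n)) \<le> e" by blast
qed (use s t cauchy_closed in blast)

lemma cauchy_scale:
  assumes s: "s \<in> cauchy_seqs A p" shows "(\<lambda>n. scale A c (s n)) \<in> cauchy_seqs A p"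
proof (rule cauchyI)
  note cl = cauchy_closed[OF s]
  fix e :: real assume "0 < e"
  then have "0 < e / (cmod c + 1)" by (simp add: add_nonneg_pos)
  then obtain N where N: "\<And>m n. m \<ge> N \<Longrightarrow> n \<ge> N \<Longrightarrow> p (s m \<ominus> s n) < e / (cmod c + 1)"
    using cauchyD[OF s] by blast
  have "p (scale A c (s m) \<ominus> scale A c (s n)) \<le> e" if "m \<ge> N" "n \<ge> N" for m n
  proof -
    have "p (scale A c (s m) \<ominus> scale A c (s n)) = cmod c * p (s m \<ominus> s n)"
      using cl by (simp add: p_scale flip: scale_diff_right)
    also have "\<dots> \<le> (cmod c + 1) * (e / (cmod c + 1))"
      using N[OF that] cl by (intro mult_mono) auto
    also have "\<dots> = e" using norm_ge_zero[of c] by (simp add: add_nonneg_eq_0_iff)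
    finally show ?thesis .
  qed
  then show "\<exists>N. \<forall>m\<ge>N. \<forall>n\<ge>N. p (scale A c (s m) \<ominus> scale A c (s n)) \<le> e" by blast
qed (use s cauchy_closed scale_closed in blast)

lemma cauchy_star: "s \<in> cauchy_seqs A p \<Longrightarrow> (\<lambda>n. star A (s n)) \<in> cauchy_seqs A p"
  unfolding cauchy_seqs_def by (auto simp: star_closed p_star simp flip: star_diff)

lemma cauchy_mult:
  assumes s: "s \<in> cauchy_seqs A p" and t: "t \<in> cauchy_seqs A p"
  shows "(\<lambda>n. s n \<otimes> t n) \<in> cauchy_seqs A p"
proof (rule cauchyI)
  note c = cauchy_closed[OF s] cauchy_closed[OF t]
  obtain S where S: "0 < S" "\<And>n. p (s n) \<le> S" using cauchy_bounded[OF s] by blast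
  obtain T where T: "0 < T" "\<And>n. p (t n) \<le> T" using cauchy_bounded[OF t] by blast
  fix e :: real assume "0 < e"
  obtain M where M: "\<And>m n. m \<ge> M \<Longrightarrow> n \<ge> M \<Longrightarrow> p (s m \<ominus> s n) < e / (2 * T)"
    using cauchyD[OF s, OF divide_pos_pos[of e "2 * T"]] \<open>0 < e\<close> T(1) by (metis zero_less_mult_iff zero_less_numeral)
  obtain N where N: "\<And>m n. m \<ge> N \<Longrightarrow> n \<ge> N \<Longrightarrow> p (t m \<ominus> t n) < e / (2 * S)"
    using cauchyD[OF t, OF divide_pos_pos[of e "2 * S"]] \<open>0 < e\<close> S(1) by (metis zero_less_mult_iff zero_less_numeral)
  have "p (s m \<otimes> t m \<ominus> s n \<otimes> t n) \<le> e" if "m \<ge> max M N" "n \<ge> max M N" for m n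
  proof -
    have "p (s m \<otimes> t m \<ominus> s n \<otimes> t n) \<le> p ((s m \<ominus> s n) \<otimes> t m) + p (s n \<otimes> (t m \<ominus> t n))"
      using c by (simp add: diff_mult_split p_add)
    also have "\<dots> \<le> p (s m \<ominus> s n) * p (t m) + p (s n) * p (t m \<ominus> t n)"
      using c by (intro add_mono p_mult) auto
    also have "\<dots> \<le> e / (2 * T) * T + S * (e / (2 * S))"
      using that c M[of m n] N[of m n] S T \<open>0 < e\<close> by (intro add_mono mult_mono) (auto simp: less_imp_le)
    also have "\<dots> = e" using S T by simp
    finally show ?thesis .
  qed
  then show "\<exists>N. \<forall>m\<ge>N. \<forall>n\<ge>N. p (s m \<otimes> t m \<ominus> s n \<otimes> t n) \<le> e" by blast
qed (use s t cauchy_closed in blast)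

lemma seq_alg_star_algebra: "star_algebra seq_alg"
proof (intro star_algebra.intro star_algebra_axioms.intro ringI abelian_groupI Group.monoidI)
  show "\<exists>y\<in>carrier seq_alg. y \<oplus>\<^bsub>seq_alg\<^esub> x = \<zero>\<^bsub>seq_alg\<^esub>" if "x \<in> carrier seq_alg" for x
    using that cauchy_scale[of x "-1"] cauchy_closed[of x]
    by (intro bexI[of _ "\<lambda>n. scale A (-1) (x n)"]) (auto simp: scale_minus_one l_neg)
qed (auto simp: cauchy_add cauchy_mult cauchy_scale cauchy_star cauchy_const cauchy_closed a_ac m_assoc
       l_distr r_distr scale_add_left scale_add_right scale_scale scale_one scale_mult_left
       scale_mult_right star_star star_add star_scale star_mult)

lemma lim_norm_seminorm: "cstar_seminorm seq_alg lim_norm"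
  unfolding cstar_seminorm_def
proof (intro conjI ballI allI)
  fix s assume s: "s \<in> carrier seq_alg"
  then have s': "s \<in> cauchy_seqs A p" by simp
  note c = cauchy_closed[OF s']
  show "0 \<le> lim_norm s" using LIMSEQ_le_const[OF lim_norm[OF s']] c by auto
  show "lim_norm (scale seq_alg k s) = cmod k * lim_norm s" for k
    using c tendsto_mult_left[OF lim_norm[OF s'], of "cmod k"] by (intro lim_norm_eqI) (simp add: p_scale)
  show "lim_norm (star seq_alg s \<otimes>\<^bsub>seq_alg\<^esub> s) = (lim_norm s)\<^sup>2"
    using c tendsto_power[OF lim_norm[OF s'], of 2] by (intro lim_norm_eqI) (simp add: p_cstar)
  fix t assume "t \<in> carrier seq_alg"
  then have t': "t \<in> cauchy_seqs A p" by simp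
  note d = cauchy_closed[OF t']
  show "lim_norm (s \<oplus>\<^bsub>seq_alg\<^esub> t) \<le> lim_norm s + lim_norm t"
    using LIMSEQ_le[OF lim_norm[OF cauchy_add[OF s' t']] tendsto_add[OF lim_norm[OF s'] lim_norm[OF t']]] p_add c d
    by auto
  show "lim_norm (s \<otimes>\<^bsub>seq_alg\<^esub> t) \<le> lim_norm s * lim_norm t"
    using LIMSEQ_le[OF lim_norm[OF cauchy_mult[OF s' t']] tendsto_mult[OF lim_norm[OF s'] lim_norm[OF t']]] p_mult c d
    by auto
qed

lemma seq_class_self: "s \<in> cauchy_seqs A p \<Longrightarrow> s \<in> seq_class A p s"
  by (simp add: seq_class_def cauchy_closed)

lemma seq_class_eqI:
  assumes s: "s \<in> cauchy_seqs A p" "t \<in> cauchy_seqs A p" and l: "(\<lambda>n. p (s n \<ominus> t n)) \<longlonglongrightarrow> 0"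
  shows "seq_class A p s = seq_class A p t"
proof -
  have *: "(\<lambda>n. p (u n \<ominus> t n)) \<longlonglongrightarrow> 0"
    if "s \<in> cauchy_seqs A p" "t \<in> cauchy_seqs A p" "u \<in> cauchy_seqs A p"
      "(\<lambda>n. p (s n \<ominus> t n)) \<longlonglongrightarrow> 0" "(\<lambda>n. p (u n \<ominus> s n)) \<longlonglongrightarrow> 0" for s t u
  proof (rule tendsto_sandwich[of "\<lambda>_. 0" _ _ "\<lambda>n. p (u n \<ominus> s n) + p (s n \<ominus> t n)"])
    show "(\<lambda>n. p (u n \<ominus> s n) + p (s n \<ominus> t n)) \<longlonglongrightarrow> 0" using tendsto_add_zero that(4,5) by blast
  qed (use that cauchy_closed p_diff_triangle in auto)
  have "(\<lambda>n. p (t n \<ominus> s n)) \<longlonglongrightarrow> 0"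
    using l p_diff_commute[OF cauchy_closed[OF s(1)] cauchy_closed[OF s(2)]] by simp
  then show ?thesis unfolding seq_class_def using *[of s t] *[of t s] s l by blast
qed

lemma seq_class_memD:
  "t \<in> seq_class A p s \<Longrightarrow> t \<in> cauchy_seqs A p \<and> (\<lambda>n. p (t n \<ominus> s n)) \<longlonglongrightarrow> 0"
  by (simp add: seq_class_def)

lemma lim_norm_cong:
  assumes s: "s \<in> cauchy_seqs A p" and t: "t \<in> seq_class A p s"
  shows "lim_norm t = lim_norm s"
proof (rule lim_norm_eqI)
  note t' = seq_class_memD[OF t]
  have "(\<lambda>n. p (t n) - p (s n)) \<longlonglongrightarrow> 0"
    by (intro tendsto_rabs_zero_cancel[of "\<lambda>n. p (t n) - p (s n)"]
        tendsto_sandwich[of "\<lambda>_. 0" "\<lambda>n. \<bar>p (t n) - p (s n)\<bar>" sequentially "\<lambda>n. p (t n \<ominus> s n)" 0])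
       (use s t' in \<open>auto simp: p_abs_diff cauchy_closed\<close>)
  from tendsto_add[OF this lim_norm[OF s]] show "(\<lambda>n. p (t n)) \<longlonglongrightarrow> lim_norm s" by simp
qed

text \<open>As for cosets, well-definedness on representatives collapses the unions in
  \<open>completion\<close> to single classes.\<close>

lemma union_class_cong:
  assumes "s \<in> cauchy_seqs A p" and "\<And>t. t \<in> seq_class A p s \<Longrightarrow> f t = f s"
  shows "(\<Union>t\<in>seq_class A p s. f t) = f s"
  using assms seq_class_self by blast

lemma union_class_cong2:
  assumes "s \<in> cauchy_seqs A p" "t \<in> cauchy_seqs A p"
    and "\<And>u v. u \<in> seq_class A p s \<Longrightarrow> v \<in> seq_class A p t \<Longrightarrow> f u v = f s t"
  shows "(\<Union>u\<in>seq_class A p s. \<Union>v\<in>seq_class A p t. f u v) = f s t"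
  using assms seq_class_self by blast

abbreviation "Compl \<equiv> completion A p"

lemma completion_carrier: "carrier Compl = seq_class A p ` carrier seq_alg"
  by (simp add: completion_def)

lemma seq_class_star_hom: "seq_class A p \<in> star_hom seq_alg Compl"
proof (rule star_homI)
  fix s assume "s \<in> carrier seq_alg"
  then have s: "s \<in> cauchy_seqs A p" by simp
  note c = cauchy_closed[OF s]
  have u: "u \<in> cauchy_seqs A p \<and> (\<forall>n. u n \<in> carrier A) \<and> (\<lambda>n. p (u n \<ominus> s n)) \<longlonglongrightarrow> 0"
    if "u \<in> seq_class A p s" for u s
    using seq_class_memD[OF that] cauchy_closed by blast
  show "seq_class A p s \<in> carrier Compl" using s by (simp add: completion_def)
  have "(\<Union>u\<in>seq_class A p s. seq_class A p (\<lambda>n. scale A k (u n))) = seq_class A p (\<lambda>n. scale A k (s n))" for k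
    using s c u[of _ s]
    by (intro union_class_cong seq_class_eqI cauchy_scale)
       (auto simp: p_scale intro: tendsto_mult_right_zero simp flip: scale_diff_right)
  then show "seq_class A p (scale seq_alg k s) = scale Compl k (seq_class A p s)" for k
    by (simp add: completion_def)
  have "(\<Union>u\<in>seq_class A p s. seq_class A p (\<lambda>n. star A (u n))) = seq_class A p (\<lambda>n. star A (s n))"
    using s c u[of _ s]
    by (intro union_class_cong seq_class_eqI cauchy_star)
       (auto simp: star_closed p_star simp flip: star_diff)
  then show "seq_class A p (star seq_alg s) = star Compl (seq_class A p s)"
    by (simp add: completion_def)
  fix t assume "t \<in> carrier seq_alg"
  then have t: "t \<in> cauchy_seqs A p" by simp
  note d = cauchy_closed[OF t]
  have add: "seq_class A p (\<lambda>n. u n \<oplus> v n) = seq_class A p (\<lambda>n. s n \<oplus> t n)"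
    if "u \<in> seq_class A p s" "v \<in> seq_class A p t" for u v
  proof (rule seq_class_eqI[OF cauchy_add cauchy_add])
    show "(\<lambda>n. p (u n \<oplus> v n \<ominus> (s n \<oplus> t n))) \<longlonglongrightarrow> 0"
      by (rule tendsto_sandwich[of "\<lambda>_. 0" _ _ "\<lambda>n. p (u n \<ominus> s n) + p (v n \<ominus> t n)"])
         (use u[OF that(1)] u[OF that(2)] c d in \<open>auto simp: diff_diff_swap p_add intro: tendsto_add_zero\<close>)
  qed (use u that s t in auto)
  have mult: "seq_class A p (\<lambda>n. u n \<otimes> v n) = seq_class A p (\<lambda>n. s n \<otimes> t n)"
    if "u \<in> seq_class A p s" "v \<in> seq_class A p t" for u v
  proof (rule seq_class_eqI[OF cauchy_mult cauchy_mult])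
    note u1 = u[OF that(1)] and v1 = u[OF that(2)]
    show "(\<lambda>n. p (u n \<otimes> v n \<ominus> s n \<otimes> t n)) \<longlonglongrightarrow> 0"
    proof (rule tendsto_sandwich[of "\<lambda>_. 0" _ _ "\<lambda>n. p (u n \<ominus> s n) * p (v n) + p (s n) * p (v n \<ominus> t n)"])
      have "p (u n \<otimes> v n \<ominus> s n \<otimes> t n) \<le> p ((u n \<ominus> s n) \<otimes> v n) + p (s n \<otimes> (v n \<ominus> t n))" for n
        using u1 v1 c d by (simp add: diff_mult_split p_add)
      also have "p ((u n \<ominus> s n) \<otimes> v n) + p (s n \<otimes> (v n \<ominus> t n)) \<le> p (u n \<ominus> s n) * p (v n) + p (s n) * p (v n \<ominus> t n)" for n
        using u1 v1 c d by (intro add_mono p_mult) auto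
      finally show "\<forall>\<^sub>F n in sequentially. p (u n \<otimes> v n \<ominus> s n \<otimes> t n) \<le> p (u n \<ominus> s n) * p (v n) + p (s n) * p (v n \<ominus> t n)"
        by simp
      have "(\<lambda>n. p (u n \<ominus> s n) * p (v n) + p (s n) * p (v n \<ominus> t n)) \<longlonglongrightarrow> 0 * lim_norm v + lim_norm s * 0"
        using u1 v1 s by (intro tendsto_intros lim_norm) auto
      then show "(\<lambda>n. p (u n \<ominus> s n) * p (v n) + p (s n) * p (v n \<ominus> t n)) \<longlonglongrightarrow> 0" by simp
    qed (use u1 v1 c d in auto)
  qed (use u that s t in auto)
  show "seq_class A p (s \<oplus>\<^bsub>seq_alg\<^esub> t) = seq_class A p s \<oplus>\<^bsub>Compl\<^esub> seq_class A p t"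
    using union_class_cong2[OF s t, of "\<lambda>u v. seq_class A p (\<lambda>n. u n \<oplus> v n)", OF add]
    by (simp add: completion_def)
  show "seq_class A p (s \<otimes>\<^bsub>seq_alg\<^esub> t) = seq_class A p s \<otimes>\<^bsub>Compl\<^esub> seq_class A p t"
    using union_class_cong2[OF s t, of "\<lambda>u v. seq_class A p (\<lambda>n. u n \<otimes> v n)", OF mult]
    by (simp add: completion_def)
qed (simp add: completion_def)

lemma completion_zero: "seq_class A p \<zero>\<^bsub>seq_alg\<^esub> = \<zero>\<^bsub>Compl\<^esub>"
  by (simp add: completion_def)

lemma completion_star_algebra: "star_algebra Compl"
  by (rule star_algebra_image[OF seq_alg_star_algebra seq_class_star_hom completion_carrier])
     (rule completion_zero)

lemma completion_norm: assumes s: "s \<in> cauchy_seqs A p" shows "cnorm Compl (seq_class A p s) = lim_norm s"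
proof -
  have "(SOME t. t \<in> seq_class A p s) \<in> seq_class A p s"
    by (rule someI[of "\<lambda>t. t \<in> seq_class A p s", OF seq_class_self[OF s]])
  from lim_norm_cong[OF s this] show ?thesis by (simp add: completion_def lim_norm_def)
qed

lemma completion_seminorm: "cstar_seminorm Compl (cnorm Compl)"
  by (rule cstar_seminorm_image[OF seq_alg_star_algebra lim_norm_seminorm seq_class_star_hom completion_carrier])
     (simp add: completion_norm)

definition compl_emb :: "'a \<Rightarrow> (nat \<Rightarrow> 'a) set" where
  "compl_emb x = seq_class A p (\<lambda>_. x)"

lemma compl_emb_star_hom: "compl_emb \<in> star_hom A Compl"
proof -
  have "(\<lambda>x _. x) \<in> star_hom A seq_alg" by (rule star_homI) (auto simp: cauchy_const)
  from star_hom_comp[OF this seq_class_star_hom] show ?thesis by (simp add: compl_emb_def[abs_def] comp_def)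
qed

lemma compl_emb_norm: "x \<in> carrier A \<Longrightarrow> cnorm Compl (compl_emb x) = p x"
  by (simp add: compl_emb_def completion_norm cauchy_const lim_norm_eqI)

text \<open>Every class is the limit of the constant sequences formed from the terms of its own
  representative. This density is what determines homomorphisms on the completion.\<close>

lemma compl_emb_dense:
  assumes s: "s \<in> cauchy_seqs A p"
  shows "seminormed_star_algebra.tends Compl (cnorm Compl) (\<lambda>k. compl_emb (s k)) (seq_class A p s)"
proof -
  interpret C: seminormed_star_algebra Compl "cnorm Compl"
    using completion_star_algebra completion_seminorm by (rule star_algebra.seminormed)
  note c = cauchy_closed[OF s]
  have cc: "(\<lambda>n. s k \<ominus> s n) \<in> cauchy_seqs A p" for k
    using cauchy_add[OF cauchy_const[OF c[of k]] cauchy_scale[OF s, of "-1"]] c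
    by (simp add: scale_minus_one minus_eq)
  have "compl_emb (s k) \<ominus>\<^bsub>Compl\<^esub> seq_class A p s = seq_class A p (\<lambda>n. s k \<ominus> s n)" for k
  proof -
    have "seq_class A p ((\<lambda>_. s k) \<ominus>\<^bsub>seq_alg\<^esub> s) = compl_emb (s k) \<ominus>\<^bsub>Compl\<^esub> seq_class A p s"
      unfolding compl_emb_def
      by (rule star_hom_diff[OF seq_alg_star_algebra completion_star_algebra seq_class_star_hom])
         (use s c cauchy_const in auto)
    moreover have "(\<lambda>_. s k) \<ominus>\<^bsub>seq_alg\<^esub> s = (\<lambda>n. s k \<ominus> s n)"
    proof -
      interpret S: star_algebra seq_alg by (rule seq_alg_star_algebra)
      have "\<ominus>\<^bsub>seq_alg\<^esub> s = scale seq_alg (-1) s"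
        by (rule S.scale_minus_one[symmetric]) (simp add: s)
      also have "\<dots> = (\<lambda>n. \<ominus> s n)" by (simp add: scale_minus_one c)
      finally show ?thesis unfolding S.minus_eq minus_eq by simp
    qed
    ultimately show ?thesis by simp
  qed
  then have n: "cnorm Compl (compl_emb (s k) \<ominus>\<^bsub>Compl\<^esub> seq_class A p s) = lim_norm (\<lambda>n. s k \<ominus> s n)" for k
    by (simp add: completion_norm cc)
  have "(\<lambda>k. lim_norm (\<lambda>n. s k \<ominus> s n)) \<longlonglongrightarrow> 0"
  proof (rule LIMSEQ_I)
    fix e :: real assume "0 < e"
    then obtain N where N: "\<And>m n. m \<ge> N \<Longrightarrow> n \<ge> N \<Longrightarrow> p (s m \<ominus> s n) < e / 2"
      using cauchyD[OF s, of "e/2"] by auto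
    have "norm (lim_norm (\<lambda>n. s k \<ominus> s n) - 0) < e" if "k \<ge> N" for k
    proof -
      have "lim_norm (\<lambda>n. s k \<ominus> s n) \<le> e / 2"
        using N[OF that] by (intro LIMSEQ_le_const2[OF lim_norm[OF cc]]) (auto intro: less_imp_le)
      moreover have "0 \<le> lim_norm (\<lambda>n. s k \<ominus> s n)"
        using c by (intro LIMSEQ_le_const[OF lim_norm[OF cc]]) auto
      ultimately show ?thesis using \<open>0 < e\<close> by simp
    qed
    then show "\<exists>no. \<forall>k\<ge>no. norm (lim_norm (\<lambda>n. s k \<ominus> s n) - 0) < e" by blast
  qed
  then show ?thesis
    unfolding C.tends_def n using s c star_hom_closed[OF compl_emb_star_hom] by (auto simp: completion_carrier)
qed

theorem completion_unital_cstar_algebra: "unital_cstar_algebra Compl"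
proof -
  interpret C: seminormed_star_algebra Compl "cnorm Compl"
    using completion_star_algebra completion_seminorm by (rule star_algebra.seminormed)
  note ec = star_hom_closed[OF compl_emb_star_hom]
  show ?thesis
  proof (intro unital_cstar_algebra.intro unital_cstar_algebra_axioms.intro completion_star_algebra completion_seminorm)
    fix x assume "x \<in> carrier Compl" "cnorm Compl x = 0"
    then obtain s where s: "s \<in> cauchy_seqs A p" "x = seq_class A p s" "lim_norm s = 0"
      by (auto simp: completion_carrier completion_norm)
    then have "seq_class A p s = seq_class A p (\<lambda>_. \<zero>)"
      using lim_norm[OF s(1)] cauchy_closed[OF s(1)]
      by (intro seq_class_eqI cauchy_const) (auto simp: minus_eq)
    then show "x = \<zero>\<^bsub>Compl\<^esub>" using s completion_zero by simp
  next
    fix S assume S: "S \<in> cauchy_seqs Compl (cnorm Compl)"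
    note Sc = C.cauchy_closed[OF S]
    \<comment> \<open>A diagonal choice: the n-th term is approximated by an element of A to within
      1/(n+1). These elements form a Cauchy sequence of A, and its class is the limit.\<close>
    have "\<exists>a\<in>carrier A. cnorm Compl (compl_emb a \<ominus>\<^bsub>Compl\<^esub> S n) < inverse (real (Suc n))" for n
    proof -
      obtain s where s: "s \<in> cauchy_seqs A p" "S n = seq_class A p s"
        using Sc[of n] by (auto simp: completion_carrier)
      have "\<forall>\<^sub>F k in sequentially. cnorm Compl (compl_emb (s k) \<ominus>\<^bsub>Compl\<^esub> S n) < inverse (real (Suc n))"
        using compl_emb_dense[OF s(1)] s(2) unfolding C.tends_def
        by (intro order_tendstoD(2)[of _ 0]) auto
      then obtain k where "cnorm Compl (compl_emb (s k) \<ominus>\<^bsub>Compl\<^esub> S n) < inverse (real (Suc n))"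
        using eventually_happens by fastforce
      then show ?thesis using cauchy_closed[OF s(1)] by blast
    qed
    then obtain a where a: "\<And>n. a n \<in> carrier A"
      "\<And>n. cnorm Compl (compl_emb (a n) \<ominus>\<^bsub>Compl\<^esub> S n) < inverse (real (Suc n))" by metis
    have "a \<in> cauchy_seqs A p"
    proof (rule cauchyI)
      fix e :: real assume "0 < e"
      obtain N where N: "\<And>m n. m \<ge> N \<Longrightarrow> n \<ge> N \<Longrightarrow> cnorm Compl (S m \<ominus>\<^bsub>Compl\<^esub> S n) < e / 3"
        using C.cauchyD[OF S, of "e/3"] \<open>0 < e\<close> by auto
      obtain M where M: "inverse (real (Suc M)) < e / 3" using reals_Archimedean[of "e/3"] \<open>0 < e\<close> by auto
      have small: "cnorm Compl (compl_emb (a n) \<ominus>\<^bsub>Compl\<^esub> S n) < e / 3" if "M \<le> n" for n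
      proof -
        have "inverse (real (Suc n)) \<le> inverse (real (Suc M))" using that by (intro le_imp_inverse_le) auto
        then show ?thesis using a(2)[of n] M by linarith
      qed
      have "p (a m \<ominus> a n) \<le> e" if "m \<ge> max M N" "n \<ge> max M N" for m n
      proof -
        have "p (a m \<ominus> a n) = cnorm Compl (compl_emb (a m) \<ominus>\<^bsub>Compl\<^esub> compl_emb (a n))"
          using a(1) star_hom_diff[OF star_algebra_axioms completion_star_algebra compl_emb_star_hom, symmetric]
          by (simp add: compl_emb_norm)
        also have "\<dots> \<le> cnorm Compl (compl_emb (a m) \<ominus>\<^bsub>Compl\<^esub> S m) + (cnorm Compl (S m \<ominus>\<^bsub>Compl\<^esub> S n)
            + cnorm Compl (S n \<ominus>\<^bsub>Compl\<^esub> compl_emb (a n)))"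
          using ec[OF a(1)] Sc
          by (intro order_trans[OF C.p_diff_triangle[of _ "S m"]] add_left_mono C.p_diff_triangle) auto
        also have "\<dots> \<le> e / 3 + (e / 3 + e / 3)"
          using that small[of m] small[of n] N[of m n] C.p_diff_commute[OF Sc ec[OF a(1)], of n n]
          by (intro add_mono) auto
        finally show ?thesis by simp
      qed
      then show "\<exists>N. \<forall>m\<ge>N. \<forall>n\<ge>N. p (a m \<ominus> a n) \<le> e" by blast
    qed (rule a(1))
    from compl_emb_dense[OF this]
    have t: "C.tends (\<lambda>k. compl_emb (a k)) (seq_class A p a)" .
    have cc: "seq_class A p a \<in> carrier Compl" using t by (simp add: C.tends_def)
    have "(\<lambda>n. cnorm Compl (S n \<ominus>\<^bsub>Compl\<^esub> seq_class A p a)) \<longlonglongrightarrow> 0"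
    proof (rule tendsto_sandwich[of "\<lambda>_. 0" _ _
          "\<lambda>n. inverse (real (Suc n)) + cnorm Compl (compl_emb (a n) \<ominus>\<^bsub>Compl\<^esub> seq_class A p a)"])
      show "(\<lambda>n. inverse (real (Suc n)) + cnorm Compl (compl_emb (a n) \<ominus>\<^bsub>Compl\<^esub> seq_class A p a)) \<longlonglongrightarrow> 0"
        using t LIMSEQ_inverse_real_of_nat tendsto_add_zero unfolding C.tends_def by blast
      have "cnorm Compl (S n \<ominus>\<^bsub>Compl\<^esub> seq_class A p a) \<le>
          inverse (real (Suc n)) + cnorm Compl (compl_emb (a n) \<ominus>\<^bsub>Compl\<^esub> seq_class A p a)" for n
        using C.p_diff_triangle[OF Sc ec[OF a(1)] cc, of n n] a(2)[of n] C.p_diff_commute[OF Sc ec[OF a(1)], of n n]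
        by linarith
      then show "\<forall>\<^sub>F n in sequentially. cnorm Compl (S n \<ominus>\<^bsub>Compl\<^esub> seq_class A p a) \<le>
          inverse (real (Suc n)) + cnorm Compl (compl_emb (a n) \<ominus>\<^bsub>Compl\<^esub> seq_class A p a)" by simp
    qed (use Sc cc in auto)
    then show "\<exists>x\<in>carrier Compl. (\<lambda>n. cnorm Compl (S n \<ominus>\<^bsub>Compl\<^esub> x)) \<longlonglongrightarrow> 0" using cc by blast
  qed
qed

text \<open>Domination by p makes the image of a Cauchy sequence Cauchy, and sequences with the same
  class have images with the same limit; the extension is that limit.\<close>

theorem completion_extension:
  assumes B: "unital_cstar_algebra B" and h: "h \<in> star_hom A B" and le: "\<And>x. x \<in> carrier A \<Longrightarrow> cnorm B (h x) \<le> p x"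
  obtains H where "H \<in> star_hom Compl B" "\<And>x. x \<in> carrier A \<Longrightarrow> H (compl_emb x) = h x"
proof -
  interpret B: unital_cstar_algebra B by fact
  have hd: "cnorm B (h x \<ominus>\<^bsub>B\<^esub> h y) \<le> p (x \<ominus> y)" if "x \<in> carrier A" "y \<in> carrier A" for x y
    using le[of "x \<ominus> y"] that star_hom_diff[OF star_algebra_axioms B.star_algebra_axioms h that] by simp
  have hC: "\<exists>y. B.tends (\<lambda>n. h (s n)) y" if s: "s \<in> cauchy_seqs A p" for s
  proof (rule B.cauchy_tends, rule B.cauchyI)
    note c = cauchy_closed[OF s]
    show "h (s n) \<in> carrier B" for n using star_hom_closed[OF h c] .
    fix e :: real assume "0 < e"
    then obtain N where "\<And>m n. m \<ge> N \<Longrightarrow> n \<ge> N \<Longrightarrow> p (s m \<ominus> s n) < e" using cauchyD[OF s] by blast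
    then show "\<exists>N. \<forall>m\<ge>N. \<forall>n\<ge>N. cnorm B (h (s m) \<ominus>\<^bsub>B\<^esub> h (s n)) \<le> e"
      using hd[OF c c] by (meson less_imp_le order_trans)
  qed
  define H where "H C = (THE y. \<forall>s\<in>C. B.tends (\<lambda>n. h (s n)) y)" for C
  have H: "B.tends (\<lambda>n. h (s n)) (H (seq_class A p s))" if s: "s \<in> cauchy_seqs A p" for s
  proof -
    obtain y where y: "B.tends (\<lambda>n. h (s n)) y" using hC[OF s] by blast
    have "B.tends (\<lambda>n. h (t n)) y" if t: "t \<in> seq_class A p s" for t
    proof (rule B.tendsI)
      note t' = seq_class_memD[OF t]
      have c: "s n \<in> carrier A" "t n \<in> carrier A" for n using s t' cauchy_closed by auto
      have hc: "h (s n) \<in> carrier B" "h (t n) \<in> carrier B" for n using c star_hom_closed[OF h] by auto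
      show "h (t n) \<in> carrier B" for n by (rule hc)
      show "y \<in> carrier B" using y by (simp add: B.tends_def)
      show "cnorm B (h (t n) \<ominus>\<^bsub>B\<^esub> y) \<le> p (t n \<ominus> s n) + cnorm B (h (s n) \<ominus>\<^bsub>B\<^esub> y)" for n
        using B.p_diff_triangle[OF hc(2) hc(1) \<open>y \<in> carrier B\<close>, of n n] hd[OF c(2) c(1), of n n] by linarith
      show "(\<lambda>n. p (t n \<ominus> s n) + cnorm B (h (s n) \<ominus>\<^bsub>B\<^esub> y)) \<longlonglongrightarrow> 0"
        using t' y tendsto_add_zero unfolding B.tends_def by blast
    qed
    then have "H (seq_class A p s) = y"
      unfolding H_def using seq_class_self[OF s] B.tends_unique y by (intro the_equality) auto
    then show ?thesis using y by simp
  qed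
  have eqI: "H (seq_class A p s) = y" if "s \<in> cauchy_seqs A p" "B.tends (\<lambda>n. h (s n)) y" for s y
    using B.tends_unique[OF H[OF that(1)] that(2)] .
  have hom: "H \<in> star_hom Compl B"
  proof (rule star_homI)
    fix C assume "C \<in> carrier Compl"
    then obtain s where s: "s \<in> cauchy_seqs A p" "C = seq_class A p s" by (auto simp: completion_carrier)
    note c = cauchy_closed[OF s(1)]
    show "H C \<in> carrier B" using H[OF s(1)] s(2) by (simp add: B.tends_def)
    show "H (scale Compl k C) = scale B k (H C)" for k
      unfolding s(2) star_hom_scale[OF seq_class_star_hom, symmetric, simplified, OF s(1)]
      by (rule eqI[OF cauchy_scale[OF s(1)]]) (use B.tends_scale[OF H[OF s(1)], of k] c star_hom_scale[OF h] in simp)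
    show "H (star Compl C) = star B (H C)"
      unfolding s(2) star_hom_star[OF seq_class_star_hom, symmetric, simplified, OF s(1)]
      by (rule eqI[OF cauchy_star[OF s(1)]]) (use B.tends_star[OF H[OF s(1)]] c star_hom_star[OF h] in simp)
    fix D assume "D \<in> carrier Compl"
    then obtain t where t: "t \<in> cauchy_seqs A p" "D = seq_class A p t" by (auto simp: completion_carrier)
    note d = cauchy_closed[OF t(1)]
    show "H (C \<otimes>\<^bsub>Compl\<^esub> D) = H C \<otimes>\<^bsub>B\<^esub> H D"
      unfolding s(2) t(2) star_hom_mult[OF seq_class_star_hom, symmetric, simplified, OF s(1) t(1)]
      by (rule eqI[OF cauchy_mult[OF s(1) t(1)]])
         (use B.tends_mult[OF H[OF s(1)] H[OF t(1)]] c d star_hom_mult[OF h] in simp)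
    show "H (C \<oplus>\<^bsub>Compl\<^esub> D) = H C \<oplus>\<^bsub>B\<^esub> H D"
      unfolding s(2) t(2) star_hom_add[OF seq_class_star_hom, symmetric, simplified, OF s(1) t(1)]
      by (rule eqI[OF cauchy_add[OF s(1) t(1)]])
         (use B.tends_add[OF H[OF s(1)] H[OF t(1)]] c d star_hom_add[OF h] in simp)
  next
    show "H \<one>\<^bsub>Compl\<^esub> = \<one>\<^bsub>B\<^esub>"
      unfolding star_hom_one[OF seq_class_star_hom, symmetric, simplified]
      by (rule eqI[OF cauchy_const]) (use B.tends_const star_hom_one[OF h] in auto)
  qed
  moreover have "H (compl_emb x) = h x" if "x \<in> carrier A" for x
    unfolding compl_emb_def
    by (rule eqI[OF cauchy_const[OF that]]) (use that star_hom_closed[OF h] in \<open>auto intro: B.tends_const\<close>)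
  ultimately show ?thesis using that by blast
qed

lemma completion_hom_eq:
  assumes B: "unital_cstar_algebra B" and f: "f \<in> star_hom Compl B" and g: "g \<in> star_hom Compl B"
    and eq: "\<And>x. x \<in> carrier A \<Longrightarrow> f (compl_emb x) = g (compl_emb x)" and C: "C \<in> carrier Compl"
  shows "f C = g C"
proof -
  interpret B: unital_cstar_algebra B by fact
  obtain s where s: "s \<in> cauchy_seqs A p" "C = seq_class A p s" using C by (auto simp: completion_carrier)
  have "B.tends (\<lambda>n. f (compl_emb (s n))) (f C)" "B.tends (\<lambda>n. g (compl_emb (s n))) (g C)"
    using star_hom_tends[OF completion_unital_cstar_algebra B f compl_emb_dense[OF s(1)]]
      star_hom_tends[OF completion_unital_cstar_algebra B g compl_emb_dense[OF s(1)]] s(2) by auto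
  then show ?thesis using B.tends_unique eq cauchy_closed[OF s(1)] by auto
qed

end

section \<open>Universal C*-algebras\<close>

text \<open>\<open>free_star\<close> relabels coefficients by \<open>Poly_Mapping.map_key\<close>,
  which is governed by its defining equation only for injective relabellings.\<close>

lemma inj_word_star: "inj word_star"
proof (rule injI)
  fix v w :: "'g word" assume "word_star v = word_star w"
  then have "map (apsnd Not) (letters v) = map (apsnd Not) (letters w)"
    by (simp add: word_star_def)
  moreover have "inj (apsnd Not :: 'g \<times> bool \<Rightarrow> 'g \<times> bool)"
    by (auto simp: inj_def)
  ultimately have "letters v = letters w" by (simp add: inj_map_eq_map)
  then show "v = w" by (cases v; cases w) auto
qed

lemma word_star_star [simp]: "word_star (word_star w) = w"
  by (cases w) (simp add: word_star_def rev_map comp_def apsnd_def map_prod_def split_beta)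

lemma word_star_add: "word_star (v + w) = word_star w + word_star v"
  by (simp add: word_star_def plus_word_def)

lemma fst_word_star: "fst ` set (letters (word_star w)) = fst ` set (letters w)"
  by (force simp: word_star_def)

lemma lookup_free_scale: "Poly_Mapping.lookup (free_scale c f) w = c * Poly_Mapping.lookup f w"
  by (simp add: free_scale_def Poly_Mapping.map.rep_eq when_def)

lemma lookup_free_star: "Poly_Mapping.lookup (free_star f) w = cnj (Poly_Mapping.lookup f (word_star w))"
  by (simp add: free_star_def Poly_Mapping.map.rep_eq Poly_Mapping.map_key.rep_eq[OF inj_word_star] when_def)

lemma free_scale_conv_mult: "free_scale c f = Poly_Mapping.single 0 c * f"
  unfolding free_scale_def by (rule mult_map_scale_conv_mult)

lemma free_poly_sum: "f = (\<Sum>w\<in>Poly_Mapping.keys f. Poly_Mapping.single w (Poly_Mapping.lookup f w))"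
  by (rule poly_mapping_eqI) (auto simp: lookup_sum lookup_single when_def sum.delta in_keys_iff)

text \<open>Reduces identities that are additive in a polynomial to a single word with a
  coefficient.\<close>

lemma free_poly_induct [case_names single add]:
  assumes "\<And>w c. P (Poly_Mapping.single w c)" and "\<And>f g. P f \<Longrightarrow> P g \<Longrightarrow> P (f + g)"
  shows "P (f :: 'g free_poly)"
proof -
  have "P (\<Sum>w\<in>K. Poly_Mapping.single w (Poly_Mapping.lookup f w))" if "finite K" for K
    using that
  proof (induction K rule: finite_induct)
    case empty
    show ?case using assms(1)[of 0 0] by simp
  qed (simp add: assms)
  from this[of "Poly_Mapping.keys f"] show ?thesis by (simp flip: free_poly_sum)
qed

text \<open>Scalars are coefficients of the empty word, and these are central.\<close>

lemma free_scale_right: "f * free_scale c g = free_scale c (f * g)"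
proof -
  have "f * Poly_Mapping.single 0 c = Poly_Mapping.single 0 c * f"
    by (induction f rule: free_poly_induct) (simp_all add: mult_single algebra_simps)
  then show ?thesis by (simp add: free_scale_conv_mult flip: mult.assoc)
qed

lemma free_scale_left: "free_scale c f * g = free_scale c (f * g)"
  by (simp add: free_scale_conv_mult mult.assoc)

lemma free_scale_add_right: "free_scale c (f + g) = free_scale c f + free_scale c g"
  by (simp add: free_scale_conv_mult distrib_left)

lemma free_scale_add_left: "free_scale (c + d) f = free_scale c f + free_scale d f"
  by (simp add: free_scale_conv_mult single_add distrib_right)

lemma letters_zero [simp]: "letters 0 = []"
  by (simp add: zero_word_def)

lemma free_star_add: "free_star (f + g) = free_star f + free_star g"
  by (rule poly_mapping_eqI) (simp add: lookup_free_star lookup_add)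

lemma free_star_single: "free_star (Poly_Mapping.single w c) = Poly_Mapping.single (word_star w) (cnj c)"
  by (rule poly_mapping_eqI) (auto simp: lookup_free_star lookup_single when_def)

lemma free_star_mult: "free_star (f * g) = free_star g * free_star f"
proof (induction f rule: free_poly_induct)
  case (single w c)
  show ?case
    by (induction g rule: free_poly_induct)
       (simp_all add: mult_single free_star_single word_star_add free_star_add algebra_simps)
qed (simp add: free_star_add algebra_simps)

lemma free_star_alg_simps [simp]:
  "mult (free_star_alg G) = (*)" "one (free_star_alg G) = 1" "zero (free_star_alg G) = 0"
  "add (free_star_alg G) = (+)" "scale (free_star_alg G) = free_scale" "star (free_star_alg G) = free_star"
  by (simp_all add: free_star_alg_def)

lemma free_carrier:
  "f \<in> carrier (free_star_alg G) \<longleftrightarrow> (\<forall>w\<in>Poly_Mapping.keys f. fst ` set (letters w) \<subseteq> G)"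
  by (simp add: free_star_alg_def)

lemma free_carrier_add:
  "f \<in> carrier (free_star_alg G) \<Longrightarrow> g \<in> carrier (free_star_alg G) \<Longrightarrow> f + g \<in> carrier (free_star_alg G)"
  unfolding free_carrier by (metis Poly_Mapping.keys_add UnE subsetD)

lemma free_carrier_minus: "f \<in> carrier (free_star_alg G) \<Longrightarrow> - f \<in> carrier (free_star_alg G)"
  by (simp add: free_carrier)

lemma free_carrier_diff:
  "f \<in> carrier (free_star_alg G) \<Longrightarrow> g \<in> carrier (free_star_alg G) \<Longrightarrow> f - g \<in> carrier (free_star_alg G)"
  unfolding free_carrier by (metis keys_diff UnE subsetD)

lemma free_carrier_mult:
  assumes "f \<in> carrier (free_star_alg G)" "g \<in> carrier (free_star_alg G)"
  shows "f * g \<in> carrier (free_star_alg G)"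
  unfolding free_carrier
proof
  fix w assume "w \<in> Poly_Mapping.keys (f * g)"
  then obtain a b where "w = a + b" "a \<in> Poly_Mapping.keys f" "b \<in> Poly_Mapping.keys g"
    using keys_mult by blast
  then show "fst ` set (letters w) \<subseteq> G" using assms by (auto simp: free_carrier plus_word_def)
qed

lemma free_carrier_scale: "f \<in> carrier (free_star_alg G) \<Longrightarrow> free_scale c f \<in> carrier (free_star_alg G)"
  by (auto simp: free_carrier in_keys_iff lookup_free_scale)

lemma free_carrier_star:
  assumes "f \<in> carrier (free_star_alg G)" shows "free_star f \<in> carrier (free_star_alg G)"
  unfolding free_carrier
proof
  fix w assume "w \<in> Poly_Mapping.keys (free_star f)"
  then have "word_star w \<in> Poly_Mapping.keys f" by (simp add: in_keys_iff lookup_free_star)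
  then have "fst ` set (letters (word_star w)) \<subseteq> G" using assms unfolding free_carrier by blast
  then show "fst ` set (letters w) \<subseteq> G" by (simp only: fst_word_star)
qed

lemma free_carrier_one: "1 \<in> carrier (free_star_alg G)"
  by (simp add: free_carrier zero_word_def)

lemma free_carrier_zero: "0 \<in> carrier (free_star_alg G)"
  by (simp add: free_carrier)

lemma free_carrier_gen: "gen g \<in> carrier (free_star_alg G) \<longleftrightarrow> g \<in> G"
  by (simp add: free_carrier gen_def)

lemma free_carrier_sum:
  "(\<And>i. i \<in> I \<Longrightarrow> f i \<in> carrier (free_star_alg G)) \<Longrightarrow> (\<Sum>i\<in>I. f i) \<in> carrier (free_star_alg G)"
  by (induction I rule: infinite_finite_induct) (auto simp: free_carrier_zero free_carrier_add)

lemmas free_carrier_intros = free_carrier_add free_carrier_minus free_carrier_diff free_carrier_mult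
  free_carrier_scale free_carrier_star free_carrier_one free_carrier_zero free_carrier_sum

lemma free_star_algebra: "star_algebra (free_star_alg G)"
proof (intro star_algebra.intro star_algebra_axioms.intro ringI abelian_groupI Group.monoidI)
  show "\<exists>y\<in>carrier (free_star_alg G). y \<oplus>\<^bsub>free_star_alg G\<^esub> x = \<zero>\<^bsub>free_star_alg G\<^esub>"
    if "x \<in> carrier (free_star_alg G)" for x
    using that by (intro bexI[of _ "- x"]) (auto simp: free_carrier_minus)
  show "star (free_star_alg G) (star (free_star_alg G) x) = x" for x
    by (simp add: poly_mapping_eqI lookup_free_star)
  show "star (free_star_alg G) (scale (free_star_alg G) c x) =
      scale (free_star_alg G) (cnj c) (star (free_star_alg G) x)" for c x
    by (simp add: poly_mapping_eqI lookup_free_star lookup_free_scale)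
  show "scale (free_star_alg G) c (scale (free_star_alg G) d x) = scale (free_star_alg G) (c * d) x" for c d x
    by (simp add: poly_mapping_eqI lookup_free_scale mult.assoc)
  show "scale (free_star_alg G) 1 x = x" for x
    by (simp add: poly_mapping_eqI lookup_free_scale)
qed (simp_all add: free_carrier_intros algebra_simps free_scale_right free_scale_left free_star_add
      free_star_mult free_scale_add_left free_scale_add_right)

lemma free_minus: "x \<in> carrier (free_star_alg G) \<Longrightarrow> \<ominus>\<^bsub>free_star_alg G\<^esub> x = - x"
proof -
  interpret star_algebra "free_star_alg G" by (rule free_star_algebra)
  show "x \<in> carrier (free_star_alg G) \<Longrightarrow> \<ominus>\<^bsub>free_star_alg G\<^esub> x = - x"
    by (rule minus_equality) (auto simp: free_carrier_minus)
qed

lemma free_diff: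
  "y \<in> carrier (free_star_alg G) \<Longrightarrow> x \<ominus>\<^bsub>free_star_alg G\<^esub> y = x - y"
  by (simp add: a_minus_def free_minus)

section \<open>Evaluation of free polynomials\<close>

context star_algebra
begin

primrec eval_letters :: "('g \<Rightarrow> 'a) \<Rightarrow> ('g \<times> bool) list \<Rightarrow> 'a" where
  "eval_letters h [] = \<one>"
| "eval_letters h (l # ls) = (if snd l then star A (h (fst l)) else h (fst l)) \<otimes> eval_letters h ls"

definition eval_free :: "('g \<Rightarrow> 'a) \<Rightarrow> 'g free_poly \<Rightarrow> 'a" where
  "eval_free h f = (\<Oplus>w\<in>Poly_Mapping.keys f. scale A (Poly_Mapping.lookup f w) (eval_letters h (letters w)))"

context
  fixes h :: "'g \<Rightarrow> 'a" assumes h: "\<And>g. h g \<in> carrier A"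
begin

lemma eval_letters_closed [simp]: "eval_letters h ls \<in> carrier A"
  by (induction ls) (auto simp: h star_closed)

lemma eval_letters_append: "eval_letters h (ls @ ms) = eval_letters h ls \<otimes> eval_letters h ms"
  by (induction ls) (auto simp: h star_closed m_assoc)

lemma eval_letters_star: "eval_letters h (rev (map (apsnd Not) ls)) = star A (eval_letters h ls)"
  by (induction ls) (auto simp: eval_letters_append h star_closed star_mult star_star)

text \<open>Cancellation may shrink the support of a sum, so additivity is proved over a common
  larger index set.\<close>

lemma eval_free_superset:
  assumes "finite K" "Poly_Mapping.keys f \<subseteq> K"
  shows "eval_free h f = (\<Oplus>w\<in>K. scale A (Poly_Mapping.lookup f w) (eval_letters h (letters w)))"
  unfolding eval_free_def
  by (rule add.finprod_mono_neutral_cong_left) (use assms in \<open>auto simp: scale_closed in_keys_iff\<close>)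

lemma eval_free_closed [simp]: "eval_free h f \<in> carrier A"
  unfolding eval_free_def by (rule finsum_closed) (auto simp: scale_closed)

lemma eval_free_add: "eval_free h (f + g) = eval_free h f \<oplus> eval_free h g"
proof -
  let ?K = "Poly_Mapping.keys f \<union> Poly_Mapping.keys g"
  have K: "finite ?K" "Poly_Mapping.keys f \<subseteq> ?K" "Poly_Mapping.keys g \<subseteq> ?K" by auto
  show ?thesis
    using eval_free_superset[OF K(1,2)] eval_free_superset[OF K(1,3)]
      eval_free_superset[OF K(1) Poly_Mapping.keys_add]
    by (simp add: lookup_add scale_add_left finsum_addf scale_closed)
qed

lemma eval_free_single: "eval_free h (Poly_Mapping.single w c) = scale A c (eval_letters h (letters w))"
  by (subst eval_free_superset[of "{w}"]) (auto simp: scale_closed)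

lemma eval_free_mult: "eval_free h (f * g) = eval_free h f \<otimes> eval_free h g"
proof (induction f rule: free_poly_induct)
  case (single w c)
  show ?case
    by (induction g rule: free_poly_induct)
       (simp_all add: mult_single eval_free_single eval_free_add distrib_left r_distr plus_word_def
          eval_letters_append scale_mult_left scale_mult_right scale_scale mult.commute scale_closed)
qed (simp add: eval_free_add distrib_right l_distr)

lemma eval_free_scale: "eval_free h (free_scale c f) = scale A c (eval_free h f)"
  by (simp add: free_scale_conv_mult eval_free_mult eval_free_single scale_mult_left)

lemma eval_free_star: "eval_free h (free_star f) = star A (eval_free h f)"
  by (induction f rule: free_poly_induct)
     (simp_all add: free_star_single free_star_add eval_free_single eval_free_add star_add star_scale
        word_star_def eval_letters_star)

lemma eval_free_gen: "eval_free h (gen g) = h g"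
  by (simp add: gen_def eval_free_single scale_one h)

lemma eval_free_star_hom: "eval_free h \<in> star_hom (free_star_alg G) A"
proof (rule star_homI)
  show "eval_free h \<one>\<^bsub>free_star_alg G\<^esub> = \<one>"
    using eval_free_single[of 0 1] by (simp add: scale_one)
qed (simp_all add: eval_free_mult eval_free_add eval_free_scale eval_free_star)

end

lemma free_eval_exists:
  assumes "\<And>g. g \<in> G \<Longrightarrow> h g \<in> carrier A"
  obtains e where "e \<in> star_hom (free_star_alg G) A" "\<And>g. g \<in> G \<Longrightarrow> e (gen g) = h g"
proof -
  \<comment> \<open>The value zero outside G only makes the evaluation total; polynomials in the
    carrier contain no such letters.\<close>
  let ?h = "\<lambda>g. if g \<in> G then h g else \<zero>"
  have h: "?h g \<in> carrier A" for g using assms by simp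
  show ?thesis
    by (rule that[of "eval_free ?h"]) (simp_all only: eval_free_star_hom[of ?h, OF h] eval_free_gen[of ?h, OF h] if_True)
qed

end

locale free_hom = star_algebra A for A :: "('a, 'm) star_alg_scheme" (structure) +
  fixes G :: "'g set" and e
  assumes hom: "e \<in> star_hom (free_star_alg G) A"
begin

lemma e_closed: "f \<in> carrier (free_star_alg G) \<Longrightarrow> e f \<in> carrier A"
  by (rule star_hom_closed[OF hom])

lemma e_add: "f \<in> carrier (free_star_alg G) \<Longrightarrow> g \<in> carrier (free_star_alg G) \<Longrightarrow> e (f + g) = e f \<oplus> e g"
  using star_hom_add[OF hom] by simp

lemma e_mult: "f \<in> carrier (free_star_alg G) \<Longrightarrow> g \<in> carrier (free_star_alg G) \<Longrightarrow> e (f * g) = e f \<otimes> e g"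
  using star_hom_mult[OF hom] by simp

lemma e_diff: "f \<in> carrier (free_star_alg G) \<Longrightarrow> g \<in> carrier (free_star_alg G) \<Longrightarrow> e (f - g) = e f \<ominus> e g"
  using star_hom_diff[OF free_star_algebra star_algebra_axioms hom, of f g] by (simp add: free_diff)

lemma e_scale: "f \<in> carrier (free_star_alg G) \<Longrightarrow> e (free_scale c f) = scale A c (e f)"
  using star_hom_scale[OF hom] by simp

lemma e_star: "f \<in> carrier (free_star_alg G) \<Longrightarrow> e (free_star f) = star A (e f)"
  using star_hom_star[OF hom] by simp

lemma e_one: "e 1 = \<one>"
  using star_hom_one[OF hom] by simp

lemma e_zero: "e 0 = \<zero>"
  using star_hom_zero[OF free_star_algebra star_algebra_axioms hom] by simp

lemma e_sum:
  "finite I \<Longrightarrow> (\<And>i. i \<in> I \<Longrightarrow> f i \<in> carrier (free_star_alg G)) \<Longrightarrow> e (\<Sum>i\<in>I. f i) = (\<Oplus>i\<in>I. e (f i))"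
  by (induction I rule: finite_induct) (auto simp: e_zero e_add e_closed free_carrier_sum Pi_def)

lemmas e_simps = e_add e_mult e_diff e_scale e_star e_one e_zero e_sum

lemma free_hom_eq:
  assumes e': "free_hom A G e'" and eq: "\<And>g. g \<in> G \<Longrightarrow> e (gen g) = e' (gen g)"
    and f: "f \<in> carrier (free_star_alg G)"
  shows "e f = e' f"
proof -
  interpret e': free_hom A G e' by fact
  have letters: "Poly_Mapping.single (Word ls) 1 \<in> carrier (free_star_alg G) \<and>
      e (Poly_Mapping.single (Word ls) 1) = e' (Poly_Mapping.single (Word ls) 1)"
    if "fst ` set ls \<subseteq> G" for ls
    using that
  proof (induction ls)
    case Nil
    then show ?case using e_one e'.e_one free_carrier_one
      by (simp add: zero_word_def[symmetric] flip: Poly_Mapping.single_one)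
  next
    case (Cons l ls)
    obtain g b where l: "l = (g, b)" by fastforce
    have g: "g \<in> G" using Cons l by simp
    let ?l = "Poly_Mapping.single (Word [l]) 1 :: 'g free_poly"
    have "?l = (if b then free_star (gen g) else gen g)"
      by (simp add: l gen_def free_star_single word_star_def)
    then have "?l \<in> carrier (free_star_alg G) \<and> e ?l = e' ?l"
      using g eq by (simp add: free_carrier_gen free_carrier_star e_star e'.e_star)
    moreover have "Poly_Mapping.single (Word (l # ls)) 1 = ?l * Poly_Mapping.single (Word ls) 1"
      by (simp add: mult_single plus_word_def)
    ultimately show ?case using Cons by (simp add: free_carrier_mult e_mult e'.e_mult)
  qed
  have single: "Poly_Mapping.single w c \<in> carrier (free_star_alg G) \<and>
      e (Poly_Mapping.single w c) = e' (Poly_Mapping.single w c)"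
    if "fst ` set (letters w) \<subseteq> G" for w c
  proof -
    have "Poly_Mapping.single w c = free_scale c (Poly_Mapping.single (Word (letters w)) 1)"
      by (simp add: free_scale_conv_mult mult_single)
    then show ?thesis using letters[OF that] by (simp add: free_carrier_scale e_scale e'.e_scale)
  qed
  have mem: "fst ` set (letters w) \<subseteq> G" if "w \<in> Poly_Mapping.keys f" for w
    using f that by (simp add: free_carrier)
  have "e (\<Sum>w\<in>Poly_Mapping.keys f. Poly_Mapping.single w (Poly_Mapping.lookup f w)) =
      e' (\<Sum>w\<in>Poly_Mapping.keys f. Poly_Mapping.single w (Poly_Mapping.lookup f w))"
    using single[OF mem] by (simp add: e_sum e'.e_sum cong: finsum_cong)
       (intro finsum_cong, auto simp: e'.e_closed)
  then show ?thesis by (simp flip: free_poly_sum)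
qed

end

section \<open>Presentations and the universal property\<close>

definition respects_relations :: "'g set \<Rightarrow> 'g free_poly set \<Rightarrow> ('g free_poly \<Rightarrow> real) \<Rightarrow> bool" where
  "respects_relations G R p \<longleftrightarrow> cstar_seminorm (free_star_alg G) p \<and> (\<forall>r\<in>R. p r = 0)"

text \<open>Boundedness on generators is exactly what keeps the supremum in
  \<open>universal_seminorm\<close> finite; the supremum of an unbounded set of reals carries no
  information.\<close>

locale presentation =
  fixes G :: "'g set" and R :: "'g free_poly set"
  assumes relations_closed: "R \<subseteq> carrier (free_star_alg G)"
    and gens_bounded: "g \<in> G \<Longrightarrow> \<exists>B. \<forall>p. respects_relations G R p \<longrightarrow> p (gen g) \<le> B"
begin

abbreviation "F \<equiv> free_star_alg G"

text \<open>Bounds multiply along words, the adjoint letters being covered by isometry of the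
  adjoint, and add up along linear combinations.\<close>

lemma polys_bounded:
  assumes f: "f \<in> carrier F" shows "\<exists>B. \<forall>p. respects_relations G R p \<longrightarrow> p f \<le> B"
proof -
  have sn: "seminormed_star_algebra F p" if "respects_relations G R p" for p
    using that unfolding respects_relations_def by (intro star_algebra.seminormed[OF free_star_algebra]) simp
  have letters: "Poly_Mapping.single (Word ls) 1 \<in> carrier F \<and>
      (\<exists>B\<ge>0. \<forall>p. respects_relations G R p \<longrightarrow> p (Poly_Mapping.single (Word ls) 1) \<le> B)"
    if "fst ` set ls \<subseteq> G" for ls
    using that
  proof (induction ls)
    case Nil
    have "p 1 \<le> 1" if "respects_relations G R p" for p
      using seminormed_star_algebra.p_one_le[OF sn[OF that]] by simp
    then show ?case using free_carrier_one[of G]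
      by (auto simp: zero_word_def[symmetric] simp flip: Poly_Mapping.single_one intro!: exI[of _ 1])
  next
    case (Cons l ls)
    obtain g b where l: "l = (g, b)" by fastforce
    have g: "g \<in> G" using Cons l by simp
    obtain C where C: "\<And>p. respects_relations G R p \<Longrightarrow> p (gen g) \<le> C" using gens_bounded[OF g] by blast
    obtain B where B: "0 \<le> B" "\<And>p. respects_relations G R p \<Longrightarrow> p (Poly_Mapping.single (Word ls) 1) \<le> B"
      and lc: "Poly_Mapping.single (Word ls) 1 \<in> carrier F"
      using Cons by auto
    let ?l = "Poly_Mapping.single (Word [l]) 1 :: 'g free_poly"
    have eq: "?l = (if b then free_star (gen g) else gen g)"
      by (simp add: l gen_def free_star_single word_star_def)
    have c: "?l \<in> carrier F" unfolding eq using g by (simp add: free_carrier_gen free_carrier_star)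
    have s: "Poly_Mapping.single (Word (l # ls)) 1 = ?l * Poly_Mapping.single (Word ls) 1"
      by (simp add: mult_single plus_word_def)
    \<comment> \<open>The maximum with 0 makes the bound of the letter nonnegative, so that bounds
      may be multiplied.\<close>
    have "p (?l * Poly_Mapping.single (Word ls) 1) \<le> max 0 C * B" if p: "respects_relations G R p" for p
    proof -
      interpret P: seminormed_star_algebra F p by (rule sn[OF p])
      have "p ?l \<le> max 0 C"
        unfolding eq using C[OF p] g P.p_star[of "gen g"] by (auto simp: free_carrier_gen)
      then show ?thesis
        using P.p_mult[OF c lc] mult_mono[of "p ?l" "max 0 C", OF _ B(2)[OF p]] P.p_nonneg[OF lc] by simp
    qed
    then show ?case unfolding s using c lc B(1) by (auto simp: free_carrier_mult intro!: exI[of _ "max 0 C * B"])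
  qed
  have mem: "fst ` set (letters w) \<subseteq> G" if "w \<in> Poly_Mapping.keys f" for w
    using f that by (simp add: free_carrier)
  have "\<forall>w\<in>Poly_Mapping.keys f. \<exists>B. \<forall>p. respects_relations G R p \<longrightarrow> p (Poly_Mapping.single w 1) \<le> B"
    using letters[OF mem] by (metis word.collapse)
  then obtain B where B: "\<And>w p. w \<in> Poly_Mapping.keys f \<Longrightarrow> respects_relations G R p \<Longrightarrow>
      p (Poly_Mapping.single w 1) \<le> B w" by metis
  have "p f \<le> (\<Sum>w\<in>Poly_Mapping.keys f. cmod (Poly_Mapping.lookup f w) * B w)" if p: "respects_relations G R p" for p
  proof -
    interpret P: seminormed_star_algebra F p by (rule sn[OF p])
    have sc: "Poly_Mapping.single w 1 \<in> carrier F" if "w \<in> Poly_Mapping.keys f" for w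
      using letters[OF mem[OF that]] by simp
    have s: "p (\<Sum>w\<in>K. free_scale (c w) (Poly_Mapping.single w 1)) \<le> (\<Sum>w\<in>K. cmod (c w) * B w)"
      if "finite K" "K \<subseteq> Poly_Mapping.keys f" for K c
      using that
    proof (induction K rule: finite_induct)
      case (insert w K)
      let ?a = "free_scale (c w) (Poly_Mapping.single w 1)"
      and ?b = "\<Sum>w\<in>K. free_scale (c w) (Poly_Mapping.single w 1)"
      have "p (?a + ?b) \<le> p ?a + p ?b"
        using P.p_add[of ?a ?b] insert sc by (auto intro!: free_carrier_scale free_carrier_sum)
      moreover have "p ?a \<le> cmod (c w) * B w"
        using P.p_scale[of "Poly_Mapping.single w 1" "c w"] B[of w p] p sc insert by (simp add: mult_left_mono)
      ultimately show ?case using insert by simp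
    qed (use P.p_zero in simp)
    have "f = (\<Sum>w\<in>Poly_Mapping.keys f. free_scale (Poly_Mapping.lookup f w) (Poly_Mapping.single w 1))"
      by (subst free_poly_sum) (simp add: free_scale_conv_mult mult_single)
    then show ?thesis using s[of "Poly_Mapping.keys f" "Poly_Mapping.lookup f"] by simp
  qed
  then show ?thesis by blast
qed

abbreviation "univ_norm \<equiv> universal_seminorm F R"

lemma univ_norm_eq: "univ_norm f = (SUP p\<in>{p. respects_relations G R p}. p f)"
  by (simp add: universal_seminorm_def respects_relations_def)

lemma zero_respects: "respects_relations G R (\<lambda>_. 0)"
  by (simp add: respects_relations_def cstar_seminorm_def)

lemma bdd: "f \<in> carrier F \<Longrightarrow> bdd_above ((\<lambda>p. p f) ` {p. respects_relations G R p})"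
  using polys_bounded[of f] by (auto simp: bdd_above_def)

lemma le_univ_norm: "f \<in> carrier F \<Longrightarrow> respects_relations G R p \<Longrightarrow> p f \<le> univ_norm f"
  unfolding univ_norm_eq by (rule cSUP_upper[OF _ bdd]) auto

lemma univ_norm_le:
  "(\<And>p. respects_relations G R p \<Longrightarrow> p f \<le> B) \<Longrightarrow> univ_norm f \<le> B"
  unfolding univ_norm_eq using zero_respects by (intro cSUP_least) auto

lemma univ_norm_nonneg: "f \<in> carrier F \<Longrightarrow> 0 \<le> univ_norm f"
  using le_univ_norm[OF _ zero_respects] .

text \<open>Every axiom passes to a pointwise finite supremum. The C*-identity survives because
  squaring is monotone on nonnegative reals.\<close>

lemma univ_norm_seminorm: "cstar_seminorm F univ_norm"
proof -
  interpret star_algebra F by (rule free_star_algebra)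
  have sn: "seminormed_star_algebra F p" if "respects_relations G R p" for p
    using that seminormed by (simp add: respects_relations_def)
  have nonneg: "0 \<le> p f" if "respects_relations G R p" "f \<in> carrier F" for p f
    using seminormed_star_algebra.p_nonneg[OF sn] that by blast
  show ?thesis
    unfolding cstar_seminorm_def
  proof (intro conjI ballI allI)
    fix f assume f: "f \<in> carrier F"
    show "0 \<le> univ_norm f" using f by (rule univ_norm_nonneg)
    show "univ_norm (scale F c f) = cmod c * univ_norm f" for c
    proof (rule antisym)
      show "univ_norm (scale F c f) \<le> cmod c * univ_norm f"
      proof (rule univ_norm_le)
        fix p assume p: "respects_relations G R p"
        show "p (scale F c f) \<le> cmod c * univ_norm f"
          unfolding seminormed_star_algebra.p_scale[OF sn[OF p] f] using le_univ_norm[OF f p]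
          by (intro mult_left_mono) auto
      qed
      show "cmod c * univ_norm f \<le> univ_norm (scale F c f)"
      proof (cases "c = 0")
        case False
        have "univ_norm f \<le> univ_norm (scale F c f) / cmod c"
        proof (rule univ_norm_le)
          fix p assume p: "respects_relations G R p"
          show "p f \<le> univ_norm (scale F c f) / cmod c"
            using seminormed_star_algebra.p_scale[OF sn[OF p] f, of c] le_univ_norm[OF scale_closed[OF f] p, of c] False
            by (simp add: field_simps)
        qed
        then show ?thesis using False by (simp add: field_simps)
      qed (use univ_norm_nonneg[OF scale_closed[OF f]] in simp)
    qed
    show "univ_norm (star F f \<otimes>\<^bsub>F\<^esub> f) = (univ_norm f)\<^sup>2"
    proof (rule antisym)
      show "univ_norm (star F f \<otimes>\<^bsub>F\<^esub> f) \<le> (univ_norm f)\<^sup>2"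
      proof (rule univ_norm_le)
        fix p assume p: "respects_relations G R p"
        show "p (star F f \<otimes>\<^bsub>F\<^esub> f) \<le> (univ_norm f)\<^sup>2"
          unfolding seminormed_star_algebra.p_cstar[OF sn[OF p] f]
          using le_univ_norm[OF f p] nonneg[OF p f] by (rule power_mono)
      qed
      have c: "star F f \<otimes>\<^bsub>F\<^esub> f \<in> carrier F" using f star_closed m_closed by blast
      have "univ_norm f \<le> sqrt (univ_norm (star F f \<otimes>\<^bsub>F\<^esub> f))"
      proof (rule univ_norm_le)
        fix p assume p: "respects_relations G R p"
        show "p f \<le> sqrt (univ_norm (star F f \<otimes>\<^bsub>F\<^esub> f))"
          using le_univ_norm[OF c p] seminormed_star_algebra.p_cstar[OF sn[OF p] f]
          by (intro real_le_rsqrt) simp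
      qed
      then show "(univ_norm f)\<^sup>2 \<le> univ_norm (star F f \<otimes>\<^bsub>F\<^esub> f)"
        using univ_norm_nonneg[OF f] univ_norm_nonneg[OF c] by (metis power_mono real_sqrt_pow2)
    qed
    fix g assume g: "g \<in> carrier F"
    show "univ_norm (f \<oplus>\<^bsub>F\<^esub> g) \<le> univ_norm f + univ_norm g"
      using seminormed_star_algebra.p_add[OF sn f g] le_univ_norm[OF f] le_univ_norm[OF g]
      by (intro univ_norm_le) (meson add_mono order_trans)
    show "univ_norm (f \<otimes>\<^bsub>F\<^esub> g) \<le> univ_norm f * univ_norm g"
      using seminormed_star_algebra.p_mult[OF sn f g] le_univ_norm[OF f] le_univ_norm[OF g] nonneg[OF _ f] nonneg[OF _ g]
        univ_norm_nonneg[OF f]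
      by (intro univ_norm_le) (meson mult_mono order_trans)
  qed
qed

sublocale free: seminormed_star_algebra F univ_norm
  by (rule star_algebra.seminormed[OF free_star_algebra univ_norm_seminorm])

abbreviation "U \<equiv> universal_cstar G R"

lemma universal_eq: "U = completion F univ_norm"
  by (simp add: universal_cstar_def)

theorem universal_unital_cstar_algebra: "unital_cstar_algebra U"
  unfolding universal_eq by (rule free.completion_unital_cstar_algebra)

lemma universal_gen_eq: "universal_gen G R g = free.compl_emb (gen g)"
  by (simp add: universal_gen_def free.compl_emb_def)

lemma universal_emb: "free.compl_emb \<in> star_hom F U"
  unfolding universal_eq by (rule free.compl_emb_star_hom)

lemma universal_relations: assumes r: "r \<in> R" shows "free.compl_emb r = \<zero>\<^bsub>U\<^esub>"
proof -
  interpret U: unital_cstar_algebra U by (rule universal_unital_cstar_algebra)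
  have rc: "r \<in> carrier F" using relations_closed r by blast
  have "univ_norm r \<le> 0" using r by (intro univ_norm_le) (simp add: respects_relations_def)
  then have "univ_norm r = 0" using univ_norm_nonneg[OF rc] by simp
  then have "cnorm U (free.compl_emb r) = 0"
    using free.compl_emb_norm[OF rc] by (simp add: universal_eq)
  then show ?thesis using U.definite star_hom_closed[OF universal_emb rc] by blast
qed

text \<open>The norm of B pulled back along e is one of the seminorms in the supremum, so e is
  dominated by the universal seminorm and extends to the completion. Since the supremum runs over
  seminorms and not over algebras, B may live over any type.\<close>

theorem universal_hom_exists:
  assumes B: "unital_cstar_algebra B" and e: "e \<in> star_hom F B" and rel: "\<And>r. r \<in> R \<Longrightarrow> e r = \<zero>\<^bsub>B\<^esub>"
  obtains H where "H \<in> star_hom U B" "\<And>g. g \<in> G \<Longrightarrow> H (universal_gen G R g) = e (gen g)"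
proof -
  interpret B: unital_cstar_algebra B by fact
  have "respects_relations G R (\<lambda>f. cnorm B (e f))"
    using cstar_seminorm_pullback[OF free_star_algebra B.star_algebra_axioms e B.seminorm] rel
    by (simp add: respects_relations_def)
  then have "cnorm B (e f) \<le> univ_norm f" if "f \<in> carrier F" for f
    using le_univ_norm[OF that] by blast
  from free.completion_extension[OF B e this] obtain H where
    H: "H \<in> star_hom U B" "\<And>f. f \<in> carrier F \<Longrightarrow> H (free.compl_emb f) = e f"
    unfolding universal_eq by blast
  show ?thesis by (rule that[OF H(1)]) (simp add: universal_gen_eq free_carrier_gen H(2))
qed

theorem universal_hom_eq:
  assumes B: "unital_cstar_algebra B" and f: "f \<in> star_hom U B" and g: "g \<in> star_hom U B"
    and eq: "\<And>x. x \<in> G \<Longrightarrow> f (universal_gen G R x) = g (universal_gen G R x)" and C: "C \<in> carrier U"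
  shows "f C = g C"
proof -
  interpret B: unital_cstar_algebra B by fact
  have h: "free_hom B G (f \<circ> free.compl_emb)" "free_hom B G (g \<circ> free.compl_emb)"
    using star_hom_comp[OF universal_emb f] star_hom_comp[OF universal_emb g]
    by (auto intro!: free_hom.intro B.star_algebra_axioms free_hom_axioms.intro)
  have "f (free.compl_emb x) = g (free.compl_emb x)" if "x \<in> carrier F" for x
    using free_hom.free_hom_eq[OF h _ that] eq by (simp add: universal_gen_eq)
  then show ?thesis
    using free.completion_hom_eq[OF B f[unfolded universal_eq] g[unfolded universal_eq]] C
    by (simp add: universal_eq)
qed

end

section \<open>Magic unitaries\<close>

context abelian_monoid
begin

lemma finsum_swap:
  assumes "finite I" "finite J" "\<And>i j. i \<in> I \<Longrightarrow> j \<in> J \<Longrightarrow> f i j \<in> carrier G"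
  shows "(\<Oplus>i\<in>I. \<Oplus>j\<in>J. f i j) = (\<Oplus>j\<in>J. \<Oplus>i\<in>I. f i j)"
  using assms(1,3)
proof (induction I rule: finite_induct)
  case (insert i I)
  then show ?case
    using finsum_addf[of "f i" J "\<lambda>j. \<Oplus>i\<in>I. f i j"]
    by (simp add: Pi_def finsum_closed cong: finsum_cong)
qed simp

lemma finsum_filter:
  assumes "finite I" "\<And>i. i \<in> I \<Longrightarrow> f i \<in> carrier G"
  shows "(\<Oplus>i\<in>{i\<in>I. P i}. f i) = (\<Oplus>i\<in>I. if P i then f i else \<zero>)"
  by (rule add.finprod_mono_neutral_cong_left) (use assms in auto)

lemma finsum_delta:
  assumes "finite I" "k \<in> I" "\<And>i. i \<in> I \<Longrightarrow> f i \<in> carrier G"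
  shows "(\<Oplus>i\<in>I. if i = k then f i else \<zero>) = f k"
  using finsum_singleton[of k I f] assms by (simp add: Pi_def eq_commute)

lemma finsum_times:
  assumes "finite I" "finite J" "\<And>i j. i \<in> I \<Longrightarrow> j \<in> J \<Longrightarrow> f (i, j) \<in> carrier G"
  shows "(\<Oplus>x\<in>I \<times> J. f x) = (\<Oplus>i\<in>I. \<Oplus>j\<in>J. f (i, j))"
  using assms(1,3)
proof (induction I rule: finite_induct)
  case (insert i I)
  have "insert i I \<times> J = (Pair i ` J) \<union> I \<times> J" by auto
  moreover have "(\<Oplus>x\<in>(Pair i ` J) \<union> I \<times> J. f x) = (\<Oplus>x\<in>Pair i ` J. f x) \<oplus> (\<Oplus>x\<in>I \<times> J. f x)"
    using insert assms(2) by (intro finsum_Un_disjoint) auto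
  moreover have "(\<Oplus>x\<in>Pair i ` J. f x) = (\<Oplus>j\<in>J. f (i, j))"
    using insert by (intro finsum_reindex) (auto simp: inj_on_def)
  ultimately show ?case using insert by (simp add: Pi_def finsum_closed)
qed simp

lemma finsum_cong_mem: "(\<And>i. i \<in> I \<Longrightarrow> f i = g i) \<Longrightarrow> (\<And>i. i \<in> I \<Longrightarrow> g i \<in> carrier G) \<Longrightarrow>
    (\<Oplus>i\<in>I. f i) = (\<Oplus>i\<in>I. g i)"
  by (rule finsum_cong') auto

lemma finsum_nonzeroE:
  assumes "(\<Oplus>i\<in>I. f i) \<noteq> \<zero>" obtains i where "i \<in> I" "f i \<noteq> \<zero>"
proof (rule ccontr)
  assume "\<not> thesis"
  with that have "\<forall>i\<in>I. f i = \<zero>" by blast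
  then have "(\<Oplus>i\<in>I. f i) = \<zero>" using finsum_cong_mem[of I f "\<lambda>_. \<zero>"] by simp
  then show False using assms by simp
qed

end

context star_algebra
begin

lemma finsum_mult_left:
  "finite I \<Longrightarrow> a \<in> carrier A \<Longrightarrow> (\<And>i. i \<in> I \<Longrightarrow> f i \<in> carrier A) \<Longrightarrow> a \<otimes> (\<Oplus>i\<in>I. f i) = (\<Oplus>i\<in>I. a \<otimes> f i)"
  using finsum_rdistr[of I a f] by (simp add: Pi_def)

lemma finsum_mult_right:
  "finite I \<Longrightarrow> a \<in> carrier A \<Longrightarrow> (\<And>i. i \<in> I \<Longrightarrow> f i \<in> carrier A) \<Longrightarrow> (\<Oplus>i\<in>I. f i) \<otimes> a = (\<Oplus>i\<in>I. f i \<otimes> a)"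
  using finsum_ldistr[of I a f] by (simp add: Pi_def)

lemma finsum_constant: "finite I \<Longrightarrow> a \<in> carrier A \<Longrightarrow> (\<Oplus>i\<in>I. a) = scale A (of_nat (card I)) a"
  by (induction I rule: finite_induct) (auto simp: scale_add_left scale_one Pi_def)

text \<open>An equality of multiples of a nonzero element becomes an equality of numbers;
  cardinalities and matrix coefficients are read off this way.\<close>

lemma scale_cancel:
  assumes "scale A c x = scale A d x" "x \<in> carrier A" "x \<noteq> \<zero>" shows "c = d"
proof (rule ccontr)
  assume "c \<noteq> d"
  have "scale A (c - d) x = scale A c x \<oplus> scale A (- d) x" using assms(2) scale_add_left[of x c "- d"] by simp
  also have "scale A (- d) x = \<ominus> scale A d x"
    using assms(2) scale_scale[of x "-1" d] by (simp add: scale_minus_one scale_closed)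
  finally have "scale A (c - d) x = \<zero>" using assms by (simp add: r_neg scale_closed)
  then have "scale A (inverse (c - d)) (scale A (c - d) x) = \<zero>" by simp
  then show False using \<open>c \<noteq> d\<close> assms(2,3) by (simp add: scale_scale scale_one)
qed

lemma scale_left_cancel:
  assumes "scale A c x = scale A c y" "x \<in> carrier A" "y \<in> carrier A" "c \<noteq> 0" shows "x = y"
proof -
  have "scale A (inverse c) (scale A c x) = scale A (inverse c) (scale A c y)" using assms(1) by simp
  then show ?thesis using assms(2-4) by (simp add: scale_scale scale_one)
qed

end

context unital_cstar_algebra
begin

lemma projection_finsum:
  assumes "finite I" "\<And>i. i \<in> I \<Longrightarrow> projection (f i)"
    and orth: "\<And>i j. i \<in> I \<Longrightarrow> j \<in> I \<Longrightarrow> i \<noteq> j \<Longrightarrow> f i \<otimes> f j = \<zero>"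
  shows "projection (\<Oplus>i\<in>I. f i)"
  unfolding projection_def
proof (intro conjI)
  have f: "f i \<in> carrier A" "f i \<otimes> f i = f i" "star A (f i) = f i" if "i \<in> I" for i
    using assms(2)[OF that] by (auto simp: projection_def)
  show c: "(\<Oplus>i\<in>I. f i) \<in> carrier A" using f by (auto intro: finsum_closed)
  have "(\<Oplus>i\<in>I. f i) \<otimes> (\<Oplus>i\<in>I. f i) = (\<Oplus>i\<in>I. f i \<otimes> (\<Oplus>j\<in>I. f j))"
    using assms(1) f(1) c by (intro finsum_mult_right) auto
  also have "\<dots> = (\<Oplus>i\<in>I. \<Oplus>j\<in>I. f i \<otimes> f j)"
    using assms(1) f(1) by (intro finsum_cong_mem finsum_mult_left finsum_closed) auto
  also have "\<dots> = (\<Oplus>i\<in>I. f i)"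
  proof (rule finsum_cong_mem)
    fix i assume i: "i \<in> I"
    have "(\<Oplus>j\<in>I. f i \<otimes> f j) = (\<Oplus>j\<in>I. if j = i then f i \<otimes> f j else \<zero>)"
      using i f orth by (intro finsum_cong_mem) auto
    also have "\<dots> = f i" using i f assms(1) by (simp add: finsum_delta)
    finally show "(\<Oplus>j\<in>I. f i \<otimes> f j) = f i" .
  qed (rule f)
  finally show "(\<Oplus>i\<in>I. f i) \<otimes> (\<Oplus>i\<in>I. f i) = (\<Oplus>i\<in>I. f i)" .
  show "star A (\<Oplus>i\<in>I. f i) = (\<Oplus>i\<in>I. f i)"
    using assms(1) f by (subst star_finsum) (auto intro!: finsum_cong_mem)
qed

lemma projection_zero: "projection \<zero>"
  by (simp add: projection_def)

end

section \<open>Relations preserved by a magic unitary\<close>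

locale magic = unital_cstar_algebra A for A :: "('a, 'm) cstar_alg_scheme" (structure) +
  fixes I :: "'i set" and J :: "'j set" and u :: "'i \<Rightarrow> 'j \<Rightarrow> 'a"
  assumes finite_rows: "finite I" and finite_cols: "finite J" and magic: "magic_unitary A I J u"
begin

lemma u_closed [simp]: "i \<in> I \<Longrightarrow> j \<in> J \<Longrightarrow> u i j \<in> carrier A"
  and u_idem: "i \<in> I \<Longrightarrow> j \<in> J \<Longrightarrow> u i j \<otimes> u i j = u i j"
  and u_star: "i \<in> I \<Longrightarrow> j \<in> J \<Longrightarrow> star A (u i j) = u i j"
  and row_sum: "i \<in> I \<Longrightarrow> (\<Oplus>j\<in>J. u i j) = \<one>"
  and col_sum: "j \<in> J \<Longrightarrow> (\<Oplus>i\<in>I. u i j) = \<one>"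
  using magic by (auto simp: magic_unitary_def)

lemma u_projection: "i \<in> I \<Longrightarrow> j \<in> J \<Longrightarrow> projection (u i j)"
  by (simp add: projection_def u_idem u_star)

lemma row_orth: "i \<in> I \<Longrightarrow> j \<in> J \<Longrightarrow> j' \<in> J \<Longrightarrow> j \<noteq> j' \<Longrightarrow> u i j \<otimes> u i j' = \<zero>"
  using projections_orthogonal[of J "u i"] finite_cols u_projection row_sum by blast

lemma col_orth: "i \<in> I \<Longrightarrow> i' \<in> I \<Longrightarrow> j \<in> J \<Longrightarrow> i \<noteq> i' \<Longrightarrow> u i j \<otimes> u i' j = \<zero>"
  using projections_orthogonal[of I "\<lambda>i. u i j"] finite_rows u_projection col_sum by blast

lemma transpose: "magic A J I (\<lambda>j i. u i j)"
  by (intro magic.intro magic_axioms.intro unital_cstar_algebra_axioms finite_rows finite_cols)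
     (use magic in \<open>auto simp: magic_unitary_def\<close>)

text \<open>Binary functions that the coaction preserves: this class is closed under everything that a
  coherent configuration is closed under.\<close>

definition invariant :: "('i \<Rightarrow> 'i \<Rightarrow> 'c) \<Rightarrow> ('j \<Rightarrow> 'j \<Rightarrow> 'c) \<Rightarrow> bool" where
  "invariant f f' \<longleftrightarrow> (\<forall>i\<in>I. \<forall>i'\<in>I. \<forall>j\<in>J. \<forall>j'\<in>J. u i j \<otimes> u i' j' \<noteq> \<zero> \<longrightarrow> f i i' = f' j j')"

lemma invariantD:
  "invariant f f' \<Longrightarrow> i \<in> I \<Longrightarrow> i' \<in> I \<Longrightarrow> j \<in> J \<Longrightarrow> j' \<in> J \<Longrightarrow> f i i' \<noteq> f' j j' \<Longrightarrow> u i j \<otimes> u i' j' = \<zero>"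
  unfolding invariant_def by blast

lemma invariantI:
  "(\<And>i i' j j'. i \<in> I \<Longrightarrow> i' \<in> I \<Longrightarrow> j \<in> J \<Longrightarrow> j' \<in> J \<Longrightarrow> u i j \<otimes> u i' j' \<noteq> \<zero> \<Longrightarrow> f i i' = f' j j') \<Longrightarrow> invariant f f'"
  unfolding invariant_def by blast

lemma invariant_eq: "invariant (=) (=)"
  using row_orth col_orth unfolding invariant_def by blast

lemma invariant_const: "invariant (\<lambda>_ _. c) (\<lambda>_ _. c)"
  unfolding invariant_def by blast

lemma invariant_map: "invariant f f' \<Longrightarrow> invariant (\<lambda>x y. h (f x y)) (\<lambda>x y. h (f' x y))"
  unfolding invariant_def by metis

lemma invariant_map2:
  "invariant f f' \<Longrightarrow> invariant g g' \<Longrightarrow> invariant (\<lambda>x y. h (f x y) (g x y)) (\<lambda>x y. h (f' x y) (g' x y))"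
  unfolding invariant_def by metis

text \<open>Put x = \<open>u i j\<close> \<open>u i' j'\<close> and let t z w be the same product
  with \<open>u z w\<close> inserted in the middle. It vanishes unless z and w are both intermediate
  points or both not. Summing it over pairs of intermediate points, rows first or columns first,
  gives x times the one count and x times the other, because rows and columns of u sum to 1.\<close>

lemma invariant_card:
  assumes R: "invariant R R'" and S: "invariant S S'"
  shows "invariant (\<lambda>x y. card {z\<in>I. R x z \<and> S z y}) (\<lambda>x y. card {z\<in>J. R' x z \<and> S' z y})"
proof (rule invariantI)
  fix i i' j j' assume ij: "i \<in> I" "i' \<in> I" "j \<in> J" "j' \<in> J" and nz: "u i j \<otimes> u i' j' \<noteq> \<zero>"
  define x where "x = u i j \<otimes> u i' j'"
  have xc: "x \<in> carrier A" using ij by (simp add: x_def)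
  define P where "P z \<longleftrightarrow> R i z \<and> S z i'" for z
  define P' where "P' w \<longleftrightarrow> R' j w \<and> S' w j'" for w
  define t where "t z w = u i j \<otimes> u z w \<otimes> u i' j'" for z w
  have tc: "t z w \<in> carrier A" if "z \<in> I" "w \<in> J" for z w using ij that by (simp add: t_def)
  have t0: "t z w = \<zero>" if "z \<in> I" "w \<in> J" "P z \<noteq> P' w" for z w
  proof (cases "R i z = R' j w")
    case True
    then have "u z w \<otimes> u i' j' = \<zero>" using that ij invariantD[OF S] by (auto simp: P_def P'_def)
    then show ?thesis using that ij by (simp add: t_def m_assoc)
  next
    case False
    then have "u i j \<otimes> u z w = \<zero>" using that ij invariantD[OF R] by auto
    then show ?thesis using that ij by (simp add: t_def)
  qed
  have row: "(\<Oplus>w\<in>J. t z w) = x" if "z \<in> I" for z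
  proof -
    have "(\<Oplus>w\<in>J. t z w) = u i j \<otimes> (\<Oplus>w\<in>J. u z w) \<otimes> u i' j'"
      unfolding t_def using ij that finite_cols
      by (simp add: finsum_mult_left finsum_mult_right)
    then show ?thesis using row_sum[OF that] ij by (simp add: x_def)
  qed
  have col: "(\<Oplus>z\<in>I. t z w) = x" if "w \<in> J" for w
  proof -
    have "(\<Oplus>z\<in>I. t z w) = u i j \<otimes> (\<Oplus>z\<in>I. u z w) \<otimes> u i' j'"
      unfolding t_def using ij that finite_rows
      by (simp add: finsum_mult_left finsum_mult_right)
    then show ?thesis using col_sum[OF that] ij by (simp add: x_def)
  qed
  have row': "(\<Oplus>w\<in>J. if P z \<and> P' w then t z w else \<zero>) = (if P z then x else \<zero>)" if "z \<in> I" for z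
  proof (cases "P z")
    case True
    then have "(\<Oplus>w\<in>J. if P z \<and> P' w then t z w else \<zero>) = (\<Oplus>w\<in>J. t z w)"
      using that tc t0 by (intro finsum_cong_mem) auto
    then show ?thesis using True row[OF that] by simp
  qed simp
  have col': "(\<Oplus>z\<in>I. if P z \<and> P' w then t z w else \<zero>) = (if P' w then x else \<zero>)" if "w \<in> J" for w
  proof (cases "P' w")
    case True
    then have "(\<Oplus>z\<in>I. if P z \<and> P' w then t z w else \<zero>) = (\<Oplus>z\<in>I. t z w)"
      using that tc t0 by (intro finsum_cong_mem) auto
    then show ?thesis using True col[OF that] by simp
  qed simp
  have count: "(\<Oplus>z\<in>K. if Q z then x else \<zero>) = scale A (of_nat (card {z\<in>K. Q z})) x" if "finite K" for K :: "'z set" and Q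
    using finsum_filter[of K "\<lambda>_. x" Q] finsum_constant[of "{z\<in>K. Q z}" x] that xc by simp
  have "scale A (of_nat (card {z\<in>I. P z})) x = (\<Oplus>z\<in>I. if P z then x else \<zero>)"
    using count[OF finite_rows] by simp
  also have "\<dots> = (\<Oplus>z\<in>I. \<Oplus>w\<in>J. if P z \<and> P' w then t z w else \<zero>)"
    using row' xc by (intro finsum_cong_mem) (auto simp: row'[symmetric] intro!: finsum_closed tc)
  also have "\<dots> = (\<Oplus>w\<in>J. \<Oplus>z\<in>I. if P z \<and> P' w then t z w else \<zero>)"
    using finite_rows finite_cols tc by (intro finsum_swap) auto
  also have "\<dots> = (\<Oplus>w\<in>J. if P' w then x else \<zero>)"
    using col' xc by (intro finsum_cong_mem) auto
  also have "\<dots> = scale A (of_nat (card {w\<in>J. P' w})) x"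
    using count[OF finite_cols] by simp
  finally have "of_nat (card {z\<in>I. P z}) = (of_nat (card {w\<in>J. P' w}) :: complex)"
    using scale_cancel xc nz x_def by blast
  then show "card {z\<in>I. R i z \<and> S z i'} = card {z\<in>J. R' j z \<and> S' z j'}"
    by (simp add: P_def P'_def)
qed

text \<open>Composition of relations is the nonvanishing of the count of intermediate
  points.\<close>

lemma invariant_ex:
  assumes "invariant R R'" "invariant S S'"
  shows "invariant (\<lambda>x y. \<exists>z\<in>I. R x z \<and> S z y) (\<lambda>x y. \<exists>z\<in>J. R' x z \<and> S' z y)"
proof -
  have "card {z\<in>I. R x z \<and> S z y} \<noteq> 0 \<longleftrightarrow> (\<exists>z\<in>I. R x z \<and> S z y)" for x y
    using finite_rows by auto
  moreover have "card {z\<in>J. R' x z \<and> S' z y} \<noteq> 0 \<longleftrightarrow> (\<exists>z\<in>J. R' x z \<and> S' z y)" for x y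
    using finite_cols by auto
  ultimately show ?thesis
    using invariant_map[OF invariant_card[OF assms], of "\<lambda>n. n \<noteq> 0"] by simp
qed

lemma invariant_relpow:
  assumes r: "invariant (\<lambda>x y. (x, y) \<in> r) (\<lambda>x y. (x, y) \<in> r')" and "r \<subseteq> I \<times> I" "r' \<subseteq> J \<times> J"
  shows "invariant (\<lambda>x y. (x, y) \<in> r ^^ n) (\<lambda>x y. (x, y) \<in> r' ^^ n)"
proof (induction n)
  case 0
  then show ?case using invariant_eq by simp
next
  case (Suc n)
  have "(x, y) \<in> r ^^ Suc n \<longleftrightarrow> (\<exists>z\<in>I. (x, z) \<in> r ^^ n \<and> (z, y) \<in> r)" for x y
    using assms(2) by auto
  moreover have "(x, y) \<in> r' ^^ Suc n \<longleftrightarrow> (\<exists>z\<in>J. (x, z) \<in> r' ^^ n \<and> (z, y) \<in> r')" for x y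
    using assms(3) by auto
  ultimately show ?case using invariant_ex[OF Suc r] by simp
qed

lemma invariant_rtrancl:
  assumes "invariant (\<lambda>x y. (x, y) \<in> r) (\<lambda>x y. (x, y) \<in> r')" "r \<subseteq> I \<times> I" "r' \<subseteq> J \<times> J"
  shows "invariant (\<lambda>x y. (x, y) \<in> r\<^sup>*) (\<lambda>x y. (x, y) \<in> r'\<^sup>*)"
  using invariant_relpow[OF assms] unfolding invariant_def rtrancl_power by blast

lemma invariant_diag: "invariant f f' \<Longrightarrow> i \<in> I \<Longrightarrow> j \<in> J \<Longrightarrow> u i j \<noteq> \<zero> \<Longrightarrow> f i i = f' j j"
  unfolding invariant_def using u_idem by metis

lemma invariant_degree:
  assumes "invariant R R'" "i \<in> I" "j \<in> J" "u i j \<noteq> \<zero>"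
  shows "card {z\<in>I. R i z} = card {z\<in>J. R' j z}"
  using invariant_diag[OF invariant_card[OF assms(1) invariant_const[of True]] assms(2-4)] by simp

lemma transpose_invariant: "invariant f f' \<Longrightarrow> magic.invariant A J I (\<lambda>j i. u i j) f' f"
  unfolding magic.invariant_def[OF transpose] invariant_def by metis

definition intertwines :: "'i pair_pre_digraph \<Rightarrow> 'j pair_pre_digraph \<Rightarrow> bool" where
  "intertwines X Y \<longleftrightarrow> (\<forall>x\<in>I. \<forall>y\<in>J. (\<Oplus>z\<in>I. scale A (adjacency X x z) (u z y)) =
     (\<Oplus>z\<in>J. scale A (adjacency Y z y) (u x z)))"

lemma adjacency_scale: "a \<in> carrier A \<Longrightarrow> scale A (adjacency X x y) a = (if (x, y) \<in> parcs X then a else \<zero>)"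
  by (simp add: adjacency_def scale_one)

text \<open>Multiplying the matrix equation at (i, j') by \<open>u i j\<close> on the left and
  \<open>u i' j'\<close> on the right leaves, by orthogonality, one term on each side, with the two
  adjacency entries as coefficients. Conversely, a row sum equal to 1 is inserted, invariance trades
  adjacency of rows for adjacency of columns, and a column sum is taken out again.\<close>

lemma intertwines_iff:
  "intertwines X Y \<longleftrightarrow> invariant (\<lambda>x y. (x, y) \<in> parcs X) (\<lambda>x y. (x, y) \<in> parcs Y)"
proof
  assume it: "intertwines X Y"
  show "invariant (\<lambda>x y. (x, y) \<in> parcs X) (\<lambda>x y. (x, y) \<in> parcs Y)"
  proof (rule invariantI)
    fix i i' j j' assume ij: "i \<in> I" "i' \<in> I" "j \<in> J" "j' \<in> J" and nz: "u i j \<otimes> u i' j' \<noteq> \<zero>"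
    have c: "scale A (adjacency X i z) (u z j') \<in> carrier A" if "z \<in> I" for z
      using that ij by (simp add: scale_closed)
    have d: "scale A (adjacency Y z j') (u i z) \<in> carrier A" if "z \<in> J" for z
      using that ij by (simp add: scale_closed)
    have "u i j \<otimes> (\<Oplus>z\<in>I. scale A (adjacency X i z) (u z j')) \<otimes> u i' j' =
        (\<Oplus>z\<in>I. u i j \<otimes> scale A (adjacency X i z) (u z j') \<otimes> u i' j')"
      using ij c finite_rows by (simp add: finsum_mult_left finsum_mult_right)
    also have "\<dots> = (\<Oplus>z\<in>I. if z = i' then scale A (adjacency X i z) (u i j \<otimes> u i' j') else \<zero>)"
      using ij col_orth u_idem
      by (intro finsum_cong_mem) (auto simp: scale_mult_left scale_mult_right scale_closed m_assoc)
    also have "\<dots> = scale A (adjacency X i i') (u i j \<otimes> u i' j')"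
      using ij finite_rows by (subst finsum_delta) (auto simp: scale_closed)
    finally have 1: "u i j \<otimes> (\<Oplus>z\<in>I. scale A (adjacency X i z) (u z j')) \<otimes> u i' j' =
      scale A (adjacency X i i') (u i j \<otimes> u i' j')" .
    have "u i j \<otimes> (\<Oplus>z\<in>J. scale A (adjacency Y z j') (u i z)) \<otimes> u i' j' =
        (\<Oplus>z\<in>J. u i j \<otimes> scale A (adjacency Y z j') (u i z) \<otimes> u i' j')"
      using ij d finite_cols by (simp add: finsum_mult_left finsum_mult_right)
    also have "\<dots> = (\<Oplus>z\<in>J. if z = j then scale A (adjacency Y z j') (u i j \<otimes> u i' j') else \<zero>)"
    proof (rule finsum_cong_mem)
      fix z assume z: "z \<in> J"
      show "u i j \<otimes> scale A (adjacency Y z j') (u i z) \<otimes> u i' j' =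
        (if z = j then scale A (adjacency Y z j') (u i j \<otimes> u i' j') else \<zero>)"
        using ij z row_orth[of i j z] u_idem[of i j] by (simp add: scale_mult_left scale_mult_right)
    qed (use ij in \<open>simp add: scale_closed\<close>)
    also have "\<dots> = scale A (adjacency Y j j') (u i j \<otimes> u i' j')"
      using ij finite_cols by (subst finsum_delta) (auto simp: scale_closed)
    finally have "scale A (adjacency X i i') (u i j \<otimes> u i' j') = scale A (adjacency Y j j') (u i j \<otimes> u i' j')"
      using it ij 1 unfolding intertwines_def by simp
    then have "adjacency X i i' = adjacency Y j j'" using scale_cancel nz ij by simp
    then show "(i, i') \<in> parcs X \<longleftrightarrow> (j, j') \<in> parcs Y" by (auto simp: adjacency_def split: if_splits)
  qed
next
  assume inv: "invariant (\<lambda>x y. (x, y) \<in> parcs X) (\<lambda>x y. (x, y) \<in> parcs Y)"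
  show "intertwines X Y"
    unfolding intertwines_def
  proof (intro ballI)
    fix x y assume xy: "x \<in> I" "y \<in> J"
    have "(\<Oplus>z\<in>I. scale A (adjacency X x z) (u z y)) =
        (\<Oplus>z\<in>I. \<Oplus>w\<in>J. if (x, z) \<in> parcs X then u x w \<otimes> u z y else \<zero>)"
    proof (rule finsum_cong_mem)
      fix z assume z: "z \<in> I"
      have "(\<Oplus>w\<in>J. u x w \<otimes> u z y) = (\<Oplus>w\<in>J. u x w) \<otimes> u z y"
        using xy z finite_cols by (simp add: finsum_mult_right)
      then show "scale A (adjacency X x z) (u z y) = (\<Oplus>w\<in>J. if (x, z) \<in> parcs X then u x w \<otimes> u z y else \<zero>)"
        using xy z row_sum[of x] by (simp add: adjacency_scale)
    qed (use xy in \<open>auto intro!: finsum_closed\<close>)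
    also have "\<dots> = (\<Oplus>z\<in>I. \<Oplus>w\<in>J. if (w, y) \<in> parcs Y then u x w \<otimes> u z y else \<zero>)"
      using xy invariantD[OF inv] by (intro finsum_cong_mem finsum_closed) auto
    also have "\<dots> = (\<Oplus>w\<in>J. \<Oplus>z\<in>I. if (w, y) \<in> parcs Y then u x w \<otimes> u z y else \<zero>)"
      using xy finite_rows finite_cols by (intro finsum_swap) auto
    also have "\<dots> = (\<Oplus>z\<in>J. scale A (adjacency Y z y) (u x z))"
    proof (rule finsum_cong_mem)
      fix w assume w: "w \<in> J"
      have "(\<Oplus>z\<in>I. u x w \<otimes> u z y) = u x w \<otimes> (\<Oplus>z\<in>I. u z y)"
        using xy w finite_rows by (simp add: finsum_mult_left)
      then show "(\<Oplus>z\<in>I. if (w, y) \<in> parcs Y then u x w \<otimes> u z y else \<zero>) = scale A (adjacency Y w y) (u x w)"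
        using xy w col_sum[of y] by (simp add: adjacency_scale)
    qed (use xy in \<open>auto simp: scale_closed\<close>)
    finally show "(\<Oplus>z\<in>I. scale A (adjacency X x z) (u z y)) = (\<Oplus>z\<in>J. scale A (adjacency Y z y) (u x z))" .
  qed
qed

end

section \<open>Block sums over the classes of a preserved equivalence\<close>

locale blocked_magic = magic A I J u
  for A :: "('a, 'm) cstar_alg_scheme" (structure) and I :: "'i set" and J :: "'j set" and u +
  fixes lab :: "'i \<Rightarrow> 'k" and lab' :: "'j \<Rightarrow> 'l"
  assumes labels: "invariant (\<lambda>x y. lab x = lab y) (\<lambda>x y. lab' x = lab' y)"
begin

definition block :: "'i \<Rightarrow> 'l \<Rightarrow> 'a" where
  "block i l = (\<Oplus>j\<in>J. if lab' j = l then u i j else \<zero>)"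

lemma block_closed [simp]: "i \<in> I \<Longrightarrow> block i l \<in> carrier A"
  unfolding block_def by (auto intro: finsum_closed)

lemma block_projection: "i \<in> I \<Longrightarrow> projection (block i l)"
  unfolding block_def using finite_cols row_orth
  by (intro projection_finsum) (auto simp: u_projection projection_zero)

lemma block_mult_entry:
  assumes "i \<in> I" "j \<in> J" shows "block i l \<otimes> u i j = (if lab' j = l then u i j else \<zero>)"
proof -
  have "block i l \<otimes> u i j = (\<Oplus>k\<in>J. (if lab' k = l then u i k else \<zero>) \<otimes> u i j)"
    unfolding block_def using assms finite_cols by (simp add: finsum_mult_right)
  also have "\<dots> = (\<Oplus>k\<in>J. if k = j then (if lab' j = l then u i j else \<zero>) else \<zero>)"
    using assms row_orth[OF assms(1) _ assms(2)] u_idem[OF assms] by (intro finsum_cong_mem) auto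
  also have "\<dots> = (if lab' j = l then u i j else \<zero>)"
    using assms finite_cols by (subst finsum_delta) auto
  finally show ?thesis .
qed

lemma entry_mult_block:
  assumes "i \<in> I" "j \<in> J" shows "u i j \<otimes> block i l = (if lab' j = l then u i j else \<zero>)"
proof -
  have "star A (block i l \<otimes> u i j) = u i j \<otimes> block i l"
    using assms block_projection[of i l] by (simp add: star_mult u_star projection_def)
  then show ?thesis using assms by (simp add: block_mult_entry u_star split: if_splits)
qed

text \<open>Multiplying one block sum by the full row of i' kills all terms with different column
  labels, since i and i' share a label; the same double sum read from the other side is the block
  sum of i'.\<close>

lemma block_eq:
  assumes i: "i \<in> I" "i' \<in> I" "lab i = lab i'" shows "block i l = block i' l"
proof -
  let ?f = "\<lambda>k. if lab' k = l then u i k else \<zero>" and ?g = "\<lambda>k. if lab' k = l then u i' k else \<zero>"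
  have mixed: "u i k \<otimes> u i' m = \<zero>" if "k \<in> J" "m \<in> J" "lab' k \<noteq> lab' m" for k m
    using invariantD[OF labels i(1,2) that(1,2)] that(3) i(3) by simp
  have "block i l = block i l \<otimes> (\<Oplus>m\<in>J. u i' m)" using i by (simp add: row_sum)
  also have "\<dots> = (\<Oplus>k\<in>J. ?f k \<otimes> (\<Oplus>m\<in>J. u i' m))"
    unfolding block_def using i finite_cols by (subst finsum_mult_right) (auto intro: finsum_closed)
  also have "\<dots> = (\<Oplus>k\<in>J. \<Oplus>m\<in>J. ?f k \<otimes> u i' m)"
    using i finite_cols by (intro finsum_cong_mem finsum_mult_left finsum_closed) auto
  also have "\<dots> = (\<Oplus>k\<in>J. \<Oplus>m\<in>J. u i k \<otimes> ?g m)"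
    using i mixed by (intro finsum_cong_mem finsum_closed) auto
  also have "\<dots> = (\<Oplus>k\<in>J. u i k \<otimes> (\<Oplus>m\<in>J. ?g m))"
    using i finite_cols by (intro finsum_cong_mem finsum_mult_left[symmetric]) (auto intro!: m_closed finsum_closed)
  also have "\<dots> = (\<Oplus>k\<in>J. u i k) \<otimes> (\<Oplus>m\<in>J. ?g m)"
    using i finite_cols by (intro finsum_mult_right[symmetric]) (auto intro: finsum_closed)
  also have "\<dots> = block i' l" using i by (simp add: row_sum flip: block_def)
  finally show ?thesis .
qed

lemma transpose_blocked: "blocked_magic A J I (\<lambda>j i. u i j) lab' lab"
  by (intro blocked_magic.intro blocked_magic_axioms.intro transpose transpose_invariant labels)

definition col_block :: "'j \<Rightarrow> 'k \<Rightarrow> 'a" where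
  "col_block j k = (\<Oplus>i\<in>I. if lab i = k then u i j else \<zero>)"

lemma col_block_transpose: "col_block = blocked_magic.block A I (\<lambda>j i. u i j) lab"
  using blocked_magic.block_def[OF transpose_blocked] by (intro ext) (simp add: col_block_def)

lemmas col_block_closed [simp] = blocked_magic.block_closed[OF transpose_blocked, folded col_block_transpose]
  and col_block_eq = blocked_magic.block_eq[OF transpose_blocked, folded col_block_transpose]

text \<open>Double counting in the submatrix between two classes: summing it by rows gives the class
  size times the row block sum, by columns the class size times the column block sum, and the common
  size cancels.\<close>

lemma block_eq_col_block:
  assumes i: "i \<in> I" and j: "j \<in> J"
    and card: "card {i'\<in>I. lab i' = lab i} = card {j'\<in>J. lab' j' = lab' j}"
  shows "block i (lab' j) = col_block j (lab i)"
proof -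
  let ?K = "{i'\<in>I. lab i' = lab i}" and ?L = "{j'\<in>J. lab' j' = lab' j}"
  have "scale A (of_nat (card ?K)) (block i (lab' j)) = (\<Oplus>i'\<in>?K. block i (lab' j))"
    using finite_rows i by (simp add: finsum_constant)
  also have "\<dots> = (\<Oplus>i'\<in>?K. \<Oplus>j'\<in>?L. u i' j')"
  proof (rule finsum_cong_mem)
    fix i' assume i': "i' \<in> ?K"
    then have "block i (lab' j) = block i' (lab' j)" using i by (intro block_eq) auto
    then show "block i (lab' j) = (\<Oplus>j'\<in>?L. u i' j')"
      using i' finite_cols by (simp add: block_def finsum_filter)
  qed (auto intro!: finsum_closed)
  also have "\<dots> = (\<Oplus>j'\<in>?L. \<Oplus>i'\<in>?K. u i' j')"
    using finite_rows finite_cols by (intro finsum_swap) auto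
  also have "\<dots> = (\<Oplus>j'\<in>?L. col_block j (lab i))"
  proof (rule finsum_cong_mem)
    fix j' assume j': "j' \<in> ?L"
    then have "col_block j (lab i) = col_block j' (lab i)" using j by (intro col_block_eq) auto
    then show "(\<Oplus>i'\<in>?K. u i' j') = col_block j (lab i)"
      using j' finite_rows by (simp add: col_block_def finsum_filter)
  qed (use j in simp)
  also have "\<dots> = scale A (of_nat (card ?K)) (col_block j (lab i))"
    using finite_cols j card by (simp add: finsum_constant)
  finally have "scale A (of_nat (card ?K)) (block i (lab' j)) = scale A (of_nat (card ?K)) (col_block j (lab i))" .
  moreover have "card ?K \<noteq> 0" using i finite_rows by auto
  ultimately show ?thesis using scale_left_cancel i j by simp
qed

lemma finsum_block: "i \<in> I \<Longrightarrow> finite L \<Longrightarrow> lab' ` J \<subseteq> L \<Longrightarrow> (\<Oplus>l\<in>L. block i l) = \<one>"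
proof -
  assume i: "i \<in> I" and L: "finite L" "lab' ` J \<subseteq> L"
  have "(\<Oplus>l\<in>L. block i l) = (\<Oplus>j\<in>J. \<Oplus>l\<in>L. if lab' j = l then u i j else \<zero>)"
    unfolding block_def using i L finite_cols by (intro finsum_swap) auto
  also have "\<dots> = (\<Oplus>j\<in>J. u i j)"
  proof (rule finsum_cong_mem)
    fix j assume "j \<in> J"
    then show "(\<Oplus>l\<in>L. if lab' j = l then u i j else \<zero>) = u i j"
      using i L finsum_singleton[of "lab' j" L "\<lambda>_. u i j"] by (auto simp: Pi_def)
  qed (use i in simp)
  finally show "(\<Oplus>l\<in>L. block i l) = \<one>" using i by (simp add: row_sum)
qed

end

text \<open>Equal block sizes make the row and column block sums agree, so that choosing one
  representative per label gives a magic unitary on the labels.\<close>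

locale quotient_magic = blocked_magic A I J u lab lab'
  for A :: "('a, 'm) cstar_alg_scheme" (structure) and I :: "'i set" and J :: "'j set" and u
    and lab :: "'i \<Rightarrow> 'k" and lab' :: "'j \<Rightarrow> 'l" +
  fixes K :: "'k set" and L :: "'l set" and \<sigma> :: "'k \<Rightarrow> 'i" and \<sigma>' :: "'l \<Rightarrow> 'j" and n :: nat
  assumes K: "finite K" "lab ` I \<subseteq> K" and L: "finite L" "lab' ` J \<subseteq> L"
    and sec: "\<And>k. k \<in> K \<Longrightarrow> \<sigma> k \<in> I \<and> lab (\<sigma> k) = k" "\<And>l. l \<in> L \<Longrightarrow> \<sigma>' l \<in> J \<and> lab' (\<sigma>' l) = l"
    and size: "\<And>k. k \<in> K \<Longrightarrow> card {i\<in>I. lab i = k} = n" "\<And>l. l \<in> L \<Longrightarrow> card {j\<in>J. lab' j = l} = n"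
begin

definition v :: "'k \<Rightarrow> 'l \<Rightarrow> 'a" where "v k l = block (\<sigma> k) l"

lemma v_eq_block: "i \<in> I \<Longrightarrow> v (lab i) l = block i l"
  unfolding v_def using sec K by (intro block_eq) auto

lemma v_eq_col_block: assumes "k \<in> K" "j \<in> J" shows "v k (lab' j) = col_block j k"
proof -
  have "block (\<sigma> k) (lab' j) = col_block j (lab (\<sigma> k))"
    using assms sec(1)[of k] size L by (intro block_eq_col_block) auto
  then show ?thesis using sec(1)[of k] assms by (simp add: v_def)
qed

lemma v_magic_unitary: "magic_unitary A K L v"
  unfolding magic_unitary_def
proof (intro conjI ballI)
  fix k l assume kl: "k \<in> K" "l \<in> L"
  show "v k l \<in> carrier A" "v k l \<otimes> v k l = v k l" "star A (v k l) = v k l"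
    using block_projection[of "\<sigma> k" l] sec(1)[OF kl(1)] by (auto simp: v_def projection_def)
next
  fix k assume "k \<in> K"
  then show "(\<Oplus>l\<in>L. v k l) = \<one>" unfolding v_def using sec(1)[of k] L by (intro finsum_block) auto
next
  fix l assume l: "l \<in> L"
  have "(\<Oplus>k\<in>K. v k l) = (\<Oplus>k\<in>K. col_block (\<sigma>' l) k)"
    using sec(2)[OF l] v_eq_col_block[of _ "\<sigma>' l"] by (intro finsum_cong_mem) auto
  also have "\<dots> = \<one>"
    using blocked_magic.finsum_block[OF transpose_blocked, folded col_block_transpose] sec(2)[OF l] K by blast
  finally show "(\<Oplus>k\<in>K. v k l) = \<one>" .
qed

lemma v_magic: "magic A K L v"
  by (intro magic.intro magic_axioms.intro unital_cstar_algebra_axioms K L v_magic_unitary)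

text \<open>A nonvanishing product of block sums contains a nonvanishing product of entries. This is
  how invariance descends from points to labels.\<close>

lemma v_mult_nonzero:
  assumes "k \<in> K" "k' \<in> K" "v k l \<otimes> v k' l' \<noteq> \<zero>"
  obtains j j' where "j \<in> J" "j' \<in> J" "lab' j = l" "lab' j' = l'" "u (\<sigma> k) j \<otimes> u (\<sigma> k') j' \<noteq> \<zero>"
proof -
  note s = sec(1)[OF assms(1)] sec(1)[OF assms(2)]
  have "v k l \<otimes> v k' l' = (\<Oplus>j\<in>J. (if lab' j = l then u (\<sigma> k) j else \<zero>) \<otimes> block (\<sigma> k') l')"
    unfolding v_def using s finite_cols by (subst block_def) (auto intro!: finsum_mult_right)
  with assms(3) have "(\<Oplus>j\<in>J. (if lab' j = l then u (\<sigma> k) j else \<zero>) \<otimes> block (\<sigma> k') l') \<noteq> \<zero>" by simp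
  then obtain j where j: "j \<in> J" "(if lab' j = l then u (\<sigma> k) j else \<zero>) \<otimes> block (\<sigma> k') l' \<noteq> \<zero>"
    by (rule finsum_nonzeroE)
  then have jl: "lab' j = l" using s by (auto split: if_splits)
  have "u (\<sigma> k) j \<otimes> block (\<sigma> k') l' = (\<Oplus>j'\<in>J. u (\<sigma> k) j \<otimes> (if lab' j' = l' then u (\<sigma> k') j' else \<zero>))"
    unfolding block_def using s j finite_cols by (intro finsum_mult_left) auto
  with j jl have "(\<Oplus>j'\<in>J. u (\<sigma> k) j \<otimes> (if lab' j' = l' then u (\<sigma> k') j' else \<zero>)) \<noteq> \<zero>" by simp
  then obtain j' where j': "j' \<in> J" "u (\<sigma> k) j \<otimes> (if lab' j' = l' then u (\<sigma> k') j' else \<zero>) \<noteq> \<zero>"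
    by (rule finsum_nonzeroE)
  then have "lab' j' = l'" using s j by (auto split: if_splits)
  then show ?thesis using that j j' jl by simp
qed

lemma v_invariant:
  assumes inv: "invariant f f'"
    and f: "\<And>k k'. k \<in> K \<Longrightarrow> k' \<in> K \<Longrightarrow> f (\<sigma> k) (\<sigma> k') = g k k'"
    and f': "\<And>j j'. j \<in> J \<Longrightarrow> j' \<in> J \<Longrightarrow> f' j j' = g' (lab' j) (lab' j')"
  shows "magic.invariant A K L v g g'"
  unfolding magic.invariant_def[OF v_magic]
proof (intro ballI impI)
  fix k k' l l' assume k: "k \<in> K" "k' \<in> K" and l: "l \<in> L" "l' \<in> L" and nz: "v k l \<otimes> v k' l' \<noteq> \<zero>"
  from v_mult_nonzero[OF k nz] obtain j j' where j: "j \<in> J" "j' \<in> J" "lab' j = l" "lab' j' = l'"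
    "u (\<sigma> k) j \<otimes> u (\<sigma> k') j' \<noteq> \<zero>" by blast
  then have "f (\<sigma> k) (\<sigma> k') = f' j j'" using inv sec(1) k unfolding invariant_def by blast
  then show "g k k' = g' l l'" using f[OF k] f'[OF j(1,2)] j by simp
qed

end

lemma star_isoI:
  assumes "f \<in> star_hom A B" "g \<in> star_hom B A"
    and "\<And>x. x \<in> carrier A \<Longrightarrow> g (f x) = x" "\<And>y. y \<in> carrier B \<Longrightarrow> f (g y) = y"
  shows "f \<in> star_iso A B"
proof -
  have "bij_betw f (carrier A) (carrier B)"
    using assms star_hom_closed[OF assms(1)] star_hom_closed[OF assms(2)]
    by (intro bij_betw_byWitness[where f' = g]) auto
  then show ?thesis using assms(1) by (simp add: star_iso_def star_hom_def)
qed

lemma magic_reindex: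
  fixes A (structure)
  assumes "magic A I J u" "bij_betw f I' I" "bij_betw g J' J"
  shows "magic A I' J' (\<lambda>i j. u (f i) (g j))"
proof -
  interpret magic A I J u by fact
  have f: "f i \<in> I" if "i \<in> I'" for i using assms(2) that by (auto simp: bij_betw_def)
  have g: "g j \<in> J" if "j \<in> J'" for j using assms(3) that by (auto simp: bij_betw_def)
  have 1: "(\<Oplus>j\<in>J'. u (f i) (g j)) = \<one>" if "i \<in> I'" for i
    using finsum_reindex[of "u (f i)" g J'] assms(3) f[OF that] row_sum[of "f i"]
    by (auto simp: bij_betw_def Pi_def)
  have 2: "(\<Oplus>i\<in>I'. u (f i) (g j)) = \<one>" if "j \<in> J'" for j
    using finsum_reindex[of "\<lambda>i. u i (g j)" f I'] assms(2) g[OF that] col_sum[of "g j"]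
    by (auto simp: bij_betw_def Pi_def)
  show ?thesis
    using f g 1 2 assms(2,3) finite_rows finite_cols u_idem u_star
    by (intro magic.intro magic_axioms.intro unital_cstar_algebra_axioms)
       (auto simp: magic_unitary_def dest: bij_betw_finite)
qed

lemma magic_image:
  assumes "magic A I J u" "unital_cstar_algebra B" "h \<in> star_hom A B"
  shows "magic B I J (\<lambda>i j. h (u i j))"
proof -
  interpret magic A I J u by fact
  interpret B: unital_cstar_algebra B by fact
  note fs = star_hom_finsum[OF star_algebra_axioms B.star_algebra_axioms assms(3), symmetric]
  show ?thesis
    by (intro magic.intro magic_axioms.intro assms(2) finite_rows finite_cols)
       (use fs[OF finite_rows] fs[OF finite_cols] in \<open>auto simp: magic_unitary_def star_hom_closed[OF assms(3)] u_idem u_star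
          row_sum col_sum star_hom_one[OF assms(3)] simp flip: star_hom_mult[OF assms(3)] star_hom_star[OF assms(3)]\<close>)
qed

section \<open>The quantum automorphism group as a universal algebra\<close>

text \<open>Modulo the relations a generator u is a projection, so p(u)^2 is at most p(u) and the
  bound is 1.\<close>

lemma Qut_presentation:
  assumes fin: "finite (pverts X)"
  shows "presentation (pverts X \<times> pverts X) (Qut_relations X)"
proof
  let ?F = "free_star_alg (pverts X \<times> pverts X)"
  show "Qut_relations X \<subseteq> carrier ?F"
    unfolding Qut_relations_def Let_def
    by (auto intro!: free_carrier_intros simp: free_carrier_gen)
  fix g assume "g \<in> pverts X \<times> pverts X"
  then obtain x y where g: "g = (x, y)" "x \<in> pverts X" "y \<in> pverts X" by auto
  have uc: "gen (x, y) \<in> carrier ?F" using g by (simp add: free_carrier_gen)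
  have "p (gen (x, y)) \<le> 1" if p: "respects_relations (pverts X \<times> pverts X) (Qut_relations X) p" for p
  proof -
    interpret P: seminormed_star_algebra ?F p
      using p unfolding respects_relations_def by (intro star_algebra.seminormed[OF free_star_algebra]) simp
    let ?u = "gen (x, y) :: ('a \<times> 'a) free_poly"
    have "?u * ?u - ?u \<in> Qut_relations X" "free_star ?u - ?u \<in> Qut_relations X"
      unfolding Qut_relations_def Let_def using g by blast+
    then have z: "p (?u * ?u - ?u) = 0" "p (free_star ?u - ?u) = 0"
      using p by (auto simp: respects_relations_def)
    have c: "free_star ?u - ?u \<in> carrier ?F" "?u * ?u - ?u \<in> carrier ?F" "(free_star ?u - ?u) * ?u \<in> carrier ?F"
      using uc by (intro free_carrier_intros; simp)+
    \<comment> \<open>A seminorm sees the relations only through its value 0 on them, so the product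
      of u with its adjoint is rewritten as u plus one multiple of the self-adjointness relation and
      the idempotency relation.\<close>
    have "p (free_star ?u * ?u) = p ((free_star ?u - ?u) * ?u + ((?u * ?u - ?u) + ?u))"
      by (simp add: algebra_simps)
    also have "\<dots> \<le> p ((free_star ?u - ?u) * ?u) + p ((?u * ?u - ?u) + ?u)"
      using P.p_add[OF c(3) free_carrier_add[OF c(2) uc]] by simp
    also have "\<dots> \<le> p (free_star ?u - ?u) * p ?u + (p (?u * ?u - ?u) + p ?u)"
      using P.p_mult[OF c(1) uc] P.p_add[OF c(2) uc] by simp
    finally have "(p ?u)\<^sup>2 \<le> p ?u" using P.p_cstar[OF uc] z by simp
    then have "p ?u * p ?u \<le> 1 * p ?u" by (simp add: power2_eq_square)
    then show ?thesis using P.p_nonneg[OF uc] by (metis mult_right_le_imp_le not_le order.trans zero_le_one less_eq_real_def)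
  qed
  then show "\<exists>B. \<forall>p. respects_relations (pverts X \<times> pverts X) (Qut_relations X) p \<longrightarrow> p (gen g) \<le> B"
    using g by blast
qed

lemma Qut_points [simp]: "points (Qut X) = pverts X"
  and Qut_qalg: "qalg (Qut X) = universal_cstar (pverts X \<times> pverts X) (Qut_relations X)"
  and Qut_fund: "fund (Qut X) = (\<lambda>x y. universal_gen (pverts X \<times> pverts X) (Qut_relations X) (x, y))"
  by (simp_all add: Qut_def)

lemma Qut_cstar: "finite (pverts X) \<Longrightarrow> unital_cstar_algebra (qalg (Qut X))"
  using presentation.universal_unital_cstar_algebra[OF Qut_presentation] by (simp add: Qut_qalg)

lemma Qut_magic:
  assumes fin: "finite (pverts X)"
  shows "magic (qalg (Qut X)) (pverts X) (pverts X) (fund (Qut X))"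
    and "magic.intertwines (qalg (Qut X)) (pverts X) (pverts X) (fund (Qut X)) X X"
proof -
  let ?V = "pverts X" let ?G = "?V \<times> ?V" let ?Q = "universal_cstar ?G (Qut_relations X)"
  let ?w = "\<lambda>x y. universal_gen ?G (Qut_relations X) (x, y)"
  interpret P: presentation ?G "Qut_relations X" by (rule Qut_presentation[OF fin])
  interpret Q: unital_cstar_algebra ?Q by (rule P.universal_unital_cstar_algebra)
  interpret E: free_hom ?Q ?G P.free.compl_emb
    by (intro free_hom.intro Q.star_algebra_axioms free_hom_axioms.intro P.universal_emb)
  let ?e = P.free.compl_emb
  have rel: "?e r = \<zero>\<^bsub>?Q\<^esub>" if "r \<in> Qut_relations X" for r using P.universal_relations[OF that] by simp
  have w: "?w x y = ?e (gen (x, y))" for x y by (simp add: P.universal_gen_eq)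
  have gc: "gen (x, y) \<in> carrier (free_star_alg ?G)" if "x \<in> ?V" "y \<in> ?V" for x y
    using that by (simp add: free_carrier_gen)
  have wc: "?w x y \<in> carrier ?Q" if "x \<in> ?V" "y \<in> ?V" for x y
    unfolding w using E.e_closed[OF gc[OF that]] .
  note cl = gc free_carrier_intros
  have R: "gen (x, y) * gen (x, y) - gen (x, y) \<in> Qut_relations X" "free_star (gen (x, y)) - gen (x, y) \<in> Qut_relations X"
    "(\<Sum>z\<in>?V. free_scale (adjacency X x z) (gen (z, y))) - (\<Sum>z\<in>?V. free_scale (adjacency X z y) (gen (x, z))) \<in> Qut_relations X"
    if "x \<in> ?V" "y \<in> ?V" for x y
    unfolding Qut_relations_def Let_def using that by blast+
  have S: "(\<Sum>y\<in>?V. gen (x, y)) - 1 \<in> Qut_relations X" "(\<Sum>y\<in>?V. gen (y, x)) - 1 \<in> Qut_relations X" if "x \<in> ?V" for x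
    unfolding Qut_relations_def Let_def using that by blast+
  have idem: "?w x y \<otimes>\<^bsub>?Q\<^esub> ?w x y = ?w x y" and sa: "star ?Q (?w x y) = ?w x y" if "x \<in> ?V" "y \<in> ?V" for x y
  proof -
    show "?w x y \<otimes>\<^bsub>?Q\<^esub> ?w x y = ?w x y"
      using rel[OF R(1)[OF that]] gc[OF that] wc[OF that] unfolding w
      by (simp only: E.e_diff E.e_mult free_carrier_mult Q.m_closed Q.diff_eq_zero_iff)
    show "star ?Q (?w x y) = ?w x y"
      using rel[OF R(2)[OF that]] gc[OF that] wc[OF that] unfolding w
      by (simp only: E.e_diff E.e_star free_carrier_star Q.star_closed Q.diff_eq_zero_iff)
  qed
  have sums: "(\<Oplus>\<^bsub>?Q\<^esub>y\<in>?V. ?w x y) = \<one>\<^bsub>?Q\<^esub>" "(\<Oplus>\<^bsub>?Q\<^esub>y\<in>?V. ?w y x) = \<one>\<^bsub>?Q\<^esub>" if x: "x \<in> ?V" for x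
  proof -
    have c: "(\<Sum>y\<in>?V. gen (x, y)) \<in> carrier (free_star_alg ?G)" "(\<Sum>y\<in>?V. gen (y, x)) \<in> carrier (free_star_alg ?G)"
      using x gc by (auto intro: free_carrier_sum)
    show "(\<Oplus>\<^bsub>?Q\<^esub>y\<in>?V. ?w x y) = \<one>\<^bsub>?Q\<^esub>"
      using rel[OF S(1)[OF x]] E.e_closed[OF c(1)] E.e_diff[OF c(1) free_carrier_one] E.e_one fin x gc unfolding w
      by (subst E.e_sum[symmetric]) simp_all
    show "(\<Oplus>\<^bsub>?Q\<^esub>y\<in>?V. ?w y x) = \<one>\<^bsub>?Q\<^esub>"
      using rel[OF S(2)[OF x]] E.e_closed[OF c(2)] E.e_diff[OF c(2) free_carrier_one] E.e_one fin x gc unfolding w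
      by (subst E.e_sum[symmetric]) simp_all
  qed
  have m: "magic ?Q ?V ?V ?w"
    by (intro magic.intro magic_axioms.intro Q.unital_cstar_algebra_axioms fin)
       (unfold magic_unitary_def, use wc idem sa sums in blast)
  have inter: "(\<Oplus>\<^bsub>?Q\<^esub>z\<in>?V. scale ?Q (adjacency X x z) (?w z y)) = (\<Oplus>\<^bsub>?Q\<^esub>z\<in>?V. scale ?Q (adjacency X z y) (?w x z))"
    if x: "x \<in> ?V" "y \<in> ?V" for x y
  proof -
    let ?a = "\<Sum>z\<in>?V. free_scale (adjacency X x z) (gen (z, y))" and ?b = "\<Sum>z\<in>?V. free_scale (adjacency X z y) (gen (x, z))"
    have c: "?a \<in> carrier (free_star_alg ?G)" "?b \<in> carrier (free_star_alg ?G)"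
      using x gc by (auto intro: free_carrier_sum free_carrier_scale)
    have "?e ?a = ?e ?b"
      using rel[OF R(3)[OF x]] E.e_closed[OF c(1)] E.e_closed[OF c(2)] by (simp add: E.e_diff[OF c])
    moreover have "?e ?a = (\<Oplus>\<^bsub>?Q\<^esub>z\<in>?V. scale ?Q (adjacency X x z) (?w z y))"
      using x gc fin wc unfolding w
      by (subst E.e_sum) (auto intro!: free_carrier_scale Q.finsum_cong_mem Q.scale_closed simp: E.e_scale E.e_closed)
    moreover have "?e ?b = (\<Oplus>\<^bsub>?Q\<^esub>z\<in>?V. scale ?Q (adjacency X z y) (?w x z))"
      using x gc fin wc unfolding w
      by (subst E.e_sum) (auto intro!: free_carrier_scale Q.finsum_cong_mem Q.scale_closed simp: E.e_scale E.e_closed)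
    ultimately show ?thesis by simp
  qed
  from m show "magic (qalg (Qut X)) (pverts X) (pverts X) (fund (Qut X))"
    by (simp only: Qut_qalg Qut_fund)
  have "magic.intertwines ?Q ?V ?V ?w X X"
    unfolding magic.intertwines_def[OF m] using inter by blast
  then show "magic.intertwines (qalg (Qut X)) (pverts X) (pverts X) (fund (Qut X)) X X"
    by (simp only: Qut_qalg Qut_fund)
qed

text \<open>Each axiom of a magic unitary intertwining the adjacency matrix is the image of one
  defining relation, so evaluating the generators at the entries of w kills all relations.\<close>

lemma Qut_hom_exists:
  assumes m: "magic B (pverts X) (pverts X) w" and it: "magic.intertwines B (pverts X) (pverts X) w X X"
  obtains H where "H \<in> star_hom (qalg (Qut X)) B"
    "\<And>x y. x \<in> pverts X \<Longrightarrow> y \<in> pverts X \<Longrightarrow> H (fund (Qut X) x y) = w x y"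
proof -
  interpret magic B "pverts X" "pverts X" w by fact
  let ?V = "pverts X" let ?G = "?V \<times> ?V"
  interpret P: presentation ?G "Qut_relations X" by (rule Qut_presentation[OF finite_rows])
  have "(\<lambda>(x, y). w x y) g \<in> carrier B" if "g \<in> ?G" for g using that by auto
  from free_eval_exists[of ?G "\<lambda>(x, y). w x y", OF this]
  obtain e where e: "e \<in> star_hom (free_star_alg ?G) B" "\<And>g. g \<in> ?G \<Longrightarrow> e (gen g) = (\<lambda>(x, y). w x y) g"
    by blast
  interpret E: free_hom B ?G e by unfold_locales (rule e(1))
  have ew: "e (gen (x, y)) = w x y" if "x \<in> ?V" "y \<in> ?V" for x y using e(2)[of "(x, y)"] that by simp
  have gc: "gen (x, y) \<in> carrier (free_star_alg ?G)" if "x \<in> ?V" "y \<in> ?V" for x y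
    using that by (simp add: free_carrier_gen)
  have 1: "e ((\<Sum>y\<in>?V. gen (x, y)) - 1) = \<zero>\<^bsub>B\<^esub>" "e ((\<Sum>y\<in>?V. gen (y, x)) - 1) = \<zero>\<^bsub>B\<^esub>" if x: "x \<in> ?V" for x
  proof -
    have "e (\<Sum>y\<in>?V. gen (x, y)) = (\<Oplus>\<^bsub>B\<^esub>y\<in>?V. w x y)" "e (\<Sum>y\<in>?V. gen (y, x)) = (\<Oplus>\<^bsub>B\<^esub>y\<in>?V. w y x)"
      using x gc ew finite_rows by (auto simp: E.e_sum intro!: finsum_cong_mem)
    then show "e ((\<Sum>y\<in>?V. gen (x, y)) - 1) = \<zero>\<^bsub>B\<^esub>" "e ((\<Sum>y\<in>?V. gen (y, x)) - 1) = \<zero>\<^bsub>B\<^esub>"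
      using x gc row_sum[OF x] col_sum[OF x] by (auto simp: E.e_diff free_carrier_sum free_carrier_one E.e_one)
  qed
  have 2: "e ((\<Sum>z\<in>?V. free_scale (adjacency X x z) (gen (z, y))) - (\<Sum>z\<in>?V. free_scale (adjacency X z y) (gen (x, z)))) = \<zero>\<^bsub>B\<^esub>"
    if x: "x \<in> ?V" "y \<in> ?V" for x y
  proof -
    let ?a = "\<Sum>z\<in>?V. free_scale (adjacency X x z) (gen (z, y))" and ?b = "\<Sum>z\<in>?V. free_scale (adjacency X z y) (gen (x, z))"
    have c: "?a \<in> carrier (free_star_alg ?G)" "?b \<in> carrier (free_star_alg ?G)"
      using x gc by (auto intro: free_carrier_sum free_carrier_scale)
    have "e ?a = (\<Oplus>\<^bsub>B\<^esub>z\<in>?V. scale B (adjacency X x z) (w z y))"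
      using x gc finite_rows
      by (subst E.e_sum) (auto intro!: free_carrier_scale finsum_cong_mem scale_closed simp: E.e_scale ew)
    moreover have "e ?b = (\<Oplus>\<^bsub>B\<^esub>z\<in>?V. scale B (adjacency X z y) (w x z))"
      using x gc finite_rows
      by (subst E.e_sum) (auto intro!: free_carrier_scale finsum_cong_mem scale_closed simp: E.e_scale ew)
    ultimately have "e ?a = e ?b" using it x unfolding intertwines_def by simp
    then show ?thesis using E.e_closed[OF c(2)] by (simp add: E.e_diff[OF c])
  qed
  have rel: "e r = \<zero>\<^bsub>B\<^esub>" if "r \<in> Qut_relations X" for r
    using that 1 2 gc unfolding Qut_relations_def Let_def
    by (auto simp: E.e_diff E.e_mult E.e_star free_carrier_mult free_carrier_star ew u_idem u_star)
  obtain H where "H \<in> star_hom P.U B" "\<And>g. g \<in> ?G \<Longrightarrow> H (universal_gen ?G (Qut_relations X) g) = e (gen g)"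
    using P.universal_hom_exists[OF unital_cstar_algebra_axioms e(1) rel] by blast
  then show ?thesis using ew by (intro that[of H]) (auto simp: Qut_qalg Qut_fund)
qed

lemma Qut_hom_eq:
  assumes "finite (pverts X)" "unital_cstar_algebra B" "f \<in> star_hom (qalg (Qut X)) B" "g \<in> star_hom (qalg (Qut X)) B"
    and "\<And>x y. x \<in> pverts X \<Longrightarrow> y \<in> pverts X \<Longrightarrow> f (fund (Qut X) x y) = g (fund (Qut X) x y)"
    and "c \<in> carrier (qalg (Qut X))"
  shows "f c = g c"
  using presentation.universal_hom_eq[OF Qut_presentation[OF assms(1)] assms(2) assms(3,4)[unfolded Qut_qalg]]
    assms(5,6) by (auto simp: Qut_qalg Qut_fund)

section \<open>Coproducts\<close>

lemma hom_relations_closed: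
  assumes "star_algebra A" "\<And>x. x \<in> carrier A \<Longrightarrow> \<iota> x \<in> carrier (free_star_alg G)"
  shows "hom_relations A \<iota> \<subseteq> carrier (free_star_alg G)"
proof -
  interpret star_algebra A by fact
  show ?thesis unfolding hom_relations_def
    by (auto intro!: free_carrier_intros assms(2) simp: scale_closed star_closed)
qed

text \<open>Used in both directions: the canonical maps into a coproduct are homomorphisms because
  the relations vanish there, and given homomorphisms on the factors satisfy the relations and
  therefore glue.\<close>

lemma hom_relations_iff:
  assumes A: "star_algebra A" and C: "star_algebra C" and e: "e \<in> star_hom (free_star_alg G) C"
    and \<iota>: "\<And>x. x \<in> carrier A \<Longrightarrow> \<iota> x \<in> carrier (free_star_alg G)"
  shows "(\<forall>r\<in>hom_relations A \<iota>. e r = \<zero>\<^bsub>C\<^esub>) \<longleftrightarrow> (\<lambda>x. e (\<iota> x)) \<in> star_hom A C"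
proof -
  interpret A: star_algebra A by fact
  interpret C: star_algebra C by fact
  interpret E: free_hom C G e by unfold_locales fact
  note s = E.e_simps \<iota> free_carrier_intros E.e_closed A.scale_closed A.star_closed C.scale_closed C.star_closed
  have "(\<forall>r\<in>hom_relations A \<iota>. e r = \<zero>\<^bsub>C\<^esub>) \<longleftrightarrow>
    (\<forall>x\<in>carrier A. \<forall>y\<in>carrier A. e (\<iota> (x \<oplus>\<^bsub>A\<^esub> y)) = e (\<iota> x) \<oplus>\<^bsub>C\<^esub> e (\<iota> y)) \<and>
    (\<forall>x\<in>carrier A. \<forall>y\<in>carrier A. e (\<iota> (x \<otimes>\<^bsub>A\<^esub> y)) = e (\<iota> x) \<otimes>\<^bsub>C\<^esub> e (\<iota> y)) \<and>
    (\<forall>c. \<forall>x\<in>carrier A. e (\<iota> (scale A c x)) = scale C c (e (\<iota> x))) \<and>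
    (\<forall>x\<in>carrier A. e (\<iota> (star A x)) = star C (e (\<iota> x))) \<and> e (\<iota> \<one>\<^bsub>A\<^esub>) = \<one>\<^bsub>C\<^esub>"
  proof -
    have 1: "e (\<iota> (x \<oplus>\<^bsub>A\<^esub> y) - (\<iota> x + \<iota> y)) = \<zero>\<^bsub>C\<^esub> \<longleftrightarrow> e (\<iota> (x \<oplus>\<^bsub>A\<^esub> y)) = e (\<iota> x) \<oplus>\<^bsub>C\<^esub> e (\<iota> y)"
      if "x \<in> carrier A" "y \<in> carrier A" for x y using that by (simp add: s)
    have 2: "e (\<iota> (x \<otimes>\<^bsub>A\<^esub> y) - \<iota> x * \<iota> y) = \<zero>\<^bsub>C\<^esub> \<longleftrightarrow> e (\<iota> (x \<otimes>\<^bsub>A\<^esub> y)) = e (\<iota> x) \<otimes>\<^bsub>C\<^esub> e (\<iota> y)"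
      if "x \<in> carrier A" "y \<in> carrier A" for x y using that by (simp add: s)
    have 3: "e (\<iota> (scale A c x) - free_scale c (\<iota> x)) = \<zero>\<^bsub>C\<^esub> \<longleftrightarrow> e (\<iota> (scale A c x)) = scale C c (e (\<iota> x))"
      if "x \<in> carrier A" for c x using that by (simp add: s)
    have 4: "e (\<iota> (star A x) - free_star (\<iota> x)) = \<zero>\<^bsub>C\<^esub> \<longleftrightarrow> e (\<iota> (star A x)) = star C (e (\<iota> x))"
      if "x \<in> carrier A" for x using that by (simp add: s)
    have 5: "e (\<iota> \<one>\<^bsub>A\<^esub> - 1) = \<zero>\<^bsub>C\<^esub> \<longleftrightarrow> e (\<iota> \<one>\<^bsub>A\<^esub>) = \<one>\<^bsub>C\<^esub>" by (simp add: s)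
    have "(\<forall>r\<in>hom_relations A \<iota>. e r = \<zero>\<^bsub>C\<^esub>) \<longleftrightarrow>
      (\<forall>x\<in>carrier A. \<forall>y\<in>carrier A. e (\<iota> (x \<oplus>\<^bsub>A\<^esub> y) - (\<iota> x + \<iota> y)) = \<zero>\<^bsub>C\<^esub>) \<and>
      (\<forall>x\<in>carrier A. \<forall>y\<in>carrier A. e (\<iota> (x \<otimes>\<^bsub>A\<^esub> y) - \<iota> x * \<iota> y) = \<zero>\<^bsub>C\<^esub>) \<and>
      (\<forall>c. \<forall>x\<in>carrier A. e (\<iota> (scale A c x) - free_scale c (\<iota> x)) = \<zero>\<^bsub>C\<^esub>) \<and>
      (\<forall>x\<in>carrier A. e (\<iota> (star A x) - free_star (\<iota> x)) = \<zero>\<^bsub>C\<^esub>) \<and> e (\<iota> \<one>\<^bsub>A\<^esub> - 1) = \<zero>\<^bsub>C\<^esub>"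
      unfolding hom_relations_def ball_Un conj_assoc by (intro conj_cong) blast+
    then show ?thesis by (simp only: 1 2 3 4 5 cong: ball_cong)
  qed
  also have "\<dots> \<longleftrightarrow> (\<lambda>x. e (\<iota> x)) \<in> star_hom A C"
    using \<iota> E.e_closed by (auto simp: star_hom_def ring_hom_def)
  finally show ?thesis .
qed

text \<open>The generators are arbitrary elements of A, and nothing but the algebra bounds them:
  modulo the relations the map \<open>\<iota>\<close> turns p into a C*-seminorm on A, which the
  norm of A dominates by \<open>seminorm_le_norm\<close>.\<close>

lemma hom_relations_bounded:
  assumes A: "unital_cstar_algebra A" and \<iota>: "\<And>x. x \<in> carrier A \<Longrightarrow> \<iota> x \<in> carrier (free_star_alg G)"
    and p: "respects_relations G R p" and R: "hom_relations A \<iota> \<subseteq> R" and x: "x \<in> carrier A"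
  shows "p (\<iota> x) \<le> cnorm A x"
proof -
  interpret A: unital_cstar_algebra A by fact
  interpret P: seminormed_star_algebra "free_star_alg G" p
    using p unfolding respects_relations_def by (intro star_algebra.seminormed[OF free_star_algebra]) simp
  have eq: "p a = p b" if "a - b \<in> hom_relations A \<iota>" "a \<in> carrier (free_star_alg G)" "b \<in> carrier (free_star_alg G)" for a b
  proof -
    have "p (a - b) = 0" using p R that(1) by (auto simp: respects_relations_def)
    then show ?thesis using P.p_abs_diff[OF that(2,3)] by (simp add: free_diff[OF that(3)])
  qed
  note c = \<iota> free_carrier_intros A.scale_closed A.star_closed
  have m: "\<iota> (x \<oplus>\<^bsub>A\<^esub> y) - (\<iota> x + \<iota> y) \<in> hom_relations A \<iota>" "\<iota> (x \<otimes>\<^bsub>A\<^esub> y) - \<iota> x * \<iota> y \<in> hom_relations A \<iota>"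
    "\<iota> (scale A k x) - free_scale k (\<iota> x) \<in> hom_relations A \<iota>"
    if "x \<in> carrier A" "y \<in> carrier A" for x y k
    using that unfolding hom_relations_def by blast+
  have add: "p (\<iota> (x \<oplus>\<^bsub>A\<^esub> y)) = p (\<iota> x + \<iota> y)" and mult: "p (\<iota> (x \<otimes>\<^bsub>A\<^esub> y)) = p (\<iota> x * \<iota> y)"
    if "x \<in> carrier A" "y \<in> carrier A" for x y
    using eq[OF m(1)[OF that]] eq[OF m(2)[OF that]] that by (simp_all add: c)
  have sc: "p (\<iota> (scale A k x)) = p (free_scale k (\<iota> x))" and st: "p (free_star (\<iota> x) * \<iota> x) = p (\<iota> (star A x) * \<iota> x)"
    if xc: "x \<in> carrier A" for k x
  proof -
    show "p (\<iota> (scale A k x)) = p (free_scale k (\<iota> x))"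
      using eq[OF m(3)[OF xc xc]] xc by (simp add: c)
    let ?d = "\<iota> (star A x) - free_star (\<iota> x)"
    have dc: "?d \<in> carrier (free_star_alg G)" using xc by (intro c)
    have "?d \<in> hom_relations A \<iota>" using xc unfolding hom_relations_def by blast
    then have "p ?d = 0" using p R by (auto simp: respects_relations_def)
    then have "p (?d * \<iota> x) = 0" using P.p_mult[OF dc \<iota>[OF xc]] P.p_nonneg[OF free_carrier_mult[OF dc \<iota>[OF xc]]] by simp
    moreover have "?d * \<iota> x = \<iota> (star A x) * \<iota> x - free_star (\<iota> x) * \<iota> x" by (simp add: algebra_simps)
    moreover have "free_star (\<iota> x) * \<iota> x \<in> carrier (free_star_alg G)" "\<iota> (star A x) * \<iota> x \<in> carrier (free_star_alg G)"
      using xc by (intro c; simp)+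
    ultimately show "p (free_star (\<iota> x) * \<iota> x) = p (\<iota> (star A x) * \<iota> x)"
      using P.p_abs_diff[of "\<iota> (star A x) * \<iota> x" "free_star (\<iota> x) * \<iota> x"] by (simp add: free_diff)
  qed
  have "cstar_seminorm A (\<lambda>x. p (\<iota> x))"
    unfolding cstar_seminorm_def
    using P.p_nonneg[OF \<iota>] P.p_add[OF \<iota> \<iota>] P.p_scale[OF \<iota>] P.p_mult[OF \<iota> \<iota>] P.p_cstar[OF \<iota>]
    by (auto simp: add mult sc st A.star_closed simp flip: st)
  then show ?thesis using A.seminorm_le_norm x by blast
qed

locale cstar_pair = A: unital_cstar_algebra A + B: unital_cstar_algebra B
  for A :: "'a cstar_alg" and B :: "'b cstar_alg"
begin

lemma inl_closed: "x \<in> carrier A \<Longrightarrow> gen (Inl x) \<in> carrier (free_star_alg (sum_gens A B))"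
  and inr_closed: "y \<in> carrier B \<Longrightarrow> gen (Inr y) \<in> carrier (free_star_alg (sum_gens A B))"
  by (simp_all add: free_carrier_gen sum_gens_def)

sublocale P: presentation "sum_gens A B" "sum_relations A B"
proof
  show "sum_relations A B \<subseteq> carrier (free_star_alg (sum_gens A B))"
    unfolding sum_relations_def
    by (intro Un_least hom_relations_closed A.star_algebra_axioms B.star_algebra_axioms inl_closed inr_closed)
  have "p (gen (Inl x)) \<le> cnorm A x" if "x \<in> carrier A" "respects_relations (sum_gens A B) (sum_relations A B) p" for x p
    by (rule hom_relations_bounded[where \<iota> = "\<lambda>x. gen (Inl x)", OF A.unital_cstar_algebra_axioms inl_closed that(2) _ that(1)])
       (auto simp: sum_relations_def)
  moreover have "p (gen (Inr x)) \<le> cnorm B x" if "x \<in> carrier B" "respects_relations (sum_gens A B) (sum_relations A B) p" for x p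
    by (rule hom_relations_bounded[where \<iota> = "\<lambda>x. gen (Inr x)", OF B.unital_cstar_algebra_axioms inr_closed that(2) _ that(1)])
       (auto simp: sum_relations_def)
  moreover fix g assume "g \<in> sum_gens A B"
  ultimately show "\<exists>b. \<forall>p. respects_relations (sum_gens A B) (sum_relations A B) p \<longrightarrow> p (gen g) \<le> b"
    unfolding sum_gens_def by blast
qed

lemma coproduct_cstar: "unital_cstar_algebra (sum_coproduct A B)"
  using P.universal_unital_cstar_algebra by (simp add: sum_coproduct_def)

lemma sum_inl_hom: "sum_inl A B \<in> star_hom A (sum_coproduct A B)"
  and sum_inr_hom: "sum_inr A B \<in> star_hom B (sum_coproduct A B)"
proof -
  interpret U: unital_cstar_algebra P.U by (rule P.universal_unital_cstar_algebra)
  have "(\<lambda>x. P.free.compl_emb (gen (Inl x))) \<in> star_hom A P.U"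
    using P.universal_relations
    by (subst hom_relations_iff[OF A.star_algebra_axioms U.star_algebra_axioms P.universal_emb inl_closed, symmetric])
       (auto simp: sum_relations_def)
  then show "sum_inl A B \<in> star_hom A (sum_coproduct A B)"
    by (simp add: sum_inl_def[abs_def] sum_coproduct_def P.universal_gen_eq)
  have "(\<lambda>x. P.free.compl_emb (gen (Inr x))) \<in> star_hom B P.U"
    using P.universal_relations
    by (subst hom_relations_iff[OF B.star_algebra_axioms U.star_algebra_axioms P.universal_emb inr_closed, symmetric])
       (auto simp: sum_relations_def)
  then show "sum_inr A B \<in> star_hom B (sum_coproduct A B)"
    by (simp add: sum_inr_def[abs_def] sum_coproduct_def P.universal_gen_eq)
qed

lemma coproduct_hom_exists:
  assumes C: "unital_cstar_algebra C" and f: "f \<in> star_hom A C" and g: "g \<in> star_hom B C"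
  obtains H where "H \<in> star_hom (sum_coproduct A B) C"
    "\<And>x. x \<in> carrier A \<Longrightarrow> H (sum_inl A B x) = f x" "\<And>y. y \<in> carrier B \<Longrightarrow> H (sum_inr A B y) = g y"
proof -
  interpret C: unital_cstar_algebra C by fact
  have "case_sum f g x \<in> carrier C" if "x \<in> sum_gens A B" for x
    using that star_hom_closed[OF f] star_hom_closed[OF g] by (auto simp: sum_gens_def)
  from C.free_eval_exists[of "sum_gens A B" "case_sum f g", OF this]
  obtain e where e: "e \<in> star_hom (free_star_alg (sum_gens A B)) C" "\<And>x. x \<in> sum_gens A B \<Longrightarrow> e (gen x) = case_sum f g x"
    by blast
  have el: "e (gen (Inl x)) = f x" if "x \<in> carrier A" for x using e(2)[of "Inl x"] that by (simp add: sum_gens_def)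
  have er: "e (gen (Inr x)) = g x" if "x \<in> carrier B" for x using e(2)[of "Inr x"] that by (simp add: sum_gens_def)
  have "(\<lambda>x. e (gen (Inl x))) \<in> star_hom A C"
    using star_homD[OF f] by (intro star_homI) (auto simp: el A.scale_closed A.star_closed)
  moreover have "(\<lambda>x. e (gen (Inr x))) \<in> star_hom B C"
    using star_homD[OF g] by (intro star_homI) (auto simp: er B.scale_closed B.star_closed)
  ultimately have "\<forall>r\<in>sum_relations A B. e r = \<zero>\<^bsub>C\<^esub>"
    unfolding sum_relations_def ball_Un
    using hom_relations_iff[where \<iota> = "\<lambda>x. gen (Inl x)", OF A.star_algebra_axioms C.star_algebra_axioms e(1) inl_closed]
      hom_relations_iff[where \<iota> = "\<lambda>x. gen (Inr x)", OF B.star_algebra_axioms C.star_algebra_axioms e(1) inr_closed]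
    by simp
  then obtain H where H: "H \<in> star_hom P.U C" "\<And>x. x \<in> sum_gens A B \<Longrightarrow> H (universal_gen (sum_gens A B) (sum_relations A B) x) = e (gen x)"
    using P.universal_hom_exists[OF C e(1)] by metis
  show ?thesis
    by (rule that[of H]) (use H el er in \<open>auto simp: sum_coproduct_def sum_inl_def sum_inr_def sum_gens_def\<close>)
qed

lemma coproduct_hom_eq:
  assumes C: "unital_cstar_algebra C" and f: "f \<in> star_hom (sum_coproduct A B) C" and g: "g \<in> star_hom (sum_coproduct A B) C"
    and l: "\<And>x. x \<in> carrier A \<Longrightarrow> f (sum_inl A B x) = g (sum_inl A B x)"
    and r: "\<And>x. x \<in> carrier B \<Longrightarrow> f (sum_inr A B x) = g (sum_inr A B x)"
    and c: "c \<in> carrier (sum_coproduct A B)"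
  shows "f c = g c"
  using P.universal_hom_eq[OF C f[unfolded sum_coproduct_def] g[unfolded sum_coproduct_def]] l r c
  by (auto simp: sum_gens_def sum_inl_def sum_inr_def sum_coproduct_def)

end

locale cstar_family =
  fixes I :: "'i set" and A :: "'i \<Rightarrow> 'a cstar_alg"
  assumes cstar: "i \<in> I \<Longrightarrow> unital_cstar_algebra (A i)"
begin

lemma star_alg: "i \<in> I \<Longrightarrow> star_algebra (A i)"
  using cstar by (simp add: unital_cstar_algebra_def)

lemma in_closed: "i \<in> I \<Longrightarrow> x \<in> carrier (A i) \<Longrightarrow> gen (i, x) \<in> carrier (free_star_alg (family_gens I A))"
  by (simp add: free_carrier_gen family_gens_def)

sublocale P: presentation "family_gens I A" "family_relations I A"
proof
  show "family_relations I A \<subseteq> carrier (free_star_alg (family_gens I A))"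
    unfolding family_relations_def by (intro UN_least hom_relations_closed star_alg in_closed)
  fix g assume "g \<in> family_gens I A"
  then obtain i x where g: "g = (i, x)" "i \<in> I" "x \<in> carrier (A i)" by (auto simp: family_gens_def)
  have "hom_relations (A i) (\<lambda>x. gen (i, x)) \<subseteq> family_relations I A"
    using g by (auto simp: family_relations_def)
  from hom_relations_bounded[OF cstar in_closed _ this g(3)] g
  show "\<exists>b. \<forall>p. respects_relations (family_gens I A) (family_relations I A) p \<longrightarrow> p (gen g) \<le> b" by blast
qed

lemma family_cstar: "unital_cstar_algebra (family_coproduct I A)"
  using P.universal_unital_cstar_algebra by (simp add: family_coproduct_def)

lemma family_in_hom: assumes "i \<in> I" shows "family_in I A i \<in> star_hom (A i) (family_coproduct I A)"
proof -
  interpret U: unital_cstar_algebra P.U by (rule P.universal_unital_cstar_algebra)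
  have "(\<lambda>x. P.free.compl_emb (gen (i, x))) \<in> star_hom (A i) P.U"
    using P.universal_relations assms
    by (subst hom_relations_iff[OF star_alg[OF assms] U.star_algebra_axioms P.universal_emb in_closed, symmetric])
       (auto simp: family_relations_def)
  then show ?thesis by (simp add: family_in_def[abs_def] family_coproduct_def P.universal_gen_eq)
qed

lemma family_hom_exists:
  assumes C: "unital_cstar_algebra C" and f: "\<And>i. i \<in> I \<Longrightarrow> f i \<in> star_hom (A i) C"
  obtains H where "H \<in> star_hom (family_coproduct I A) C"
    "\<And>i x. i \<in> I \<Longrightarrow> x \<in> carrier (A i) \<Longrightarrow> H (family_in I A i x) = f i x"
proof -
  interpret C: unital_cstar_algebra C by fact
  have "(\<lambda>(i, x). f i x) x \<in> carrier C" if "x \<in> family_gens I A" for x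
    using that star_hom_closed[OF f] by (auto simp: family_gens_def)
  from C.free_eval_exists[of "family_gens I A" "\<lambda>(i, x). f i x", OF this]
  obtain e where e: "e \<in> star_hom (free_star_alg (family_gens I A)) C"
    "\<And>x. x \<in> family_gens I A \<Longrightarrow> e (gen x) = (\<lambda>(i, x). f i x) x"
    by blast
  have ei: "e (gen (i, x)) = f i x" if "i \<in> I" "x \<in> carrier (A i)" for i x
    using e(2)[of "(i, x)"] that by (simp add: family_gens_def)
  have "(\<lambda>x. e (gen (i, x))) \<in> star_hom (A i) C" if i: "i \<in> I" for i
  proof -
    interpret Ai: star_algebra "A i" by (rule star_alg[OF i])
    show ?thesis
      using star_homD[OF f[OF i]] by (intro star_homI) (auto simp: ei i Ai.scale_closed Ai.star_closed)
  qed
  then have "\<forall>r\<in>family_relations I A. e r = \<zero>\<^bsub>C\<^esub>"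
    unfolding family_relations_def
    using hom_relations_iff[where \<iota> = "\<lambda>x. gen (i, x)" for i, OF star_alg C.star_algebra_axioms e(1) in_closed]
    by simp
  then obtain H where H: "H \<in> star_hom P.U C" "\<And>x. x \<in> family_gens I A \<Longrightarrow> H (universal_gen (family_gens I A) (family_relations I A) x) = e (gen x)"
    using P.universal_hom_exists[OF C e(1)] by metis
  show ?thesis
    by (rule that[of H]) (use H ei in \<open>auto simp: family_coproduct_def family_in_def family_gens_def\<close>)
qed

lemma family_hom_eq:
  assumes C: "unital_cstar_algebra C" and f: "f \<in> star_hom (family_coproduct I A) C" and g: "g \<in> star_hom (family_coproduct I A) C"
    and eq: "\<And>i x. i \<in> I \<Longrightarrow> x \<in> carrier (A i) \<Longrightarrow> f (family_in I A i x) = g (family_in I A i x)"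
    and c: "c \<in> carrier (family_coproduct I A)"
  shows "f c = g c"
  using P.universal_hom_eq[OF C f[unfolded family_coproduct_def] g[unfolded family_coproduct_def]] eq c
  by (auto simp: family_gens_def family_in_def family_coproduct_def)

end

section \<open>Closed ideals and homomorphisms out of quotients\<close>

lemma (in star_algebra) minus_diff:
  "\<lbrakk>x \<in> carrier A; y \<in> carrier A\<rbrakk> \<Longrightarrow> \<ominus> (x \<ominus> y) = y \<ominus> x"
  by (simp add: minus_eq minus_add a_comm)

lemma (in star_algebra) idealI':
  assumes J: "J \<subseteq> carrier A" "\<zero> \<in> J" and add: "\<And>x y. x \<in> J \<Longrightarrow> y \<in> J \<Longrightarrow> x \<oplus> y \<in> J"
    and l: "\<And>x a. a \<in> J \<Longrightarrow> x \<in> carrier A \<Longrightarrow> x \<otimes> a \<in> J" and r: "\<And>x a. a \<in> J \<Longrightarrow> x \<in> carrier A \<Longrightarrow> a \<otimes> x \<in> J"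
  shows "ideal J A"
proof (rule idealI)
  show "subgroup J (add_monoid A)"
  proof (rule add.subgroupI)
    fix a assume a: "a \<in> J"
    then have "(\<ominus> \<one>) \<otimes> a = \<ominus> a" using J by (simp add: l_minus subsetD)
    then show "\<ominus> a \<in> J" using l[OF a, of "\<ominus> \<one>"] by simp
  qed (use J add in auto)
qed (use l r ring_axioms in auto)

context unital_cstar_algebra
begin

lemma closed_ideal_carrier: "closed_ideal (carrier A) A"
  unfolding closed_ideal_def by (auto intro: idealI')

lemma closed_ideal_kernel:
  assumes B: "unital_cstar_algebra B" and h: "h \<in> star_hom A B"
  shows "closed_ideal {x \<in> carrier A. h x = \<zero>\<^bsub>B\<^esub>} A"
  unfolding closed_ideal_def
proof (intro conjI allI ballI impI)
  interpret B: unital_cstar_algebra B by fact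
  note hs = star_homD[OF h]
  show "ideal {x \<in> carrier A. h x = \<zero>\<^bsub>B\<^esub>} A"
    using star_hom_zero[OF star_algebra_axioms B.star_algebra_axioms h]
    by (intro idealI') (auto simp: hs)
  fix s x assume x: "x \<in> carrier A" and s: "(\<forall>n. s n \<in> {x \<in> carrier A. h x = \<zero>\<^bsub>B\<^esub>}) \<and> (\<lambda>n. cnorm A (s n \<ominus> x)) \<longlonglongrightarrow> 0"
  then have "tends s x" by (simp add: tends_def)
  from star_hom_tends[OF unital_cstar_algebra_axioms B h this]
  have "B.tends (\<lambda>n. \<zero>\<^bsub>B\<^esub>) (h x)" using s by simp
  then have "h x = \<zero>\<^bsub>B\<^esub>" using B.tends_unique B.tends_const B.zero_closed by blast
  then show "x \<in> {x \<in> carrier A. h x = \<zero>\<^bsub>B\<^esub>}" using x by simp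
qed

lemma closed_ideal_limit:
  assumes "closed_ideal J A" "\<And>n. s n \<in> J" "tends s x" shows "x \<in> J"
proof -
  have "\<forall>x\<in>carrier A. (\<forall>n. s n \<in> J) \<and> (\<lambda>n. cnorm A (s n \<ominus> x)) \<longlonglongrightarrow> 0 \<longrightarrow> x \<in> J"
    using assms(1) unfolding closed_ideal_def by (elim conjE) (erule spec)
  moreover have "x \<in> carrier A" "(\<lambda>n. cnorm A (s n \<ominus> x)) \<longlonglongrightarrow> 0"
    using assms(3) unfolding tends_def by blast+
  ultimately show ?thesis using assms(2) by blast
qed

text \<open>Serves minimality: if the adjoints of the generators lie in the generated closed ideal,
  that ideal is contained in its own adjoint.\<close>

lemma closed_ideal_star: assumes "closed_ideal J A" shows "closed_ideal {x \<in> carrier A. star A x \<in> J} A"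
  unfolding closed_ideal_def
proof (intro conjI allI ballI impI)
  interpret J: ideal J A using assms by (simp add: closed_ideal_def)
  show "ideal {x \<in> carrier A. star A x \<in> J} A"
    by (intro idealI') (auto simp: star_add star_mult star_closed J.I_l_closed J.I_r_closed)
  fix s x assume x: "x \<in> carrier A" and s: "(\<forall>n. s n \<in> {x \<in> carrier A. star A x \<in> J}) \<and> (\<lambda>n. cnorm A (s n \<ominus> x)) \<longlonglongrightarrow> 0"
  then have "tends (\<lambda>n. star A (s n)) (star A x)" by (intro tends_star) (simp add: tends_def)
  then have "star A x \<in> J" by (rule closed_ideal_limit[OF assms, rotated]) (use s in auto)
  then show "x \<in> {x \<in> carrier A. star A x \<in> J}" using x by simp
qed

lemma closed_ideal_generated_least: "closed_ideal J A \<Longrightarrow> S \<subseteq> J \<Longrightarrow> closed_ideal_generated A S \<subseteq> J"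
  unfolding closed_ideal_generated_def by blast

lemma closed_ideal_generated_superset: "S \<subseteq> closed_ideal_generated A S"
  unfolding closed_ideal_generated_def by blast

lemma closed_ideal_generated_closed:
  assumes "S \<subseteq> carrier A" shows "closed_ideal (closed_ideal_generated A S) A"
proof -
  have ne: "{J. closed_ideal J A \<and> S \<subseteq> J} \<noteq> {}" using closed_ideal_carrier assms by blast
  have "ideal (closed_ideal_generated A S) A"
    unfolding closed_ideal_generated_def using ne by (intro i_Intersect) (auto simp: closed_ideal_def)
  moreover have "x \<in> closed_ideal_generated A S"
    if "x \<in> carrier A" "\<forall>n. s n \<in> closed_ideal_generated A S" "(\<lambda>n. cnorm A (s n \<ominus> x)) \<longlonglongrightarrow> 0" for s x
    unfolding closed_ideal_generated_def
  proof (rule InterI)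
    fix J assume J: "J \<in> {J. closed_ideal J A \<and> S \<subseteq> J}"
    then have "\<forall>n. s n \<in> J" using that(2) unfolding closed_ideal_generated_def by blast
    then show "x \<in> J" using J that(1,3) unfolding closed_ideal_def by blast
  qed
  ultimately show ?thesis unfolding closed_ideal_def by blast
qed

lemma closed_ideal_generated_star:
  assumes S: "S \<subseteq> carrier A" and star: "\<And>s. s \<in> S \<Longrightarrow> star A s \<in> closed_ideal_generated A S"
  shows "closed_star_ideal A (closed_ideal_generated A S)"
proof (intro closed_star_ideal.intro closed_star_ideal_axioms.intro unital_cstar_algebra_axioms)
  note c = closed_ideal_generated_closed[OF S]
  show "closed_ideal (closed_ideal_generated A S) A" by (rule c)
  have "closed_ideal_generated A S \<subseteq> {x \<in> carrier A. star A x \<in> closed_ideal_generated A S}"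
    using S star by (intro closed_ideal_generated_least closed_ideal_star c) auto
  then show "star A x \<in> closed_ideal_generated A S" if "x \<in> closed_ideal_generated A S" for x
    using that by blast
qed

end

context closed_star_ideal
begin

lemma quotient_hom_exists:
  assumes B: "unital_cstar_algebra B" and k: "k \<in> star_hom A B" and J: "\<And>x. x \<in> J \<Longrightarrow> k x = \<zero>\<^bsub>B\<^esub>"
  obtains H where "H \<in> star_hom AJ B" "\<And>x. x \<in> carrier A \<Longrightarrow> H (J +> x) = k x"
proof -
  interpret B: unital_cstar_algebra B by fact
  define H where "H C = k (SOME x. x \<in> C)" for C
  have H: "H (J +> x) = k x" if x: "x \<in> carrier A" for x
  proof -
    define y where "y = (SOME y. y \<in> J +> x)"
    have "y \<in> J +> x" unfolding y_def by (rule someI[of "\<lambda>y. y \<in> J +> x", OF J.a_rcos_self[OF x]])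
    then obtain j where j: "j \<in> J" "y = j \<oplus> x" by (auto simp: coset_eq)
    then have "k y = k x"
      using x J[OF j(1)] star_hom_add[OF k, of j x] star_hom_closed[OF k x] by simp
    then show ?thesis by (simp add: H_def y_def)
  qed
  note ch = star_hom_mult[OF coset_star_hom, symmetric] star_hom_add[OF coset_star_hom, symmetric]
    star_hom_one[OF coset_star_hom, symmetric] star_hom_scale[OF coset_star_hom, symmetric]
    star_hom_star[OF coset_star_hom, symmetric]
  have "H \<in> star_hom AJ B"
    by (rule star_homI) (auto simp: quotient_carrier ch H star_homD[OF k] scale_closed star_closed)
  then show ?thesis using that H by blast
qed

end

section \<open>The free wreath product and its universal property\<close>

locale wreath =
  fixes P :: "('i, 'a) qpg" and Q :: "('k, 'b) qpg"
  assumes P_magic: "magic (qalg P) (points P) (points P) (fund P)"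
    and Q_magic: "magic (qalg Q) (points Q) (points Q) (fund Q)"
begin

sublocale p: magic "qalg P" "points P" "points P" "fund P" by (rule P_magic)
sublocale q: magic "qalg Q" "points Q" "points Q" "fund Q" by (rule Q_magic)

sublocale copies: cstar_family "points Q" "\<lambda>_. qalg P"
  by unfold_locales

sublocale cover: cstar_pair "wreath_copies P Q" "qalg Q"
  by (intro cstar_pair.intro) (use copies.family_cstar q.unital_cstar_algebra_axioms in \<open>simp_all add: wreath_copies_def\<close>)

sublocale W: unital_cstar_algebra "wreath_cover P Q"
  using cover.coproduct_cstar by (simp add: wreath_cover_def)

definition hu :: "'k \<Rightarrow> 'a \<Rightarrow> (('k \<times> 'a) universal + 'b) universal" where
  "hu a x = sum_inl (wreath_copies P Q) (qalg Q) (family_in (points Q) (\<lambda>_. qalg P) a x)"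

lemma hu_hom: assumes "a \<in> points Q" shows "hu a \<in> star_hom (qalg P) (wreath_cover P Q)"
  using star_hom_comp[OF copies.family_in_hom[OF assms] cover.sum_inl_hom[unfolded wreath_copies_def]]
  by (simp add: hu_def[abs_def] comp_def wreath_cover_def wreath_copies_def)

abbreviation "hv \<equiv> sum_inr (wreath_copies P Q) (qalg Q)"

lemma hv_hom: "hv \<in> star_hom (qalg Q) (wreath_cover P Q)"
  using cover.sum_inr_hom by (simp add: wreath_cover_def)

lemma wreath_u_eq: "wreath_u P Q a i j = hu a (fund P i j)"
  by (simp add: wreath_u_def hu_def)

lemma wreath_v_eq: "wreath_v P Q a b = hv (fund Q a b)"
  by (simp add: wreath_v_def)

abbreviation "J \<equiv> wreath_ideal P Q"

definition commutators :: "(('k \<times> 'a) universal + 'b) universal set" where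
  "commutators = {wreath_u P Q a i j \<otimes>\<^bsub>wreath_cover P Q\<^esub> wreath_v P Q a b \<ominus>\<^bsub>wreath_cover P Q\<^esub>
      wreath_v P Q a b \<otimes>\<^bsub>wreath_cover P Q\<^esub> wreath_u P Q a i j | i j a b.
      i \<in> points P \<and> j \<in> points P \<and> a \<in> points Q \<and> b \<in> points Q}"

lemma J_eq: "J = closed_ideal_generated (wreath_cover P Q) commutators"
  by (simp add: wreath_ideal_def commutators_def)

lemma wreath_u_closed: "a \<in> points Q \<Longrightarrow> i \<in> points P \<Longrightarrow> j \<in> points P \<Longrightarrow> wreath_u P Q a i j \<in> carrier (wreath_cover P Q)"
  unfolding wreath_u_eq by (intro star_hom_closed[OF hu_hom]) auto

lemma wreath_v_closed: "a \<in> points Q \<Longrightarrow> b \<in> points Q \<Longrightarrow> wreath_v P Q a b \<in> carrier (wreath_cover P Q)"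
  unfolding wreath_v_eq by (intro star_hom_closed[OF hv_hom]) auto

sublocale Quo: closed_star_ideal "wreath_cover P Q" J
proof -
  have S: "commutators \<subseteq> carrier (wreath_cover P Q)"
    unfolding commutators_def by (auto intro!: W.minus_closed W.m_closed wreath_u_closed wreath_v_closed)
  have star: "star (wreath_cover P Q) s \<in> closed_ideal_generated (wreath_cover P Q) commutators" if s: "s \<in> commutators" for s
  proof -
    interpret I: ideal "closed_ideal_generated (wreath_cover P Q) commutators" "wreath_cover P Q"
      using W.closed_ideal_generated_closed[OF S] by (simp add: closed_ideal_def)
    obtain i j a b where ij: "i \<in> points P" "j \<in> points P" "a \<in> points Q" "b \<in> points Q"
      and s_eq: "s = wreath_u P Q a i j \<otimes>\<^bsub>wreath_cover P Q\<^esub> wreath_v P Q a b \<ominus>\<^bsub>wreath_cover P Q\<^esub>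
        wreath_v P Q a b \<otimes>\<^bsub>wreath_cover P Q\<^esub> wreath_u P Q a i j"
      using s unfolding commutators_def by blast
    have "star (wreath_cover P Q) (wreath_u P Q a i j) = wreath_u P Q a i j"
      using star_hom_star[OF hu_hom[OF ij(3)], of "fund P i j"] p.u_star ij by (simp add: wreath_u_eq)
    moreover have "star (wreath_cover P Q) (wreath_v P Q a b) = wreath_v P Q a b"
      using star_hom_star[OF hv_hom, of "fund Q a b"] q.u_star ij by (simp add: wreath_v_eq)
    \<comment> \<open>A commutator of self-adjoint elements is skew-adjoint, so the generating set
      is stable under the adjoint up to sign.\<close>
    ultimately have "star (wreath_cover P Q) s = \<ominus>\<^bsub>wreath_cover P Q\<^esub> s"
      using wreath_u_closed wreath_v_closed ij unfolding s_eq
      by (simp add: W.star_diff W.star_mult W.minus_diff)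
    then show ?thesis using W.closed_ideal_generated_superset s by auto
  qed
  show "closed_star_ideal (wreath_cover P Q) J"
    unfolding J_eq by (rule W.closed_ideal_generated_star[OF S star])
qed

abbreviation "wr \<equiv> qalg (free_wreath P Q)"

lemma wr_eq: "wr = Quo.AJ"
  by (simp add: free_wreath_def)

sublocale wr: unital_cstar_algebra wr
  unfolding wr_eq by (rule Quo.quotient_unital_cstar_algebra)

text \<open>The canonical map from the a-th copy of the algebra of \<open>P\<close>;
  \<open>Hv\<close> is the one from the algebra of \<open>Q\<close>.\<close>

definition Hu :: "'k \<Rightarrow> 'a \<Rightarrow> (('k \<times> 'a) universal + 'b) universal set" where
  "Hu a x = J +>\<^bsub>wreath_cover P Q\<^esub> hu a x"

definition Hv :: "'b \<Rightarrow> (('k \<times> 'a) universal + 'b) universal set" where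
  "Hv x = J +>\<^bsub>wreath_cover P Q\<^esub> hv x"

lemma Hu_hom: "a \<in> points Q \<Longrightarrow> Hu a \<in> star_hom (qalg P) wr"
  using star_hom_comp[OF hu_hom Quo.coset_star_hom] by (simp add: Hu_def[abs_def] comp_def wr_eq)

lemma Hv_hom: "Hv \<in> star_hom (qalg Q) wr"
  using star_hom_comp[OF hv_hom Quo.coset_star_hom] by (simp add: Hv_def[abs_def] comp_def wr_eq)

lemma wreath_fund:
  assumes "a \<in> points Q" "b \<in> points Q" "i \<in> points P" "j \<in> points P"
  shows "fund (free_wreath P Q) (a, i) (b, j) = Hu a (fund P i j) \<otimes>\<^bsub>wr\<^esub> Hv (fund Q a b)"
  using star_hom_mult[OF Quo.coset_star_hom wreath_u_closed wreath_v_closed] assms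
  by (simp add: free_wreath_def Hu_def Hv_def wreath_u_eq wreath_v_eq)

lemma wreath_commute:
  assumes "a \<in> points Q" "b \<in> points Q" "i \<in> points P" "j \<in> points P"
  shows "Hu a (fund P i j) \<otimes>\<^bsub>wr\<^esub> Hv (fund Q a b) = Hv (fund Q a b) \<otimes>\<^bsub>wr\<^esub> Hu a (fund P i j)"
proof -
  let ?U = "wreath_u P Q a i j" and ?V = "wreath_v P Q a b"
  note c = wreath_u_closed[OF assms(1,3,4)] wreath_v_closed[OF assms(1,2)]
  have "?U \<otimes>\<^bsub>wreath_cover P Q\<^esub> ?V \<ominus>\<^bsub>wreath_cover P Q\<^esub> ?V \<otimes>\<^bsub>wreath_cover P Q\<^esub> ?U \<in> commutators"
    unfolding commutators_def using assms by blast
  then have "?U \<otimes>\<^bsub>wreath_cover P Q\<^esub> ?V \<ominus>\<^bsub>wreath_cover P Q\<^esub> ?V \<otimes>\<^bsub>wreath_cover P Q\<^esub> ?U \<in> J"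
    unfolding J_eq by (rule subsetD[OF W.closed_ideal_generated_superset])
  then have "J +>\<^bsub>wreath_cover P Q\<^esub> (?U \<otimes>\<^bsub>wreath_cover P Q\<^esub> ?V) = J +>\<^bsub>wreath_cover P Q\<^esub> (?V \<otimes>\<^bsub>wreath_cover P Q\<^esub> ?U)"
    using c by (subst Quo.coset_cong_iff) auto
  then show ?thesis
    using star_hom_mult[OF Quo.coset_star_hom c] star_hom_mult[OF Quo.coset_star_hom c(2,1)]
    by (simp add: wr_eq Hu_def Hv_def wreath_u_eq wreath_v_eq)
qed

text \<open>The maps are glued over the copies, then with the one on \<open>Q\<close>, and finally
  passed to the quotient. The kernel of the glued map is a closed ideal containing the commutators,
  hence the whole wreath ideal.\<close>

lemma wreath_hom_exists:
  assumes C: "unital_cstar_algebra C" and f: "\<And>a. a \<in> points Q \<Longrightarrow> f a \<in> star_hom (qalg P) C"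
    and g: "g \<in> star_hom (qalg Q) C"
    and comm: "\<And>a b i j. \<lbrakk>a \<in> points Q; b \<in> points Q; i \<in> points P; j \<in> points P\<rbrakk> \<Longrightarrow>
      f a (fund P i j) \<otimes>\<^bsub>C\<^esub> g (fund Q a b) = g (fund Q a b) \<otimes>\<^bsub>C\<^esub> f a (fund P i j)"
  obtains H where "H \<in> star_hom wr C"
    "\<And>a x. a \<in> points Q \<Longrightarrow> x \<in> carrier (qalg P) \<Longrightarrow> H (Hu a x) = f a x"
    "\<And>x. x \<in> carrier (qalg Q) \<Longrightarrow> H (Hv x) = g x"
proof -
  interpret C: unital_cstar_algebra C by fact
  obtain h where h: "h \<in> star_hom (wreath_copies P Q) C"
    "\<And>a x. a \<in> points Q \<Longrightarrow> x \<in> carrier (qalg P) \<Longrightarrow> h (family_in (points Q) (\<lambda>_. qalg P) a x) = f a x"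
    using copies.family_hom_exists[where f = f, OF C f] unfolding wreath_copies_def by metis
  obtain k where k: "k \<in> star_hom (wreath_cover P Q) C"
    "\<And>x. x \<in> carrier (wreath_copies P Q) \<Longrightarrow> k (sum_inl (wreath_copies P Q) (qalg Q) x) = h x"
    "\<And>x. x \<in> carrier (qalg Q) \<Longrightarrow> k (hv x) = g x"
    using cover.coproduct_hom_exists[OF C h(1) g] unfolding wreath_cover_def by metis
  have ku: "k (hu a x) = f a x" if "a \<in> points Q" "x \<in> carrier (qalg P)" for a x
    using that k(2) h(2) star_hom_closed[OF copies.family_in_hom[OF that(1)] that(2)]
    by (simp add: hu_def wreath_copies_def)
  have "J \<subseteq> {x \<in> carrier (wreath_cover P Q). k x = \<zero>\<^bsub>C\<^esub>}"
    unfolding J_eq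
  proof (rule W.closed_ideal_generated_least[OF W.closed_ideal_kernel[OF C k(1)]], rule subsetI)
    fix s assume "s \<in> commutators"
    then obtain i j a b where ij: "i \<in> points P" "j \<in> points P" "a \<in> points Q" "b \<in> points Q"
      and s: "s = wreath_u P Q a i j \<otimes>\<^bsub>wreath_cover P Q\<^esub> wreath_v P Q a b \<ominus>\<^bsub>wreath_cover P Q\<^esub>
        wreath_v P Q a b \<otimes>\<^bsub>wreath_cover P Q\<^esub> wreath_u P Q a i j"
      unfolding commutators_def by blast
    have c: "wreath_u P Q a i j \<in> carrier (wreath_cover P Q)" "wreath_v P Q a b \<in> carrier (wreath_cover P Q)"
      using ij wreath_u_closed wreath_v_closed by auto
    have "k s = k (wreath_u P Q a i j) \<otimes>\<^bsub>C\<^esub> k (wreath_v P Q a b) \<ominus>\<^bsub>C\<^esub> k (wreath_v P Q a b) \<otimes>\<^bsub>C\<^esub> k (wreath_u P Q a i j)"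
      unfolding s using c
      by (simp add: star_hom_diff[OF W.star_algebra_axioms C.star_algebra_axioms k(1)] star_hom_mult[OF k(1)])
    also have "\<dots> = \<zero>\<^bsub>C\<^esub>"
      using ij comm[of a b i j] star_hom_closed[OF f] star_hom_closed[OF g]
      by (simp add: wreath_u_eq wreath_v_eq ku k(3))
    finally show "s \<in> {x \<in> carrier (wreath_cover P Q). k x = \<zero>\<^bsub>C\<^esub>}" using c s by simp
  qed
  then obtain H where H: "H \<in> star_hom Quo.AJ C"
    "\<And>x. x \<in> carrier (wreath_cover P Q) \<Longrightarrow> H (J +>\<^bsub>wreath_cover P Q\<^esub> x) = k x"
    using Quo.quotient_hom_exists[OF C k(1)] by blast
  show ?thesis
    by (rule that[of H])
       (use H ku k(3) star_hom_closed[OF hu_hom] star_hom_closed[OF hv_hom] in \<open>auto simp: wr_eq Hu_def Hv_def\<close>)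
qed

lemma wreath_hom_eq:
  assumes C: "unital_cstar_algebra C" and f: "f \<in> star_hom wr C" and g: "g \<in> star_hom wr C"
    and u: "\<And>a x. a \<in> points Q \<Longrightarrow> x \<in> carrier (qalg P) \<Longrightarrow> f (Hu a x) = g (Hu a x)"
    and v: "\<And>x. x \<in> carrier (qalg Q) \<Longrightarrow> f (Hv x) = g (Hv x)" and c: "c \<in> carrier wr"
  shows "f c = g c"
proof -
  let ?pr = "\<lambda>x. J +>\<^bsub>wreath_cover P Q\<^esub> x"
  have fh: "f \<circ> ?pr \<in> star_hom (wreath_cover P Q) C" "g \<circ> ?pr \<in> star_hom (wreath_cover P Q) C"
    using star_hom_comp[OF Quo.coset_star_hom] f g by (auto simp: wr_eq)
  note fi = star_hom_comp[OF cover.sum_inl_hom fh(1)[unfolded wreath_cover_def]]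
    and gi = star_hom_comp[OF cover.sum_inl_hom fh(2)[unfolded wreath_cover_def]]
  have l: "(f \<circ> ?pr) (sum_inl (wreath_copies P Q) (qalg Q) x) = (g \<circ> ?pr) (sum_inl (wreath_copies P Q) (qalg Q) x)"
    if x: "x \<in> carrier (wreath_copies P Q)" for x
    using copies.family_hom_eq[OF C fi[unfolded wreath_copies_def] gi[unfolded wreath_copies_def] _ x[unfolded wreath_copies_def]] u
    by (auto simp: Hu_def hu_def wreath_cover_def wreath_copies_def)
  have eq: "(f \<circ> ?pr) x = (g \<circ> ?pr) x" if x: "x \<in> carrier (wreath_cover P Q)" for x
    using cover.coproduct_hom_eq[OF C fh[unfolded wreath_cover_def] _ _ x[unfolded wreath_cover_def]] l v
    by (auto simp: Hv_def wreath_cover_def)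
  obtain x where "x \<in> carrier (wreath_cover P Q)" "c = ?pr x"
    using c unfolding wr_eq Quo.quotient_carrier by blast
  then show ?thesis using eq by simp
qed

end

section \<open>Corners\<close>

text \<open>The algebra pAp, described as the elements fixed by p on both sides, with unit p. It
  keeps the element type of A; corners of \<open>Qut Y\<close> thus live in the very type that
  \<open>quantum_isomorphic\<close> prescribes for subgraphs of Y.\<close>

definition corner :: "('a, 'm) cstar_alg_scheme \<Rightarrow> 'a \<Rightarrow> ('a, 'm) cstar_alg_scheme" where
  "corner A p = A\<lparr>carrier := {x \<in> carrier A. p \<otimes>\<^bsub>A\<^esub> x = x \<and> x \<otimes>\<^bsub>A\<^esub> p = x}, one := p\<rparr>"

lemma corner_simps [simp]:
  "carrier (corner A p) = {x \<in> carrier A. p \<otimes>\<^bsub>A\<^esub> x = x \<and> x \<otimes>\<^bsub>A\<^esub> p = x}"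
  "mult (corner A p) = mult A" "one (corner A p) = p" "zero (corner A p) = zero A" "add (corner A p) = add A"
  "scale (corner A p) = scale A" "star (corner A p) = star A" "cnorm (corner A p) = cnorm A"
  by (simp_all add: corner_def)

locale cstar_corner = unital_cstar_algebra A for A :: "('a, 'm) cstar_alg_scheme" (structure) +
  fixes p assumes p: "projection p"
begin

lemma p_closed: "p \<in> carrier A" and p_idem: "p \<otimes> p = p" and p_star': "star A p = p"
  using p by (auto simp: projection_def)

lemma corner_star_algebra: "star_algebra (corner A p)"
proof (intro star_algebra.intro star_algebra_axioms.intro ringI abelian_groupI Group.monoidI)
  show "\<exists>y\<in>carrier (corner A p). y \<oplus>\<^bsub>corner A p\<^esub> x = \<zero>\<^bsub>corner A p\<^esub>" if "x \<in> carrier (corner A p)" for x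
    using that p_closed by (intro bexI[of _ "\<ominus> x"]) (auto simp: l_neg r_minus l_minus)
  show "star (corner A p) x \<in> carrier (corner A p)" if "x \<in> carrier (corner A p)" for x
    using that p_closed p_star' star_mult[of p x] star_mult[of x p] by (auto simp: star_closed)
  show "x \<otimes>\<^bsub>corner A p\<^esub> y \<in> carrier (corner A p)" if "x \<in> carrier (corner A p)" "y \<in> carrier (corner A p)" for x y
    using that p_closed m_assoc[of p x y] m_assoc[of x y p] by auto
qed (use p_closed p_idem in \<open>auto simp: a_ac m_assoc l_distr r_distr scale_closed scale_add_right scale_add_left scale_scale
       scale_one scale_mult_left scale_mult_right star_star star_add star_scale star_mult\<close>)

text \<open>Negatives are chosen inside the carrier, so subtraction has to be compared between the
  two carriers.\<close>

lemma corner_diff: assumes "x \<in> carrier (corner A p)" "y \<in> carrier (corner A p)"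
  shows "x \<ominus>\<^bsub>corner A p\<^esub> y = x \<ominus> y"
proof -
  interpret C: star_algebra "corner A p" by (rule corner_star_algebra)
  have "scale (corner A p) (-1) y = \<ominus>\<^bsub>corner A p\<^esub> y" using assms(2) by (rule C.scale_minus_one)
  then show ?thesis using assms(2) scale_minus_one[of y] by (simp add: a_minus_def)
qed

theorem corner_cstar: "unital_cstar_algebra (corner A p)"
proof (intro unital_cstar_algebra.intro unital_cstar_algebra_axioms.intro corner_star_algebra)
  show "cstar_seminorm (corner A p) (cnorm (corner A p))"
    using seminorm by (auto simp: cstar_seminorm_def)
  show "x = \<zero>\<^bsub>corner A p\<^esub>" if "x \<in> carrier (corner A p)" "cnorm (corner A p) x = 0" for x
    using that definite by simp
  fix s assume s: "s \<in> cauchy_seqs (corner A p) (cnorm (corner A p))"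
  then have c: "s n \<in> carrier (corner A p)" for n by (simp add: cauchy_seqs_def)
  then have "s \<in> cauchy_seqs A (cnorm A)"
    using s corner_diff[OF c c] by (simp add: cauchy_seqs_def)
  then obtain x where x: "tends s x" using cauchy_tends by blast
  have xc: "x \<in> carrier A" using x by (simp add: tends_def)
  have "tends (\<lambda>n. p \<otimes> s n) (p \<otimes> x)" "tends (\<lambda>n. s n \<otimes> p) (x \<otimes> p)"
    using x p_closed by (auto intro!: tends_mult tends_const)
  then have "tends s (p \<otimes> x)" "tends s (x \<otimes> p)" using c by auto
  then have "p \<otimes> x = x" "x \<otimes> p = x" using tends_unique x by auto
  then have xp: "x \<in> carrier (corner A p)" using xc by simp
  have "(\<lambda>n. cnorm A (s n \<ominus> x)) \<longlonglongrightarrow> 0" using x by (simp add: tends_def)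
  then show "\<exists>x\<in>carrier (corner A p). (\<lambda>n. cnorm (corner A p) (s n \<ominus>\<^bsub>corner A p\<^esub> x)) \<longlonglongrightarrow> 0"
    using corner_diff[OF c xp] xp by (intro bexI[of _ x]) auto
qed

lemma corner_finsum:
  assumes "finite I" "\<And>i. i \<in> I \<Longrightarrow> f i \<in> carrier (corner A p)"
  shows "(\<Oplus>\<^bsub>corner A p\<^esub>i\<in>I. f i) = (\<Oplus>i\<in>I. f i)"
  using assms
proof (induction I rule: finite_induct)
  interpret C: star_algebra "corner A p" by (rule corner_star_algebra)
  case empty
  show ?case by simp
next
  interpret C: star_algebra "corner A p" by (rule corner_star_algebra)
  case (insert i I)
  have "(\<Oplus>\<^bsub>corner A p\<^esub>i\<in>insert i I. f i) = f i \<oplus>\<^bsub>corner A p\<^esub> (\<Oplus>\<^bsub>corner A p\<^esub>i\<in>I. f i)"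
    using insert by (intro C.finsum_insert) auto
  moreover have "(\<Oplus>i\<in>insert i I. f i) = f i \<oplus> (\<Oplus>i\<in>I. f i)"
    using insert by (intro finsum_insert) auto
  ultimately show ?case using insert by simp
qed

end

section \<open>Simple graphs\<close>

lemma simple_graph_iff:
  "simple_graph X \<longleftrightarrow> finite (pverts X) \<and> pverts X \<noteq> {} \<and> parcs X \<subseteq> pverts X \<times> pverts X \<and>
     irrefl (parcs X) \<and> sym (parcs X)"
proof
  assume "simple_graph X"
  then interpret pair_graph X by (simp add: simple_graph_def)
  have "sym (parcs X)" using pair_sym_arcs by (simp add: symmetric_def)
  then show "finite (pverts X) \<and> pverts X \<noteq> {} \<and> parcs X \<subseteq> pverts X \<times> pverts X \<and> irrefl (parcs X) \<and> sym (parcs X)"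
    using \<open>simple_graph X\<close> pair_no_loops pair_finite_verts arc_fst_in_verts arc_snd_in_verts
    by (fastforce simp: simple_graph_def irrefl_def)
next
  assume X: "finite (pverts X) \<and> pverts X \<noteq> {} \<and> parcs X \<subseteq> pverts X \<times> pverts X \<and> irrefl (parcs X) \<and> sym (parcs X)"
  then have "finite (parcs X)" by (meson finite_SigmaI finite_subset)
  then have "pair_graph X"
    using X by unfold_locales (auto simp: symmetric_def irrefl_def)
  then show "simple_graph X" using X by (simp add: simple_graph_def)
qed

lemma simple_graphD:
  assumes "simple_graph X"
  shows simple_graph_finite: "finite (pverts X)" and simple_graph_nonempty: "pverts X \<noteq> {}"
    and simple_graph_arcs: "parcs X \<subseteq> pverts X \<times> pverts X" and simple_graph_irrefl: "(x, x) \<notin> parcs X"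
    and simple_graph_sym: "(x, y) \<in> parcs X \<Longrightarrow> (y, x) \<in> parcs X"
  using assms by (auto simp: simple_graph_iff irrefl_def dest: symD)

lemma simple_graph_complement: "simple_graph X \<Longrightarrow> simple_graph (complement X)"
  by (auto simp: simple_graph_iff complement_def irrefl_def sym_def)

lemma rtrancl_on_iff:
  assumes "r \<subseteq> V \<times> V"
  shows "(x, y) \<in> rtrancl_on V r \<longleftrightarrow> x \<in> V \<and> y \<in> V \<and> (x, y) \<in> r\<^sup>*"
proof
  assume "(x, y) \<in> rtrancl_on V r"
  then show "x \<in> V \<and> y \<in> V \<and> (x, y) \<in> r\<^sup>*" by (intro conjI) (erule in_rtrancl_on_in_F rtrancl_on_rtranclI)+
next
  assume "x \<in> V \<and> y \<in> V \<and> (x, y) \<in> r\<^sup>*"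
  moreover have "b \<in> V" if "(a, b) \<in> r" for a b using assms that by blast
  ultimately show "(x, y) \<in> rtrancl_on V r" using rtrancl_consistent_rtrancl_on by metis
qed

text \<open>Reduces the library notion to the plain reflexive transitive closure of the arcs, the
  form in which \<open>invariant_rtrancl\<close> handles connectivity.\<close>

lemma connected_iff:
  assumes "simple_graph X"
  shows "Digraph_Component.connected (with_proj X) \<longleftrightarrow> (\<forall>x\<in>pverts X. \<forall>y\<in>pverts X. (x, y) \<in> (parcs X)\<^sup>*)"
proof -
  have "parcs (mk_symmetric (with_proj X)) = parcs X"
    using simple_graph_sym[OF assms] by (auto simp: mk_symmetric_def)
  then show ?thesis
    using rtrancl_on_iff[OF simple_graph_arcs[OF assms]] simple_graph_nonempty[OF assms]
    by (simp add: Digraph_Component.connected_def strongly_connected_def reachable_def)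
qed

lemma lex_pverts [simp]: "pverts (lex_product X Y) = pverts X \<times> pverts Y"
  by (simp add: lex_product_def)

lemma lex_arc_iff:
  assumes "simple_graph X" "simple_graph Y" "y \<in> pverts Y" "y' \<in> pverts Y" "x \<in> pverts X" "x' \<in> pverts X"
  shows "((x, y), (x', y')) \<in> parcs (lex_product X Y) \<longleftrightarrow> (x, x') \<in> parcs X \<or> x = x' \<and> (y, y') \<in> parcs Y"
  using assms by (auto simp: lex_product_def)

lemma simple_graph_lex: assumes X: "simple_graph X" and Y: "simple_graph Y" shows "simple_graph (lex_product X Y)"
  unfolding simple_graph_iff
proof (intro conjI)
  show "parcs (lex_product X Y) \<subseteq> pverts (lex_product X Y) \<times> pverts (lex_product X Y)"
    using simple_graph_arcs[OF X] simple_graph_arcs[OF Y] by (auto simp: lex_product_def)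
  show "irrefl (parcs (lex_product X Y))"
    using simple_graph_irrefl[OF X] simple_graph_irrefl[OF Y] by (auto simp: lex_product_def irrefl_def)
  show "sym (parcs (lex_product X Y))"
    using simple_graph_sym[OF X] simple_graph_sym[OF Y] by (fastforce simp: lex_product_def intro!: symI)
qed (use simple_graph_finite[OF X] simple_graph_finite[OF Y] simple_graph_nonempty[OF X] simple_graph_nonempty[OF Y] in auto)

section \<open>Free wreath products of quantum automorphism groups\<close>

lemma invariant_image:
  assumes m: "magic A I J u" and B: "unital_cstar_algebra B" and h: "h \<in> star_hom A B"
    and inv: "magic.invariant A I J u f f'"
  shows "magic.invariant B I J (\<lambda>i j. h (u i j)) f f'"
proof -
  interpret magic A I J u by fact
  interpret B: magic B I J "\<lambda>i j. h (u i j)" by (rule magic_image[OF m B h])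
  have "u i j \<otimes>\<^bsub>A\<^esub> u i' j' \<noteq> \<zero>\<^bsub>A\<^esub>"
    if "i \<in> I" "i' \<in> I" "j \<in> J" "j' \<in> J" "h (u i j) \<otimes>\<^bsub>B\<^esub> h (u i' j') \<noteq> \<zero>\<^bsub>B\<^esub>" for i i' j j'
    using that star_hom_mult[OF h, of "u i j" "u i' j'"]
      star_hom_zero[OF star_algebra_axioms B.star_algebra_axioms h] by auto
  then show ?thesis using inv unfolding invariant_def B.invariant_def by blast
qed

text \<open>The universal properties need W = UV to be a quantum automorphism of the lexicographic
  product. A nonzero product of two entries of W forces a nonzero product of the V factors, which
  settles adjacency and equality in X; over equal base points it also forces a nonzero product of
  the U factors, which settles adjacency in Y.\<close>

lemma lex_product_magic:
  fixes A (structure)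
  assumes X: "simple_graph X" and Y: "simple_graph Y"
    and U: "\<And>a. a \<in> pverts X \<Longrightarrow> magic A (pverts Y) (pverts Y) (U a)"
      "\<And>a. a \<in> pverts X \<Longrightarrow> magic.intertwines A (pverts Y) (pverts Y) (U a) Y Y"
    and V: "magic A (pverts X) (pverts X) V" "magic.intertwines A (pverts X) (pverts X) V X X"
    and comm: "\<And>a b i j. \<lbrakk>a \<in> pverts X; b \<in> pverts X; i \<in> pverts Y; j \<in> pverts Y\<rbrakk> \<Longrightarrow> U a i j \<otimes> V a b = V a b \<otimes> U a i j"
  defines "W \<equiv> \<lambda>(a, i) (b, j). U a i j \<otimes> V a b"
  shows "magic A (pverts X \<times> pverts Y) (pverts X \<times> pverts Y) W"
    and "magic.intertwines A (pverts X \<times> pverts Y) (pverts X \<times> pverts Y) W (lex_product X Y) (lex_product X Y)"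
proof -
  interpret V: magic A "pverts X" "pverts X" V by (rule V(1))
  note fin = simple_graph_finite[OF X] simple_graph_finite[OF Y]
  have Uc: "U a i j \<in> carrier A" if "a \<in> pverts X" "i \<in> pverts Y" "j \<in> pverts Y" for a i j
    using magic.u_closed[OF U(1)] that by blast
  have proj: "W p q \<in> carrier A \<and> W p q \<otimes> W p q = W p q \<and> star A (W p q) = W p q"
    if "p \<in> pverts X \<times> pverts Y" "q \<in> pverts X \<times> pverts Y" for p q
  proof -
    obtain a i b j where [simp]: "p = (a, i)" "q = (b, j)" by (cases p, cases q)
    have ab: "a \<in> pverts X" "b \<in> pverts X" "i \<in> pverts Y" "j \<in> pverts Y" using that by auto
    have c: "U a i j \<in> carrier A" "V a b \<in> carrier A" using Uc ab by auto
    have "(U a i j \<otimes> V a b) \<otimes> (U a i j \<otimes> V a b) = U a i j \<otimes> (V a b \<otimes> U a i j) \<otimes> V a b"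
      using c by (simp add: V.m_assoc)
    also have "\<dots> = (U a i j \<otimes> U a i j) \<otimes> (V a b \<otimes> V a b)"
      using c comm[OF ab, symmetric] by (simp add: V.m_assoc)
    finally show ?thesis
      using c ab magic.u_idem[OF U(1)] magic.u_star[OF U(1)] V.u_idem V.u_star comm[OF ab]
      by (simp add: W_def V.star_mult)
  qed
  have row: "(\<Oplus>q\<in>pverts X \<times> pverts Y. W p q) = \<one>" if pm: "p \<in> pverts X \<times> pverts Y" for p
  proof -
    obtain a i where p: "p = (a, i)" "a \<in> pverts X" "i \<in> pverts Y" using pm by auto
    have "(\<Oplus>q\<in>pverts X \<times> pverts Y. W p q) = (\<Oplus>b\<in>pverts X. \<Oplus>j\<in>pverts Y. U a i j \<otimes> V a b)"
      using p Uc fin by (subst V.finsum_times) (auto simp: W_def)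
    also have "\<dots> = (\<Oplus>b\<in>pverts X. V a b)"
    proof (rule V.finsum_cong_mem)
      fix b assume b: "b \<in> pverts X"
      have "(\<Oplus>j\<in>pverts Y. U a i j \<otimes> V a b) = (\<Oplus>j\<in>pverts Y. U a i j) \<otimes> V a b"
        using p b Uc fin by (intro V.finsum_mult_right[symmetric]) auto
      then show "(\<Oplus>j\<in>pverts Y. U a i j \<otimes> V a b) = V a b"
        using magic.row_sum[OF U(1)] p b by simp
    qed (use p in simp)
    finally show ?thesis using V.row_sum p by simp
  qed
  have col: "(\<Oplus>p\<in>pverts X \<times> pverts Y. W p q) = \<one>" if qm: "q \<in> pverts X \<times> pverts Y" for q
  proof -
    obtain b j where q: "q = (b, j)" "b \<in> pverts X" "j \<in> pverts Y" using qm by auto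
    have "(\<Oplus>p\<in>pverts X \<times> pverts Y. W p q) = (\<Oplus>a\<in>pverts X. \<Oplus>i\<in>pverts Y. U a i j \<otimes> V a b)"
      using q Uc fin by (subst V.finsum_times) (auto simp: W_def)
    also have "\<dots> = (\<Oplus>a\<in>pverts X. V a b)"
    proof (rule V.finsum_cong_mem)
      fix a assume a: "a \<in> pverts X"
      have "(\<Oplus>i\<in>pverts Y. U a i j \<otimes> V a b) = (\<Oplus>i\<in>pverts Y. U a i j) \<otimes> V a b"
        using q a Uc fin by (intro V.finsum_mult_right[symmetric]) auto
      then show "(\<Oplus>i\<in>pverts Y. U a i j \<otimes> V a b) = V a b"
        using magic.col_sum[OF U(1)] q a by simp
    qed (use q in simp)
    finally show ?thesis using V.col_sum q by simp
  qed
  show m: "magic A (pverts X \<times> pverts Y) (pverts X \<times> pverts Y) W"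
    by (intro magic.intro magic_axioms.intro V.unital_cstar_algebra_axioms finite_cartesian_product fin)
       (use proj row col in \<open>auto simp: magic_unitary_def\<close>)
  interpret W: magic A "pverts X \<times> pverts Y" "pverts X \<times> pverts Y" W by (rule m)
  have "W.invariant (\<lambda>p q. (p, q) \<in> parcs (lex_product X Y)) (\<lambda>p q. (p, q) \<in> parcs (lex_product X Y))"
  proof (rule W.invariantI)
    fix p p' q q' assume "p \<in> pverts X \<times> pverts Y" "p' \<in> pverts X \<times> pverts Y" "q \<in> pverts X \<times> pverts Y" "q' \<in> pverts X \<times> pverts Y"
      and nz: "W p q \<otimes> W p' q' \<noteq> \<zero>"
    then obtain a i a' i' b j b' j' where eq: "p = (a, i)" "p' = (a', i')" "q = (b, j)" "q' = (b', j')"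
      and ab: "a \<in> pverts X" "a' \<in> pverts X" "b \<in> pverts X" "b' \<in> pverts X"
      and ij: "i \<in> pverts Y" "i' \<in> pverts Y" "j \<in> pverts Y" "j' \<in> pverts Y" by auto
    have c: "U a i j \<in> carrier A" "V a b \<in> carrier A" "U a' i' j' \<in> carrier A" "V a' b' \<in> carrier A"
      using Uc ab ij by auto
    \<comment> \<open>Commutation inside the second entry brings the two V factors together.\<close>
    have prod: "W p q \<otimes> W p' q' = U a i j \<otimes> (V a b \<otimes> V a' b') \<otimes> U a' i' j'"
      using c comm[OF ab(2,4) ij(2,4)] by (simp add: eq W_def V.m_assoc)
    have "V a b \<otimes> V a' b' \<noteq> \<zero>" using nz c unfolding prod by auto
    then have ab': "a = a' \<longleftrightarrow> b = b'" "(a, a') \<in> parcs X \<longleftrightarrow> (b, b') \<in> parcs X"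
      using V.invariant_eq V(2) ab unfolding V.intertwines_iff V.invariant_def by blast+
    show "(p, p') \<in> parcs (lex_product X Y) \<longleftrightarrow> (q, q') \<in> parcs (lex_product X Y)"
    proof (cases "a = a'")
      case True
      interpret Ua: magic A "pverts Y" "pverts Y" "U a" by (rule U(1)[OF ab(1)])
      have "W p q \<otimes> W p' q' = U a i j \<otimes> U a i' j' \<otimes> V a b"
        unfolding prod using True ab' c comm[OF ab(1,3) ij(2,4)] V.u_idem ab by (simp add: V.m_assoc)
      then have "U a i j \<otimes> U a i' j' \<noteq> \<zero>" using nz c by auto
      then have "(i, i') \<in> parcs Y \<longleftrightarrow> (j, j') \<in> parcs Y"
        using U(2)[OF ab(1)] ij unfolding Ua.intertwines_iff Ua.invariant_def by blast
      then show ?thesis using ab ij True ab' by (simp add: eq lex_arc_iff[OF X Y] simple_graph_irrefl[OF X])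
    next
      case False
      then show ?thesis using ab ij ab' by (simp add: eq lex_arc_iff[OF X Y])
    qed
  qed
  then show "W.intertwines (lex_product X Y) (lex_product X Y)" unfolding W.intertwines_iff .
qed

text \<open>Once the coaction preserves the fibres of the lexicographic product it splits: \<open>v\<close> is its
  action on the fibres and \<open>w x\<close> the action seen from the fibre over \<open>x\<close>.\<close>

locale fibred_magic = magic A "pverts X \<times> pverts Y" "pverts X \<times> pverts Y" u
  for A :: "('a, 'm) cstar_alg_scheme" (structure) and X :: "'x pair_pre_digraph" and Y :: "'y pair_pre_digraph" and u +
  assumes X: "simple_graph X" and Y: "simple_graph Y"
    and lex: "intertwines (lex_product X Y) (lex_product X Y)"
    and fibres: "invariant (\<lambda>p q. fst p = fst q) (\<lambda>p q. fst p = fst q)"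
begin

abbreviation "VX \<equiv> pverts X"
abbreviation "VY \<equiv> pverts Y"

lemma fin: "finite VX" "finite VY"
  using simple_graph_finite X Y by auto

definition base :: 'y where "base = (SOME y. y \<in> VY)"

lemma base: "base \<in> VY"
  unfolding base_def using simple_graph_nonempty[OF Y] by (simp add: some_in_eq)

sublocale quotient_magic A "VX \<times> VY" "VX \<times> VY" u fst fst VX VX "\<lambda>x. (x, base)" "\<lambda>x. (x, base)" "card VY"
proof -
  have "{i \<in> VX \<times> VY. fst i = k} = {k} \<times> VY" if "k \<in> VX" for k using that by auto
  then have "card {i \<in> VX \<times> VY. fst i = k} = card VY" if "k \<in> VX" for k
    using that by (simp add: card_cartesian_product)
  moreover have "blocked_magic A (VX \<times> VY) (VX \<times> VY) u fst fst"
    by (intro blocked_magic.intro blocked_magic_axioms.intro magic_axioms fibres)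
  ultimately show "quotient_magic A (VX \<times> VY) (VX \<times> VY) u fst fst VX VX (\<lambda>x. (x, base)) (\<lambda>x. (x, base)) (card VY)"
    by (intro quotient_magic.intro quotient_magic_axioms.intro) (use fin base in auto)
qed

lemma arcs_invariant: "invariant (\<lambda>p q. (p, q) \<in> parcs (lex_product X Y)) (\<lambda>p q. (p, q) \<in> parcs (lex_product X Y))"
  using lex by (simp add: intertwines_iff)

lemma v_intertwines: "magic.intertwines A VX VX v X X"
  unfolding magic.intertwines_iff[OF v_magic]
proof (rule v_invariant)
  show "invariant (\<lambda>p q. fst p \<noteq> fst q \<and> (p, q) \<in> parcs (lex_product X Y)) (\<lambda>p q. fst p \<noteq> fst q \<and> (p, q) \<in> parcs (lex_product X Y))"
    using invariant_map2[OF fibres arcs_invariant, of "\<lambda>a b. \<not> a \<and> b"] .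
qed (use base in \<open>auto simp: lex_arc_iff[OF X Y] simple_graph_irrefl[OF X]\<close>)

definition w :: "'x \<Rightarrow> 'y \<Rightarrow> 'y \<Rightarrow> 'a" where
  "w x y b = (\<Oplus>a\<in>VX. u (x, y) (a, b))"

lemma block_eq_sum: "x \<in> VX \<Longrightarrow> y \<in> VY \<Longrightarrow> a \<in> VX \<Longrightarrow> block (x, y) a = (\<Oplus>b\<in>VY. u (x, y) (a, b))"
proof -
  assume xy: "x \<in> VX" "y \<in> VY" "a \<in> VX"
  have "block (x, y) a = (\<Oplus>a'\<in>VX. \<Oplus>b\<in>VY. if a' = a then u (x, y) (a', b) else \<zero>)"
    unfolding block_def using xy fin by (subst finsum_times) auto
  also have "\<dots> = (\<Oplus>a'\<in>VX. if a' = a then (\<Oplus>b\<in>VY. u (x, y) (a', b)) else \<zero>)"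
    using xy fin by (intro finsum_cong_mem) (auto intro: finsum_closed)
  also have "\<dots> = (\<Oplus>b\<in>VY. u (x, y) (a, b))"
    using xy fin by (subst finsum_delta) (auto intro: finsum_closed)
  finally show ?thesis .
qed

lemma col_block_eq_sum: "a \<in> VX \<Longrightarrow> b \<in> VY \<Longrightarrow> x \<in> VX \<Longrightarrow> col_block (a, b) x = (\<Oplus>y\<in>VY. u (x, y) (a, b))"
proof -
  assume ab: "a \<in> VX" "b \<in> VY" "x \<in> VX"
  have "col_block (a, b) x = (\<Oplus>x'\<in>VX. \<Oplus>y\<in>VY. if x' = x then u (x', y) (a, b) else \<zero>)"
    unfolding col_block_def using ab fin by (subst finsum_times) auto
  also have "\<dots> = (\<Oplus>x'\<in>VX. if x' = x then (\<Oplus>y\<in>VY. u (x', y) (a, b)) else \<zero>)"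
    using ab fin by (intro finsum_cong_mem) (auto intro: finsum_closed)
  also have "\<dots> = (\<Oplus>y\<in>VY. u (x, y) (a, b))"
    using ab fin by (subst finsum_delta) (auto intro: finsum_closed)
  finally show ?thesis .
qed

lemma v_eq_sum: assumes "x \<in> VX" "y \<in> VY" "a \<in> VX" shows "v x a = (\<Oplus>b\<in>VY. u (x, y) (a, b))"
  using v_eq_block[of "(x, y)" a] block_eq_sum[OF assms] assms by simp

lemma w_closed: "x \<in> VX \<Longrightarrow> y \<in> VY \<Longrightarrow> b \<in> VY \<Longrightarrow> w x y b \<in> carrier A"
  unfolding w_def by (auto intro: finsum_closed)

lemma w_magic: assumes x: "x \<in> VX" shows "magic A VY VY (w x)"
proof (intro magic.intro magic_axioms.intro unital_cstar_algebra_axioms fin)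
  show "magic_unitary A VY VY (w x)"
    unfolding magic_unitary_def
  proof (intro conjI ballI)
    fix y b assume yb: "y \<in> VY" "b \<in> VY"
    have "projection (w x y b)"
      unfolding w_def using x yb fin row_orth by (intro projection_finsum) (auto simp: u_projection)
    then show "w x y b \<in> carrier A" "w x y b \<otimes> w x y b = w x y b" "star A (w x y b) = w x y b"
      by (auto simp: projection_def)
  next
    fix y assume y: "y \<in> VY"
    have "(\<Oplus>b\<in>VY. w x y b) = (\<Oplus>a\<in>VX. \<Oplus>b\<in>VY. u (x, y) (a, b))"
      unfolding w_def using x y fin by (intro finsum_swap) auto
    also have "\<dots> = (\<Oplus>q\<in>VX \<times> VY. u (x, y) q)"
      using x y fin by (intro finsum_times[symmetric]) auto
    finally show "(\<Oplus>b\<in>VY. w x y b) = \<one>" using row_sum x y by simp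
  next
    fix b assume b: "b \<in> VY"
    have "(\<Oplus>y\<in>VY. w x y b) = (\<Oplus>a\<in>VX. \<Oplus>y\<in>VY. u (x, y) (a, b))"
      unfolding w_def using x b fin by (intro finsum_swap) auto
    \<comment> \<open>Here row and column block sums have to agree: the inner sum runs down a column
      of the block between two fibres, whereas v is defined by its rows.\<close>
    also have "\<dots> = (\<Oplus>a\<in>VX. v x a)"
      using x b v_eq_col_block[of x "(_, b)"] col_block_eq_sum[of _ b x] magic.u_closed[OF v_magic]
      by (intro finsum_cong_mem) auto
    finally show "(\<Oplus>y\<in>VY. w x y b) = \<one>" using magic.row_sum[OF v_magic] x by simp
  qed
qed

lemma w_mult_nonzero:
  assumes x: "x \<in> VX" "y \<in> VY" "y' \<in> VY" "b \<in> VY" "b' \<in> VY" and nz: "w x y b \<otimes> w x y' b' \<noteq> \<zero>"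
  obtains a where "a \<in> VX" "u (x, y) (a, b) \<otimes> u (x, y') (a, b') \<noteq> \<zero>"
proof -
  have "w x y b \<otimes> w x y' b' = (\<Oplus>a\<in>VX. u (x, y) (a, b) \<otimes> w x y' b')"
    unfolding w_def[of x y] using x fin w_closed by (intro finsum_mult_right) auto
  with nz obtain a where a: "a \<in> VX" "u (x, y) (a, b) \<otimes> w x y' b' \<noteq> \<zero>" by (auto elim: finsum_nonzeroE)
  have "u (x, y) (a, b) \<otimes> w x y' b' = (\<Oplus>a'\<in>VX. u (x, y) (a, b) \<otimes> u (x, y') (a', b'))"
    unfolding w_def using x a fin by (intro finsum_mult_left) auto
  with a obtain a' where a': "a' \<in> VX" "u (x, y) (a, b) \<otimes> u (x, y') (a', b') \<noteq> \<zero>" by (auto elim: finsum_nonzeroE)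
  \<comment> \<open>Both rows lie in the fibre over x, so a nonvanishing product has its columns in
    one fibre too.\<close>
  then have "a = a'" using invariantD[OF fibres, of "(x, y)" "(x, y')" "(a, b)" "(a', b')"] x a by auto
  then show ?thesis using that a a' by blast
qed

lemma w_intertwines: assumes x: "x \<in> VX" shows "magic.intertwines A VY VY (w x) Y Y"
  unfolding magic.intertwines_iff[OF w_magic[OF x]] magic.invariant_def[OF w_magic[OF x]]
proof (intro ballI impI)
  fix y y' b b' assume yb: "y \<in> VY" "y' \<in> VY" "b \<in> VY" "b' \<in> VY" "w x y b \<otimes> w x y' b' \<noteq> \<zero>"
  then obtain a where a: "a \<in> VX" "u (x, y) (a, b) \<otimes> u (x, y') (a, b') \<noteq> \<zero>"
    using w_mult_nonzero x by blast
  then have "((x, y), (x, y')) \<in> parcs (lex_product X Y) \<longleftrightarrow> ((a, b), (a, b')) \<in> parcs (lex_product X Y)"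
    using invariantD[OF arcs_invariant, of "(x, y)" "(x, y')" "(a, b)" "(a, b')"] x yb by auto
  then show "(y, y') \<in> parcs Y \<longleftrightarrow> (b, b') \<in> parcs Y"
    using x yb a by (simp add: lex_arc_iff[OF X Y] simple_graph_irrefl[OF X])
qed

text \<open>The factorisation of u as in a free wreath product: v x a is the block sum of the row
  (x, y), and multiplying by it keeps exactly the entries whose column lies over a. The two orders
  agree, which is the commutation relation of the wreath.\<close>

lemma w_mult_v:
  assumes x: "x \<in> VX" "y \<in> VY" "a \<in> VX" "b \<in> VY"
  shows "w x y b \<otimes> v x a = u (x, y) (a, b)" and "v x a \<otimes> w x y b = u (x, y) (a, b)"
proof -
  have v: "v x a = block (x, y) a" using v_eq_block[of "(x, y)" a] x by simp
  have "w x y b \<otimes> v x a = (\<Oplus>a'\<in>VX. u (x, y) (a', b) \<otimes> block (x, y) a)"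
    unfolding w_def v using x fin by (intro finsum_mult_right) auto
  also have "\<dots> = (\<Oplus>a'\<in>VX. if a' = a then u (x, y) (a', b) else \<zero>)"
    using x by (intro finsum_cong_mem) (auto simp: entry_mult_block)
  also have "\<dots> = u (x, y) (a, b)" using x fin by (subst finsum_delta) auto
  finally show "w x y b \<otimes> v x a = u (x, y) (a, b)" .
  have "v x a \<otimes> w x y b = (\<Oplus>a'\<in>VX. block (x, y) a \<otimes> u (x, y) (a', b))"
    unfolding w_def v using x fin by (intro finsum_mult_left) auto
  also have "\<dots> = (\<Oplus>a'\<in>VX. if a' = a then u (x, y) (a', b) else \<zero>)"
    using x by (intro finsum_cong_mem) (auto simp: block_mult_entry)
  also have "\<dots> = u (x, y) (a, b)" using x fin by (subst finsum_delta) auto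
  finally show "v x a \<otimes> w x y b = u (x, y) (a, b)" .
qed

end

lemma graph_iso_intertwines:
  assumes m: "magic A (pverts G') (pverts G') u" and it: "magic.intertwines A (pverts G') (pverts G') u G' G'"
    and iso: "graph_iso F G G'"
  shows "magic A (pverts G) (pverts G) (\<lambda>x y. u (F x) (F y))"
    and "magic.intertwines A (pverts G) (pverts G) (\<lambda>x y. u (F x) (F y)) G G"
proof -
  have bij: "bij_betw F (pverts G) (pverts G')" and arcs: "\<And>x y. x \<in> pverts G \<Longrightarrow> y \<in> pverts G \<Longrightarrow>
      (x, y) \<in> parcs G \<longleftrightarrow> (F x, F y) \<in> parcs G'" using iso by (auto simp: graph_iso_def)
  show m': "magic A (pverts G) (pverts G) (\<lambda>x y. u (F x) (F y))"
    by (rule magic_reindex[OF m bij bij])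
  have Fc: "F x \<in> pverts G'" if "x \<in> pverts G" for x using bij that by (auto simp: bij_betw_def)
  show "magic.intertwines A (pverts G) (pverts G) (\<lambda>x y. u (F x) (F y)) G G"
    using it arcs Fc
    unfolding magic.intertwines_iff[OF m'] magic.intertwines_iff[OF m] magic.invariant_def[OF m'] magic.invariant_def[OF m]
    by blast
qed

lemma graph_iso_inverse: assumes "graph_iso F G G'" shows "graph_iso (inv_into (pverts G) F) G' G"
proof -
  have bij: "bij_betw F (pverts G) (pverts G')" using assms by (simp add: graph_iso_def)
  note b' = bij_betw_inv_into[OF bij]
  have "inv_into (pverts G) F x \<in> pverts G" "F (inv_into (pverts G) F x) = x" if "x \<in> pverts G'" for x
    using that b' bij_betw_inv_into_right[OF bij] by (auto simp: bij_betw_def)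
  then show ?thesis using assms b' unfolding graph_iso_def by metis
qed

text \<open>The graph G is only isomorphic to a lexicographic product, since X[Y] itself has to be
  read as X'[D] later. The inverse maps send u to UV, and U, V back to w, v; that they are inverse
  is checked on generators, where summing UV over one coordinate recovers the other factor.
  Invariance of fibres is demanded only over the element type of \<open>Qut G\<close>, the type of
  the representation to which it is applied.\<close>

theorem Qut_lex_product:
  assumes X: "simple_graph X" and Y: "simple_graph Y" and fin: "finite (pverts G)"
    and iso: "graph_iso F G (lex_product X Y)"
    and fibres: "\<And>(A :: ('g \<times> 'g) universal cstar_alg) u. magic A (pverts X \<times> pverts Y) (pverts X \<times> pverts Y) u \<Longrightarrow>
      magic.intertwines A (pverts X \<times> pverts Y) (pverts X \<times> pverts Y) u (lex_product X Y) (lex_product X Y) \<Longrightarrow>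
      magic.invariant A (pverts X \<times> pverts Y) (pverts X \<times> pverts Y) u (\<lambda>p q. fst p = fst q) (\<lambda>p q. fst p = fst q)"
  shows "qpg_equal_via F (Qut (G :: 'g pair_pre_digraph)) (free_wreath (Qut Y) (Qut X))"
proof -
  let ?A = "qalg (Qut G)" let ?L = "lex_product X Y"
  define F' where "F' = inv_into (pverts G) F"
  define u where "u p q = fund (Qut G) (F' p) (F' q)" for p q
  note finX = simple_graph_finite[OF X] and finY = simple_graph_finite[OF Y]
  have iso': "graph_iso F' ?L G" unfolding F'_def by (rule graph_iso_inverse[OF iso])
  have FF': "F' (F x) = x" "F x \<in> pverts ?L" if "x \<in> pverts G" for x
    using iso that unfolding F'_def graph_iso_def by (auto simp: bij_betw_def)
  have F'F: "F (F' x) = x" "F' x \<in> pverts G" if "x \<in> pverts ?L" for x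
    using iso iso' that unfolding F'_def graph_iso_def by (auto simp: bij_betw_inv_into_right bij_betw_def f_inv_into_f)
  note u = graph_iso_intertwines[OF Qut_magic[OF fin] iso', folded u_def]
  interpret f: fibred_magic ?A X Y u
    by (intro fibred_magic.intro fibred_magic_axioms.intro X Y fibres) (use u in simp_all)
  interpret w: wreath "Qut Y" "Qut X"
    by (intro wreath.intro) (use Qut_magic(1)[OF finX] Qut_magic(1)[OF finY] in simp_all)
  note fundX = magic.u_closed[OF Qut_magic(1)[OF finX]] and fundY = magic.u_closed[OF Qut_magic(1)[OF finY]]
  have "\<exists>h\<in>star_hom (qalg (Qut Y)) ?A. \<forall>y\<in>pverts Y. \<forall>b\<in>pverts Y. h (fund (Qut Y) y b) = f.w x y b" if "x \<in> pverts X" for x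
    using Qut_hom_exists[OF f.w_magic[OF that] f.w_intertwines[OF that]] by metis
  then obtain hw where hw: "\<And>x. x \<in> pverts X \<Longrightarrow> hw x \<in> star_hom (qalg (Qut Y)) ?A"
    "\<And>x y b. x \<in> pverts X \<Longrightarrow> y \<in> pverts Y \<Longrightarrow> b \<in> pverts Y \<Longrightarrow> hw x (fund (Qut Y) y b) = f.w x y b"
    by metis
  obtain hv where hv: "hv \<in> star_hom (qalg (Qut X)) ?A"
    "\<And>x a. x \<in> pverts X \<Longrightarrow> a \<in> pverts X \<Longrightarrow> hv (fund (Qut X) x a) = f.v x a"
    using Qut_hom_exists[OF f.v_magic f.v_intertwines] by metis
  obtain \<Psi> where \<Psi>: "\<Psi> \<in> star_hom w.wr ?A"
    "\<And>a x. a \<in> pverts X \<Longrightarrow> x \<in> carrier (qalg (Qut Y)) \<Longrightarrow> \<Psi> (w.Hu a x) = hw a x"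
    "\<And>x. x \<in> carrier (qalg (Qut X)) \<Longrightarrow> \<Psi> (w.Hv x) = hv x"
    using w.wreath_hom_exists[OF f.unital_cstar_algebra_axioms, of hw hv] hw hv
    by (auto simp: f.w_mult_v)
  define U where "U a i j = w.Hu a (fund (Qut Y) i j)" for a i j
  define V where "V a b = w.Hv (fund (Qut X) a b)" for a b
  define W where "W = (\<lambda>(a, i) (b, j). U a i j \<otimes>\<^bsub>w.wr\<^esub> V a b)"
  have Um: "magic w.wr (pverts Y) (pverts Y) (U a)" "magic.intertwines w.wr (pverts Y) (pverts Y) (U a) Y Y" if a: "a \<in> pverts X" for a
  proof -
    have h: "w.Hu a \<in> star_hom (qalg (Qut Y)) w.wr" using a by (intro w.Hu_hom) simp
    show m: "magic w.wr (pverts Y) (pverts Y) (U a)"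
      using magic_image[OF Qut_magic(1)[OF finY] w.wr.unital_cstar_algebra_axioms h] by (simp add: U_def[abs_def])
    show "magic.intertwines w.wr (pverts Y) (pverts Y) (U a) Y Y"
      using invariant_image[OF Qut_magic(1)[OF finY] w.wr.unital_cstar_algebra_axioms h] Qut_magic(2)[OF finY]
      unfolding magic.intertwines_iff[OF m] magic.intertwines_iff[OF Qut_magic(1)[OF finY]] by (simp add: U_def[abs_def])
  qed
  have Vm: "magic w.wr (pverts X) (pverts X) V" "magic.intertwines w.wr (pverts X) (pverts X) V X X"
  proof -
    show m: "magic w.wr (pverts X) (pverts X) V"
      using magic_image[OF Qut_magic(1)[OF finX] w.wr.unital_cstar_algebra_axioms w.Hv_hom] by (simp add: V_def[abs_def])
    show "magic.intertwines w.wr (pverts X) (pverts X) V X X"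
      using invariant_image[OF Qut_magic(1)[OF finX] w.wr.unital_cstar_algebra_axioms w.Hv_hom] Qut_magic(2)[OF finX]
      unfolding magic.intertwines_iff[OF m] magic.intertwines_iff[OF Qut_magic(1)[OF finX]] by (simp add: V_def[abs_def])
  qed
  have comm: "U a i j \<otimes>\<^bsub>w.wr\<^esub> V a b = V a b \<otimes>\<^bsub>w.wr\<^esub> U a i j"
    if "a \<in> pverts X" "b \<in> pverts X" "i \<in> pverts Y" "j \<in> pverts Y" for a b i j
    using w.wreath_commute[of a b i j] that by (simp add: U_def V_def)
  note Wm = lex_product_magic[OF X Y Um Vm comm, folded W_def]
  have "magic w.wr (pverts ?L) (pverts ?L) W" "magic.intertwines w.wr (pverts ?L) (pverts ?L) W ?L ?L"
    using Wm by simp_all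
  note Wm' = graph_iso_intertwines[OF this iso]
  obtain \<Phi> where \<Phi>: "\<Phi> \<in> star_hom ?A w.wr"
    "\<And>x y. x \<in> pverts G \<Longrightarrow> y \<in> pverts G \<Longrightarrow> \<Phi> (fund (Qut G) x y) = W (F x) (F y)"
    using Qut_hom_exists[OF Wm'] by metis
  note Uc = magic.u_closed[OF Um(1)] and Urow = magic.row_sum[OF Um(1)]
  interpret Vm: magic w.wr "pverts X" "pverts X" V by (rule Vm(1))
  have \<Phi>u: "\<Phi> (u (x, y) (a, b)) = U x y b \<otimes>\<^bsub>w.wr\<^esub> V x a" if "x \<in> pverts X" "y \<in> pverts Y" "a \<in> pverts X" "b \<in> pverts Y" for x y a b
    using that F'F[of "(x, y)"] F'F[of "(a, b)"] by (simp add: u_def \<Phi>(2) W_def)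
  note \<Phi>sum = star_hom_finsum[OF f.star_algebra_axioms w.wr.star_algebra_axioms \<Phi>(1)]
  have \<Phi>v: "\<Phi> (f.v x a) = V x a" if xa: "x \<in> pverts X" "a \<in> pverts X" for x a
  proof -
    have "\<Phi> (f.v x a) = (\<Oplus>\<^bsub>w.wr\<^esub>b\<in>pverts Y. \<Phi> (u (x, f.base) (a, b)))"
      unfolding f.v_eq_sum[OF xa(1) f.base xa(2)] using xa finY f.base by (intro \<Phi>sum) auto
    also have "\<dots> = (\<Oplus>\<^bsub>w.wr\<^esub>b\<in>pverts Y. U x f.base b \<otimes>\<^bsub>w.wr\<^esub> V x a)"
      using xa f.base Uc[OF xa(1)] by (intro w.wr.finsum_cong_mem) (auto simp: \<Phi>u)
    also have "\<dots> = (\<Oplus>\<^bsub>w.wr\<^esub>b\<in>pverts Y. U x f.base b) \<otimes>\<^bsub>w.wr\<^esub> V x a"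
      using xa f.base Uc[OF xa(1)] finY by (intro w.wr.finsum_mult_right[symmetric]) auto
    finally show ?thesis using Urow[OF xa(1) f.base] xa by simp
  qed
  have \<Phi>w: "\<Phi> (f.w x y b) = U x y b" if xy: "x \<in> pverts X" "y \<in> pverts Y" "b \<in> pverts Y" for x y b
  proof -
    have "\<Phi> (f.w x y b) = (\<Oplus>\<^bsub>w.wr\<^esub>a\<in>pverts X. \<Phi> (u (x, y) (a, b)))"
      unfolding f.w_def using xy finX by (intro \<Phi>sum) auto
    also have "\<dots> = (\<Oplus>\<^bsub>w.wr\<^esub>a\<in>pverts X. U x y b \<otimes>\<^bsub>w.wr\<^esub> V x a)"
      using xy Uc[OF xy(1)] by (intro w.wr.finsum_cong_mem) (auto simp: \<Phi>u)
    also have "\<dots> = U x y b \<otimes>\<^bsub>w.wr\<^esub> (\<Oplus>\<^bsub>w.wr\<^esub>a\<in>pverts X. V x a)"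
      using xy Uc[OF xy(1)] finX by (intro w.wr.finsum_mult_left[symmetric]) auto
    finally show ?thesis using Vm.row_sum xy Uc[OF xy(1)] by simp
  qed
  have \<Psi>U: "\<Psi> (U a i j) = f.w a i j" if "a \<in> pverts X" "i \<in> pverts Y" "j \<in> pverts Y" for a i j
    using that by (simp add: U_def \<Psi>(2) fundY hw(2))
  have \<Psi>V: "\<Psi> (V a b) = f.v a b" if "a \<in> pverts X" "b \<in> pverts X" for a b
    using that by (simp add: V_def \<Psi>(3) fundX hv(2))
  have \<Psi>\<Phi>: "\<Psi> (\<Phi> c) = c" if "c \<in> carrier ?A" for c
  proof -
    have "(\<Psi> \<circ> \<Phi>) (fund (Qut G) x y) = fund (Qut G) x y" if xy: "x \<in> pverts G" "y \<in> pverts G" for x y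
    proof -
      obtain p q a b where F: "F x = (p, q)" "F y = (a, b)" by (cases "F x", cases "F y")
      have pq: "p \<in> pverts X" "q \<in> pverts Y" "a \<in> pverts X" "b \<in> pverts Y"
        using FF'(2)[OF xy(1)] FF'(2)[OF xy(2)] F by auto
      have "\<Psi> (W (F x) (F y)) = f.w p q b \<otimes>\<^bsub>?A\<^esub> f.v p a"
        using pq Uc[OF pq(1)] by (simp add: F W_def star_hom_mult[OF \<Psi>(1)] \<Psi>U \<Psi>V)
      also have "\<dots> = u (F x) (F y)" using pq by (simp add: f.w_mult_v F)
      finally show ?thesis using xy FF'(1) by (simp add: \<Phi>(2) u_def)
    qed
    then show ?thesis
      using Qut_hom_eq[OF fin f.unital_cstar_algebra_axioms star_hom_comp[OF \<Phi>(1) \<Psi>(1)] star_hom_id _ that] by simp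
  qed
  have \<Phi>\<Psi>: "\<Phi> (\<Psi> c) = c" if c: "c \<in> carrier w.wr" for c
  proof -
    note h = star_hom_comp[OF \<Psi>(1) \<Phi>(1)]
    have "(\<Phi> \<circ> \<Psi>) (w.Hu a x) = w.Hu a x" if a: "a \<in> points (Qut X)" and x: "x \<in> carrier (qalg (Qut Y))" for a x
    proof -
      have a': "a \<in> pverts X" using a by simp
      have "((\<Phi> \<circ> \<Psi>) \<circ> w.Hu a) x = w.Hu a x"
        by (rule Qut_hom_eq[OF finY w.wr.unital_cstar_algebra_axioms star_hom_comp[OF w.Hu_hom[OF a] h] w.Hu_hom[OF a] _ x])
           (use a' in \<open>simp add: \<Psi>U \<Phi>w flip: U_def\<close>)
      then show ?thesis by simp
    qed
    moreover have "(\<Phi> \<circ> \<Psi>) (w.Hv x) = w.Hv x" if x: "x \<in> carrier (qalg (Qut X))" for x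
    proof -
      have "((\<Phi> \<circ> \<Psi>) \<circ> w.Hv) x = w.Hv x"
        by (rule Qut_hom_eq[OF finX w.wr.unital_cstar_algebra_axioms star_hom_comp[OF w.Hv_hom h] w.Hv_hom _ x])
           (simp add: \<Psi>V \<Phi>v flip: V_def)
      then show ?thesis by simp
    qed
    ultimately have "(\<Phi> \<circ> \<Psi>) c = c"
      by (intro w.wreath_hom_eq[OF w.wr.unital_cstar_algebra_axioms h star_hom_id _ _ c]) auto
    then show ?thesis by simp
  qed
  have "\<Phi> \<in> star_iso ?A w.wr" by (rule star_isoI[OF \<Phi>(1) \<Psi>(1) \<Psi>\<Phi> \<Phi>\<Psi>])
  moreover have "\<Phi> (fund (Qut G) x y) = fund (free_wreath (Qut Y) (Qut X)) (F x) (F y)"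
    if xy: "x \<in> pverts G" "y \<in> pverts G" for x y
  proof -
    obtain p q a b where F: "F x = (p, q)" "F y = (a, b)" by (cases "F x", cases "F y")
    have pq: "p \<in> pverts X" "q \<in> pverts Y" "a \<in> pverts X" "b \<in> pverts Y"
      using FF'(2)[OF xy(1)] FF'(2)[OF xy(2)] F by auto
    then show ?thesis using xy w.wreath_fund[of p a q b] by (simp add: \<Phi>(2) F W_def U_def V_def)
  qed
  moreover have "points (free_wreath (Qut Y) (Qut X)) = pverts ?L" by (simp add: free_wreath_def)
  ultimately show ?thesis
    using iso unfolding qpg_equal_via_def graph_iso_def by auto
qed

section \<open>The fibres of a lexicographic product\<close>

text \<open>Writing \<open>m\<close> and \<open>d\<close> for order and degree of \<open>Y\<close>, two distinct fibres differ in at least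
  \<open>2d\<close> neighbours at nonadjacent points and in at least \<open>2(m - d)\<close> neighbours at adjacent ones;
  pairs below these bounds therefore lie in a common fibre, and they generate the fibre.\<close>

lemma lex_fibres_invariant:
  fixes A (structure)
  assumes X: "simple_graph X" and Y: "simple_graph Y"
    and reg: "\<And>y. y \<in> pverts Y \<Longrightarrow> card {z\<in>pverts Y. (y, z) \<in> parcs Y} = d"
    and co: "Digraph_Component.connected (with_proj (complement Y))"
    and alt: "Digraph_Component.connected (with_proj Y) \<or> (\<nexists>x y. twins X x y)"
    and m: "magic A (pverts X \<times> pverts Y) (pverts X \<times> pverts Y) u"
    and lex: "magic.intertwines A (pverts X \<times> pverts Y) (pverts X \<times> pverts Y) u (lex_product X Y) (lex_product X Y)"
  shows "magic.invariant A (pverts X \<times> pverts Y) (pverts X \<times> pverts Y) u (\<lambda>p q. fst p = fst q) (\<lambda>p q. fst p = fst q)"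
proof -
  interpret magic A "pverts X \<times> pverts Y" "pverts X \<times> pverts Y" u by (rule m)
  let ?V = "pverts X \<times> pverts Y"
  define E where "E p q \<longleftrightarrow> (p, q) \<in> parcs (lex_product X Y)" for p q
  define N where "N y = {z\<in>pverts Y. (y, z) \<in> parcs Y}" for y
  \<comment> \<open>The number of vertices adjacent to exactly one of p and q. It is split in two so
    that each half counts two-step paths, as \<open>invariant_card\<close> requires.\<close>
  define D where "D p q = card {z\<in>?V. E p z \<and> \<not> E z q} + card {z\<in>?V. \<not> E p z \<and> E z q}" for p q
  note fin = simple_graph_finite[OF X] simple_graph_finite[OF Y]
  have finV: "finite ?V" using fin by simp
  have E: "invariant E E" using lex unfolding intertwines_iff E_def .
  have D: "invariant D D"
    unfolding D_def
    by (rule invariant_map2[OF invariant_card invariant_card, of _ _ _ _ _ _ _ _ "(+)"])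
       (intro E invariant_map[OF E])+
  have Eiff: "E (x, y) (x', y') \<longleftrightarrow> (x, x') \<in> parcs X \<or> x = x' \<and> (y, y') \<in> parcs Y"
    if "x \<in> pverts X" "x' \<in> pverts X" "y \<in> pverts Y" "y' \<in> pverts Y" for x x' y y'
    unfolding E_def using lex_arc_iff[OF X Y that(3,4,1,2)] .
  have N: "finite (N y)" "card (N y) = d" "N y \<subseteq> pverts Y" if "y \<in> pverts Y" for y
    using reg[OF that] fin by (auto simp: N_def)
  note symX = simple_graph_sym[OF X] and symY = simple_graph_sym[OF Y]
  note irr = simple_graph_irrefl[OF X] simple_graph_irrefl[OF Y]
  define n where "n = card (pverts Y)"
  have same: "{z\<in>?V. E (x, y) z \<and> \<not> E z (x, y')} = {x} \<times> (N y - N y')"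
    "{z\<in>?V. \<not> E (x, y) z \<and> E z (x, y')} = {x} \<times> (N y' - N y)"
    if "x \<in> pverts X" "y \<in> pverts Y" "y' \<in> pverts Y" for x y y'
    using that symX symY irr by (auto simp: Eiff N_def)
  have D_same: "D (x, y) (x, y') = card (N y - N y') + card (N y' - N y)"
    if "x \<in> pverts X" "y \<in> pverts Y" "y' \<in> pverts Y" for x y y'
    unfolding D_def same[OF that] by (simp add: card_cartesian_product)
  have D_le: "D (x, y) (x, y') \<le> 2 * d" if "x \<in> pverts X" "y \<in> pverts Y" "y' \<in> pverts Y" for x y y'
    using D_same[OF that] card_mono[OF N(1), of y "N y - N y'"] card_mono[OF N(1), of y' "N y' - N y"] N(2) that by fastforce
  \<comment> \<open>A common neighbour makes both halves strictly smaller than d.\<close>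
  have D_less: "D (x, y) (x, y') < 2 * d"
    if "x \<in> pverts X" "y \<in> pverts Y" "y' \<in> pverts Y" "N y \<inter> N y' \<noteq> {}" for x y y'
    using D_same[OF that(1-3)] psubset_card_mono[OF N(1), of y "N y - N y'"] psubset_card_mono[OF N(1), of y' "N y' - N y"]
      N(2) that by fastforce
  \<comment> \<open>Each of the two vertices has d neighbours in its own fibre, none of them
    adjacent to the other vertex: d on either side. A vertex z of X that distinguishes x from x'
    adds at least one more vertex, in the fibre over z.\<close>
  have D_nonadj: "2 * d \<le> D (x, y) (x', y')"
    and D_nonadj_strict: "z \<in> pverts X \<Longrightarrow> ((x, z) \<in> parcs X) \<noteq> ((x', z) \<in> parcs X) \<Longrightarrow> 2 * d < D (x, y) (x', y')"
    if xy: "x \<in> pverts X" "x' \<in> pverts X" "y \<in> pverts Y" "y' \<in> pverts Y" "x \<noteq> x'" "(x, x') \<notin> parcs X" for x x' y y' z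
  proof -
    have nx: "(x', x) \<notin> parcs X" using xy symX by blast
    let ?S = "{z\<in>?V. E (x, y) z \<and> \<not> E z (x', y')}" and ?T = "{z\<in>?V. \<not> E (x, y) z \<and> E z (x', y')}"
    have sub: "{x} \<times> N y \<subseteq> ?S" "{x'} \<times> N y' \<subseteq> ?T"
      using xy nx irr symY by (auto simp: Eiff N_def)
    have fST: "finite ?S" "finite ?T" using finV by auto
    have c: "d \<le> card ?S" "d \<le> card ?T"
      using card_mono[OF fST(1) sub(1)] card_mono[OF fST(2) sub(2)] N xy by (auto simp: card_cartesian_product)
    then show "2 * d \<le> D (x, y) (x', y')" by (simp add: D_def)
    assume z: "z \<in> pverts X" "((x, z) \<in> parcs X) \<noteq> ((x', z) \<in> parcs X)"
    then have zne: "z \<noteq> x" "z \<noteq> x'" using irr xy nx by auto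
    have "d < card ?S \<or> d < card ?T"
    proof (cases "(x, z) \<in> parcs X")
      case True
      then have "insert (z, y) ({x} \<times> N y) \<subseteq> ?S"
        using sub xy z zne symX by (auto simp: Eiff)
      from card_mono[OF fST(1) this] show ?thesis using N xy zne by (simp add: card_cartesian_product)
    next
      case False
      then have "insert (z, y') ({x'} \<times> N y') \<subseteq> ?T"
        using sub xy z zne symX by (auto simp: Eiff)
      from card_mono[OF fST(2) this] show ?thesis using N xy zne by (simp add: card_cartesian_product)
    qed
    then show "2 * d < D (x, y) (x', y')" using c by (auto simp: D_def)
  qed
  \<comment> \<open>Over adjacent base points each vertex is adjacent to the whole fibre of the
    other, which in turn is adjacent to only d vertices there: n - d on either side.\<close>
  have D_adj: "2 * (n - d) \<le> D (x, y) (x', y')"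
    if xy: "x \<in> pverts X" "x' \<in> pverts X" "y \<in> pverts Y" "y' \<in> pverts Y" "x \<noteq> x'" "(x, x') \<in> parcs X" for x x' y y'
  proof -
    let ?S = "{z\<in>?V. E (x, y) z \<and> \<not> E z (x', y')}" and ?T = "{z\<in>?V. \<not> E (x, y) z \<and> E z (x', y')}"
    have sub: "{x'} \<times> (pverts Y - N y') \<subseteq> ?S" "{x} \<times> (pverts Y - N y) \<subseteq> ?T"
      using xy irr symY by (auto simp: Eiff N_def)
    have fST: "finite ?S" "finite ?T" using finV by auto
    have "n - d \<le> card ?S" "n - d \<le> card ?T"
      using card_mono[OF fST(1) sub(1)] card_mono[OF fST(2) sub(2)] N xy
      by (auto simp: card_cartesian_product card_Diff_subset n_def)
    then show ?thesis by (simp add: D_def)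
  qed
  \<comment> \<open>A preserved relation that stays inside the fibres and contains a connected graph
    on each of them has the fibre relation as its transitive closure, which is preserved as
    well.\<close>
  have generate: ?thesis
    if R: "invariant R R" and sub: "\<And>x x' y y'. \<lbrakk>x \<in> pverts X; x' \<in> pverts X; y \<in> pverts Y; y' \<in> pverts Y; R (x, y) (x', y')\<rbrakk> \<Longrightarrow> x = x'"
      and gen: "\<And>x y y'. \<lbrakk>x \<in> pverts X; y \<in> pverts Y; y' \<in> pverts Y; (y, y') \<in> parcs Z\<rbrakk> \<Longrightarrow> R (x, y) (x, y')"
      and Z: "simple_graph Z" "pverts Z = pverts Y" "Digraph_Component.connected (with_proj Z)" for R Z
  proof -
    define r where "r = {(p, q). p \<in> ?V \<and> q \<in> ?V \<and> R p q}"
    have "invariant (\<lambda>p q. (p, q) \<in> r) (\<lambda>p q. (p, q) \<in> r)"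
      using R unfolding invariant_def r_def by blast
    then have inv: "invariant (\<lambda>p q. (p, q) \<in> r\<^sup>*) (\<lambda>p q. (p, q) \<in> r\<^sup>*)"
      by (rule invariant_rtrancl) (auto simp: r_def)
    have fwd: "fst p = fst q" if "(p, q) \<in> r\<^sup>*" for p q
      using that by (induction rule: rtrancl_induct) (use sub in \<open>auto simp: r_def\<close>)
    have bwd: "((x, y), (x, y')) \<in> r\<^sup>*" if "x \<in> pverts X" "y \<in> pverts Y" "y' \<in> pverts Y" for x y y'
    proof -
      have "(y, y') \<in> (parcs Z)\<^sup>*" using Z that connected_iff[OF Z(1)] by auto
      then show ?thesis
      proof (induction rule: rtrancl_induct)
        case (step a b)
        then have "a \<in> pverts Y" "b \<in> pverts Y" using simple_graph_arcs[OF Z(1)] Z(2) by auto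
        then have "((x, a), (x, b)) \<in> r" using gen step that by (auto simp: r_def)
        then show ?case using step by auto
      qed simp
    qed
    have "(p, q) \<in> r\<^sup>* \<longleftrightarrow> fst p = fst q" if "p \<in> ?V" "q \<in> ?V" for p q
      using fwd[of p q] bwd[of "fst p" "snd p" "snd q"] that by (cases p; cases q) auto
    then show ?thesis using inv unfolding invariant_def by blast
  qed
  note coY = simple_graph_complement[OF Y] co
  have coE: "(y, y') \<in> parcs (complement Y) \<longleftrightarrow> y \<in> pverts Y \<and> y' \<in> pverts Y \<and> y \<noteq> y' \<and> (y, y') \<notin> parcs Y" for y y'
    by (simp add: complement_def)
  have coV: "pverts (complement Y) = pverts Y" by (simp add: complement_def)
  show ?thesis
  proof (cases "\<exists>x y. twins X x y")
    case False
    show ?thesis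
    proof (rule generate[OF _ _ _ coY(1) coV coY(2)])
      \<comment> \<open>Without twins, nonadjacent points of different fibres exceed 2d strictly.
        Nonadjacency together with D at most 2d therefore stays inside fibres, and it contains all
        nonadjacent pairs of a fibre.\<close>
      show "invariant (\<lambda>p q. \<not> E p q \<and> D p q \<le> 2 * d) (\<lambda>p q. \<not> E p q \<and> D p q \<le> 2 * d)"
        by (rule invariant_map2[OF E D, of "\<lambda>e k. \<not> e \<and> k \<le> 2 * d"])
      show "x = x'" if xy: "x \<in> pverts X" "x' \<in> pverts X" "y \<in> pverts Y" "y' \<in> pverts Y"
        and R: "\<not> E (x, y) (x', y') \<and> D (x, y) (x', y') \<le> 2 * d" for x x' y y'
      proof (rule ccontr)
        assume ne: "x \<noteq> x'"
        have na: "(x, x') \<notin> parcs X" using R xy by (auto simp: Eiff)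
        obtain z where "((x, z) \<in> parcs X) \<noteq> ((x', z) \<in> parcs X)"
          using False xy ne unfolding twins_def by blast
        moreover from this have "z \<in> pverts X" using simple_graph_arcs[OF X] by blast
        ultimately show False using D_nonadj_strict[OF xy ne na] R by fastforce
      qed
      show "\<not> E (x, y) (x, y') \<and> D (x, y) (x, y') \<le> 2 * d"
        if "x \<in> pverts X" "y \<in> pverts Y" "y' \<in> pverts Y" "(y, y') \<in> parcs (complement Y)" for x y y'
        using that D_le[OF that(1-3)] irr by (auto simp: Eiff coE)
    qed
  next
    case True
    then have con: "Digraph_Component.connected (with_proj Y)" using alt by blast
    define R where "R p q \<longleftrightarrow> (if E p q then D p q < 2 * (n - d) else D p q < 2 * d)" for p q
    have R: "invariant R R"
      unfolding R_def by (rule invariant_map2[OF E D, of "\<lambda>e k. if e then k < 2 * (n - d) else k < 2 * d"])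
    have sub: "x = x'" if xy: "x \<in> pverts X" "x' \<in> pverts X" "y \<in> pverts Y" "y' \<in> pverts Y"
        and R: "R (x, y) (x', y')" for x x' y y'
    proof (rule ccontr)
      assume ne: "x \<noteq> x'"
      show False
        using R D_adj[OF xy ne] D_nonadj[OF xy ne] xy ne by (auto simp: R_def Eiff split: if_splits)
    qed
    show ?thesis
    \<comment> \<open>Two nonadjacent vertices of Y with disjoint neighbourhoods occupy 2d + 2
      vertices. Below that order nonadjacent vertices of a fibre share a neighbour, fall under 2d,
      and the complement of Y generates the fibre. From that order on, 2d < 2(n - d), so the
      adjacent pairs of a fibre fall under their threshold and Y itself generates.\<close>
    proof (cases "n < 2 * d + 2")
      case True
      show ?thesis
      proof (rule generate[OF R sub _ coY(1) coV coY(2)])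
        fix x y y' assume xy: "x \<in> pverts X" "y \<in> pverts Y" "y' \<in> pverts Y" "(y, y') \<in> parcs (complement Y)"
        have ne: "y \<noteq> y'" and na: "(y, y') \<notin> parcs Y" "(y', y) \<notin> parcs Y" using xy symY by (auto simp: coE)
        have "N y \<inter> N y' \<noteq> {}"
        proof
          assume dis: "N y \<inter> N y' = {}"
          have "N y \<union> N y' \<subseteq> pverts Y - {y, y'}" using na irr by (auto simp: N_def)
          then have "card (N y \<union> N y') \<le> card (pverts Y - {y, y'})" using fin by (intro card_mono) auto
          moreover have "card (pverts Y - {y, y'}) = n - 2" using xy ne fin by (simp add: card_Diff_subset n_def)
          moreover have "card (N y \<union> N y') = 2 * d" using dis N xy by (simp add: card_Un_disjoint)
          moreover have "2 \<le> n" using card_mono[of "pverts Y" "{y, y'}"] xy ne fin by (simp add: n_def)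
          ultimately show False using True by linarith
        qed
        then show "R (x, y) (x, y')" using D_less xy na irr by (simp add: R_def Eiff)
      qed
    next
      case False
      show ?thesis
      proof (rule generate[OF R sub _ Y refl con])
        fix x y y' assume xy: "x \<in> pverts X" "y \<in> pverts Y" "y' \<in> pverts Y" "(y, y') \<in> parcs Y"
        have "D (x, y) (x, y') < 2 * (n - d)" using D_le[OF xy(1-3)] False by linarith
        then show "R (x, y) (x, y')" using xy by (simp add: R_def Eiff)
      qed
    qed
  qed
qed

corollary Qut_lex_eq_free_wreath:
  assumes "simple_graph X" "simple_graph Y" "finite (pverts G)" "graph_iso F G (lex_product X Y)"
    and "\<And>y. y \<in> pverts Y \<Longrightarrow> card {z\<in>pverts Y. (y, z) \<in> parcs Y} = d"
    and "Digraph_Component.connected (with_proj (complement Y))"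
    and "Digraph_Component.connected (with_proj Y) \<or> (\<nexists>x y. twins X x y)"
  shows "qpg_equal_via F (Qut G) (free_wreath (Qut Y) (Qut X))"
  by (rule Qut_lex_product[OF assms(1-4)]) (rule lex_fibres_invariant[OF assms(1,2,5-7)])

section \<open>Quantum vertex transitive graphs\<close>

text \<open>A nonzero entry of the fundamental representation forces equal degrees of its two
  indices, and transitivity makes all entries nonzero.\<close>

lemma quantum_vertex_transitive_regular:
  assumes X: "simple_graph X" and t: "quantum_vertex_transitive X" and xy: "x \<in> pverts X" "y \<in> pverts X"
  shows "card {z\<in>pverts X. (x, z) \<in> parcs X} = card {z\<in>pverts X. (y, z) \<in> parcs X}"
proof -
  note fin = simple_graph_finite[OF X]
  interpret magic "qalg (Qut X)" "pverts X" "pverts X" "fund (Qut X)" by (rule Qut_magic(1)[OF fin])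
  show ?thesis
    by (rule invariant_degree[OF Qut_magic(2)[OF fin, unfolded intertwines_iff] xy])
       (use t xy in \<open>simp add: quantum_vertex_transitive_def\<close>)
qed

text \<open>Nonvanishing is tested in any convenient algebra: the universal homomorphism carries the
  fundamental entries to those of w and zero to zero.\<close>

lemma quantum_vertex_transitiveI:
  assumes m: "magic B (pverts X) (pverts X) w" and it: "magic.intertwines B (pverts X) (pverts X) w X X"
    and nz: "\<And>x y. x \<in> pverts X \<Longrightarrow> y \<in> pverts X \<Longrightarrow> w x y \<noteq> \<zero>\<^bsub>B\<^esub>"
  shows "quantum_vertex_transitive X"
proof -
  interpret magic B "pverts X" "pverts X" w by (rule m)
  interpret Q: unital_cstar_algebra "qalg (Qut X)" by (rule Qut_cstar[OF finite_rows])
  obtain H where H: "H \<in> star_hom (qalg (Qut X)) B"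
    "\<And>x y. x \<in> pverts X \<Longrightarrow> y \<in> pverts X \<Longrightarrow> H (fund (Qut X) x y) = w x y"
    using Qut_hom_exists[OF m it] by blast
  show ?thesis
    unfolding quantum_vertex_transitive_def
    using H(2) nz star_hom_zero[OF Q.star_algebra_axioms star_algebra_axioms H(1)] by metis
qed

section \<open>Components and twin classes\<close>

definition induced :: "'v pair_pre_digraph \<Rightarrow> 'v set \<Rightarrow> 'v pair_pre_digraph" where
  "induced X S = \<lparr>pverts = S, parcs = parcs X \<inter> S \<times> S\<rparr>"

lemma induced_simps [simp]:
  "pverts (induced X S) = S" "(x, y) \<in> parcs (induced X S) \<longleftrightarrow> (x, y) \<in> parcs X \<and> x \<in> S \<and> y \<in> S"
  by (auto simp: induced_def)

lemma simple_graph_induced: "simple_graph X \<Longrightarrow> S \<subseteq> pverts X \<Longrightarrow> S \<noteq> {} \<Longrightarrow> simple_graph (induced X S)"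
  by (auto simp: simple_graph_iff induced_def irrefl_def sym_def intro: finite_subset)

context blocked_magic
begin

text \<open>Between two classes of equal size all row sums and all column sums of the submatrix
  equal the same projection p. Its entries are fixed by p on both sides, so in the corner, where p
  is the unit, the submatrix is a magic unitary.\<close>

lemma corner_magic:
  fixes i0 j0
  assumes i0: "i0 \<in> I" and j0: "j0 \<in> J"
    and card: "card {i\<in>I. lab i = lab i0} = card {j\<in>J. lab' j = lab' j0}"
  defines "I0 \<equiv> {i\<in>I. lab i = lab i0}" and "J0 \<equiv> {j\<in>J. lab' j = lab' j0}" and "p \<equiv> block i0 (lab' j0)"
  shows "magic (corner A p) I0 J0 u"
    and "invariant f f' \<Longrightarrow> magic.invariant (corner A p) I0 J0 u f f'"
proof -
  interpret C: cstar_corner A p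
    by (intro cstar_corner.intro cstar_corner_axioms.intro unital_cstar_algebra_axioms)
       (simp add: p_def block_projection i0)
  interpret CC: unital_cstar_algebra "corner A p" by (rule C.corner_cstar)
  have row: "block i (lab' j0) = p" if "i \<in> I0" for i
    using that i0 unfolding p_def I0_def by (intro block_eq) auto
  have col: "col_block j (lab i0) = p" if "j \<in> J0" for j
    using that i0 j0 block_eq_col_block[of i0 j] card unfolding p_def J0_def by simp
  have uc: "u i j \<in> carrier (corner A p)" if "i \<in> I0" "j \<in> J0" for i j
    using that block_mult_entry[of i j "lab' j0"] entry_mult_block[of i j "lab' j0"] row[of i]
    by (auto simp: I0_def J0_def)
  have fin0: "finite I0" "finite J0" using finite_rows finite_cols by (auto simp: I0_def J0_def)
  have "(\<Oplus>\<^bsub>corner A p\<^esub>j\<in>J0. u i j) = p" if i: "i \<in> I0" for i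
  proof -
    have "(\<Oplus>\<^bsub>corner A p\<^esub>j\<in>J0. u i j) = (\<Oplus>j\<in>J0. u i j)" using fin0 uc i by (intro C.corner_finsum) auto
    also have "\<dots> = block i (lab' j0)"
      unfolding block_def J0_def using i finite_cols by (intro finsum_filter) (auto simp: I0_def)
    finally show ?thesis using row[OF i] by simp
  qed
  moreover have "(\<Oplus>\<^bsub>corner A p\<^esub>i\<in>I0. u i j) = p" if j: "j \<in> J0" for j
  proof -
    have "(\<Oplus>\<^bsub>corner A p\<^esub>i\<in>I0. u i j) = (\<Oplus>i\<in>I0. u i j)" using fin0 uc j by (intro C.corner_finsum) auto
    also have "\<dots> = col_block j (lab i0)"
      unfolding col_block_def I0_def using j finite_rows by (intro finsum_filter) (auto simp: J0_def)
    finally show ?thesis using col[OF j] by simp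
  qed
  ultimately show m: "magic (corner A p) I0 J0 u"
    using uc u_idem u_star fin0
    by (intro magic.intro magic_axioms.intro CC.unital_cstar_algebra_axioms)
       (auto simp: magic_unitary_def I0_def J0_def)
  show "magic.invariant (corner A p) I0 J0 u f f'" if "invariant f f'"
    using that unfolding magic.invariant_def[OF m] invariant_def by (auto simp: I0_def J0_def)
qed

end

text \<open>One corner argument serves both claims. For different components the compressed
  submatrix is a quantum isomorphism; from a component to itself it witnesses quantum vertex
  transitivity, its entries being entries of the original representation and hence nonzero. The
  components are induced subgraphs on the original vertices, numbered by
  \<open>\<iota>\<close>.\<close>

lemma connected_components:
  assumes Y: "simple_graph (Y :: 'b pair_pre_digraph)" and t: "quantum_vertex_transitive Y"
  shows "\<exists>(\<beta>::nat) (Z :: nat \<Rightarrow> 'b pair_pre_digraph) (\<iota> :: 'b \<Rightarrow> nat).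
    (\<forall>i<\<beta>. simple_graph (Z i) \<and> Digraph_Component.connected (with_proj (Z i)) \<and> quantum_vertex_transitive (Z i)) \<and>
    (\<forall>i<\<beta>. \<forall>j<\<beta>. quantum_isomorphic (Z i) (Z j)) \<and>
    (\<forall>i<\<beta>. Z i = induced Y {y\<in>pverts Y. \<iota> y = i}) \<and>
    (\<forall>y\<in>pverts Y. \<iota> y < \<beta>) \<and> (\<forall>y y'. (y, y') \<in> parcs Y \<longrightarrow> \<iota> y = \<iota> y') \<and>
    (Digraph_Component.connected (with_proj Y) \<or> 1 < \<beta>)"
proof -
  let ?V = "pverts Y" let ?r = "parcs Y"
  note fin = simple_graph_finite[OF Y]
  have sym: "sym (?r\<^sup>*)" using Y by (intro sym_rtrancl) (simp add: simple_graph_iff)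
  define cl where "cl y = {z\<in>?V. (y, z) \<in> ?r\<^sup>*}" for y
  have cl_eq: "cl y = cl y' \<longleftrightarrow> (y, y') \<in> ?r\<^sup>*" if "y \<in> ?V" "y' \<in> ?V" for y y'
  proof
    assume "cl y = cl y'"
    then have "y' \<in> cl y" using that by (simp add: cl_def)
    then show "(y, y') \<in> ?r\<^sup>*" by (simp add: cl_def)
  next
    assume yy': "(y, y') \<in> ?r\<^sup>*"
    then have "(y', y) \<in> ?r\<^sup>*" using sym by (rule symD[rotated])
    then show "cl y = cl y'" using yy' unfolding cl_def by (auto intro: rtrancl_trans)
  qed
  obtain h where h: "bij_betw h {0..<card (cl ` ?V)} (cl ` ?V)"
    using ex_bij_betw_nat_finite[of "cl ` ?V"] fin by blast
  define \<beta> where "\<beta> = card (cl ` ?V)"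
  define \<iota> where "\<iota> y = inv_into {0..<\<beta>} h (cl y)" for y
  have h': "bij_betw h {0..<\<beta>} (cl ` ?V)" using h by (simp add: \<beta>_def)
  have h\<iota>: "h (\<iota> y) = cl y" "\<iota> y < \<beta>" if "y \<in> ?V" for y
    using that bij_betw_inv_into_right[OF h', of "cl y"] bij_betw_apply[OF bij_betw_inv_into[OF h'], of "cl y"]
    by (auto simp: \<iota>_def)
  have \<iota>_eq: "\<iota> y = \<iota> y' \<longleftrightarrow> (y, y') \<in> ?r\<^sup>*" if "y \<in> ?V" "y' \<in> ?V" for y y'
    using cl_eq[OF that] h\<iota>(1)[OF that(1)] h\<iota>(1)[OF that(2)] by (metis \<iota>_def)
  have surj: "\<exists>y\<in>?V. \<iota> y = i" if "i < \<beta>" for i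
  proof -
    have "h i \<in> cl ` ?V" using bij_betw_apply[OF h', of i] that by simp
    then obtain y where y: "y \<in> ?V" "h i = cl y" by blast
    then have "\<iota> y = i" using bij_betw_inv_into_left[OF h', of i] that by (simp add: \<iota>_def)
    then show ?thesis using y by blast
  qed
  define Z where "Z i = induced Y {y\<in>?V. \<iota> y = i}" for i
  have arc: "\<iota> y = \<iota> y'" if "(y, y') \<in> ?r" for y y'
    using that \<iota>_eq[of y y'] simple_graph_arcs[OF Y] by blast
  have simple: "simple_graph (Z i)" if "i < \<beta>" for i
    unfolding Z_def using surj[OF that] by (intro simple_graph_induced Y) auto
  have conn: "Digraph_Component.connected (with_proj (Z i))" if i: "i < \<beta>" for i
    unfolding connected_iff[OF simple[OF i]]
  proof (intro ballI)
    fix x y assume "x \<in> pverts (Z i)" "y \<in> pverts (Z i)"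
    then have xy: "x \<in> ?V" "y \<in> ?V" "\<iota> x = i" "\<iota> y = i" by (auto simp: Z_def)
    then have "(x, y) \<in> ?r\<^sup>*" using \<iota>_eq[of x y] by simp
    then have "(x, y) \<in> (parcs (Z i))\<^sup>* \<and> \<iota> y = i"
    proof (induction rule: rtrancl_induct)
      case (step a b)
      then have "(a, b) \<in> parcs (Z i)" using arc[of a b] simple_graph_arcs[OF Y] by (auto simp: Z_def)
      then show ?case using step arc[of a b] by auto
    qed (use xy in simp)
    then show "(x, y) \<in> (parcs (Z i))\<^sup>*" by blast
  qed
  let ?u = "fund (Qut Y)"
  interpret magic "qalg (Qut Y)" ?V ?V ?u by (rule Qut_magic(1)[OF fin])
  have arcs_inv: "invariant (\<lambda>x y. (x, y) \<in> ?r) (\<lambda>x y. (x, y) \<in> ?r)"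
    using Qut_magic(2)[OF fin] by (simp add: intertwines_iff)
  have "invariant (\<lambda>x y. (x, y) \<in> ?r\<^sup>*) (\<lambda>x y. (x, y) \<in> ?r\<^sup>*)"
    using simple_graph_arcs[OF Y] by (intro invariant_rtrancl arcs_inv)
  then have lab: "invariant (\<lambda>x y. \<iota> x = \<iota> y) (\<lambda>x y. \<iota> x = \<iota> y)"
    unfolding invariant_def using \<iota>_eq by metis
  interpret blocked_magic "qalg (Qut Y)" ?V ?V ?u \<iota> \<iota>
    by (intro blocked_magic.intro blocked_magic_axioms.intro magic_axioms lab)
  have nz: "?u x y \<noteq> \<zero>\<^bsub>qalg (Qut Y)\<^esub>" if "x \<in> ?V" "y \<in> ?V" for x y
    using t that by (simp add: quantum_vertex_transitive_def)
  have sizes: "card {z\<in>?V. \<iota> z = \<iota> x} = card {z\<in>?V. \<iota> z = \<iota> y}" if "x \<in> ?V" "y \<in> ?V" for x y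
    using invariant_degree[OF lab that nz[OF that]] by (simp add: eq_commute)
  have pair: "\<exists>p. unital_cstar_algebra (corner (qalg (Qut Y)) p) \<and> p \<noteq> \<zero>\<^bsub>qalg (Qut Y)\<^esub> \<and>
      magic (corner (qalg (Qut Y)) p) (pverts (Z i)) (pverts (Z j)) ?u \<and>
      magic.intertwines (corner (qalg (Qut Y)) p) (pverts (Z i)) (pverts (Z j)) ?u (Z i) (Z j)"
    if ij: "i < \<beta>" "j < \<beta>" for i j
  proof -
    obtain x y where xy: "x \<in> ?V" "y \<in> ?V" "\<iota> x = i" "\<iota> y = j" using surj ij by metis
    have V: "pverts (Z i) = {z\<in>?V. \<iota> z = \<iota> x}" "pverts (Z j) = {z\<in>?V. \<iota> z = \<iota> y}"
      using xy by (auto simp: Z_def)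
    let ?p = "block x (\<iota> y)"
    note m = corner_magic(1)[OF xy(1,2) sizes[OF xy(1,2)], folded V]
    have "magic.invariant (corner (qalg (Qut Y)) ?p) (pverts (Z i)) (pverts (Z j)) ?u (\<lambda>x y. (x, y) \<in> ?r) (\<lambda>x y. (x, y) \<in> ?r)"
      using corner_magic(2)[OF xy(1,2) sizes[OF xy(1,2)] arcs_inv] unfolding V .
    then have "magic.invariant (corner (qalg (Qut Y)) ?p) (pverts (Z i)) (pverts (Z j)) ?u
        (\<lambda>x y. (x, y) \<in> parcs (Z i)) (\<lambda>x y. (x, y) \<in> parcs (Z j))"
      unfolding magic.invariant_def[OF m] by (simp add: Z_def)
    \<comment> \<open>The corner is not the zero algebra because p absorbs the nonzero entry at (x,
      y).\<close>
    moreover have "?p \<noteq> \<zero>\<^bsub>qalg (Qut Y)\<^esub>"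
      using block_mult_entry[OF xy(1,2), of "\<iota> y"] nz[OF xy(1,2)] xy by auto
    ultimately show ?thesis
      using m magic.axioms(1)[OF m] magic.intertwines_iff[OF m] by blast
  qed
  have qvt: "quantum_vertex_transitive (Z i)" if i: "i < \<beta>" for i
  proof -
    obtain p where p: "magic (corner (qalg (Qut Y)) p) (pverts (Z i)) (pverts (Z i)) ?u"
      "magic.intertwines (corner (qalg (Qut Y)) p) (pverts (Z i)) (pverts (Z i)) ?u (Z i) (Z i)"
      using pair[OF i i] by blast
    show ?thesis by (rule quantum_vertex_transitiveI[OF p]) (use nz in \<open>auto simp: Z_def\<close>)
  qed
  have qiso: "quantum_isomorphic (Z i) (Z j)" if ij: "i < \<beta>" "j < \<beta>" for i j
  proof -
    obtain p where p: "unital_cstar_algebra (corner (qalg (Qut Y)) p)" "p \<noteq> \<zero>\<^bsub>qalg (Qut Y)\<^esub>"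
      and m: "magic (corner (qalg (Qut Y)) p) (pverts (Z i)) (pverts (Z j)) ?u"
      and it: "magic.intertwines (corner (qalg (Qut Y)) p) (pverts (Z i)) (pverts (Z j)) ?u (Z i) (Z j)"
      using pair[OF ij] by blast
    show ?thesis
      unfolding quantum_isomorphic_def
    proof (intro exI conjI)
      show "unital_cstar_algebra (corner (qalg (Qut Y)) p)" by (rule p(1))
      show "\<one>\<^bsub>corner (qalg (Qut Y)) p\<^esub> \<noteq> \<zero>\<^bsub>corner (qalg (Qut Y)) p\<^esub>" using p(2) by simp
      show "magic_unitary (corner (qalg (Qut Y)) p) (pverts (Z i)) (pverts (Z j)) ?u"
        by (rule magic.magic[OF m])
    qed (rule it[unfolded magic.intertwines_def[OF m]])
  qed
  have "Digraph_Component.connected (with_proj Y) \<or> 1 < \<beta>"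
  proof (rule disjCI)
    assume "\<not> 1 < \<beta>"
    then have "\<iota> y = \<iota> y'" if "y \<in> ?V" "y' \<in> ?V" for y y'
      using h\<iota>(2)[OF that(1)] h\<iota>(2)[OF that(2)] by simp
    then show "Digraph_Component.connected (with_proj Y)"
      unfolding connected_iff[OF Y] using \<iota>_eq by blast
  qed
  moreover have "\<forall>i<\<beta>. Z i = induced Y {y\<in>?V. \<iota> y = i}" by (simp add: Z_def)
  ultimately show ?thesis
    using simple conn qvt qiso h\<iota>(2) arc by (intro exI[of _ \<beta>] exI[of _ Z] exI[of _ \<iota>]) blast
qed

text \<open>Every vertex is sent by \<open>\<rho>\<close> to a representative of its twin class, and
  \<open>\<kappa>\<close> numbers the vertices within a class. Classes have equal size by
  transitivity, so block sums over them form a magic unitary on X', whose entries are nonzero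
  because a block sum absorbs the nonzero entries in it.\<close>

lemma twin_quotient:
  assumes X: "simple_graph (X :: 'a pair_pre_digraph)" and t: "quantum_vertex_transitive X" and tw: "twins X a b"
  shows "\<exists>(X' :: 'a pair_pre_digraph) (\<alpha>::nat) (\<rho> :: 'a \<Rightarrow> 'a) (\<kappa> :: 'a \<Rightarrow> nat).
    simple_graph X' \<and> quantum_vertex_transitive X' \<and> (\<nexists>x y. twins X' x y) \<and> 1 < \<alpha> \<and>
    bij_betw (\<lambda>x. (\<rho> x, \<kappa> x)) (pverts X) (pverts X' \<times> {..<\<alpha>}) \<and>
    (\<forall>x\<in>pverts X. \<forall>x'\<in>pverts X. (x, x') \<in> parcs X \<longleftrightarrow> (\<rho> x, \<rho> x') \<in> parcs X')"
proof -
  let ?V = "pverts X"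
  note fin = simple_graph_finite[OF X] and sym = simple_graph_sym[OF X]
  define N where "N x = {z. (x, z) \<in> parcs X}" for x
  have NV: "N x \<subseteq> ?V" for x using simple_graph_arcs[OF X] by (auto simp: N_def)
  define \<rho> where "\<rho> x = (SOME y. y \<in> ?V \<and> N y = N x)" for x
  have \<rho>: "\<rho> x \<in> ?V" "N (\<rho> x) = N x" if "x \<in> ?V" for x
    using someI[of "\<lambda>y. y \<in> ?V \<and> N y = N x" x] that by (auto simp: \<rho>_def)
  have \<rho>_eq: "\<rho> x = \<rho> y \<longleftrightarrow> N x = N y" if "x \<in> ?V" "y \<in> ?V" for x y
    using \<rho>(2)[OF that(1)] \<rho>(2)[OF that(2)] by (metis \<rho>_def)
  have \<rho>\<rho>: "\<rho> (\<rho> x) = \<rho> x" if "x \<in> ?V" for x using \<rho>_eq[OF \<rho>(1)[OF that] that] \<rho>(2)[OF that] by simp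
  have arc: "(x, y) \<in> parcs X \<longleftrightarrow> (\<rho> x, \<rho> y) \<in> parcs X" if "x \<in> ?V" "y \<in> ?V" for x y
  proof -
    have "(x, y) \<in> parcs X \<longleftrightarrow> y \<in> N (\<rho> x)" using \<rho>(2)[OF that(1)] by (simp add: N_def)
    also have "\<dots> \<longleftrightarrow> \<rho> x \<in> N y" using sym by (auto simp: N_def)
    also have "\<dots> \<longleftrightarrow> \<rho> x \<in> N (\<rho> y)" using \<rho>(2)[OF that(2)] by simp
    also have "\<dots> \<longleftrightarrow> (\<rho> x, \<rho> y) \<in> parcs X" using sym by (auto simp: N_def)
    finally show ?thesis .
  qed
  define K where "K = \<rho> ` ?V"
  have K: "K \<subseteq> ?V" "K \<noteq> {}" "finite K" using \<rho>(1) simple_graph_nonempty[OF X] fin by (auto simp: K_def)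
  note KV = K(1)
  have \<rho>K: "\<rho> k = k" if "k \<in> K" for k using that \<rho>\<rho> by (auto simp: K_def)
  define X' where "X' = induced X K"
  have X': "simple_graph X'" unfolding X'_def using K by (intro simple_graph_induced X) auto
  let ?Q = "qalg (Qut X)" let ?u = "fund (Qut X)"
  interpret magic ?Q ?V ?V ?u by (rule Qut_magic(1)[OF fin])
  have arcs_inv: "invariant (\<lambda>x y. (x, y) \<in> parcs X) (\<lambda>x y. (x, y) \<in> parcs X)"
    using Qut_magic(2)[OF fin] by (simp add: intertwines_iff)
  note ninv = invariant_map[OF arcs_inv, of Not]
  \<comment> \<open>Having equal neighbourhoods means that no two-step path joins x and y through an
    edge and a non-edge, in either order, so it is built from preserved compositions.\<close>
  have "invariant (\<lambda>x y. \<not> ((\<exists>z\<in>?V. (x, z) \<in> parcs X \<and> (z, y) \<notin> parcs X) \<or> (\<exists>z\<in>?V. (x, z) \<notin> parcs X \<and> (z, y) \<in> parcs X)))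
      (\<lambda>x y. \<not> ((\<exists>z\<in>?V. (x, z) \<in> parcs X \<and> (z, y) \<notin> parcs X) \<or> (\<exists>z\<in>?V. (x, z) \<notin> parcs X \<and> (z, y) \<in> parcs X)))"
    by (rule invariant_map2[OF invariant_ex[OF arcs_inv ninv] invariant_ex[OF ninv arcs_inv], of "\<lambda>p q. \<not> (p \<or> q)"])
  moreover have "(\<not> ((\<exists>z\<in>?V. (x, z) \<in> parcs X \<and> (z, y) \<notin> parcs X) \<or> (\<exists>z\<in>?V. (x, z) \<notin> parcs X \<and> (z, y) \<in> parcs X))) \<longleftrightarrow> \<rho> x = \<rho> y"
    if "x \<in> ?V" "y \<in> ?V" for x y
    unfolding \<rho>_eq[OF that] N_def using sym simple_graph_arcs[OF X] by blast
  ultimately have lab: "invariant (\<lambda>x y. \<rho> x = \<rho> y) (\<lambda>x y. \<rho> x = \<rho> y)"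
    unfolding invariant_def by simp
  have nz: "?u x y \<noteq> \<zero>\<^bsub>?Q\<^esub>" if "x \<in> ?V" "y \<in> ?V" for x y
    using t that by (simp add: quantum_vertex_transitive_def)
  have sizes: "card {z\<in>?V. \<rho> z = \<rho> x} = card {z\<in>?V. \<rho> z = \<rho> y}" if "x \<in> ?V" "y \<in> ?V" for x y
    using invariant_degree[OF lab that nz[OF that]] by (simp add: eq_commute)
  have ab: "a \<in> ?V" "b \<in> ?V" "a \<noteq> b" "\<rho> a = \<rho> b"
    using tw \<rho>_eq[of a b] by (auto simp: twins_def N_def)
  define \<alpha> where "\<alpha> = card {z\<in>?V. \<rho> z = \<rho> a}"
  have \<alpha>: "card {z\<in>?V. \<rho> z = k} = \<alpha>" if kK: "k \<in> K" for k
  proof -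
    obtain x where x: "x \<in> ?V" "k = \<rho> x" using kK unfolding K_def by blast
    show ?thesis unfolding x(2) \<alpha>_def by (rule sizes[OF x(1) ab(1)])
  qed
  have "card {a, b} \<le> \<alpha>" unfolding \<alpha>_def using ab fin by (intro card_mono) auto
  then have \<alpha>1: "1 < \<alpha>" using ab(3) by simp
  interpret quotient_magic ?Q ?V ?V ?u \<rho> \<rho> K K "\<lambda>k. k" "\<lambda>k. k" \<alpha>
    by (intro quotient_magic.intro blocked_magic.intro blocked_magic_axioms.intro quotient_magic_axioms.intro magic_axioms lab)
       (use K \<rho>K \<alpha> subsetD[OF K(1)] in \<open>simp_all flip: K_def\<close>)
  have qvt: "quantum_vertex_transitive X'"
  proof (rule quantum_vertex_transitiveI)
    show m: "magic ?Q (pverts X') (pverts X') v" using v_magic by (simp add: X'_def)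
    have "magic.invariant ?Q K K v (\<lambda>x y. (x, y) \<in> parcs X) (\<lambda>x y. (x, y) \<in> parcs X)"
      by (rule v_invariant[OF arcs_inv]) (use arc in auto)
    then show "magic.intertwines ?Q (pverts X') (pverts X') v X' X'"
      unfolding magic.intertwines_iff[OF m] magic.invariant_def[OF m] magic.invariant_def[OF v_magic]
      by (simp add: X'_def)
    fix x y assume "x \<in> pverts X'" "y \<in> pverts X'"
    then have xy: "x \<in> ?V" "y \<in> ?V" "\<rho> y = y" using KV \<rho>K by (auto simp: X'_def)
    then show "v x y \<noteq> \<zero>\<^bsub>?Q\<^esub>"
      using block_mult_entry[OF xy(1,2), of y] nz[OF xy(1,2)] by (auto simp: v_def)
  qed
  have notwins: "\<nexists>x y. twins X' x y"
  proof
    assume "\<exists>x y. twins X' x y"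
    then obtain x y where xy: "x \<in> K" "y \<in> K" "x \<noteq> y" and
      eq: "{z. (x, z) \<in> parcs X'} = {z. (y, z) \<in> parcs X'}" by (auto simp: twins_def X'_def)
    \<comment> \<open>Neighbourhoods in X are unions of twin classes, hence determined by the
      representatives they contain; twins of X' would have equal neighbourhoods already in
      X.\<close>
    have "N x \<subseteq> N y" if "x \<in> K" "y \<in> K" "{z. (x, z) \<in> parcs X'} = {z. (y, z) \<in> parcs X'}" for x y
    proof
      fix z assume z: "z \<in> N x"
      then have zV: "z \<in> ?V" using NV by blast
      have "(x, \<rho> z) \<in> parcs X" using z arc[of x z] \<rho>K that KV zV by (auto simp: N_def)
      then have "(x, \<rho> z) \<in> parcs X'" using zV that by (simp add: X'_def K_def)
      then have "(y, \<rho> z) \<in> parcs X" using that(3) by (auto simp: X'_def)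
      then show "z \<in> N y" using arc[of y z] \<rho>K that KV zV by (auto simp: N_def)
    qed
    from this[OF xy(1,2) eq] this[OF xy(2,1) eq[symmetric]] have "N x = N y" by blast
    then have "\<rho> x = \<rho> y" using \<rho>_eq xy KV by blast
    then show False using xy \<rho>K by simp
  qed
  have "\<exists>f. bij_betw f {z\<in>?V. \<rho> z = k} {..<\<alpha>}" if "k \<in> K" for k
    using ex_bij_betw_finite_nat[of "{z\<in>?V. \<rho> z = k}"] fin \<alpha>[OF that] by (auto simp: atLeast0LessThan)
  then obtain en where en: "\<And>k. k \<in> K \<Longrightarrow> bij_betw (en k) {z\<in>?V. \<rho> z = k} {..<\<alpha>}" by metis
  define \<kappa> where "\<kappa> x = en (\<rho> x) x" for x
  have "bij_betw (\<lambda>x. (\<rho> x, \<kappa> x)) ?V (K \<times> {..<\<alpha>})"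
  proof (rule bij_betw_imageI)
    show "inj_on (\<lambda>x. (\<rho> x, \<kappa> x)) ?V"
    proof (rule inj_onI)
      fix x y assume xy: "x \<in> ?V" "y \<in> ?V" "(\<rho> x, \<kappa> x) = (\<rho> y, \<kappa> y)"
      have "inj_on (en (\<rho> x)) {z\<in>?V. \<rho> z = \<rho> x}" using en[of "\<rho> x"] xy by (simp add: K_def bij_betw_def)
      then show "x = y" by (rule inj_onD) (use xy in \<open>auto simp: \<kappa>_def\<close>)
    qed
    show "(\<lambda>x. (\<rho> x, \<kappa> x)) ` ?V = K \<times> {..<\<alpha>}"
    proof (intro equalityI subsetI)
      fix q assume "q \<in> (\<lambda>x. (\<rho> x, \<kappa> x)) ` ?V"
      then obtain x where x: "x \<in> ?V" "q = (\<rho> x, \<kappa> x)" by blast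
      have "en (\<rho> x) x \<in> {..<\<alpha>}" using bij_betw_apply[OF en[of "\<rho> x"], of x] x by (simp add: K_def)
      then show "q \<in> K \<times> {..<\<alpha>}" using x by (simp add: K_def \<kappa>_def)
    next
      fix q assume "q \<in> K \<times> {..<\<alpha>}"
      then obtain k n where q: "q = (k, n)" "k \<in> K" "n \<in> {..<\<alpha>}" by blast
      have "n \<in> en k ` {z\<in>?V. \<rho> z = k}" using en[OF q(2)] q(3) by (simp add: bij_betw_def)
      then obtain x where "x \<in> ?V" "\<rho> x = k" "en k x = n" by blast
      then show "q \<in> (\<lambda>x. (\<rho> x, \<kappa> x)) ` ?V" using q by (auto simp: \<kappa>_def intro!: image_eqI[of _ _ x])
    qed
  qed
  then have bij: "bij_betw (\<lambda>x. (\<rho> x, \<kappa> x)) ?V (pverts X' \<times> {..<\<alpha>})" by (simp add: X'_def)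
  have "(x, x') \<in> parcs X \<longleftrightarrow> (\<rho> x, \<rho> x') \<in> parcs X'" if "x \<in> ?V" "x' \<in> ?V" for x x'
    using arc[OF that] that by (simp add: X'_def K_def)
  then show ?thesis
    using X' qvt notwins \<alpha>1 bij by (intro exI[of _ X'] exI[of _ \<alpha>] exI[of _ \<rho>] exI[of _ \<kappa>]) blast
qed

section \<open>Disconnected second factors\<close>

lemma simple_graph_edgeless: "0 < n \<Longrightarrow> simple_graph (edgeless n)"
  by (auto simp: simple_graph_iff edgeless_def irrefl_def sym_def)

lemma disjoint_union_simps [simp]:
  "pverts (disjoint_union I Y) = (SIGMA i:I. pverts (Y i))"
  "((i, y), (j, y')) \<in> parcs (disjoint_union I Y) \<longleftrightarrow> i \<in> I \<and> j = i \<and> (y, y') \<in> parcs (Y i)"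
  by (auto simp: disjoint_union_def)

lemma simple_graph_disjoint_union:
  assumes "finite I" "I \<noteq> {}" "\<And>i. i \<in> I \<Longrightarrow> simple_graph (Y i)"
  shows "simple_graph (disjoint_union I Y)"
  unfolding simple_graph_iff
proof (intro conjI)
  show "finite (pverts (disjoint_union I Y))" using assms(1) simple_graph_finite[OF assms(3)] by auto
  show "pverts (disjoint_union I Y) \<noteq> {}" using assms(2) simple_graph_nonempty[OF assms(3)] by auto
  show "parcs (disjoint_union I Y) \<subseteq> pverts (disjoint_union I Y) \<times> pverts (disjoint_union I Y)"
    using simple_graph_arcs[OF assms(3)] by (force simp: disjoint_union_def)
  show "irrefl (parcs (disjoint_union I Y))"
    using simple_graph_irrefl[OF assms(3)] by (auto simp: irrefl_def)
  show "sym (parcs (disjoint_union I Y))"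
    using simple_graph_sym[OF assms(3)] by (auto intro!: symI)
qed

text \<open>Vertices of different parts are adjacent in the complement, and vertices of the same
  part have a common neighbour in any other part.\<close>

lemma connected_complement_disjoint_union:
  assumes I: "finite I" "i0 \<in> I" "i1 \<in> I" "i0 \<noteq> i1" and Y: "\<And>i. i \<in> I \<Longrightarrow> simple_graph (Y i)"
  shows "Digraph_Component.connected (with_proj (complement (disjoint_union I Y)))"
proof -
  let ?D = "disjoint_union I Y"
  have D: "simple_graph ?D" using I Y by (intro simple_graph_disjoint_union) auto
  have cross: "(p, q) \<in> parcs (complement ?D)" if "p \<in> pverts ?D" "q \<in> pverts ?D" "fst p \<noteq> fst q" for p q
    using that by (cases p; cases q) (auto simp: complement_def)
  show ?thesis
    unfolding connected_iff[OF simple_graph_complement[OF D]]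
  proof (intro ballI)
    fix p q assume pq: "p \<in> pverts (complement ?D)" "q \<in> pverts (complement ?D)"
    then have pq': "p \<in> pverts ?D" "q \<in> pverts ?D" by (auto simp: complement_def)
    show "(p, q) \<in> (parcs (complement ?D))\<^sup>*"
    proof (cases "fst p = fst q")
      case False
      then show ?thesis using cross[OF pq'] by blast
    next
      case True
      obtain i where i: "i \<in> I" "i \<noteq> fst p" using I by metis
      obtain y where "y \<in> pverts (Y i)" using simple_graph_nonempty[OF Y[OF i(1)]] by blast
      then have "(i, y) \<in> pverts ?D" using i by simp
      then have "(p, (i, y)) \<in> parcs (complement ?D)" "((i, y), q) \<in> parcs (complement ?D)"
        using cross pq' i True by auto
      then show ?thesis by (meson r_into_rtrancl rtrancl_trans)
    qed
  qed
qed

theorem theorem6p8: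
  fixes X :: "'a pair_pre_digraph" and Y :: "'b pair_pre_digraph"
  assumes "simple_graph X" and "simple_graph Y"
    and "quantum_vertex_transitive X" and "quantum_vertex_transitive Y"
    and "\<not> qpg_equal (Qut (lex_product X Y)) (free_wreath (Qut Y) (Qut X))"
    and "Digraph_Component.connected (with_proj (complement Y))"
  shows "\<exists>(\<beta>::nat) (Z :: nat \<Rightarrow> 'b pair_pre_digraph) (X' :: 'a pair_pre_digraph) (\<alpha>::nat) \<psi> \<phi>.
    1 < \<beta> \<and>
    (\<forall>i<\<beta>. simple_graph (Z i) \<and> Digraph_Component.connected (with_proj (Z i)) \<and>
       quantum_vertex_transitive (Z i)) \<and>
    (\<forall>i<\<beta>. \<forall>j<\<beta>. quantum_isomorphic (Z i) (Z j)) \<and>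
    graph_iso \<psi> Y (disjoint_union {..<\<beta>} Z) \<and>
    simple_graph X' \<and> quantum_vertex_transitive X' \<and> (\<nexists>x y. twins X' x y) \<and>
    1 < \<alpha> \<and>
    graph_iso \<phi> X (lex_product X' (edgeless \<alpha>)) \<and>
    qpg_equal_via
      (\<lambda>(x, y). let (x', k) = \<phi> x; (i, z) = \<psi> y in (x', (i, (k, z))))
      (Qut (lex_product X Y))
      (free_wreath (Qut (disjoint_union {..<\<beta>} (\<lambda>i. lex_product (edgeless \<alpha>) (Z i)))) (Qut X'))"
proof -
  note X = assms(1) and Y = assms(2)
  obtain y0 where y0: "y0 \<in> pverts Y" using simple_graph_nonempty[OF Y] by blast
  define d where "d = card {z\<in>pverts Y. (y0, z) \<in> parcs Y}"
  have reg: "card {z\<in>pverts Y. (y, z) \<in> parcs Y} = d" if "y \<in> pverts Y" for y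
    unfolding d_def by (rule quantum_vertex_transitive_regular[OF Y assms(4) that y0])
  have XY: "simple_graph (lex_product X Y)" by (rule simple_graph_lex[OF X Y])
  note finXY = simple_graph_finite[OF XY]
  have id: "graph_iso id (lex_product X Y) (lex_product X Y)" by (simp add: graph_iso_def)
  \<comment> \<open>Either alternative of the fibre criterion would yield the excluded equality,
    with the identity as identification of vertices.\<close>
  have "\<not> Digraph_Component.connected (with_proj Y)" and "\<exists>x y. twins X x y"
    using Qut_lex_eq_free_wreath[OF X Y finXY id reg assms(6)] assms(5) by (auto simp: qpg_equal_def)
  then obtain a b where disc: "\<not> Digraph_Component.connected (with_proj Y)" and tw: "twins X a b" by blast
  obtain \<beta> :: nat and Z \<iota> where C:
    "(\<forall>i<\<beta>. simple_graph (Z i) \<and> Digraph_Component.connected (with_proj (Z i)) \<and> quantum_vertex_transitive (Z i)) \<and>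
    (\<forall>i<\<beta>. \<forall>j<\<beta>. quantum_isomorphic (Z i) (Z j)) \<and>
    (\<forall>i<\<beta>. Z i = induced Y {y\<in>pverts Y. \<iota> y = i}) \<and>
    (\<forall>y\<in>pverts Y. \<iota> y < \<beta>) \<and> (\<forall>y y'. (y, y') \<in> parcs Y \<longrightarrow> \<iota> y = \<iota> y') \<and>
    (Digraph_Component.connected (with_proj Y) \<or> 1 < \<beta>)"
    using connected_components[OF Y assms(4)] by (elim exE) (erule that)
  have Z: "\<And>i. i < \<beta> \<Longrightarrow> simple_graph (Z i) \<and> Digraph_Component.connected (with_proj (Z i)) \<and> quantum_vertex_transitive (Z i)"
    "\<And>i j. i < \<beta> \<Longrightarrow> j < \<beta> \<Longrightarrow> quantum_isomorphic (Z i) (Z j)"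
    and Z_eq: "\<And>i. i < \<beta> \<Longrightarrow> Z i = induced Y {y\<in>pverts Y. \<iota> y = i}"
    and \<iota>: "\<And>y. y \<in> pverts Y \<Longrightarrow> \<iota> y < \<beta>" "\<And>y y'. (y, y') \<in> parcs Y \<Longrightarrow> \<iota> y = \<iota> y'"
    and "Digraph_Component.connected (with_proj Y) \<or> 1 < \<beta>"
    using C by blast+
  then have \<beta>: "1 < \<beta>" using disc by blast
  obtain X' :: "'a pair_pre_digraph" and \<alpha> :: nat and \<rho> :: "'a \<Rightarrow> 'a" and \<kappa> :: "'a \<Rightarrow> nat" where T:
    "simple_graph X' \<and> quantum_vertex_transitive X' \<and> (\<nexists>x y. twins X' x y) \<and> 1 < \<alpha> \<and>
    bij_betw (\<lambda>x. (\<rho> x, \<kappa> x)) (pverts X) (pverts X' \<times> {..<\<alpha>}) \<and>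
    (\<forall>x\<in>pverts X. \<forall>x'\<in>pverts X. (x, x') \<in> parcs X \<longleftrightarrow> (\<rho> x, \<rho> x') \<in> parcs X')"
    using twin_quotient[OF X assms(3) tw] by (elim exE) (erule that)
  have X': "simple_graph X'" "quantum_vertex_transitive X'" "\<nexists>x y. twins X' x y" and \<alpha>: "1 < \<alpha>"
    and bij: "bij_betw (\<lambda>x. (\<rho> x, \<kappa> x)) (pverts X) (pverts X' \<times> {..<\<alpha>})"
    and arcX: "\<And>x x'. x \<in> pverts X \<Longrightarrow> x' \<in> pverts X \<Longrightarrow> (x, x') \<in> parcs X \<longleftrightarrow> (\<rho> x, \<rho> x') \<in> parcs X'"
    using T by blast+
  let ?\<phi> = "\<lambda>x. (\<rho> x, \<kappa> x)" let ?\<psi> = "\<lambda>y. (\<iota> y, y)"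
  let ?D = "disjoint_union {..<\<beta>} (\<lambda>i. lex_product (edgeless \<alpha>) (Z i))"
  \<comment> \<open>The regrouping that moves the position k within a twin class from the X factor
    into the fibre over x', next to the component index i.\<close>
  let ?F = "\<lambda>(x, y). let (x', k) = ?\<phi> x; (i, z) = ?\<psi> y in (x', (i, (k, z)))"
  have edgeless: "simple_graph (edgeless \<alpha>)" using \<alpha> by (intro simple_graph_edgeless) simp
  have edgeless_simps: "pverts (edgeless \<alpha>) = {..<\<alpha>}" "parcs (edgeless \<alpha>) = {}" by (simp_all add: edgeless_def)
  have Zs: "pverts (Z i) = {y\<in>pverts Y. \<iota> y = i}"
    "(y, y') \<in> parcs (Z i) \<longleftrightarrow> (y, y') \<in> parcs Y \<and> y \<in> pverts Y \<and> y' \<in> pverts Y \<and> \<iota> y = i \<and> \<iota> y' = i" if "i < \<beta>" for i y y'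
    using Z_eq[OF that] by auto
  have \<phi>V: "\<rho> x \<in> pverts X'" "\<kappa> x < \<alpha>" if "x \<in> pverts X" for x
    using bij_betw_apply[OF bij that] by auto
  have \<phi>inj: "\<rho> x = \<rho> x' \<and> \<kappa> x = \<kappa> x' \<longleftrightarrow> x = x'" if "x \<in> pverts X" "x' \<in> pverts X" for x x'
    using inj_onD[OF bij_betw_imp_inj_on[OF bij], of x x'] that by auto
  have \<psi>_iso: "graph_iso ?\<psi> Y (disjoint_union {..<\<beta>} Z)"
    unfolding graph_iso_def
  proof
    show "bij_betw ?\<psi> (pverts Y) (pverts (disjoint_union {..<\<beta>} Z))"
      by (intro bij_betw_imageI) (use \<iota>(1) Zs in \<open>auto simp: inj_on_def\<close>)
    show "\<forall>y\<in>pverts Y. \<forall>y'\<in>pverts Y. (y, y') \<in> parcs Y \<longleftrightarrow> (?\<psi> y, ?\<psi> y') \<in> parcs (disjoint_union {..<\<beta>} Z)"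
      using \<iota> Zs by auto
  qed
  have \<phi>_iso: "graph_iso ?\<phi> X (lex_product X' (edgeless \<alpha>))"
    unfolding graph_iso_def
  proof
    show "bij_betw ?\<phi> (pverts X) (pverts (lex_product X' (edgeless \<alpha>)))" using bij by (simp add: edgeless_simps)
    show "\<forall>x\<in>pverts X. \<forall>x'\<in>pverts X. (x, x') \<in> parcs X \<longleftrightarrow> (?\<phi> x, ?\<phi> x') \<in> parcs (lex_product X' (edgeless \<alpha>))"
      using \<phi>V arcX by (simp add: lex_arc_iff[OF X'(1) edgeless] edgeless_simps)
  qed
  have lexZ: "simple_graph (lex_product (edgeless \<alpha>) (Z i))" if "i < \<beta>" for i
    using Z(1)[OF that] by (intro simple_graph_lex edgeless) simp
  have D: "simple_graph ?D" using \<beta> lexZ by (intro simple_graph_disjoint_union) auto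
  have DV: "pverts ?D = {(i, k, y). i < \<beta> \<and> k < \<alpha> \<and> y \<in> pverts Y \<and> \<iota> y = i}"
    using Zs by (auto simp: edgeless_simps)
  have Darc: "((i, k, y), (i', k', y')) \<in> parcs ?D \<longleftrightarrow> i = i' \<and> k = k' \<and> (y, y') \<in> parcs Y"
    if "i < \<beta>" "k < \<alpha>" "y \<in> pverts Y" "\<iota> y = i" "i' < \<beta>" "k' < \<alpha>" "y' \<in> pverts Y" "\<iota> y' = i'" for i k y i' k' y'
  proof (cases "i' = i")
    case True
    have Zi: "simple_graph (Z i)" using Z(1) that by simp
    have "((k, y), (k', y')) \<in> parcs (lex_product (edgeless \<alpha>) (Z i)) \<longleftrightarrow> k = k' \<and> (y, y') \<in> parcs (Z i)"
      using that True Zs(1)[OF that(1)] by (simp add: lex_arc_iff[OF edgeless Zi] edgeless_simps)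
    then show ?thesis using that True Zs(2)[OF that(1)] by auto
  next
    case False
    then show ?thesis by simp
  qed
  have F_iso: "graph_iso ?F (lex_product X Y) (lex_product X' ?D)"
    unfolding graph_iso_def
  proof
    show "bij_betw ?F (pverts (lex_product X Y)) (pverts (lex_product X' ?D))"
    proof (rule bij_betw_imageI)
      show "inj_on ?F (pverts (lex_product X Y))" using \<phi>inj by (auto simp: inj_on_def)
      show "?F ` pverts (lex_product X Y) = pverts (lex_product X' ?D)"
      proof (intro equalityI subsetI)
        fix q assume "q \<in> ?F ` pverts (lex_product X Y)"
        then show "q \<in> pverts (lex_product X' ?D)" using \<phi>V \<iota>(1) unfolding lex_pverts DV by auto
      next
        fix q assume "q \<in> pverts (lex_product X' ?D)"
        then obtain x' k y where q: "q = (x', (\<iota> y, (k, y)))" "x' \<in> pverts X'" "k < \<alpha>" "y \<in> pverts Y"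
          unfolding lex_pverts DV by auto
        have "(x', k) \<in> ?\<phi> ` pverts X" using q bij by (simp add: bij_betw_def)
        then obtain x where "x \<in> pverts X" "\<rho> x = x'" "\<kappa> x = k" by blast
        then show "q \<in> ?F ` pverts (lex_product X Y)" using q by (auto intro!: image_eqI[of _ _ "(x, y)"])
      qed
    qed
    show "\<forall>p\<in>pverts (lex_product X Y). \<forall>q\<in>pverts (lex_product X Y).
        (p, q) \<in> parcs (lex_product X Y) \<longleftrightarrow> (?F p, ?F q) \<in> parcs (lex_product X' ?D)"
    proof (intro ballI)
      fix p q assume "p \<in> pverts (lex_product X Y)" "q \<in> pverts (lex_product X Y)"
      then obtain x y x' y' where pq: "p = (x, y)" "q = (x', y')" and xy: "x \<in> pverts X" "y \<in> pverts Y" "x' \<in> pverts X" "y' \<in> pverts Y"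
        by auto
      have V: "(\<iota> y, \<kappa> x, y) \<in> pverts ?D" "(\<iota> y', \<kappa> x', y') \<in> pverts ?D"
        unfolding DV using \<phi>V \<iota>(1) xy by auto
      have "(?F p, ?F q) \<in> parcs (lex_product X' ?D) \<longleftrightarrow>
          (\<rho> x, \<rho> x') \<in> parcs X' \<or> \<rho> x = \<rho> x' \<and> \<iota> y = \<iota> y' \<and> \<kappa> x = \<kappa> x' \<and> (y, y') \<in> parcs Y"
        using lex_arc_iff[OF X'(1) D V \<phi>V(1)[OF xy(1)] \<phi>V(1)[OF xy(3)]] Darc[of "\<iota> y" "\<kappa> x" y "\<iota> y'" "\<kappa> x'" y'] xy \<phi>V(2) \<iota>(1)
        by (simp add: pq)
      \<comment> \<open>Adjacent vertices of Y lie in one component, so the condition on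
        \<open>\<iota>\<close> is absorbed, and equality of both \<open>\<rho>\<close> and
        \<open>\<kappa>\<close> is equality of vertices of X.\<close>
      also have "\<dots> \<longleftrightarrow> (x, x') \<in> parcs X \<or> x = x' \<and> (y, y') \<in> parcs Y"
        using arcX[OF xy(1,3)] \<phi>inj[OF xy(1,3)] \<iota>(2)[of y y'] by blast
      finally show "(p, q) \<in> parcs (lex_product X Y) \<longleftrightarrow> (?F p, ?F q) \<in> parcs (lex_product X' ?D)"
        using lex_arc_iff[OF X Y xy(2,4,1,3)] by (simp add: pq)
    qed
  qed
  \<comment> \<open>A vertex of the union has neighbours only in its own copy of its own component,
    so the degree d of Y is unchanged.\<close>
  have Dreg: "card {q\<in>pverts ?D. (p, q) \<in> parcs ?D} = d" if "p \<in> pverts ?D" for p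
  proof -
    obtain k y where p: "p = (\<iota> y, k, y)" "k < \<alpha>" "y \<in> pverts Y" using \<open>p \<in> pverts ?D\<close> unfolding DV by auto
    have "{q\<in>pverts ?D. (p, q) \<in> parcs ?D} = (\<lambda>z. (\<iota> y, k, z)) ` {z\<in>pverts Y. (y, z) \<in> parcs Y}"
    proof (intro equalityI subsetI)
      fix q assume q: "q \<in> {q\<in>pverts ?D. (p, q) \<in> parcs ?D}"
      then obtain k' z where "q = (\<iota> z, k', z)" "k' < \<alpha>" "z \<in> pverts Y" unfolding DV by auto
      then show "q \<in> (\<lambda>z. (\<iota> y, k, z)) ` {z\<in>pverts Y. (y, z) \<in> parcs Y}"
        using q p Darc[of "\<iota> y" k y "\<iota> z" k' z] \<iota>(1) by auto
    next
      fix q assume "q \<in> (\<lambda>z. (\<iota> y, k, z)) ` {z\<in>pverts Y. (y, z) \<in> parcs Y}"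
      then obtain z where z: "q = (\<iota> z, k, z)" "z \<in> pverts Y" "(y, z) \<in> parcs Y" using \<iota>(2) by auto
      then have "(p, q) \<in> parcs ?D" "q \<in> pverts ?D"
        using p Darc[of "\<iota> y" k y "\<iota> z" k z] \<iota> unfolding DV by auto
      then show "q \<in> {q\<in>pverts ?D. (p, q) \<in> parcs ?D}" by blast
    qed
    then show ?thesis using reg[OF p(3)] by (simp add: card_image inj_on_def)
  qed
  have Dco: "Digraph_Component.connected (with_proj (complement ?D))"
    using \<beta> lexZ by (intro connected_complement_disjoint_union[of _ 0 1]) auto
  \<comment> \<open>The union is disconnected, so the criterion enters through the alternative that
    X' has no twins.\<close>
  have "qpg_equal_via ?F (Qut (lex_product X Y)) (free_wreath (Qut ?D) (Qut X'))"
    using X'(3) by (intro Qut_lex_eq_free_wreath[OF X'(1) D finXY F_iso Dreg Dco] disjI2)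
  then show ?thesis
    by (intro exI[of _ \<beta>] exI[of _ Z] exI[of _ X'] exI[of _ \<alpha>] exI[of _ ?\<psi>] exI[of _ ?\<phi>] conjI)
       (use \<beta> Z \<psi>_iso X' \<alpha> \<phi>_iso in simp_all)
qed

end
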